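(* There exist integers $d\ge 3$ and $M\ge 17$ such that the graph $G=G(d,M)$ constructed in the context satisfies: (1) for some $p\in\bigl(\tfrac12,\,1-p_c^{\mathrm{site}}(G)\bigr)$, $\mathbb P_p$-a.s. there are finitely many infinite $1$-clusters; and (2) $p_u^{\mathrm{site}}(G)<1-p_c^{\mathrm{site}}(G)$.
   Context: Site percolation: under $\mathbb P_p$ each vertex is independently open (state $1$) with probability $p$, closed (state $0$) otherwise; $1$-clusters are connected components of the subgraph induced by open vertices. $p_c^{\mathrm{site}}(G)=\inf\{p\in[0,1]:\mathbb P_p(\exists\text{ infinite open cluster})>0\}$, $p_u^{\mathrm{site}}(G)=\inf\{p\in[0,1]:\mathbb P_p(\exists\text{ unique infinite open cluster})>0\}$. Construction of $G(d,M)$, for integers $d\ge3$, $M\ge2$. Let $B=M^d$ and let $T_B$ be the rooted $B$-ary tree (every vertex has $B$ children); $L_n$ is the set of vertices at depth $n$, $|L_n|=M^{dn}$. Step 1. Embed $T_B$ in the upper half plane so that $L_n$ lies on a horizontal line $\ell_n$, the $B$ children of each $v\in L_{n-1}$ appear consecutively on $\ell_n$, these blocks of children are ordered left to right as their parents on $\ell_{n-1}$, and all accumulation points are on the real line. Label $L_n=\{(n,i):1\le i\le M^{dn}\}$ from left to right. Step 2. Let $\Sigma=\{0,1,\dots,M-1\}$ and $s_n=M^{(d-1)n}$. For $\mathbf b=(b_1,\dots,b_n)\in\Sigma^n$ let $\mathrm{addr}(\mathbf b)=\sum_{t=1}^n b_tM^{n-t}$ and let $Q_{\mathbf b}=\{(n,j):\mathrm{addr}(\mathbf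 b)s_n+1\le j\le(\mathrm{addr}(\mathbf b)+1)s_n\}$. These blocks partition $L_n$ into $M^n$ contiguous blocks of size $s_n$. Step 3. For every $n\ge1$, $\mathbf b\in\Sigma^n$ and $\mathrm{addr}(\mathbf b)s_n+1\le j\le(\mathrm{addr}(\mathbf b)+1)s_n-1$, add the horizontal edge $\{(n,j),(n,j+1)\}$, obtaining an embedded planar graph $G_{\mathrm{strip}}$. Then triangulate every finite face $f$ of $G_{\mathrm{strip}}$ whose boundary cycle has length $\ge4$ by the fan rule: let $w(f)$ be the leftmost among the uppermost boundary vertices of $f$, and add inside $f$ all diagonals from $w(f)$ to every other boundary vertex of $f$ not already adjacent to $w(f)$. Call the result $\widetilde G$. Step 4. Let $\widetilde G^{(1)},\widetilde G^{(2)}$ be disjoint copies of $\widetilde G$, where $\widetilde G^{(1)}$ is embedded as $\widetilde G$ in the upper half plane and $\widetilde G^{(2)}$ is its reflection in the real axis; $x^{(1)},x^{(2)}$ denote the copies of a vertex $x$. For each $n\ge1$ and $1\le i\le M^n-1$ put $\ell_{n,i}=(n,(i-1)s_n+1)$ and $r_{n,i}=(n,is_n)$, and add the vertical edges $\{\ell_{n,i}^{(1)},\ell_{n,i}^{(2)}\}$ and $\{r_{n,i}^{(1)},r_{n,i}^{(2)}\}$. Call the resulting planar graph $G_0$. Step 5. Triangulate every finite face of $G_0$ by the same fan rule. The result is $G=G(d,M)$. *)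

theory Defs
  imports "HOL-Probability.Probability"
begin

section \<open>Site percolation on a countable graph\<close>

text \<open>A simple graph is given by its vertex set \<open>V\<close> and a set \<open>E\<close> of two-element subsets of \<open>V\<close>.\<close>

definition open_adj :: "'v set \<Rightarrow> 'v set set \<Rightarrow> ('v \<Rightarrow> bool) \<Rightarrow> ('v \<times> 'v) set" where
  "open_adj V E \<omega> = {(u, v). u \<in> V \<and> v \<in> V \<and> \<omega> u \<and> \<omega> v \<and> {u, v} \<in> E}"

definition open_clusters :: "'v set \<Rightarrow> 'v set set \<Rightarrow> ('v \<Rightarrow> bool) \<Rightarrow> 'v set set" where
  "open_clusters V E \<omega> = {(open_adj V E \<omega>)\<^sup>* `` {v} | v. v \<in> V \<and> \<omega> v}"

definition infinite_open_clusters :: "'v set \<Rightarrow> 'v set set \<Rightarrow> ('v \<Rightarrow> bool) \<Rightarrow> 'v set set" where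
  "infinite_open_clusters V E \<omega> = {C \<in> open_clusters V E \<omega>. infinite C}"

definition site_measure :: "'v set \<Rightarrow> real \<Rightarrow> ('v \<Rightarrow> bool) measure" where
  "site_measure V p = PiM V (\<lambda>_. measure_pmf (bernoulli_pmf p))"

definition p_c_site :: "'v set \<Rightarrow> 'v set set \<Rightarrow> real" where
  "p_c_site V E = Inf {p \<in> {0..1}.
     measure (site_measure V p)
       {\<omega> \<in> space (site_measure V p). \<exists>C. C \<in> infinite_open_clusters V E \<omega>} > 0}"

definition p_u_site :: "'v set \<Rightarrow> 'v set set \<Rightarrow> real" where
  "p_u_site V E = Inf {p \<in> {0..1}.
     measure (site_measure V p)
       {\<omega> \<in> space (site_measure V p). \<exists>!C. C \<in> infinite_open_clusters V E \<omega>} > 0}"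


section \<open>Straight-line drawings, faces and the fan rule\<close>

text \<open>Every edge \<open>{u, v}\<close> is drawn as the segment between \<open>pos u\<close> and \<open>pos v\<close>.\<close>

definition drawing :: "('v \<Rightarrow> complex) \<Rightarrow> 'v set set \<Rightarrow> complex set" where
  "drawing pos E = (\<Union>e\<in>E. convex hull (pos ` e))"

definition faces :: "('v \<Rightarrow> complex) \<Rightarrow> 'v set set \<Rightarrow> complex set set" where
  "faces pos E = components (- drawing pos E)"

definition boundary_verts :: "('v \<Rightarrow> complex) \<Rightarrow> 'v set \<Rightarrow> complex set \<Rightarrow> 'v set" where
  "boundary_verts pos V f = {v \<in> V. pos v \<in> frontier f}"

text \<open>
  A finite face is one with finitely many vertices on its boundary. Being bounded is not enough: below
  one can have bounded faces whose boundary runs through infinitely many vertices that accumulate on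
  the real line. The boundary of a finite face is a cycle, whose length is its number of vertices.
\<close>

definition fan_faces :: "('v \<Rightarrow> complex) \<Rightarrow> 'v set \<Rightarrow> 'v set set \<Rightarrow> complex set set" where
  "fan_faces pos V E =
     {f \<in> faces pos E. finite (boundary_verts pos V f) \<and> 4 \<le> card (boundary_verts pos V f)}"

definition fan_apex :: "('v \<Rightarrow> complex) \<Rightarrow> 'v set \<Rightarrow> complex set \<Rightarrow> 'v \<Rightarrow> bool" where
  "fan_apex pos V f w \<longleftrightarrow> w \<in> boundary_verts pos V f \<and>
     (\<forall>x \<in> boundary_verts pos V f. Im (pos x) \<le> Im (pos w) \<and>
        (Im (pos x) = Im (pos w) \<longrightarrow> Re (pos w) \<le> Re (pos x)))"

definition fan_triangulate :: "('v \<Rightarrow> complex) \<Rightarrow> 'v set \<Rightarrow> 'v set set \<Rightarrow> 'v set set" where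
  "fan_triangulate pos V E = E \<union>
     {{w, x} | f w x. f \<in> fan_faces pos V E \<and> fan_apex pos V f w \<and>
        x \<in> boundary_verts pos V f \<and> x \<noteq> w \<and> {w, x} \<notin> E}"


section \<open>The graph \<open>G(d, M)\<close>\<close>

text \<open>The pair \<open>(n, i)\<close> is the \<open>i\<close>-th vertex from the left at depth \<open>n\<close>, with \<open>i\<close> counted from 1.\<close>

type_synonym vertex = "nat \<times> nat"

definition tree_verts :: "nat \<Rightarrow> nat \<Rightarrow> vertex set" where
  "tree_verts d M = {(n, i). 1 \<le> i \<and> i \<le> M ^ (d * n)}"

definition tree_edges :: "nat \<Rightarrow> nat \<Rightarrow> vertex set set" where
  "tree_edges d M =
     {{(n, i), (Suc n, (i - 1) * M ^ d + c)} | n i c. (n, i) \<in> tree_verts d M \<and> 1 \<le> c \<and> c \<le> M ^ d}"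

definition block_size :: "nat \<Rightarrow> nat \<Rightarrow> nat \<Rightarrow> nat" where
  "block_size d M n = M ^ ((d - 1) * n)"

text \<open>Words \<open>b\<^sub>1 \<dots> b\<^sub>n\<close> are lists, so \<open>b\<^sub>t\<close> is \<open>bs ! (t - 1)\<close>.\<close>

definition words :: "nat \<Rightarrow> nat \<Rightarrow> nat list set" where
  "words M n = {bs. length bs = n \<and> set bs \<subseteq> {0..<M}}"

definition addr :: "nat \<Rightarrow> nat list \<Rightarrow> nat" where
  "addr M bs = (\<Sum>t = 1..length bs. bs ! (t - 1) * M ^ (length bs - t))"

definition horizontal_edges :: "nat \<Rightarrow> nat \<Rightarrow> vertex set set" where
  "horizontal_edges d M =
     {{(n, j), (n, j + 1)} | n bs j. 1 \<le> n \<and> bs \<in> words M n \<and>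
        addr M bs * block_size d M n + 1 \<le> j \<and> j \<le> (addr M bs + 1) * block_size d M n - 1}"

definition strip_edges :: "nat \<Rightarrow> nat \<Rightarrow> vertex set set" where
  "strip_edges d M = tree_edges d M \<union> horizontal_edges d M"

text \<open>
  Coordinates of the embedding. The line \<open>\<ell>\<^sub>n\<close> has height \<open>2\<^sup>-\<^sup>n\<close>. The block with address \<open>k\<close> at depth
  \<open>n\<close> occupies an interval of length \<open>(2 M + 1)\<^sup>-\<^sup>n\<close> with left endpoint \<open>block_left M n k\<close>, on which its
  vertices are equally spaced from endpoint to endpoint. Cutting this interval into \<open>2 M + 1\<close> equal
  parts numbered from 0, the parts with odd number belong to the \<open>M\<close> child blocks. So
  child blocks are pairwise disjoint and lie in the interior of the parent's interval; this
  leaves room for vertical segments from the end vertices of a block down to the real line,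
  which meet no other edge.
\<close>

primrec block_left :: "nat \<Rightarrow> nat \<Rightarrow> nat \<Rightarrow> real" where
  "block_left M 0 k = 0"
| "block_left M (Suc n) k =
     block_left M n (k div M) + real (2 * (k mod M) + 1) / real (2 * M + 1) ^ Suc n"

definition vertex_x :: "nat \<Rightarrow> nat \<Rightarrow> vertex \<Rightarrow> real" where
  "vertex_x d M = (\<lambda>(n, i).
     if n = 0 then 1 / 2
     else block_left M n ((i - 1) div block_size d M n) +
       (real ((i - 1) mod block_size d M n) / real (block_size d M n - 1)) / real (2 * M + 1) ^ n)"

definition pos :: "nat \<Rightarrow> nat \<Rightarrow> vertex \<Rightarrow> complex" where
  "pos d M v = Complex (vertex_x d M v) ((1 / 2) ^ fst v)"

text \<open>
  The finite faces of \<open>G\<^sub>s\<^sub>t\<^sub>r\<^sub>i\<^sub>p\<close> with at least four boundary vertices are convex quadrilaterals, so the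
  added diagonals may again be drawn as segments.
\<close>

definition half_edges :: "nat \<Rightarrow> nat \<Rightarrow> vertex set set" where
  "half_edges d M = fan_triangulate (pos d M) (tree_verts d M) (strip_edges d M)"

datatype side = Upper | Lower

definition G_verts :: "nat \<Rightarrow> nat \<Rightarrow> (side \<times> vertex) set" where
  "G_verts d M = UNIV \<times> tree_verts d M"

definition G_pos :: "nat \<Rightarrow> nat \<Rightarrow> side \<times> vertex \<Rightarrow> complex" where
  "G_pos d M = (\<lambda>(s, v). case s of Upper \<Rightarrow> pos d M v | Lower \<Rightarrow> cnj (pos d M v))"

definition block_first :: "nat \<Rightarrow> nat \<Rightarrow> nat \<Rightarrow> nat \<Rightarrow> vertex" where
  "block_first d M n i = (n, (i - 1) * block_size d M n + 1)"

definition block_last :: "nat \<Rightarrow> nat \<Rightarrow> nat \<Rightarrow> nat \<Rightarrow> vertex" where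
  "block_last d M n i = (n, i * block_size d M n)"

definition vertical_edges :: "nat \<Rightarrow> nat \<Rightarrow> (side \<times> vertex) set set" where
  "vertical_edges d M =
     {{(Upper, v), (Lower, v)} | n i v. 1 \<le> n \<and> 1 \<le> i \<and> i \<le> M ^ n - 1 \<and>
        (v = block_first d M n i \<or> v = block_last d M n i)}"

definition G0_edges :: "nat \<Rightarrow> nat \<Rightarrow> (side \<times> vertex) set set" where
  "G0_edges d M = {Pair s ` e | s e. e \<in> half_edges d M} \<union> vertical_edges d M"

definition G_edges :: "nat \<Rightarrow> nat \<Rightarrow> (side \<times> vertex) set set" where
  "G_edges d M = fan_triangulate (G_pos d M) (G_verts d M) (G0_edges d M)"

end

theory Submission
  imports Defs
begin

text \<open>
  With \<open>B = M\<^sup>d\<close> children per vertex, the tree survives already at density \<open>q = 8 / B\<close>, so \<open>p\<^sub>c \<le> 8 / B\<close>,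
  and the claims are proved at \<open>p = 1 - 16 / B\<close>. A vertex is fertile if one of its children starts doubly
  open tree paths to vertical edges of arbitrary depth; the open copies of a fertile vertex are then
  connected. Components of open fertile vertices reaching infinitely far into the same block are separated
  by a set of edges connected through the triangles and quadrilaterals of the strip, hence by a chain of bad
  vertices of the upper half. The same edges block the lower half, so that each downward step of the chain,
  which has \<open>B\<close> choices, must be paid for with a bad vertex of the lower half as well: its cost per step is
  \<open>\<theta>\<^sup>7 B\<close> with \<open>\<theta>\<^sup>6 = 4 (1 - p)\<close>, which is small although \<open>\<theta>\<^sup>6 B\<close> is not. A separating chain is infinite or
  connects two different gaps between blocks; in the latter case it starts at one of the \<open>O(M\<^sup>l)\<close>
  vertices of depth \<open>l\<close> next to a gap and has length at least \<open>l / 2\<close>. So, by Borel-Cantelli, almost surely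
  only finitely many levels start such chains, and the number of infinite clusters is at most the number
  of blocks at the first level beyond which there are none. With positive probability no level is bad, and
  the infinite cluster is unique.
\<close>

section \<open>Independence of local events\<close>

text \<open>Chains exist for a homological reason. The triangles and quadrilaterals generate the
  cycles of the strip, so a set of edges that meets each of them evenly is a cut, and a cut with
  both sides connected does not split into two such sets. The fan diagonals are never computed: the
  drawing is bracketed between two explicit point sets, which confines the vertices of each finite
  face to a short list. The outer face is infinite because the last block of a level has no vertical
  edges, so it sees the right end of every level. The density \<open>1 - p = 16 / B\<close> lies
  above the bound \<open>8 / B\<close> for \<open>p_c\<close>, which gives
  \<open>p < 1 - p_c\<close>. Then \<open>\<theta>\<close> has order \<open>B\<close> to the power
  \<open>-1/6\<close>, and so has the weight \<open>\<theta> ^ 7 * B\<close> of a downward step. A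
  chain from depth \<open>l\<close> may be as short as \<open>l / 2\<close>, so the square root of
  this weight has to beat the growth rate \<open>M\<close> of the number of vertices next to gaps.
  In this count \<open>B\<close> to the power \<open>1/6\<close> has to exceed a multiple of
  \<open>M ^ 2\<close>, hence \<open>d\<close> well above \<open>12\<close>.\<close>

definition local_event :: "'v set \<Rightarrow> 'v set \<Rightarrow> (('v \<Rightarrow> bool) \<Rightarrow> bool) \<Rightarrow> bool" where
  "local_event V K P \<longleftrightarrow> Measurable.pred (PiM V (\<lambda>_. count_space UNIV)) P \<and>
     (\<forall>\<omega> \<omega>'. (\<forall>i\<in>K. \<omega> i = \<omega>' i) \<longrightarrow> P \<omega> = P \<omega>')"

text \<open>Every set of states is measurable for the one-site measure, so the sigma-algebra does
  not depend on \<open>p\<close>. Measurability is therefore proved once, over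
  \<open>count_space\<close>, for all densities.\<close>

lemma sets_site_measure: "sets (site_measure V p) = sets (PiM V (\<lambda>_. count_space UNIV))"
  unfolding site_measure_def by (intro sets_PiM_cong) auto

lemma space_site_measure: "space (site_measure V p) = PiE V (\<lambda>_. UNIV)"
  unfolding site_measure_def by (simp add: space_PiM)

lemma pred_site_measure:
  "Measurable.pred (site_measure V p) P \<longleftrightarrow> Measurable.pred (PiM V (\<lambda>_. count_space UNIV)) P"
  by (simp add: measurable_cong_sets[OF sets_site_measure refl])

lemma prob_space_site_measure: "prob_space (site_measure V p)"
proof -
  interpret product_prob_space "\<lambda>_. measure_pmf (bernoulli_pmf p)" V
    by (intro product_prob_spaceI) (rule measure_pmf.prob_space_axioms)
  show ?thesis
    unfolding site_measure_def by (rule P.prob_space_axioms)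
qed

lemma local_event_pred:
  "local_event V K P \<Longrightarrow> Measurable.pred (PiM V (\<lambda>_. count_space UNIV)) P"
  by (simp add: local_event_def)

lemma local_event_mono: "local_event V K P \<Longrightarrow> K \<subseteq> K' \<Longrightarrow> local_event V K' P"
  unfolding local_event_def by blast

lemma local_event_site: "v \<in> V \<Longrightarrow> local_event V {v} (\<lambda>\<omega>. \<omega> v)"
  unfolding local_event_def by auto

lemma local_event_const: "local_event V K (\<lambda>\<omega>. c)"
  unfolding local_event_def by simp

lemma local_eventI:
  assumes "Measurable.pred (PiM V (\<lambda>_. count_space UNIV)) P"
    and "\<And>\<omega> \<omega>'. (\<And>i. i \<in> K \<Longrightarrow> \<omega> i = \<omega>' i) \<Longrightarrow> P \<omega> = P \<omega>'"
  shows "local_event V K P"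
  unfolding local_event_def using assms by blast

lemma local_eventD:
  assumes "local_event V K P" "\<And>i. i \<in> K \<Longrightarrow> \<omega> i = \<omega>' i"
  shows "P \<omega> = P \<omega>'"
proof -
  have "\<forall>i\<in>K. \<omega> i = \<omega>' i" using assms(2) by simp
  with assms(1) show ?thesis unfolding local_event_def by (elim conjE allE impE) assumption+
qed

lemma local_event_not:
  assumes "local_event V K P"
  shows "local_event V K (\<lambda>\<omega>. \<not> P \<omega>)"
proof (rule local_eventI)
  show "Measurable.pred (PiM V (\<lambda>_. count_space UNIV)) (\<lambda>\<omega>. \<not> P \<omega>)"
    by (rule pred_intros_logic(2)[OF local_event_pred[OF assms]])
  show "(\<not> P \<omega>) = (\<not> P \<omega>')" if "\<And>i. i \<in> K \<Longrightarrow> \<omega> i = \<omega>' i" for \<omega> \<omega>'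
    using local_eventD[OF assms that] by simp
qed

lemma local_event_conj:
  assumes "local_event V K P" "local_event V K Q"
  shows "local_event V K (\<lambda>\<omega>. P \<omega> \<and> Q \<omega>)"
proof (rule local_eventI)
  show "Measurable.pred (PiM V (\<lambda>_. count_space UNIV)) (\<lambda>\<omega>. P \<omega> \<and> Q \<omega>)"
    by (rule pred_intros_logic(3)[OF local_event_pred[OF assms(1)] local_event_pred[OF assms(2)]])
  show "(P \<omega> \<and> Q \<omega>) = (P \<omega>' \<and> Q \<omega>')" if "\<And>i. i \<in> K \<Longrightarrow> \<omega> i = \<omega>' i" for \<omega> \<omega>'
    using local_eventD[OF assms(1) that] local_eventD[OF assms(2) that] by simp
qed

lemma local_event_bex:
  assumes "countable I" "\<And>i. i \<in> I \<Longrightarrow> local_event V K (P i)"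
  shows "local_event V K (\<lambda>\<omega>. \<exists>i\<in>I. P i \<omega>)"
proof (rule local_eventI)
  show "Measurable.pred (PiM V (\<lambda>_. count_space UNIV)) (\<lambda>\<omega>. \<exists>i\<in>I. P i \<omega>)"
    unfolding pred_def
    by (rule sets.sets_Collect_countable_Ex'[OF _ assms(1)])
       (rule local_event_pred[OF assms(2), unfolded pred_def])
  show "(\<exists>i\<in>I. P i \<omega>) = (\<exists>i\<in>I. P i \<omega>')" if "\<And>i. i \<in> K \<Longrightarrow> \<omega> i = \<omega>' i" for \<omega> \<omega>'
    using local_eventD[OF assms(2) that] by simp
qed

lemma local_event_ball:
  assumes "countable I" "\<And>i. i \<in> I \<Longrightarrow> local_event V K (P i)"
  shows "local_event V K (\<lambda>\<omega>. \<forall>i\<in>I. P i \<omega>)"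
proof (rule local_eventI)
  show "Measurable.pred (PiM V (\<lambda>_. count_space UNIV)) (\<lambda>\<omega>. \<forall>i\<in>I. P i \<omega>)"
    unfolding pred_def
    by (rule sets.sets_Collect_countable_All'[OF _ assms(1)])
       (rule local_event_pred[OF assms(2), unfolded pred_def])
  show "(\<forall>i\<in>I. P i \<omega>) = (\<forall>i\<in>I. P i \<omega>')" if "\<And>i. i \<in> K \<Longrightarrow> \<omega> i = \<omega>' i" for \<omega> \<omega>'
    using local_eventD[OF assms(2) that] by simp
qed

lemma indep_vars_sites:
  assumes "V \<noteq> {}"
  shows "prob_space.indep_vars (site_measure V p) (\<lambda>_. measure_pmf (bernoulli_pmf p)) (\<lambda>v \<omega>. \<omega> v) V"
proof -
  interpret product_prob_space "\<lambda>_. measure_pmf (bernoulli_pmf p)" V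
    by (intro product_prob_spaceI) (rule measure_pmf.prob_space_axioms)
  let ?M = "PiM V (\<lambda>_. measure_pmf (bernoulli_pmf p))"
  have "distr ?M ?M (\<lambda>x. \<lambda>i\<in>V. x i) = distr ?M ?M (\<lambda>x. x)"
    by (intro distr_cong) (auto simp: space_PiM PiE_def extensional_restrict)
  also have "\<dots> = ?M" by (rule distr_id)
  also have "\<dots> = PiM V (\<lambda>i. distr ?M (measure_pmf (bernoulli_pmf p)) (\<lambda>x. x i))"
    by (intro PiM_cong) (auto simp: PiM_component)
  finally show ?thesis
    unfolding site_measure_def
    by (subst P.indep_vars_iff_distr_eq_PiM'[OF assms]) (auto intro: measurable_component_singleton)
qed

text \<open>Independent coordinates stay independent when grouped into disjoint sets
  \<open>K i\<close>, and each event is a preimage under the restriction to its own group.\<close>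

lemma prob_local_events:
  assumes fin: "finite I" and ev: "\<And>i. i \<in> I \<Longrightarrow> local_event V (K i) (P i)"
    and K: "\<And>i. i \<in> I \<Longrightarrow> K i \<subseteq> V" and disj: "disjoint_family_on K I"
  shows "measure (site_measure V p) {\<omega> \<in> space (site_measure V p). \<forall>i\<in>I. P i \<omega>} =
    (\<Prod>i\<in>I. measure (site_measure V p) {\<omega> \<in> space (site_measure V p). P i \<omega>})"
proof -
  let ?S = "site_measure V p" and ?b = "measure_pmf (bernoulli_pmf p)"
  interpret prob_space ?S by (rule prob_space_site_measure)
  show ?thesis
  \<comment> \<open>The independence statements are available for nonempty \<open>V\<close> and
    \<open>I\<close>; for empty \<open>V\<close> the space is a single point.\<close>
  proof (cases "V = {} \<or> I = {}")
    case False
    then have "V \<noteq> {}" "I \<noteq> {}" by auto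
    define Y where "Y = (\<lambda>j \<omega>. restrict (\<lambda>i. \<omega> i :: bool) (K j))"
    have "indep_vars (\<lambda>j. PiM (K j) (\<lambda>_. ?b)) Y I"
      unfolding Y_def by (rule indep_vars_restrict[OF indep_vars_sites[OF \<open>V \<noteq> {}\<close>] K disj])
    then have ind: "indep_sets (\<lambda>i. {Y i -` A \<inter> space ?S |A. A \<in> sets (PiM (K i) (\<lambda>_. ?b))}) I"
      unfolding indep_vars_def2 by auto
    have mem: "{\<omega> \<in> space ?S. P i \<omega>} \<in> {Y i -` A \<inter> space ?S |A. A \<in> sets (PiM (K i) (\<lambda>_. ?b))}"
      if i: "i \<in> I" for i
    proof -
      \<comment> \<open>A configuration on \<open>K i\<close> is extended by the arbitrary value
        \<open>True\<close>; by locality \<open>P i\<close> does not see the extension.\<close>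
      define A where "A = {\<tau> \<in> space (PiM (K i) (\<lambda>_. ?b)). P i (merge (K i) (V - K i) (\<tau>, \<lambda>v\<in>V - K i. True))}"
      have m1: "(\<lambda>\<tau>. merge (K i) (V - K i) (\<tau>, \<lambda>v\<in>V - K i. True)) \<in>
          measurable (PiM (K i) (\<lambda>_. ?b)) (PiM (K i \<union> (V - K i)) (\<lambda>_. ?b))"
        by (rule measurable_compose[OF measurable_Pair measurable_merge])
           (auto intro!: measurable_const simp: space_PiM)
      have "K i \<union> (V - K i) = V" using K[OF i] by auto
      with m1 have m1: "(\<lambda>\<tau>. merge (K i) (V - K i) (\<tau>, \<lambda>v\<in>V - K i. True)) \<in>
          measurable (PiM (K i) (\<lambda>_. ?b)) (PiM V (\<lambda>_. count_space UNIV))"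
        by (simp add: measurable_cong_sets[OF refl sets_site_measure[unfolded site_measure_def]])
      have "Measurable.pred (PiM (K i) (\<lambda>_. ?b)) (\<lambda>\<tau>. P i (merge (K i) (V - K i) (\<tau>, \<lambda>v\<in>V - K i. True)))"
        by (rule measurable_compose[OF m1 local_event_pred[OF ev[OF i]]])
      then have "A \<in> sets (PiM (K i) (\<lambda>_. ?b))"
        unfolding A_def by (rule predE)
      moreover have "{\<omega> \<in> space ?S. P i \<omega>} = Y i -` A \<inter> space ?S"
      proof -
        have "P i (merge (K i) (V - K i) (Y i \<omega>, \<lambda>v\<in>V - K i. True)) = P i \<omega>" for \<omega>
          by (rule local_eventD[OF ev[OF i]]) (simp add: Y_def merge_def)
        moreover have "Y i \<omega> \<in> space (PiM (K i) (\<lambda>_. ?b))" for \<omega>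
          by (simp add: Y_def space_PiM)
        ultimately show ?thesis
          unfolding A_def vimage_def by (simp add: set_eq_iff conj_commute)
      qed
      ultimately show ?thesis by blast
    qed
    have "prob (\<Inter>j\<in>I. {\<omega> \<in> space ?S. P j \<omega>}) = (\<Prod>j\<in>I. prob {\<omega> \<in> space ?S. P j \<omega>})"
      by (rule indep_setsD[OF ind order_refl \<open>I \<noteq> {}\<close> fin]) (use mem in auto)
    moreover have "(\<Inter>j\<in>I. {\<omega> \<in> space ?S. P j \<omega>}) = {\<omega> \<in> space ?S. \<forall>i\<in>I. P i \<omega>}"
      using \<open>I \<noteq> {}\<close> by auto
    ultimately show ?thesis by simp
  next
    case True
    show ?thesis
    proof (cases "I = {}")
      case True
      then show ?thesis by (simp add: prob_space)
    next
      case False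
      with \<open>V = {} \<or> I = {}\<close> have "V = {}" by simp
      then have sp: "space ?S = {\<lambda>x. undefined}" by (simp add: space_site_measure)
      have eq: "prob {\<omega> \<in> space ?S. Q \<omega>} = (if Q (\<lambda>x. undefined) then 1 else 0)" for Q
      proof (cases "Q (\<lambda>x. undefined)")
        case True
        then have e: "{\<omega> \<in> space ?S. Q \<omega>} = space ?S" unfolding sp by blast
        show ?thesis unfolding e using True prob_space by simp
      next
        case False
        then have e: "{\<omega> \<in> space ?S. Q \<omega>} = {}" unfolding sp by blast
        show ?thesis unfolding e using False by simp
      qed
      show ?thesis
        unfolding eq using fin by (auto simp: prod_zero_iff)
    qed
  qed
qed

lemma prob_site_open:
  assumes "v \<in> V" "0 \<le> p" "p \<le> 1"
  shows "measure (site_measure V p) {\<omega> \<in> space (site_measure V p). \<omega> v} = p"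
    and "measure (site_measure V p) {\<omega> \<in> space (site_measure V p). \<not> \<omega> v} = 1 - p"
proof -
  interpret product_prob_space "\<lambda>_. measure_pmf (bernoulli_pmf p)" V
    by (intro product_prob_spaceI) (rule measure_pmf.prob_space_axioms)
  let ?S = "site_measure V p"
  have *: "measure ?S {\<omega> \<in> space ?S. \<omega> v \<in> A} = measure (bernoulli_pmf p) A" for A
    using emeasure_PiM_Collect_single[OF assms(1), of A]
    unfolding site_measure_def measure_def by simp
  show "measure ?S {\<omega> \<in> space ?S. \<omega> v} = p"
    using *[of "{True}"] assms by (simp add: measure_pmf_single)
  show "measure ?S {\<omega> \<in> space ?S. \<not> \<omega> v} = 1 - p"
    using *[of "{False}"] assms by (simp add: measure_pmf_single)
qed

section \<open>The tree and its cells\<close>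

locale strip_tree =
  fixes d M :: nat
  assumes d_ge: "3 \<le> d" and M_ge: "2 \<le> M"
begin

abbreviation B :: nat where "B \<equiv> M ^ d"
abbreviation V :: "vertex set" where "V \<equiv> tree_verts d M"

definition pidx :: "nat \<Rightarrow> nat" where "pidx k = (k - 1) div B + 1"

definition children :: "vertex \<Rightarrow> vertex set" where
  "children x = {(Suc (fst x), k) | k. 1 \<le> k \<and> pidx k = snd x}"

text \<open>Blocks are handled through the numerical value of their address; by
  \<open>addr_words\<close> these values are exactly the numbers below \<open>M ^ n\<close>.\<close>

definition blk :: "nat \<Rightarrow> nat \<Rightarrow> nat" where "blk n i = (i - 1) div block_size d M n"

text \<open>By \<open>horizontal_edges_eq\<close> this characterizes the horizontal edges of depth
  \<open>Suc n\<close>. It also indexes the cells, since each cell sits above exactly one horizontal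
  edge.\<close>

definition proper :: "nat \<Rightarrow> nat \<Rightarrow> bool" where
  "proper n k \<longleftrightarrow> 1 \<le> k \<and> k + 1 \<le> B ^ Suc n \<and> blk (Suc n) k = blk (Suc n) (k + 1)"

text \<open>Corners of the face above a horizontal edge; if both lower corners have the same parent,
  the face is a triangle.\<close>

definition cell :: "nat \<Rightarrow> nat \<Rightarrow> vertex set" where
  "cell n k = {(n, pidx k), (n, pidx (k + 1)), (Suc n, k), (Suc n, k + 1)}"

lemma B_ge: "8 \<le> B"
proof -
  have "(8::nat) = 2 ^ 3" by simp
  also have "\<dots> \<le> M ^ 3" using M_ge by (intro power_mono) auto
  also have "\<dots> \<le> M ^ d" using M_ge d_ge by (intro power_increasing) auto
  finally show ?thesis .
qed

lemma M_pos [simp]: "0 < M" using M_ge by simp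

lemma mem_V: "(n, i) \<in> V \<longleftrightarrow> 1 \<le> i \<and> i \<le> B ^ n"
  by (simp add: tree_verts_def power_mult)

lemma pidx_pos [simp]: "1 \<le> pidx k" "Suc 0 \<le> pidx k" "0 < pidx k" by (auto simp: pidx_def)

lemma pidx_le: "k \<le> B ^ Suc n \<Longrightarrow> pidx k \<le> B ^ n"
proof -
  assume k: "k \<le> B ^ Suc n"
  have "k - 1 < B ^ n * B" using k B_ge by (cases k) (auto simp: mult.commute)
  then have "(k - 1) div B < B ^ n" by (subst less_mult_imp_div_less) auto
  then show ?thesis by (simp add: pidx_def)
qed

lemma pidx_V: "(Suc n, k) \<in> V \<Longrightarrow> (n, pidx k) \<in> V"
  using pidx_le[of k n] pidx_pos(1)[of k] by (simp add: mem_V)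

lemma pidx_eq_iff: "1 \<le> k \<Longrightarrow> 1 \<le> i \<Longrightarrow> pidx k = i \<longleftrightarrow> (i - 1) * B < k \<and> k \<le> i * B"
proof -
  assume k: "1 \<le> k" and i: "1 \<le> i"
  obtain j where j: "i = Suc j" using i by (cases i) auto
  obtain l where l: "k = Suc l" using k by (cases k) auto
  have B: "0 < B" using B_ge by linarith
  have "l div B = j \<longleftrightarrow> j \<le> l div B \<and> l div B < Suc j" by auto
  also have "\<dots> \<longleftrightarrow> j * B \<le> l \<and> l < Suc j * B"
    by (simp only: less_eq_div_iff_mult_less_eq[OF B] div_less_iff_less_mult[OF B])
  finally show ?thesis unfolding pidx_def j l by (simp add: less_Suc_eq_le) linarith
qed

lemma pidx_Suc: "1 \<le> k \<Longrightarrow> pidx (k + 1) = pidx k \<or> pidx (k + 1) = pidx k + 1"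
proof -
  assume "1 \<le> k"
  then obtain l where l: "k = Suc l" by (cases k) auto
  have "Suc l div B = l div B \<or> Suc l div B = Suc (l div B)"
    by (simp add: div_Suc)
  then show ?thesis by (auto simp: pidx_def l)
qed

lemma children_V: "x \<in> V \<Longrightarrow> y \<in> children x \<Longrightarrow> y \<in> V"
proof -
  assume "x \<in> V" "y \<in> children x"
  then obtain n i k where *: "x = (n, i)" "y = (Suc n, k)" "1 \<le> k" "pidx k = i" "1 \<le> i" "i \<le> B ^ n"
    by (cases x) (auto simp: children_def mem_V)
  then have "k \<le> i * B" using pidx_eq_iff by auto
  also have "\<dots> \<le> B ^ n * B" using * by simp
  finally show ?thesis using * by (simp add: mem_V mult.commute)
qed

lemma children_eq: "1 \<le> i \<Longrightarrow> children (n, i) = (\<lambda>c. (Suc n, (i - 1) * B + c)) ` {1..B}"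
proof -
  assume i: "1 \<le> i"
  show ?thesis
  proof (intro set_eqI iffI)
    fix y assume "y \<in> children (n, i)"
    then obtain k where k: "y = (Suc n, k)" "1 \<le> k" "pidx k = i" by (auto simp: children_def)
    then have "(i - 1) * B < k" "k \<le> i * B" using pidx_eq_iff[OF k(2) i] by auto
    moreover have "i * B = (i - 1) * B + B" using i by (cases i) auto
    ultimately have "k - (i - 1) * B \<in> {1..B}" "k = (i - 1) * B + (k - (i - 1) * B)" by auto
    then show "y \<in> (\<lambda>c. (Suc n, (i - 1) * B + c)) ` {1..B}" using k(1) by blast
  next
    fix y assume "y \<in> (\<lambda>c. (Suc n, (i - 1) * B + c)) ` {1..B}"
    then obtain c where c: "y = (Suc n, (i - 1) * B + c)" "1 \<le> c" "c \<le> B" by auto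
    moreover have "i * B = (i - 1) * B + B" using i by (cases i) auto
    ultimately have "pidx ((i - 1) * B + c) = i" by (subst pidx_eq_iff) (use i in auto)
    then show "y \<in> children (n, i)" using c by (auto simp: children_def)
  qed
qed

lemma finite_children: "finite (children x)"
proof (cases "1 \<le> snd x")
  case True
  then show ?thesis using children_eq[of "snd x" "fst x"] by simp
next
  case False
  then have "pidx k \<noteq> snd x" for k by (metis pidx_pos(1))
  then have "children x = {}" unfolding children_def by auto
  then show ?thesis by simp
qed

lemma card_children: "x \<in> V \<Longrightarrow> card (children x) = B"
  by (cases x) (auto simp: mem_V children_eq card_image inj_on_def)

lemma block_size_pos [simp]: "0 < block_size d M n" by (simp add: block_size_def)

text \<open>The exponents agree because \<open>d + (d - 1) * n = 1 + (d - 1) * Suc n\<close>: the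
  children of one block fill exactly \<open>M\<close> blocks of the next level.\<close>

lemma block_size_Suc: "B * block_size d M n = M * block_size d M (Suc n)"
proof -
  have "d + (d - 1) * n = 1 + (d - 1) * Suc n" using d_ge by (cases d) auto
  then show ?thesis by (simp add: block_size_def flip: power_add power_Suc)
qed

lemma B_power: "B ^ n = M ^ n * block_size d M n"
proof -
  have "d * n = n + (d - 1) * n" using d_ge by (cases d) auto
  then show ?thesis by (simp add: block_size_def flip: power_add power_mult)
qed

lemma blk_less: "k \<le> B ^ n \<Longrightarrow> 1 \<le> k \<Longrightarrow> blk n k < M ^ n"
  unfolding blk_def by (rule less_mult_imp_div_less) (auto simp: B_power)

lemma blk_parent: "blk n (pidx k) = blk (Suc n) k div M"
proof -
  have "blk n (pidx k) = (k - 1) div (B * block_size d M n)"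
    by (simp add: blk_def pidx_def div_mult2_eq)
  also have "\<dots> = (k - 1) div (block_size d M (Suc n) * M)"
    by (simp only: block_size_Suc mult.commute)
  finally show ?thesis by (simp add: blk_def div_mult2_eq)
qed

lemma blk_mono: "i \<le> j \<Longrightarrow> blk n i \<le> blk n j"
  unfolding blk_def by (intro div_le_mono) auto

text \<open>Parents of vertices in one block are again in one block, because the parent address is a
  quotient by \<open>M\<close>. The upper side of a quadrilateral is thus a horizontal edge one
  level higher, which drives the inductions over depth.\<close>

lemma proper_parents:
  assumes "proper n k"
  shows "pidx (k + 1) = pidx k \<or>
    (\<exists>m. n = Suc m \<and> proper m (pidx k) \<and> pidx (k + 1) = pidx k + 1)"
proof (cases "pidx (k + 1) = pidx k")
  case False
  have k: "1 \<le> k" "k + 1 \<le> B ^ Suc n" "blk (Suc n) k = blk (Suc n) (k + 1)"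
    using assms by (auto simp: proper_def)
  from False pidx_Suc[OF k(1)] have e: "pidx (k + 1) = pidx k + 1" by simp
  have le: "pidx k + 1 \<le> B ^ n" using pidx_le[OF k(2)] e by simp
  then obtain m where m: "n = Suc m" using pidx_pos(1)[of k] by (cases n) auto
  have "blk n (pidx k) = blk n (pidx (k + 1))"
    unfolding blk_parent using k(3) by simp
  then have "proper m (pidx k)" using le e m by (simp add: proper_def)
  with m e show ?thesis by blast
qed simp

lemma proper_V: "proper n k \<Longrightarrow> cell n k \<subseteq> V"
  using pidx_le[of k n] pidx_le[of "k + 1" n] pidx_pos
  by (auto simp: proper_def cell_def mem_V)

lemma addr_Nil: "addr M [] = 0" by (simp add: addr_def)

lemma addr_snoc: "addr M (bs @ [b]) = addr M bs * M + b"
proof -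
  have "addr M (bs @ [b]) =
      (\<Sum>t = 1..length bs. (bs @ [b]) ! (t - 1) * M ^ (Suc (length bs) - t)) + b"
    by (simp add: addr_def nth_append)
  also have "(\<Sum>t = 1..length bs. (bs @ [b]) ! (t - 1) * M ^ (Suc (length bs) - t)) =
      (\<Sum>t = 1..length bs. (bs ! (t - 1) * M ^ (length bs - t)) * M)"
    by (intro sum.cong) (auto simp: nth_append Suc_diff_le)
  finally show ?thesis by (simp add: addr_def sum_distrib_right)
qed

lemma addr_words: "addr M ` words M n = {..<M ^ n}"
proof (induction n)
  case 0
  show ?case by (auto simp: words_def addr_Nil)
next
  case (Suc n)
  have w: "words M (Suc n) = (\<lambda>(bs, b). bs @ [b]) ` (words M n \<times> {..<M})"
  proof (intro set_eqI iffI)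
    fix bs assume "bs \<in> words M (Suc n)"
    then have bs: "length bs = Suc n" "set bs \<subseteq> {0..<M}" by (auto simp: words_def)
    then obtain cs c where "bs = cs @ [c]" by (cases bs rule: rev_cases) auto
    with bs have "(cs, c) \<in> words M n \<times> {..<M}" "bs = (\<lambda>(bs, b). bs @ [b]) (cs, c)"
      by (auto simp: words_def)
    then show "bs \<in> (\<lambda>(bs, b). bs @ [b]) ` (words M n \<times> {..<M})" by blast
  qed (auto simp: words_def)
  have "addr M ` words M (Suc n) = (\<lambda>(a, b). a * M + b) ` ((addr M ` words M n) \<times> {..<M})"
    unfolding w by (force simp: addr_snoc image_iff)
  also have "\<dots> = {..<M ^ Suc n}"
  proof (intro set_eqI iffI)
    fix x assume "x \<in> (\<lambda>(a, b). a * M + b) ` ((addr M ` words M n) \<times> {..<M})"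
    then obtain a b where x: "x = a * M + b" "a < M ^ n" "b < M" unfolding Suc by auto
    then have "x < Suc a * M" by simp
    also have "\<dots> \<le> M ^ n * M" using x(2) by (intro mult_le_mono1) simp
    finally show "x \<in> {..<M ^ Suc n}" by (simp add: mult.commute)
  next
    fix x assume "x \<in> {..<M ^ Suc n}"
    then have "x div M < M ^ n" by (intro less_mult_imp_div_less) (simp add: mult.commute)
    moreover have "x = x div M * M + x mod M" "x mod M < M" by simp_all
    ultimately show "x \<in> (\<lambda>(a, b). a * M + b) ` ((addr M ` words M n) \<times> {..<M})"
      unfolding Suc by (metis (no_types, lifting) SigmaI case_prod_conv image_eqI lessThan_iff)
  qed
  finally show ?case .
qed

lemma horizontal_edges_eq:
  "horizontal_edges d M = {{(Suc n, k), (Suc n, k + 1)} | n k. proper n k}"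
proof (intro set_eqI iffI)
  fix e assume "e \<in> horizontal_edges d M"
  then obtain n bs j where *: "e = {(n, j), (n, j + 1)}" "1 \<le> n" "bs \<in> words M n"
    "addr M bs * block_size d M n + 1 \<le> j" "j \<le> (addr M bs + 1) * block_size d M n - 1"
    by (auto simp: horizontal_edges_def)
  let ?s = "block_size d M n" and ?a = "addr M bs"
  have a: "?a < M ^ n" using addr_words[of n] *(3) by auto
  have j: "?a * ?s \<le> j - 1" "j < (?a + 1) * ?s" using *(4,5) block_size_pos[of n] by auto
  have "(j - 1) div ?s = ?a" "j div ?s = ?a"
    using j by (auto intro!: div_nat_eqI simp: algebra_simps)
  then have b: "blk n j = blk n (j + 1)" by (simp add: blk_def)
  have "(?a + 1) * ?s \<le> M ^ n * ?s" using a by (intro mult_le_mono1) simp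
  then have "j + 1 \<le> B ^ n" using j unfolding B_power by linarith
  moreover obtain m where "n = Suc m" using *(2) by (cases n) auto
  ultimately show "e \<in> {{(Suc n, k), (Suc n, k + 1)} | n k. proper n k}"
    using * b by (auto simp: proper_def)
next
  fix e assume "e \<in> {{(Suc n, k), (Suc n, k + 1)} | n k. proper n k}"
  then obtain n k where e: "e = {(Suc n, k), (Suc n, k + 1)}" and p: "proper n k" by auto
  let ?s = "block_size d M (Suc n)" and ?a = "blk (Suc n) k"
  have k: "1 \<le> k" "k + 1 \<le> B ^ Suc n" "?a = k div ?s" using p by (auto simp: proper_def blk_def)
  then have "?a < M ^ Suc n" by (intro blk_less) auto
  then obtain bs where bs: "bs \<in> words M (Suc n)" "addr M bs = ?a"
    using addr_words[of "Suc n"] by (metis (no_types, lifting) imageE lessThan_iff)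
  have "?a * ?s \<le> k - 1" unfolding blk_def by simp
  moreover have "k < (?a + 1) * ?s" unfolding k(3)
    using dividend_less_div_times[of ?s k] by (simp add: algebra_simps)
  ultimately have "addr M bs * ?s + 1 \<le> k" "k \<le> (addr M bs + 1) * ?s - 1"
    using k(1) bs(2) by auto
  then show "e \<in> horizontal_edges d M"
    unfolding horizontal_edges_def using e bs(1) by (auto intro!: exI[of _ "Suc n"])
qed

lemma tree_edges_eq: "tree_edges d M = {{(n, pidx k), (Suc n, k)} | n k. (Suc n, k) \<in> V}"
proof (intro set_eqI iffI)
  fix e assume "e \<in> tree_edges d M"
  then obtain n i c where *: "e = {(n, i), (Suc n, (i - 1) * B + c)}" "(n, i) \<in> V" "1 \<le> c" "c \<le> B"
    by (auto simp: tree_edges_def)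
  then have "(Suc n, (i - 1) * B + c) \<in> children (n, i)" by (subst children_eq) (auto simp: mem_V)
  then show "e \<in> {{(n, pidx k), (Suc n, k)} | n k. (Suc n, k) \<in> V}"
    using * children_V[OF *(2)] unfolding children_def
    by (intro CollectI exI[of _ n] exI[of _ "(i - 1) * B + c"]) auto
next
  fix e assume "e \<in> {{(n, pidx k), (Suc n, k)} | n k. (Suc n, k) \<in> V}"
  then obtain n k where e: "e = {(n, pidx k), (Suc n, k)}" "(Suc n, k) \<in> V" by auto
  have "(Suc n, k) \<in> children (n, pidx k)" using e(2) by (simp add: children_def mem_V)
  then obtain c where c: "1 \<le> c" "c \<le> B" "k = (pidx k - 1) * B + c"
    unfolding children_eq[OF pidx_pos(1)] by auto
  have "e = {(n, pidx k), (Suc n, (pidx k - 1) * B + c)}" using e(1) c(3) by simp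
  then show "e \<in> tree_edges d M"
    unfolding tree_edges_def using pidx_V[OF e(2)] c(1,2) by blast
qed

lemma strip_edges_eq: "strip_edges d M =
    {{(n, pidx k), (Suc n, k)} | n k. (Suc n, k) \<in> V} \<union>
    {{(Suc n, k), (Suc n, k + 1)} | n k. proper n k}"
  unfolding strip_edges_def horizontal_edges_eq tree_edges_eq ..

lemma strip_edge_tree: "(Suc n, k) \<in> V \<Longrightarrow> {(n, pidx k), (Suc n, k)} \<in> strip_edges d M"
  and strip_edge_hor: "proper n k \<Longrightarrow> {(Suc n, k), (Suc n, k + 1)} \<in> strip_edges d M"
  unfolding strip_edges_eq by blast+

lemma strip_edge_V: "{x, y} \<in> strip_edges d M \<Longrightarrow> x \<in> V \<and> y \<in> V"
  using pidx_V unfolding strip_edges_eq by (auto simp: doubleton_eq_iff mem_V proper_def)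

lemma strip_edge_cases:
  assumes "e \<in> strip_edges d M"
  obtains (tree) n k where "(Suc n, k) \<in> V" "e = {(n, pidx k), (Suc n, k)}"
    | (hor) n k where "proper n k" "e = {(Suc n, k), (Suc n, k + 1)}"
  using assms unfolding strip_edges_eq by blast

lemma strip_edge_irrefl: "{x} \<notin> strip_edges d M"
proof
  assume "{x} \<in> strip_edges d M"
  then obtain y z where yz: "{x} = {y, z}" "y \<noteq> z"
    by (cases rule: strip_edge_cases)
      (metis Pair_inject n_not_Suc_n, metis Pair_inject Suc_eq_plus1 n_not_Suc_n)
  from yz(1) have "y = x" "z = x" by blast+
  with yz(2) show False by simp
qed

section \<open>Cuts of the strip and their connectedness through cells\<close>

primrec parity :: "vertex set set \<Rightarrow> nat \<Rightarrow> nat \<Rightarrow> bool" where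
  "parity Q 0 k = False"
| "parity Q (Suc n) k = (parity Q n (pidx k) \<noteq> ({(n, pidx k), (Suc n, k)} \<in> Q))"

text \<open>\<open>parity\<close> counts the edges of \<open>Q\<close> modulo 2 along the tree path
  from the root. Evenness on a cell transfers the claim from its upper side to its lower side, so
  \<open>Q\<close> is exactly the set of edges across which this two-colouring changes.\<close>

lemma parity_horizontal:
  assumes Q: "Q \<subseteq> strip_edges d M"
    and even: "\<And>n k. proper n k \<Longrightarrow> ({(Suc n, k), (Suc n, k + 1)} \<in> Q) =
      (({(n, pidx k), (Suc n, k)} \<in> Q) \<noteq>
       (({(n, pidx (k + 1)), (Suc n, k + 1)} \<in> Q) \<noteq> ({(n, pidx k), (n, pidx (k + 1))} \<in> Q)))"
  shows "proper n k \<Longrightarrow>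
    (parity Q (Suc n) k \<noteq> parity Q (Suc n) (k + 1)) = ({(Suc n, k), (Suc n, k + 1)} \<in> Q)"
proof (induction n arbitrary: k)
  have single: "{x} \<notin> Q" for x using Q strip_edge_irrefl by blast
  case 0
  then have "pidx (k + 1) = pidx k" using proper_parents by fastforce
  then show ?case using even[OF 0] single by auto
next
  have single: "{x} \<notin> Q" for x using Q strip_edge_irrefl by blast
  case (Suc n)
  show ?case
  proof (cases "pidx (k + 1) = pidx k")
    case True
    then show ?thesis using even[OF Suc.prems] single by auto
  next
    case False
    with proper_parents[OF Suc.prems] have p: "proper n (pidx k)" and e: "pidx (k + 1) = pidx k + 1"
      by auto
    show ?thesis using Suc.IH[OF p] even[OF Suc.prems] unfolding e parity.simps(2)[of Q "Suc n"] by blast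
  qed
qed

definition adj :: "vertex set \<Rightarrow> (vertex \<times> vertex) set" where
  "adj S = {(x, y). x \<in> S \<and> y \<in> S \<and> {x, y} \<in> strip_edges d M}"

definition edge_cut :: "vertex set \<Rightarrow> vertex set set" where
  "edge_cut D = {{x, y} | x y. x \<in> D \<and> y \<notin> D \<and> {x, y} \<in> strip_edges d M}"

text \<open>Let \<open>Q\<close> consist of the cut edges reachable from \<open>e\<close> through
  common cells. A cell contains all or none of its cut edges in \<open>Q\<close>, and a cut meets
  the boundary of a cell evenly, so \<open>Q\<close> is itself given by a two-colouring. The
  colouring is constant on \<open>A\<close> and on \<open>D\<close>, hence \<open>Q\<close> cannot
  contain \<open>e\<close> and miss \<open>f\<close>.\<close>

lemma cut_connected:
  assumes A: "\<And>a b. a \<in> A \<Longrightarrow> b \<in> A \<Longrightarrow> (a, b) \<in> (adj A)\<^sup>*"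
    and D: "\<And>a b. a \<in> D \<Longrightarrow> b \<in> D \<Longrightarrow> (a, b) \<in> (adj D)\<^sup>*"
    and disj: "A \<inter> D = {}"
    and nbr: "\<And>x y. x \<in> D \<Longrightarrow> y \<notin> D \<Longrightarrow> {x, y} \<in> strip_edges d M \<Longrightarrow> y \<in> A"
    and e: "e \<in> edge_cut D" and f: "f \<in> edge_cut D"
  shows "(e, f) \<in> {(e, f). e \<in> edge_cut D \<and> f \<in> edge_cut D \<and> (\<exists>n k. proper n k \<and> e \<union> f \<subseteq> cell n k)}\<^sup>*"
    (is "_ \<in> ?R\<^sup>*")
proof (rule ccontr)
  assume nf: "(e, f) \<notin> ?R\<^sup>*"
  define Q where "Q = {g \<in> edge_cut D. (e, g) \<in> ?R\<^sup>*}"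
  have in_cut: "{x, y} \<in> edge_cut D \<longleftrightarrow> {x, y} \<in> strip_edges d M \<and> (x \<in> D) \<noteq> (y \<in> D)" for x y
  proof -
    have *: "{y, x} = {x, y}" by (rule insert_commute)
    show ?thesis
    proof
      assume "{x, y} \<in> edge_cut D"
      then obtain a b where "{x, y} = {a, b}" "a \<in> D" "b \<notin> D" "{a, b} \<in> strip_edges d M"
        unfolding edge_cut_def by blast
      then show "{x, y} \<in> strip_edges d M \<and> (x \<in> D) \<noteq> (y \<in> D)"
        unfolding doubleton_eq_iff using * by metis
    next
      assume h: "{x, y} \<in> strip_edges d M \<and> (x \<in> D) \<noteq> (y \<in> D)"
      show "{x, y} \<in> edge_cut D"
      proof (cases "x \<in> D")
        case True
        then show ?thesis unfolding edge_cut_def using h by blast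
      next
        case False
        with h have "y \<in> D \<and> x \<notin> D \<and> {y, x} \<in> strip_edges d M" unfolding * by simp
        then have "{y, x} \<in> edge_cut D" unfolding edge_cut_def by blast
        then show ?thesis unfolding * .
      qed
    qed
  qed
  have Qsub: "Q \<subseteq> strip_edges d M" unfolding Q_def edge_cut_def by auto
  have QD: "g \<in> Q \<Longrightarrow> g \<in> edge_cut D" for g by (simp add: Q_def)
  have Qcell: "h \<in> Q" if "proper n k" "g \<in> Q" "h \<in> edge_cut D" "g \<subseteq> cell n k" "h \<subseteq> cell n k" for g h n k
  proof -
    have "(g, h) \<in> ?R" using that QD by blast
    then show ?thesis using that(2,3) unfolding Q_def by (auto intro: rtrancl_into_rtrancl)
  qed
  have par: "(parity Q (Suc n) k \<noteq> parity Q (Suc n) (k + 1)) = ({(Suc n, k), (Suc n, k + 1)} \<in> Q)"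
    if "proper n k" for n k
  proof (rule parity_horizontal[OF Qsub _ that])
    fix n k assume p: "proper n k"
    let ?a = "(n, pidx k)" and ?b = "(n, pidx (k + 1))" and ?c = "(Suc n, k)" and ?c' = "(Suc n, k + 1)"
    have V: "?c \<in> V" "?c' \<in> V" using proper_V[OF p] by (auto simp: cell_def)
    have edges: "{?a, ?c} \<in> strip_edges d M" "{?b, ?c'} \<in> strip_edges d M" "{?c, ?c'} \<in> strip_edges d M"
      using strip_edge_tree V strip_edge_hor[OF p] by auto
    \<comment> \<open>In a triangle \<open>?a = ?b\<close>, and the upper side degenerates to a
      singleton, which is no edge.\<close>
    have ab: "{?a, ?b} \<in> strip_edges d M \<or> ?a = ?b"
      using proper_parents[OF p] strip_edge_hor by fastforce
    have sub: "{?a, ?c} \<subseteq> cell n k" "{?b, ?c'} \<subseteq> cell n k" "{?c, ?c'} \<subseteq> cell n k" "{?a, ?b} \<subseteq> cell n k"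
      by (auto simp: cell_def)
    \<comment> \<open>Any two cut edges in one cell are related by \<open>?R\<close>, so a single
      truth value \<open>u\<close> decides membership in \<open>Q\<close> for all of them.\<close>
    define u where "u = (\<exists>g\<in>Q. g \<subseteq> cell n k)"
    have iff: "g \<in> Q \<longleftrightarrow> u \<and> g \<in> edge_cut D" if "g \<subseteq> cell n k" for g
      using Qcell[OF p _ _ _ that] QD that unfolding u_def by blast
    have 1: "{?a, ?c} \<in> edge_cut D \<longleftrightarrow> (?a \<in> D) \<noteq> (?c \<in> D)" "{?b, ?c'} \<in> edge_cut D \<longleftrightarrow> (?b \<in> D) \<noteq> (?c' \<in> D)"
      "{?c, ?c'} \<in> edge_cut D \<longleftrightarrow> (?c \<in> D) \<noteq> (?c' \<in> D)"
      unfolding in_cut using edges by simp_all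
    have 2: "{?a, ?b} \<in> edge_cut D \<longleftrightarrow> (?a \<in> D) \<noteq> (?b \<in> D)"
      unfolding in_cut using ab by auto
    show "({?c, ?c'} \<in> Q) = (({?a, ?c} \<in> Q) \<noteq> (({?b, ?c'} \<in> Q) \<noteq> ({?a, ?b} \<in> Q)))"
      unfolding iff[OF sub(1)] iff[OF sub(2)] iff[OF sub(3)] iff[OF sub(4)] 1 2 by blast
  qed
  define h where "h = (\<lambda>x. parity Q (fst x) (snd x))"
  have hQ: "(h x \<noteq> h y) = ({x, y} \<in> Q)" if "{x, y} \<in> strip_edges d M" for x y
    using that
  proof (cases rule: strip_edge_cases)
    case (tree n k)
    have k: "(h (n, pidx k) \<noteq> h (Suc n, k)) = ({x, y} \<in> Q)"
      unfolding tree(2) by (simp add: h_def) blast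
    from tree(2) have "x = (n, pidx k) \<and> y = (Suc n, k) \<or> x = (Suc n, k) \<and> y = (n, pidx k)"
      by (simp only: doubleton_eq_iff)
    then show ?thesis using k by blast
  next
    case (hor n k)
    have k: "(h (Suc n, k) \<noteq> h (Suc n, k + 1)) = ({x, y} \<in> Q)"
      unfolding hor(2) using par[OF hor(1)] by (simp only: h_def fst_conv snd_conv)
    from hor(2) have "x = (Suc n, k) \<and> y = (Suc n, k + 1) \<or> x = (Suc n, k + 1) \<and> y = (Suc n, k)"
      by (simp only: doubleton_eq_iff)
    then show ?thesis using k by blast
  qed
  have const: "h a = h b" if "(a, b) \<in> (adj S)\<^sup>*" and S: "S \<subseteq> D \<or> S \<inter> D = {}" for S a b
    using that(1)
  proof (induction rule: rtrancl_induct)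
    case (step y z)
    then have yz: "y \<in> S" "z \<in> S" "{y, z} \<in> strip_edges d M" by (auto simp: adj_def)
    then have "{y, z} \<notin> edge_cut D" unfolding in_cut using S by blast
    then have "h y = h z" using hQ[OF yz(3)] QD by blast
    with step.IH show ?case by simp
  qed simp
  obtain x y where xy: "e = {x, y}" "x \<in> D" "y \<notin> D" "{x, y} \<in> strip_edges d M" "y \<in> A"
    using e nbr unfolding edge_cut_def by blast
  obtain x' y' where xy': "f = {x', y'}" "x' \<in> D" "y' \<notin> D" "{x', y'} \<in> strip_edges d M" "y' \<in> A"
    using f nbr unfolding edge_cut_def by blast
  have "h x = h x'" by (rule const[OF D[OF xy(2) xy'(2)]]) simp
  moreover have "h y = h y'" by (rule const[OF A[OF xy(5) xy'(5)]]) (use disj in simp)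
  moreover have "h x \<noteq> h y" using hQ[OF xy(4)] e xy(1) by (simp add: Q_def)
  moreover have "h x' = h y'" using hQ[OF xy'(4)] nf xy'(1) by (simp add: Q_def)
  ultimately show False by simp
qed

end

section \<open>Coordinates of the drawing\<close>

declare block_left.simps(2) [simp del]

context strip_tree
begin

definition hgt :: "nat \<Rightarrow> real" where "hgt n = (1 / 2) ^ n"
definition wd :: "nat \<Rightarrow> real" where "wd n = 1 / real (2 * M + 1) ^ n"

abbreviation bl :: "nat \<Rightarrow> nat \<Rightarrow> real" where "bl n j \<equiv> block_left M n j"
abbreviation br :: "nat \<Rightarrow> nat \<Rightarrow> real" where "br n j \<equiv> block_left M n j + wd n"
abbreviation X :: "nat \<Rightarrow> nat \<Rightarrow> real" where "X n i \<equiv> vertex_x d M (n, i)"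

lemma hgt_pos [simp]: "0 < hgt n" by (simp add: hgt_def)
lemma hgt_Suc: "hgt n = 2 * hgt (Suc n)" by (simp add: hgt_def)
lemma hgt_0 [simp]: "hgt 0 = 1" by (simp add: hgt_def)
lemma hgt_less: "m < n \<Longrightarrow> hgt n < hgt m" by (simp add: hgt_def power_strict_decreasing)
lemma hgt_mono: "m \<le> n \<Longrightarrow> hgt n \<le> hgt m" by (simp add: hgt_def power_decreasing)
lemma hgt_le_iff: "hgt n \<le> hgt m \<longleftrightarrow> m \<le> n" using hgt_less hgt_mono by (metis not_le)
lemma hgt_eq_iff: "hgt n = hgt m \<longleftrightarrow> n = m" using hgt_less by (metis less_irrefl nat_neq_iff)
lemma hgt_mult: "2 ^ Suc n * hgt (Suc n) = 1" "2 ^ Suc n * hgt n = 2"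
  by (simp_all add: hgt_def power_one_over)

lemma wd_pos [simp]: "0 < wd n" by (simp add: wd_def)
lemma wd_Suc: "wd n = real (2 * M + 1) * wd (Suc n)"
proof -
  have "real (2 * M + 1) \<noteq> 0" by linarith
  then show ?thesis unfolding wd_def power_Suc by simp
qed
lemma wd_0: "wd 0 = 1" by (simp add: wd_def)

lemma bl_Suc: "bl (Suc n) j = bl n (j div M) + real (2 * (j mod M) + 1) * wd (Suc n)"
  by (simp add: wd_def block_left.simps(2))

lemma block_nested:
  "bl n (j div M) < bl (Suc n) j" "br (Suc n) j < br n (j div M)"
proof -
  show "bl n (j div M) < bl (Suc n) j" unfolding bl_Suc by (simp add: add_nonneg_pos)
  have "real (2 * (j mod M) + 1) * wd (Suc n) + wd (Suc n) = real (2 * (j mod M) + 2) * wd (Suc n)"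
    by (simp add: algebra_simps)
  also have "\<dots> < real (2 * M + 1) * wd (Suc n)"
  proof (rule mult_strict_right_mono)
    have "j mod M < M" by simp
    then show "real (2 * (j mod M) + 2) < real (2 * M + 1)" by linarith
  qed simp
  finally show "br (Suc n) j < br n (j div M)" unfolding bl_Suc wd_Suc[of n] by simp
qed

lemma block_nested_le:
  "bl n (j div M ^ r) \<le> bl (n + r) j" "br (n + r) j \<le> br n (j div M ^ r)"
proof (induction r arbitrary: j)
  case (Suc r)
  have e: "j div M ^ Suc r = j div M div M ^ r" for j by (simp add: div_mult2_eq)
  have a: "n + Suc r = Suc (n + r)" by simp
  { case 1
    have "bl n (j div M ^ Suc r) \<le> bl (n + r) (j div M)" unfolding e by (rule Suc(1))
    then show ?case unfolding a by (rule less_imp_le[OF le_less_trans[OF _ block_nested(1)]]) }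
  { case 2
    have "br (n + r) (j div M) \<le> br n (j div M ^ Suc r)" unfolding e by (rule Suc(2))
    then show ?case unfolding a by (rule less_imp_le[OF less_le_trans[OF block_nested(2)]]) }
qed auto

text \<open>Siblings occupy different odd parts of the parent interval and are separated by an even
  part; other blocks inherit the gap between their parents.\<close>

lemma block_order: "j < j' \<Longrightarrow> j' < M ^ n \<Longrightarrow> br n j < bl n j'"
proof (induction n arbitrary: j j')
  case (Suc n)
  have j'n: "j' div M < M ^ n" using Suc.prems(2) by (intro less_mult_imp_div_less) (simp add: mult.commute)
  have le: "j div M \<le> j' div M" using Suc.prems by (simp add: div_le_mono)
  show ?case
  proof (cases "j div M = j' div M")
    case True
    then have "j mod M < j' mod M" using Suc.prems(1)
      by (metis div_mult_mod_eq nat_add_left_cancel_less)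
    then have "real (2 * (j mod M) + 1) + 1 < real (2 * (j' mod M) + 1)" by linarith
    then have "(real (2 * (j mod M) + 1) + 1) * wd (Suc n) < real (2 * (j' mod M) + 1) * wd (Suc n)"
      by (rule mult_strict_right_mono) simp
    then show ?thesis unfolding bl_Suc True by (simp add: algebra_simps)
  next
    case False
    then have "br n (j div M) < bl n (j' div M)" using le j'n by (intro Suc.IH) auto
    then show ?thesis using block_nested(2)[of n j] block_nested(1)[of n j'] by linarith
  qed
qed simp

lemma block_order_le: "j \<le> j' \<Longrightarrow> j' < M ^ n \<Longrightarrow> bl n j \<le> bl n j'"
proof -
  assume "j \<le> j'" "j' < M ^ n"
  then have "j = j' \<or> br n j < bl n j'" using block_order[of j j' n] by linarith
  then show ?thesis using wd_pos[of n] by (elim disjE) (simp, linarith)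
qed

lemma block_size_ge: "1 \<le> n \<Longrightarrow> 2 \<le> block_size d M n"
proof -
  assume "1 \<le> n"
  then have "1 \<le> (d - 1) * n" using d_ge by simp
  then have "M ^ 1 \<le> M ^ ((d - 1) * n)" using M_ge by (intro power_increasing) linarith+
  then show ?thesis using M_ge by (simp add: block_size_def)
qed

lemma X_0: "X 0 i = 1 / 2" by (simp add: vertex_x_def)

lemma X_pos: "1 \<le> n \<Longrightarrow> X n i = bl n (blk n i) +
    real ((i - 1) mod block_size d M n) / real (block_size d M n - 1) * wd n"
  by (simp add: vertex_x_def blk_def wd_def)

lemma X_bounds: "i \<le> B ^ n \<Longrightarrow> bl n (blk n i) \<le> X n i \<and> X n i \<le> br n (blk n i)"
proof (cases "n = 0")
  case True
  then show ?thesis by (simp add: X_0 wd_0)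
next
  case False
  let ?s = "block_size d M n"
  have s: "2 \<le> ?s" using False block_size_ge by simp
  have "(i - 1) mod ?s \<le> ?s - 1" using s by (metis Suc_pred' block_size_pos less_Suc_eq_le mod_less_divisor)
  then have "0 \<le> real ((i - 1) mod ?s) / real (?s - 1)" "real ((i - 1) mod ?s) / real (?s - 1) \<le> 1"
    using s by auto
  then have "0 \<le> real ((i - 1) mod ?s) / real (?s - 1) * wd n"
     "real ((i - 1) mod ?s) / real (?s - 1) * wd n \<le> 1 * wd n"
    using wd_pos[of n] by (intro mult_nonneg_nonneg mult_right_mono; linarith)+
  moreover have "1 \<le> n" using False by simp
  ultimately show ?thesis unfolding X_pos[OF \<open>1 \<le> n\<close>] mult_1
    by (simp only: le_add_same_cancel1 add_le_cancel_left simp_thms)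
qed

lemma X_mono: "1 \<le> i \<Longrightarrow> i < i' \<Longrightarrow> i' \<le> B ^ n \<Longrightarrow> X n i < X n i'"
proof -
  assume i: "1 \<le> i" "i < i'" "i' \<le> B ^ n"
  then have n: "1 \<le> n" by (cases n) auto
  let ?s = "block_size d M n"
  have s: "2 \<le> ?s" using n block_size_ge by simp
  show ?thesis
  proof (cases "blk n i = blk n i'")
    case True
    have "(i - 1) mod ?s < (i' - 1) mod ?s"
    proof -
      have "i - 1 = blk n i * ?s + (i - 1) mod ?s" "i' - 1 = blk n i' * ?s + (i' - 1) mod ?s"
        unfolding blk_def by (simp_all only: div_mult_mod_eq)
      moreover have "i - 1 < i' - 1" using i by linarith
      ultimately show ?thesis unfolding True by linarith
    qed
    then show ?thesis using n s True
      by (auto simp: X_pos intro!: mult_strict_right_mono divide_strict_right_mono)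
  next
    case False
    then have "blk n i < blk n i'" using blk_mono[of i i' n] i by simp
    moreover have "blk n i' < M ^ n" using blk_less i by simp
    ultimately have "br n (blk n i) < bl n (blk n i')" by (rule block_order)
    then show ?thesis using X_bounds[of i n] X_bounds[of i' n] i by linarith
  qed
qed

lemma X_mono_le: "1 \<le> i \<Longrightarrow> i \<le> i' \<Longrightarrow> i' \<le> B ^ n \<Longrightarrow> X n i \<le> X n i'"
  using X_mono[of i i' n] by (cases "i = i'") auto

lemma X_less_iff: "1 \<le> i \<Longrightarrow> i \<le> B ^ n \<Longrightarrow> 1 \<le> i' \<Longrightarrow> i' \<le> B ^ n \<Longrightarrow> X n i < X n i' \<longleftrightarrow> i < i'"
  using X_mono[of i i' n] X_mono_le[of i' i n] by (cases "i < i'") auto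

lemma X_le_iff: "1 \<le> i \<Longrightarrow> i \<le> B ^ n \<Longrightarrow> 1 \<le> i' \<Longrightarrow> i' \<le> B ^ n \<Longrightarrow> X n i \<le> X n i' \<longleftrightarrow> i \<le> i'"
  using X_less_iff[of i' n i] by (simp add: not_less flip: not_less)

definition bfirst :: "nat \<Rightarrow> nat \<Rightarrow> nat" where "bfirst n b = b * block_size d M n + 1"
definition blast :: "nat \<Rightarrow> nat \<Rightarrow> nat" where "blast n b = (b + 1) * block_size d M n"

lemma bfirst_le: "b < M ^ n \<Longrightarrow> bfirst n b \<le> B ^ n" and blast_le: "b < M ^ n \<Longrightarrow> blast n b \<le> B ^ n"
proof -
  assume "b < M ^ n"
  then have "(b + 1) * block_size d M n \<le> M ^ n * block_size d M n" by (intro mult_le_mono1) simp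
  then show "blast n b \<le> B ^ n" "bfirst n b \<le> B ^ n"
    using block_size_pos[of n] unfolding blast_def bfirst_def B_power add_mult_distrib by linarith+
qed

lemma bfirst_pos [simp]: "1 \<le> bfirst n b" "Suc 0 \<le> bfirst n b" by (simp_all add: bfirst_def)
lemma blast_pos [simp]: "1 \<le> blast n b" "Suc 0 \<le> blast n b"
  using block_size_pos[of n] by (auto simp: blast_def simp del: block_size_pos)
lemma blast_Suc: "blast n b + 1 = bfirst n (b + 1)" by (simp add: bfirst_def blast_def)

lemma blk_bfirst [simp]: "blk n (bfirst n b) = b" by (simp add: blk_def bfirst_def)
lemma blk_blast [simp]: "blk n (blast n b) = b"
proof -
  have "blast n b - 1 = b * block_size d M n + (block_size d M n - 1)"
    using block_size_pos[of n] unfolding blast_def add_mult_distrib by linarith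
  then show ?thesis unfolding blk_def by (simp add: div_add1_eq)
qed

lemma blk_range: "1 \<le> i \<Longrightarrow> bfirst n (blk n i) \<le> i \<and> i \<le> blast n (blk n i)"
proof -
  assume "1 \<le> i"
  moreover have "blk n i * block_size d M n \<le> i - 1" by (simp add: blk_def)
  moreover have "i - 1 < (blk n i + 1) * block_size d M n"
    using dividend_less_div_times[of "block_size d M n" "i - 1"]
    by (simp add: blk_def algebra_simps)
  ultimately show ?thesis by (auto simp: bfirst_def blast_def)
qed

lemma X_bfirst: "1 \<le> n \<Longrightarrow> X n (bfirst n b) = bl n b"
  by (subst X_pos) (simp_all add: bfirst_def[of n b, THEN arg_cong, of "\<lambda>x. x - 1"] del: bfirst_pos, simp_all add: bfirst_def)

lemma X_blast: "1 \<le> n \<Longrightarrow> X n (blast n b) = br n b"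
proof -
  assume n: "1 \<le> n"
  have s: "2 \<le> block_size d M n" using n block_size_ge by simp
  have e: "blast n b - 1 = (block_size d M n - 1) + b * block_size d M n"
    using s unfolding blast_def add_mult_distrib by linarith
  have "(blast n b - 1) mod block_size d M n = block_size d M n - 1"
    unfolding e by (subst mod_mult_self1) (use s in simp)
  then show ?thesis using n s by (simp add: X_pos)
qed

lemma pidx_bfirst: "pidx (bfirst (Suc n) (b * M)) = bfirst n b"
proof -
  have "b * M * block_size d M (Suc n) = b * block_size d M n * B"
    using block_size_Suc[of n] by (simp add: mult.assoc mult.commute mult.left_commute)
  moreover have "0 < B" using B_ge by linarith
  ultimately show ?thesis unfolding pidx_def bfirst_def by (simp only: add_diff_cancel_right' nonzero_mult_div_cancel_right neq0_conv)
qed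

lemma pidx_blast: "pidx (blast (Suc n) (b * M + M - 1)) = blast n b"
proof -
  have "blast (Suc n) (b * M + M - 1) = (b + 1) * M * block_size d M (Suc n)"
    using M_ge by (simp add: blast_def algebra_simps)
  also have "\<dots> = blast n b * B"
    using block_size_Suc[of n] unfolding blast_def by (metis mult.assoc mult.commute)
  finally have e: "blast (Suc n) (b * M + M - 1) = blast n b * B" .
  have "0 < blast n b" using blast_pos(1)[of n b] by linarith
  then have "0 < blast n b * B" using B_ge by simp
  then have "1 \<le> blast n b * B" by linarith
  moreover have "(blast n b - 1) * B < blast n b * B"
    using \<open>0 < blast n b\<close> B_ge by (intro mult_strict_right_mono) linarith+
  ultimately show ?thesis unfolding e by (subst pidx_eq_iff) simp_all
qed

text \<open>The horizontal coordinate at height \<open>y\<close> of the tree edge ending in \<open>(Suc n, k)\<close>.\<close>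
definition eg :: "nat \<Rightarrow> nat \<Rightarrow> real \<Rightarrow> real" where
  "eg n k y = X (Suc n) k + (2 ^ Suc n * y - 1) * (X n (pidx k) - X (Suc n) k)"

lemma eg_bot: "eg n k (hgt (Suc n)) = X (Suc n) k" unfolding eg_def hgt_mult by simp
lemma eg_top: "eg n k (hgt n) = X n (pidx k)" unfolding eg_def hgt_mult by simp

lemma eg_convex: "eg n k y = (1 - (2 ^ Suc n * y - 1)) * X (Suc n) k + (2 ^ Suc n * y - 1) * X n (pidx k)"
  by (simp only: eg_def algebra_simps)

lemma eg_weight:
  assumes "hgt (Suc n) \<le> y" shows "0 \<le> 2 ^ Suc n * y - 1"
    and "y \<le> hgt n \<Longrightarrow> 2 ^ Suc n * y - 1 \<le> 1" and "y < hgt n \<Longrightarrow> 2 ^ Suc n * y - 1 < 1"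
proof -
  have p: "(0::real) < 2 ^ Suc n" by simp
  show "0 \<le> 2 ^ Suc n * y - 1"
    using mult_left_mono[OF assms, of "2 ^ Suc n"] unfolding hgt_mult by simp
  show "y \<le> hgt n \<Longrightarrow> 2 ^ Suc n * y - 1 \<le> 1"
    using mult_left_mono[of y "hgt n" "2 ^ Suc n"] unfolding hgt_mult by simp
  show "y < hgt n \<Longrightarrow> 2 ^ Suc n * y - 1 < 1"
    using mult_strict_left_mono[OF _ p, of y "hgt n"] unfolding hgt_mult by simp
qed

lemma eg_between:
  assumes "hgt (Suc n) \<le> y" "y \<le> hgt n" "lo \<le> X (Suc n) k" "X (Suc n) k \<le> hi"
    "lo \<le> X n (pidx k)" "X n (pidx k) \<le> hi"
  shows "lo \<le> eg n k y" "eg n k y \<le> hi"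
proof -
  let ?t = "2 ^ Suc n * y - 1"
  have t: "0 \<le> ?t" "0 \<le> 1 - ?t" using eg_weight[OF assms(1)] assms(2) by auto
  have "(1 - ?t) * lo + ?t * lo \<le> (1 - ?t) * X (Suc n) k + ?t * X n (pidx k)"
    using t assms by (intro add_mono mult_left_mono) auto
  then show "lo \<le> eg n k y" unfolding eg_convex by (simp add: algebra_simps)
  have "(1 - ?t) * X (Suc n) k + ?t * X n (pidx k) \<le> (1 - ?t) * hi + ?t * hi"
    using t assms by (intro add_mono mult_left_mono) auto
  then show "eg n k y \<le> hi" unfolding eg_convex by (simp add: algebra_simps)
qed

lemma pidx_mono: "k \<le> k' \<Longrightarrow> pidx k \<le> pidx k'" by (auto simp: pidx_def div_le_mono)

text \<open>Strictness comes from the lower end points, whose weight is positive for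
  \<open>y < hgt n\<close>. At the top, edges from a common parent meet.\<close>

lemma eg_mono:
  assumes "hgt (Suc n) \<le> y" "y < hgt n" "1 \<le> k" "k < k'" "k' \<le> B ^ Suc n"
  shows "eg n k y < eg n k' y"
proof -
  let ?t = "2 ^ Suc n * y - 1"
  have t: "0 \<le> ?t" "0 < 1 - ?t" using eg_weight[OF assms(1)] assms(2) by auto
  have "X n (pidx k) \<le> X n (pidx k')"
    using assms pidx_mono[of k k'] pidx_le[of k' n] by (intro X_mono_le) auto
  moreover have "X (Suc n) k < X (Suc n) k'" using assms by (intro X_mono) auto
  ultimately show ?thesis unfolding eg_convex using t
    by (intro add_less_le_mono mult_strict_left_mono mult_left_mono) auto
qed

lemma eg_mono_le:
  assumes "hgt (Suc n) \<le> y" "y \<le> hgt n" "1 \<le> k" "k \<le> k'" "k' \<le> B ^ Suc n"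
  shows "eg n k y \<le> eg n k' y"
proof -
  let ?t = "2 ^ Suc n * y - 1"
  have t: "0 \<le> ?t" "0 \<le> 1 - ?t" using eg_weight[OF assms(1)] assms(2) by auto
  have "X n (pidx k) \<le> X n (pidx k')"
    using assms pidx_mono[of k k'] pidx_le[of k' n] by (intro X_mono_le) auto
  moreover have "X (Suc n) k \<le> X (Suc n) k'" using assms by (intro X_mono_le) auto
  ultimately show ?thesis unfolding eg_convex using t
    by (intro add_mono mult_left_mono) auto
qed

text \<open>Both ends lie over the interval of the parent's block, since intervals of child blocks
  are nested in it.\<close>

lemma eg_block:
  assumes "hgt (Suc n) \<le> y" "y \<le> hgt n" "1 \<le> k" "k \<le> B ^ Suc n"
  shows "bl n (blk n (pidx k)) \<le> eg n k y \<and> eg n k y \<le> br n (blk n (pidx k))"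
proof -
  have 1: "bl n (blk n (pidx k)) \<le> X n (pidx k)" "X n (pidx k) \<le> br n (blk n (pidx k))"
    using X_bounds[OF pidx_le[OF assms(4)]] by auto
  have 2: "bl n (blk n (pidx k)) \<le> X (Suc n) k" "X (Suc n) k \<le> br n (blk n (pidx k))"
    using X_bounds[OF assms(4)] block_nested[of n "blk (Suc n) k"] unfolding blk_parent by linarith+
  show ?thesis using eg_between[OF assms(1,2) 2 1] by blast
qed

section \<open>The drawing as a point set, described height by height\<close>

definition on_strip :: "real \<Rightarrow> real \<Rightarrow> bool" where
  "on_strip x y \<longleftrightarrow>
     (\<exists>n k. (Suc n, k) \<in> V \<and> hgt (Suc n) \<le> y \<and> y \<le> hgt n \<and> x = eg n k y) \<or>
     (\<exists>n k. proper n k \<and> y = hgt (Suc n) \<and> X (Suc n) k \<le> x \<and> x \<le> X (Suc n) (k + 1))"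

definition in_cell :: "nat \<Rightarrow> nat \<Rightarrow> real \<Rightarrow> real \<Rightarrow> bool" where
  "in_cell n k x y \<longleftrightarrow> hgt (Suc n) < y \<and> y < hgt n \<and> eg n k y < x \<and> x < eg n (k + 1) y"

text \<open>Points on the vertical segments below the ends of the blocks other than the last one.\<close>
definition on_vert :: "real \<Rightarrow> real \<Rightarrow> bool" where
  "on_vert x y \<longleftrightarrow> (\<exists>n b. 1 \<le> n \<and> b + 1 < M ^ n \<and> y \<le> hgt n \<and> (x = bl n b \<or> x = br n b))"

lemma block_desc: "j < M ^ (m + r) \<Longrightarrow> j div M ^ r < M ^ m"
  by (intro less_mult_imp_div_less) (simp add: power_add)

lemma block_in:
  assumes "m \<le> n" "j < M ^ n" "bl n j \<le> x" "x \<le> br n j"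
  shows "\<exists>j'<M ^ m. bl m j' \<le> x \<and> x \<le> br m j'"
proof -
  obtain r where r: "n = m + r" using assms(1) le_Suc_ex by blast
  show ?thesis using block_nested_le(1)[of m j r] block_nested_le(2)[of m r j] assms block_desc[of j m r] unfolding r
    by (intro exI[of _ "j div M ^ r"]) auto
qed

lemma strip_index:
  assumes "0 < y" "y < 1"
  obtains n where "hgt (Suc n) \<le> y" "y < hgt n"
proof -
  have ex: "\<exists>n. hgt n \<le> y"
    using real_arch_pow_inv[OF assms(1), of "1 / 2"] by (auto simp: hgt_def intro: less_imp_le)
  define m where "m = (LEAST n. hgt n \<le> y)"
  have m: "hgt m \<le> y" unfolding m_def using ex by (rule LeastI_ex)
  have "m \<noteq> 0" using m assms hgt_0 by (metis not_le)
  then obtain n where n: "m = Suc n" by (cases m) auto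
  have "\<not> hgt n \<le> y" using not_less_Least[of n "\<lambda>n. hgt n \<le> y"] n unfolding m_def by simp
  then show thesis using that[of n] m n by simp
qed

text \<open>Intervals are nested and tree edges stay over the block of their upper end. Hence
  nothing of the strip is drawn over the gaps of depth \<open>m\<close> below the line of depth
  \<open>m\<close>; this is the room for the vertical edges.\<close>

lemma on_strip_block:
  assumes "on_strip x y" "y \<le> hgt m" "1 \<le> m"
  shows "\<exists>j<M ^ m. bl m j \<le> x \<and> x \<le> br m j"
  using assms(1) unfolding on_strip_def
proof (elim disjE exE conjE)
  fix n k assume *: "(Suc n, k) \<in> V" "hgt (Suc n) \<le> y" "y \<le> hgt n" "x = eg n k y"
  have kV: "1 \<le> k" "k \<le> B ^ Suc n" using *(1) by (auto simp: mem_V)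
  show ?thesis
  proof (cases "m \<le> n")
    case True
    have "blk n (pidx k) < M ^ n" using pidx_le[OF kV(2)] by (intro blk_less) auto
    then show ?thesis using block_in[OF True _ _ _] eg_block[OF *(2,3) kV] *(4) by metis
  next
    case False
    have "hgt m \<le> hgt (Suc n)" using False by (intro hgt_mono) simp
    then have y: "y = hgt (Suc n)" and "hgt m = hgt (Suc n)" using *(2) assms(2) by linarith+
    then have m: "m = Suc n" unfolding hgt_eq_iff by simp
    have "x = X (Suc n) k" using *(4) unfolding y eg_bot .
    then show ?thesis unfolding m using X_bounds[OF kV(2)] blk_less[OF kV(2,1)] by blast
  qed
next
  fix n k assume *: "proper n k" "y = hgt (Suc n)" "X (Suc n) k \<le> x" "x \<le> X (Suc n) (k + 1)"
  have k: "1 \<le> k" "k + 1 \<le> B ^ Suc n" "blk (Suc n) k = blk (Suc n) (k + 1)"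
    using *(1) by (auto simp: proper_def)
  have "m \<le> Suc n" using assms(2) unfolding *(2) hgt_le_iff .
  moreover have "blk (Suc n) k < M ^ Suc n" using k by (intro blk_less) auto
  moreover have "bl (Suc n) (blk (Suc n) k) \<le> x" "x \<le> br (Suc n) (blk (Suc n) k)"
    using X_bounds[of k "Suc n"] X_bounds[of "k + 1" "Suc n"] k *(3,4) by auto
  ultimately show ?thesis by (rule block_in)
qed

text \<open>The half-open range assigns a single level to each height. Edges of the next level meet
  this range only in their upper end points, where edges of level \<open>n\<close> end as
  well.\<close>

lemma on_strip_level:
  assumes "hgt (Suc n) \<le> y" "y < hgt n"
  shows "on_strip x y \<longleftrightarrow> (\<exists>k. (Suc n, k) \<in> V \<and> x = eg n k y) \<or>
     (y = hgt (Suc n) \<and> (\<exists>k. proper n k \<and> X (Suc n) k \<le> x \<and> x \<le> X (Suc n) (k + 1)))"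
proof
  assume "on_strip x y"
  then show "(\<exists>k. (Suc n, k) \<in> V \<and> x = eg n k y) \<or>
     (y = hgt (Suc n) \<and> (\<exists>k. proper n k \<and> X (Suc n) k \<le> x \<and> x \<le> X (Suc n) (k + 1)))"
    unfolding on_strip_def
  proof (elim disjE exE conjE)
    fix m k assume *: "(Suc m, k) \<in> V" "hgt (Suc m) \<le> y" "y \<le> hgt m" "x = eg m k y"
    have "hgt (Suc m) < hgt n" "hgt (Suc n) \<le> hgt m" using * assms by linarith+
    then have "n < Suc m" "m \<le> Suc n" unfolding hgt_le_iff by (metis hgt_le_iff not_le)+
    then consider "m = n" | "m = Suc n" by linarith
    then show ?thesis
    proof cases
      case 2
      then have y: "y = hgt (Suc n)" using *(3) assms(1) by simp
      have "x = eg n (pidx k) y" using *(4) unfolding 2 y eg_top eg_bot .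
      then show ?thesis using pidx_V[OF *(1)] 2 by blast
    qed (use * in blast)
  next
    fix m k assume *: "proper m k" "y = hgt (Suc m)" "X (Suc m) k \<le> x" "x \<le> X (Suc m) (k + 1)"
    have "\<not> hgt n \<le> hgt (Suc m)" "hgt (Suc n) \<le> hgt (Suc m)" using * assms by linarith+
    then have "m = n" unfolding hgt_le_iff by simp
    then show ?thesis using * by blast
  qed
next
  assume "(\<exists>k. (Suc n, k) \<in> V \<and> x = eg n k y) \<or>
     (y = hgt (Suc n) \<and> (\<exists>k. proper n k \<and> X (Suc n) k \<le> x \<and> x \<le> X (Suc n) (k + 1)))"
  then show "on_strip x y" unfolding on_strip_def using assms less_imp_le by blast
qed

lemma on_strip_above: "1 \<le> y \<Longrightarrow> on_strip x y \<longleftrightarrow> x = 1 / 2 \<and> y = 1"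
proof
  assume y: "1 \<le> y" and "on_strip x y"
  from this(2) show "x = 1 / 2 \<and> y = 1" unfolding on_strip_def
  proof (elim disjE exE conjE)
    fix n k assume *: "(Suc n, k) \<in> V" "hgt (Suc n) \<le> y" "y \<le> hgt n" "x = eg n k y"
    have "hgt 0 \<le> hgt n" using y *(3) by simp
    then have "n = 0" unfolding hgt_le_iff by simp
    then have "y = hgt 0" using y *(3) by simp
    then show ?thesis using *(4) eg_top[of 0 k] \<open>n = 0\<close> by (simp add: X_0)
  next
    fix n k assume "proper n k" "y = hgt (Suc n)"
    then have "hgt 0 \<le> hgt (Suc n)" using y by simp
    then show ?thesis unfolding hgt_le_iff by simp
  qed
next
  assume "x = 1 / 2 \<and> y = 1"
  moreover have "(Suc 0, 1) \<in> V" using B_ge by (simp add: mem_V)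
  ultimately show "on_strip x y" unfolding on_strip_def
    using eg_top[of 0 1] hgt_Suc[of 0] hgt_0 by (intro disjI1 exI[of _ 0] exI[of _ 1]) (simp add: X_0)
qed

lemma locate:
  assumes y: "hgt (Suc n) \<le> y" "y < hgt n" and off: "\<not> on_strip x y"
  obtains (left) "x < eg n 1 y"
    | (right) "eg n (B ^ Suc n) y < x"
    | (cell) k where "proper n k" "in_cell n k x y"
    | (gap) k where "1 \<le> k" "k + 1 \<le> B ^ Suc n" "blk (Suc n) k \<noteq> blk (Suc n) (k + 1)"
        "eg n k y < x" "x < eg n (k + 1) y"
proof -
  have ne: "x \<noteq> eg n k y" if "1 \<le> k" "k \<le> B ^ Suc n" for k
    using off that unfolding on_strip_level[OF y] by (auto simp: mem_V)
  have B1: "1 \<le> B ^ Suc n" using M_ge by simp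
  show thesis
  proof (cases "x < eg n 1 y \<or> eg n (B ^ Suc n) y < x")
    case True
    then show ?thesis using left right by blast
  next
    case False
    then have lo: "eg n 1 y < x" and hi: "x < eg n (B ^ Suc n) y"
      using ne[of 1] ne[of "B ^ Suc n"] B1 by force+
    \<comment> \<open>The maximum of \<open>K\<close> is the last tree edge to the left of the
      point. Whether it and its successor end in one block decides between cell and gap.\<close>
    define K where "K = {k. 1 \<le> k \<and> k \<le> B ^ Suc n \<and> eg n k y < x}"
    have K: "finite K" "1 \<in> K" using lo B1 unfolding K_def by auto
    define k where "k = Max K"
    have k: "k \<in> K" unfolding k_def using K by (intro Max_in) auto
    then have k1: "1 \<le> k" "k \<le> B ^ Suc n" "eg n k y < x" by (auto simp: K_def)
    have "k \<noteq> B ^ Suc n" using k1(3) hi by auto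
    then have k2: "k + 1 \<le> B ^ Suc n" using k1 by simp
    have "k + 1 \<notin> K" using Max_ge[OF K(1), of "k + 1"] unfolding k_def by auto
    then have "x < eg n (k + 1) y" using k2 ne[of "k + 1"] unfolding K_def by auto
    note x = k1(3) this
    show ?thesis
    proof (cases "blk (Suc n) k = blk (Suc n) (k + 1)")
      case False
      then show ?thesis using gap[OF k1(1) k2 _ x] by blast
    next
      case True
      then have p: "proper n k" using k1 k2 by (simp add: proper_def)
      show ?thesis
      proof (cases "y = hgt (Suc n)")
        case True
        then have "X (Suc n) k \<le> x \<and> x \<le> X (Suc n) (k + 1)" using x unfolding True eg_bot by simp
        then have "on_strip x y" unfolding on_strip_def using p True by blast
        with off show ?thesis by simp
      next
        case False
        then show ?thesis using cell[OF p] x y by (simp add: in_cell_def)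
      qed
    qed
  qed
qed

lemma gap_blocks:
  assumes "1 \<le> k" "blk n k \<noteq> blk n (k + 1)"
  shows "k = blast n (blk n k)" "k + 1 = bfirst n (blk n k + 1)" "blk n (k + 1) = blk n k + 1"
proof -
  have "k \<le> blast n (blk n k)" using blk_range[OF assms(1)] by blast
  moreover have "\<not> k + 1 \<le> blast n (blk n k)"
  proof
    assume "k + 1 \<le> blast n (blk n k)"
    then have "blk n (k + 1) \<le> blk n (blast n (blk n k))" by (rule blk_mono)
    then show False using blk_mono[of k "k + 1" n] assms(2) by simp
  qed
  ultimately show k: "k = blast n (blk n k)" by simp
  then show f: "k + 1 = bfirst n (blk n k + 1)" using blast_Suc[of n "blk n k"] by simp
  show "blk n (k + 1) = blk n k + 1" by (subst f) simp
qed

lemmas pidx_blast' = pidx_blast[unfolded One_nat_def]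

text \<open>The inequalities are strict because the vertex already lies over a block of depth
  \<open>Suc p\<close>, whose interval is in the interior of its parent's.\<close>

lemma X_deep:
  assumes "(m, i) \<in> V" "p < m"
  shows "\<exists>j<M ^ p. bl p j < X m i \<and> X m i < br p j"
proof -
  have i: "1 \<le> i" "i \<le> B ^ m" using assms(1) by (auto simp: mem_V)
  obtain j where j: "j < M ^ Suc p" "bl (Suc p) j \<le> X m i" "X m i \<le> br (Suc p) j"
    using block_in[of "Suc p" m "blk m i" "X m i"] blk_less[OF i(2,1)] X_bounds[OF i(2)] assms(2) by auto
  have "j div M < M ^ p" using block_desc[of j p 1] j(1) by simp
  then show ?thesis using block_nested[of p j] j(2,3) by (intro exI[of _ "j div M"]) linarith
qed

section \<open>Walls of a block and the slots between walls and vertical edges\<close>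

definition LW :: "nat \<Rightarrow> nat \<Rightarrow> real \<Rightarrow> real" where
  "LW n b y = eg n (bfirst (Suc n) (b * M)) (max y (hgt (Suc n)))"

definition RW :: "nat \<Rightarrow> nat \<Rightarrow> real \<Rightarrow> real" where
  "RW n b y = eg n (blast (Suc n) (b * M + M - 1)) (max y (hgt (Suc n)))"

lemma wall_range:
  assumes "b < M ^ n"
  shows "bfirst (Suc n) (b * M) \<le> B ^ Suc n" "blast (Suc n) (b * M + M - 1) \<le> B ^ Suc n"
    "b * M < M ^ Suc n" "b * M + M - 1 < M ^ Suc n"
proof -
  have "(b + 1) * M \<le> M ^ n * M" using assms by (intro mult_le_mono1) simp
  then have *: "b * M + M \<le> M ^ Suc n" by (simp add: mult.commute)
  then show 1: "b * M < M ^ Suc n" "b * M + M - 1 < M ^ Suc n" using M_ge by linarith+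
  show "bfirst (Suc n) (b * M) \<le> B ^ Suc n" "blast (Suc n) (b * M + M - 1) \<le> B ^ Suc n"
    using bfirst_le[OF 1(1)] blast_le[OF 1(2)] .
qed

lemma wall_low:
  assumes "y \<le> hgt (Suc n)"
  shows "LW n b y = bl (Suc n) (b * M)" "RW n b y = br (Suc n) (b * M + M - 1)"
  unfolding LW_def RW_def using assms by (simp_all add: max_absorb2 eg_bot X_bfirst X_blast)

lemma wall_high:
  assumes "hgt (Suc n) \<le> y"
  shows "LW n b y = eg n (bfirst (Suc n) (b * M)) y"
    "RW n b y = eg n (blast (Suc n) (b * M + M - 1)) y"
  unfolding LW_def RW_def using assms by (simp_all only: max_absorb1)

lemma wall_top:
  assumes "1 \<le> n" shows "LW n b (hgt n) = bl n b" "RW n b (hgt n) = br n b"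
proof -
  have "hgt (Suc n) \<le> hgt n" by (rule hgt_mono) simp
  then show "LW n b (hgt n) = bl n b" "RW n b (hgt n) = br n b"
    using assms by (simp_all only: wall_high eg_top pidx_bfirst pidx_blast X_bfirst X_blast)
qed

text \<open>
  The bounded middle faces of \<open>G\<^sub>0\<close> are regions \<open>\<bar>y\<bar> < hgt n\<close>, \<open>A \<bar>y\<bar> < x < A' \<bar>y\<bar>\<close>. The last block of a
  level has no vertical edges, so there the right boundary goes down one level further.
\<close>
inductive slot :: "nat \<Rightarrow> nat \<Rightarrow> (real \<Rightarrow> real) \<Rightarrow> (real \<Rightarrow> real) \<Rightarrow> bool" where
  right: "1 \<le> n \<Longrightarrow> b + 1 < M ^ n \<Longrightarrow>
    slot n (blast (Suc n) (b * M + M - 1)) (RW n b) (\<lambda>_. br n b)"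
| left: "1 \<le> n \<Longrightarrow> b + 1 < M ^ n \<Longrightarrow>
    slot n (bfirst (Suc n) (b * M) - 1) (\<lambda>_. bl n b) (LW n b)"
| mid: "1 \<le> k \<Longrightarrow> k + 1 \<le> B ^ Suc n \<Longrightarrow> blk (Suc n) k \<noteq> blk (Suc n) (k + 1) \<Longrightarrow>
    blk n (pidx k) = blk n (pidx (k + 1)) \<Longrightarrow> blk (Suc n) (k + 1) + 1 < M ^ Suc n \<Longrightarrow>
    slot n k (\<lambda>y. eg n k (max y (hgt (Suc n)))) (\<lambda>y. eg n (k + 1) (max y (hgt (Suc n))))"
| mid_last: "1 \<le> k \<Longrightarrow> k + 1 \<le> B ^ Suc n \<Longrightarrow> blk (Suc n) k \<noteq> blk (Suc n) (k + 1) \<Longrightarrow>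
    blk n (pidx k) = blk n (pidx (k + 1)) \<Longrightarrow> blk (Suc n) (k + 1) + 1 = M ^ Suc n \<Longrightarrow>
    slot n k (\<lambda>y. eg n k (max y (hgt (Suc n))))
      (\<lambda>y. eg n (k + 1) (max y (hgt (Suc n))) +
        (LW (Suc n) (blk (Suc n) (k + 1)) (min y (hgt (Suc n))) - X (Suc n) (k + 1)))"

lemma slot_continuous: "slot n k A A' \<Longrightarrow> continuous_on UNIV A \<and> continuous_on UNIV A'"
  by (induction rule: slot.induct) (auto simp: eg_def LW_def RW_def intro!: continuous_intros)

lemma on_strip_edge: "(Suc n, k) \<in> V \<Longrightarrow> hgt (Suc n) \<le> y \<Longrightarrow> y \<le> hgt n \<Longrightarrow> on_strip (eg n k y) y"
  unfolding on_strip_def by blast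

lemma on_vert_ends:
  assumes "1 \<le> n" "b + 1 < M ^ n" "y \<le> hgt n"
  shows "on_vert (bl n b) y" "on_vert (br n b) y"
  unfolding on_vert_def using assms by blast+

text \<open>Below the line of depth \<open>Suc n\<close> the left wall follows the vertical edge of
  the first child block, which exists because that block is not the last one of its level.\<close>

lemma wall_drawn:
  assumes "b + 1 < M ^ n \<or> b * M + 1 < M ^ Suc n" "b < M ^ n" "y \<le> hgt n"
  shows "on_strip (LW n b y) y \<or> on_vert (LW n b y) y"
proof (cases "hgt (Suc n) \<le> y")
  case True
  then show ?thesis using wall_range[OF assms(2)] on_strip_edge[OF _ True assms(3)]
    by (simp add: wall_high[OF True] mem_V)
next
  case False
  have "b * M + 1 < M ^ Suc n" using assms(1)
  proof
    assume "b + 1 < M ^ n"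
    then have "(b + 1) * M < M ^ n * M" by (intro mult_strict_right_mono) auto
    then show ?thesis using M_ge by (simp add: mult.commute)
  qed
  then show ?thesis using False on_vert_ends(1)[of "Suc n" "b * M" y] by (simp add: wall_low)
qed

text \<open>Together with \<open>slot_top\<close> this places the frontier of a slot inside the
  drawing, so that no face can leave a slot.\<close>

lemma slot_sides:
  assumes "slot n k A A'" "y \<le> hgt n"
  shows "(on_strip (A y) y \<or> on_vert (A y) y) \<and> (on_strip (A' y) y \<or> on_vert (A' y) y)"
  using assms
proof (induction rule: slot.induct)
  case (right n b)
  have b: "b < M ^ n" using right by simp
  have "on_strip (RW n b y) y \<or> on_vert (RW n b y) y"
  proof (cases "hgt (Suc n) \<le> y")
    case True
    then show ?thesis using wall_range[OF b] on_strip_edge[OF _ True right(3)]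
      by (simp add: wall_high[OF True] mem_V)
  next
    case False
    have "(b + 1) * M < M ^ n * M" using right(2) by (intro mult_strict_right_mono) auto
    then have "b * M + M - 1 + 1 < M ^ Suc n" using M_ge by (simp add: mult.commute)
    then show ?thesis using False on_vert_ends(2)[of "Suc n" "b * M + M - 1" y] by (simp add: wall_low)
  qed
  then show ?case using on_vert_ends(2)[OF right(1,2,3)] by blast
next
  case (left n b)
  have "b < M ^ n" using left by simp
  then show ?case using on_vert_ends(1)[OF left(1,2,3)] wall_drawn left(2,3) by blast
next
  case (mid k n)
  note g = gap_blocks[OF mid(1,3)]
  show ?case
  proof (cases "hgt (Suc n) \<le> y")
    case True
    then show ?thesis using on_strip_edge[OF _ True mid(6)] mid(1,2)
      by (simp add: max_absorb1 mem_V)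
  next
    case False
    have "X (Suc n) k = br (Suc n) (blk (Suc n) k)" by (subst g(1)) (rule X_blast, simp)
    moreover have "X (Suc n) (k + 1) = bl (Suc n) (blk (Suc n) k + 1)" by (subst g(2)) (rule X_bfirst, simp)
    ultimately show ?thesis
      using on_vert_ends(2)[of "Suc n" "blk (Suc n) k" y] on_vert_ends(1)[of "Suc n" "blk (Suc n) k + 1" y]
        mid(5) False g(3) by (simp add: max_absorb2 eg_bot)
  qed
next
  case (mid_last k n)
  note g = gap_blocks[OF mid_last(1,3)]
  let ?j = "blk (Suc n) (k + 1)"
  have j: "?j < M ^ Suc n" using mid_last(5) by simp
  have X: "X (Suc n) k = br (Suc n) (blk (Suc n) k)" by (subst g(1)) (rule X_blast, simp)
  have X': "X (Suc n) (k + 1) = bl (Suc n) ?j" unfolding g(3) by (subst g(2)) (rule X_bfirst, simp)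
  show ?case
  proof (cases "hgt (Suc n) \<le> y")
    case True
    have "LW (Suc n) ?j (min y (hgt (Suc n))) = X (Suc n) (k + 1)"
      unfolding X' using True by (simp only: min_absorb2 wall_top[of "Suc n"])
    then show ?thesis using on_strip_edge[OF _ True mid_last(6)] mid_last(1,2) True
      by (simp add: max_absorb1 mem_V)
  next
    case False
    then have y: "y \<le> hgt (Suc n)" by simp
    \<comment> \<open>The first child block of the last block is not the last of its own level, so
      it has a vertical edge on its left end, along which the boundary of a \<open>mid_last\<close>
      slot continues.\<close>
    have "?j * M + 1 < M ^ Suc (Suc n)"
    proof -
      have "(?j + 1) * M = M ^ Suc (Suc n)" using mid_last(5) by (simp add: mult.commute)
      then show ?thesis using M_ge by (simp add: algebra_simps)
    qed
    then have "on_strip (LW (Suc n) ?j y) y \<or> on_vert (LW (Suc n) ?j y) y"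
      using wall_drawn[OF _ j y] by blast
    then show ?thesis
      using on_vert_ends(2)[of "Suc n" "blk (Suc n) k" y] mid_last(5) g(3) y X
      by (simp add: max_absorb2 min_absorb1 eg_bot)
  qed
qed

lemma on_strip_vertex: "(n, i) \<in> V \<Longrightarrow> on_strip (X n i) (hgt n)"
proof -
  assume V: "(n, i) \<in> V"
  then have i: "1 \<le> i" "i \<le> B ^ n" by (auto simp: mem_V)
  have k: "(Suc n, (i - 1) * B + 1) \<in> children (n, i)"
    unfolding children_eq[OF i(1)] using B_ge by (intro image_eqI[of _ _ 1]) auto
  then have "pidx ((i - 1) * B + 1) = i" by (simp add: children_def)
  then show ?thesis using on_strip_edge[OF children_V[OF V k], of "hgt n"] hgt_mono[of n "Suc n"]
    by (simp add: eg_top)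
qed

lemma mid_top:
  assumes "1 \<le> k" "k + 1 \<le> B ^ Suc n" "blk n (pidx k) = blk n (pidx (k + 1))"
    "X n (pidx k) \<le> x" "x \<le> X n (pidx (k + 1))"
  shows "on_strip x (hgt n)"
proof (cases "pidx (k + 1) = pidx k")
  case True
  have "(n, pidx k) \<in> V" using pidx_le[of k n] assms by (simp add: mem_V)
  then show ?thesis using on_strip_vertex True assms(4,5) by (metis order_antisym)
next
  case False
  then have e: "pidx (k + 1) = pidx k + 1" using pidx_Suc[OF assms(1)] by simp
  have le: "pidx k + 1 \<le> B ^ n" using pidx_le[OF assms(2)] e by simp
  then obtain m where m: "n = Suc m" using pidx_pos(1)[of k] by (cases n) auto
  have "proper m (pidx k)" using le assms(3) e m by (simp add: proper_def)
  then show ?thesis unfolding on_strip_def using assms(4,5) e m by auto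
qed

lemma slot_top:
  assumes "slot n k A A'" "A (hgt n) \<le> x" "x \<le> A' (hgt n)"
  shows "on_strip x (hgt n)"
  using assms
proof (induction rule: slot.induct)
  case (right n b)
  have "(n, blast n b) \<in> V" using blast_le[of b n] right(2) by (simp add: mem_V)
  moreover have "x = X n (blast n b)" using right(1,3,4) by (simp add: wall_top X_blast)
  ultimately show ?case using on_strip_vertex by simp
next
  case (left n b)
  have "(n, bfirst n b) \<in> V" using bfirst_le[of b n] left(2) by (simp add: mem_V)
  moreover have "x = X n (bfirst n b)" using left(1,3,4) by (simp add: wall_top X_bfirst)
  ultimately show ?case using on_strip_vertex by simp
next
  case (mid k n)
  have "hgt (Suc n) \<le> hgt n" by (rule hgt_mono) simp
  then show ?case using mid_top[OF mid(1,2,4)] mid(6,7) by (simp add: max_absorb1 eg_top)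
next
  case (mid_last k n)
  note g = gap_blocks[OF mid_last(1,3)]
  have h: "hgt (Suc n) \<le> hgt n" by (rule hgt_mono) simp
  have "X (Suc n) (k + 1) = bl (Suc n) (blk (Suc n) (k + 1))"
    unfolding g(3) by (subst g(2)) (rule X_bfirst, simp)
  then show ?case using mid_top[OF mid_last(1,2,4)] mid_last(6,7) h
    by (simp add: max_absorb1 min_absorb2 eg_top wall_top)
qed

text \<open>Candidates for the boundary vertices of one face: the corners around positions
  \<open>k\<close> and \<open>k + 1\<close> of depth \<open>Suc n\<close>, and the first child of
  \<open>(Suc n, k + 1)\<close>, which is reached by the right side of a \<open>mid_last\<close>
  slot.\<close>

definition near :: "nat \<Rightarrow> nat \<Rightarrow> vertex set" where
  "near n k = {(n, pidx k), (n, pidx (k + 1)), (Suc n, k), (Suc n, k + 1), (Suc (Suc n), k * B + 1)}"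

lemma X_eq_iff: "1 \<le> i \<Longrightarrow> i \<le> B ^ n \<Longrightarrow> 1 \<le> i' \<Longrightarrow> i' \<le> B ^ n \<Longrightarrow> X n i = X n i' \<longleftrightarrow> i = i'"
  using X_less_iff[of i n i'] X_less_iff[of i' n i] by (metis less_irrefl nat_neq_iff)

text \<open>A vertex deeper than \<open>Suc n\<close> lies strictly inside a block interval of depth
  \<open>Suc n\<close>, so it cannot lie over the gap between two consecutive blocks.\<close>

lemma mid_vertices:
  assumes k: "1 \<le> k" "k + 1 \<le> B ^ Suc n" "blk (Suc n) k \<noteq> blk (Suc n) (k + 1)"
    and V: "(m, i) \<in> V" "n \<le> m" "m \<le> Suc n \<or> X m i \<le> bl (Suc n) (blk (Suc n) k + 1)"
    and lo: "eg n k (max (hgt m) (hgt (Suc n))) \<le> X m i"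
    and hi: "X m i \<le> eg n (k + 1) (max (hgt m) (hgt (Suc n)))"
  shows "(m, i) \<in> near n k"
proof -
  note g = gap_blocks[OF k(1,3)]
  have i: "1 \<le> i" "i \<le> B ^ m" using V(1) by (auto simp: mem_V)
  have p: "pidx k \<le> B ^ n" "pidx (k + 1) \<le> B ^ n" using pidx_le[of k n] pidx_le[of "k + 1" n] k by auto
  consider "m = n" | "m = Suc n" | "Suc n < m" using V(2) by linarith
  then show ?thesis
  proof cases
    case 1
    have "hgt (Suc n) \<le> hgt n" by (rule hgt_mono) simp
    then have "X n (pidx k) \<le> X n i" "X n i \<le> X n (pidx (k + 1))"
      using lo hi unfolding 1 by (simp_all only: max_absorb1 eg_top)
    then have "pidx k \<le> i" "i \<le> pidx (k + 1)" using X_le_iff i p unfolding 1 by auto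
    then show ?thesis using pidx_Suc[OF k(1)] unfolding 1 near_def by auto
  next
    case 2
    have "X (Suc n) k \<le> X (Suc n) i" "X (Suc n) i \<le> X (Suc n) (k + 1)"
      using lo hi unfolding 2 by (simp_all only: max.idem eg_bot)
    then have "k \<le> i" "i \<le> k + 1" using X_le_iff i k unfolding 2 by auto
    then show ?thesis unfolding 2 near_def by auto
  next
    case 3
    obtain j where j: "j < M ^ Suc n" "bl (Suc n) j < X m i" "X m i < br (Suc n) j"
      using X_deep[OF V(1) 3] by blast
    have "hgt m \<le> hgt (Suc n)" using 3 by (intro hgt_mono) simp
    then have "X (Suc n) k \<le> X m i" using lo by (simp only: max_absorb2 eg_bot)
    moreover have "X (Suc n) k = br (Suc n) (blk (Suc n) k)" by (subst g(1)) (rule X_blast, simp)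
    ultimately have "br (Suc n) (blk (Suc n) k) < br (Suc n) j" using j by linarith
    have kl: "blk (Suc n) k < M ^ Suc n" using k by (intro blk_less) auto
    have "\<not> j \<le> blk (Suc n) k"
      using block_order_le[OF _ kl, of j] \<open>br (Suc n) (blk (Suc n) k) < br (Suc n) j\<close> by fastforce
    then have "bl (Suc n) (blk (Suc n) k + 1) \<le> bl (Suc n) j" using j(1) by (intro block_order_le) auto
    then show ?thesis using V(3) 3 j by linarith
  qed
qed

text \<open>On the lines of depth \<open>n\<close> and \<open>Suc n\<close>, positions are compared
  with the two sides. Deeper vertices lie strictly inside blocks, whereas a slot lies over gaps and
  margins; only \<open>mid_last\<close> reaches one level further and catches the first vertex
  there.\<close>

lemma slot_vertices:
  assumes "slot n k A A'" "(m, i) \<in> V" "n \<le> m" "A (hgt m) \<le> X m i" "X m i \<le> A' (hgt m)"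
  shows "(m, i) \<in> near n k"
  using assms
proof (induction rule: slot.induct)
  case (right n b)
  have i: "1 \<le> i" "i \<le> B ^ m" using right(3) by (auto simp: mem_V)
  have b: "b < M ^ n" using right(2) by simp
  note w = wall_range[OF b]
  consider "m = n" | "m = Suc n" | "Suc n < m" using right(4) by linarith
  then show ?case
  proof cases
    case 1
    have "X n i = X n (blast n b)" using right unfolding 1 by (simp add: wall_top X_blast)
    then have "i = blast n b" using X_eq_iff[of i n "blast n b"] i blast_le[OF b] unfolding 1 by simp
    then show ?thesis unfolding 1 near_def by (simp add: pidx_blast')
  next
    case 2
    let ?k = "blast (Suc n) (b * M + M - 1)"
    have "X (Suc n) ?k \<le> X (Suc n) i" using right(5) unfolding 2 by (simp add: wall_low X_blast)
    then have "?k \<le> i" using X_le_iff[of ?k "Suc n" i] w i unfolding 2 by simp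
    moreover have "\<not> ?k < i"
    proof
      assume "?k < i"
      then have le: "bfirst (Suc n) (b * M + M) \<le> i" using blast_Suc[of "Suc n" "b * M + M - 1"] M_ge by simp
      have "(b + 1) * M < M ^ n * M" using right(2) by (intro mult_strict_right_mono) auto
      then have l: "b * M + M < M ^ Suc n" by (simp add: mult.commute)
      have "bl (Suc n) (b * M + M) \<le> X (Suc n) i"
        using X_mono_le[OF _ le, of "Suc n"] i unfolding 2 by (simp add: X_bfirst)
      moreover have "(b * M + M) div M = b + 1" using M_ge by (simp add: div_add1_eq)
      then have "bl n (b + 1) < bl (Suc n) (b * M + M)" using block_nested(1)[of n "b * M + M"] by simp
      moreover have "br n b < bl n (b + 1)" using right(2) by (intro block_order) auto
      ultimately show False using right(6) unfolding 2 by linarith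
    qed
    ultimately show ?thesis unfolding 2 near_def by simp
  next
    case 3
    obtain j where j: "j < M ^ Suc n" "bl (Suc n) j < X m i" "X m i < br (Suc n) j"
      using X_deep[OF right(3) 3] by blast
    have "hgt m \<le> hgt (Suc n)" using 3 by (intro hgt_mono) simp
    then have "br (Suc n) (b * M + M - 1) < br (Suc n) j" using right(5) j by (simp add: wall_low)
    then have "\<not> j \<le> b * M + M - 1" using block_order_le[OF _ w(4), of j] by fastforce
    then have "(b + 1) * M \<le> j" by simp
    then have "b + 1 \<le> j div M" by (simp add: less_eq_div_iff_mult_less_eq)
    moreover have "j div M < M ^ n" using block_desc[of j n 1] j(1) by simp
    ultimately have "br n b < bl n (j div M)" by (intro block_order) auto
    then show ?thesis using block_nested(1)[of n j] j right(6) by linarith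
  qed
next
  case (left n b)
  have i: "1 \<le> i" "i \<le> B ^ m" using left(3) by (auto simp: mem_V)
  have b: "b < M ^ n" using left(2) by simp
  note w = wall_range[OF b]
  let ?k = "bfirst (Suc n) (b * M)"
  have kk: "?k - 1 + 1 = ?k" using bfirst_pos(1) by (rule le_add_diff_inverse2)
  consider "m = n" | "m = Suc n" | "Suc n < m" using left(4) by linarith
  then show ?case
  proof cases
    case 1
    have "X n i = X n (bfirst n b)" using left unfolding 1 by (simp add: wall_top X_bfirst)
    then have "i = bfirst n b" using X_eq_iff[of i n "bfirst n b"] i bfirst_le[OF b] unfolding 1 by simp
    then show ?thesis unfolding 1 near_def kk by (simp add: pidx_bfirst)
  next
    case 2
    have "X (Suc n) i \<le> X (Suc n) ?k" using left(6) unfolding 2 by (simp add: wall_low X_bfirst)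
    then have "i \<le> ?k" using X_le_iff[of i "Suc n" ?k] w i unfolding 2 by simp
    moreover have "\<not> i < ?k"
    proof
      assume "i < ?k"
      then have "blk (Suc n) i \<noteq> b * M" using blk_range[OF i(1), of "Suc n"] by auto
      moreover have "blk (Suc n) i \<le> b * M" using blk_mono[of i ?k "Suc n"] \<open>i < ?k\<close> by simp
      ultimately have lt: "blk (Suc n) i < b * M" by simp
      then have "blk (Suc n) i div M < b" by (simp add: div_less_iff_less_mult)
      then have "br n (blk (Suc n) i div M) < bl n b" using b by (rule block_order)
      then have "X (Suc n) i < bl n b"
        using block_nested(2)[of n "blk (Suc n) i"] X_bounds[of i "Suc n"] i unfolding 2 by linarith
      then show False using left(5) unfolding 2 by simp
    qed
    ultimately show ?thesis unfolding 2 near_def kk by simp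
  next
    case 3
    obtain j where j: "j < M ^ Suc n" "bl (Suc n) j < X m i" "X m i < br (Suc n) j"
      using X_deep[OF left(3) 3] by blast
    have "hgt m \<le> hgt (Suc n)" using 3 by (intro hgt_mono) simp
    then have "bl (Suc n) j < bl (Suc n) (b * M)" using left(6) j by (simp add: wall_low)
    then have "\<not> b * M \<le> j" using block_order_le[OF _ j(1), of "b * M"] by fastforce
    then have "j div M < b" by (simp add: div_less_iff_less_mult)
    then have "br n (j div M) < bl n b" using b by (rule block_order)
    then show ?thesis using block_nested(2)[of n j] j left(5) by linarith
  qed
next
  case (mid k n)
  note g = gap_blocks[OF mid(1,3)]
  show ?case
  proof (rule mid_vertices[OF mid(1-3) mid(6,7) _ mid(8,9)])
    show "m \<le> Suc n \<or> X m i \<le> bl (Suc n) (blk (Suc n) k + 1)"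
    proof (cases "m \<le> Suc n")
      case False
      then have "hgt m \<le> hgt (Suc n)" by (intro hgt_mono) simp
      then have "X m i \<le> X (Suc n) (k + 1)" using mid(9) by (simp only: max_absorb2 eg_bot)
      also have "\<dots> = bl (Suc n) (blk (Suc n) k + 1)" by (subst g(2)) (rule X_bfirst, simp)
      finally show ?thesis by simp
    qed simp
  qed
next
  case (mid_last k n)
  note g = gap_blocks[OF mid_last(1,3)]
  let ?j = "blk (Suc n) k"
  have i: "1 \<le> i" "i \<le> B ^ m" using mid_last(6) by (auto simp: mem_V)
  have X': "X (Suc n) (k + 1) = bl (Suc n) (?j + 1)" by (subst g(2)) (rule X_bfirst, simp)
  show ?case
  proof (cases "m \<le> Suc n")
    case True
    have "LW (Suc n) (?j + 1) (min (hgt m) (hgt (Suc n))) = X (Suc n) (k + 1)"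
      unfolding X' using True hgt_mono[of m "Suc n"] by (simp only: min_absorb2 wall_top[of "Suc n"])
    then have "X m i \<le> eg n (k + 1) (max (hgt m) (hgt (Suc n)))" using mid_last(9) unfolding g(3) by simp
    then show ?thesis using mid_vertices[OF mid_last(1-3) mid_last(6,7) _ mid_last(8)] True by blast
  next
    case False
    then have m: "Suc (Suc n) \<le> m" by simp
    have h: "hgt m \<le> hgt (Suc n)" "hgt m \<le> hgt (Suc (Suc n))" using m by (intro hgt_mono; simp)+
    have "X m i \<le> LW (Suc n) (?j + 1) (hgt m)"
      using mid_last(9) unfolding g(3) using h by (simp add: max_absorb2 min_absorb1 eg_bot)
    then have up: "X m i \<le> bl (Suc (Suc n)) ((?j + 1) * M)" using h by (simp add: wall_low)
    have "X (Suc n) k \<le> X m i" using mid_last(8) h by (simp only: max_absorb2 eg_bot)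
    moreover have "X (Suc n) k = br (Suc n) ?j" by (subst g(1)) (rule X_blast, simp)
    ultimately have low: "br (Suc n) ?j \<le> X m i" by simp
    have jl: "?j + 1 < M ^ Suc n" using mid_last(5) g(3) by simp
    have "Suc (Suc n) = m"
    proof (rule ccontr)
      assume "Suc (Suc n) \<noteq> m"
      then have "Suc (Suc n) < m" using m by simp
      then obtain j where j: "j < M ^ Suc (Suc n)" "bl (Suc (Suc n)) j < X m i" "X m i < br (Suc (Suc n)) j"
        using X_deep[OF mid_last(6)] by blast
      have "\<not> (?j + 1) * M \<le> j" using block_order_le[OF _ j(1), of "(?j + 1) * M"] j up by fastforce
      then have "j div M < ?j + 1" by (simp only: div_less_iff_less_mult M_pos not_le)
      then have "j div M \<le> ?j" by simp
      then have "bl (Suc n) (j div M) \<le> bl (Suc n) ?j" using jl by (intro block_order_le) auto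
      then show False using block_nested(2)[of "Suc n" j] j low by linarith
    qed
    note m = this[symmetric]
    have "blk m i < M ^ Suc (Suc n)" using i blk_less unfolding m by blast
    have "\<not> blk m i < (?j + 1) * M"
    proof
      assume "blk m i < (?j + 1) * M"
      then have "blk m i div M < ?j + 1" by (simp only: div_less_iff_less_mult M_pos)
      then have "blk m i div M \<le> ?j" by simp
      then have "bl (Suc n) (blk m i div M) \<le> bl (Suc n) ?j" using jl by (intro block_order_le) auto
      then show False using block_nested(2)[of "Suc n" "blk m i"] X_bounds[OF i(2)] low unfolding m by linarith
    qed
    then have "(?j + 1) * M \<le> blk m i" by simp
    then have "bfirst m ((?j + 1) * M) \<le> bfirst m (blk m i)" unfolding bfirst_def by (intro add_mono mult_le_mono1) auto
    then have "bfirst m ((?j + 1) * M) \<le> i" using blk_range[OF i(1), of m] by linarith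
    moreover have "(?j + 1) * M < M ^ m"
    proof -
      have "(?j + 1) * M < M ^ Suc n * M" using jl by (intro mult_strict_right_mono) auto
      then show ?thesis unfolding m by (simp add: mult.commute)
    qed
    then have bl: "bfirst m ((?j + 1) * M) \<le> B ^ m" by (rule bfirst_le)
    have "X m i \<le> X m (bfirst m ((?j + 1) * M))" using up unfolding m by (simp add: X_bfirst)
    then have "i \<le> bfirst m ((?j + 1) * M)" using X_le_iff[OF i bfirst_pos(1) bl] by simp
    ultimately have "i = bfirst m ((?j + 1) * M)" by simp
    also have "\<dots> = k * B + 1"
    proof -
      have "(?j + 1) * M * block_size d M (Suc (Suc n)) = (?j + 1) * block_size d M (Suc n) * B"
        using block_size_Suc[of "Suc n"] by (metis mult.assoc mult.commute)
      also have "\<dots> = k * B" using g(1) unfolding blast_def by simp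
      finally show ?thesis unfolding bfirst_def m by simp
    qed
    finally show ?thesis unfolding near_def m by simp
  qed
qed

section \<open>Locating the points of the complement\<close>

definition in_slot :: "real \<Rightarrow> real \<Rightarrow> bool" where
  "in_slot x y \<longleftrightarrow> (\<exists>n k A A'. slot n k A A' \<and> y < hgt n \<and> A y < x \<and> x < A' y)"

lemma in_slotI: "slot n k A A' \<Longrightarrow> y < hgt n \<Longrightarrow> A y < x \<Longrightarrow> x < A' y \<Longrightarrow> in_slot x y"
  unfolding in_slot_def by blast

text \<open>Induction towards the root. A point between the walls of two consecutive blocks is in a
  slot beside one of the facing vertical edges, or in the slot between the two blocks if they have
  the same parent block, or else between the walls of the two parent blocks.\<close>

lemma between_walls:
  assumes "b + 1 < M ^ n" "y < hgt n" "RW n b y < x" "x < LW n (b + 1) y" "\<not> on_vert x y"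
  shows "in_slot x y"
  using assms
proof (induction n arbitrary: b)
  case (Suc m)
  let ?n = "Suc m"
  have y: "y \<le> hgt ?n" "y < hgt m" using Suc.prems(2) hgt_less[of m ?n] by simp_all
  have nv: "x \<noteq> br ?n b" using on_vert_ends(2)[OF _ Suc.prems(1) y(1)] Suc.prems(5) by auto
  show ?case
  proof (cases "x < br ?n b")
    case True
    then show ?thesis using slot.right[of ?n b] Suc.prems by (intro in_slotI[OF slot.right]) auto
  next
    case False
    with nv have lo: "br ?n b < x" by simp
    have nv': "b + 2 < M ^ ?n \<Longrightarrow> x \<noteq> bl ?n (b + 1)"
      using on_vert_ends(1)[of ?n "b + 1" y] y(1) Suc.prems(5) by auto
    show ?thesis
    proof (cases "b + 2 < M ^ ?n \<and> bl ?n (b + 1) < x")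
      case True
      then show ?thesis using Suc.prems by (intro in_slotI[OF slot.left[of ?n "b + 1"]]) auto
    next
      case False
      then have up: "x < bl ?n (b + 1) \<or> b + 2 = M ^ ?n" using nv' Suc.prems(1) by linarith
      let ?k = "blast ?n b"
      have k: "1 \<le> ?k" "?k + 1 = bfirst ?n (b + 1)" by (rule blast_pos(1), rule blast_Suc)
      have kB: "?k + 1 \<le> B ^ ?n" unfolding k(2) by (rule bfirst_le[OF Suc.prems(1)])
      have bk: "blk ?n ?k = b" "blk ?n (?k + 1) = b + 1" unfolding k(2) by simp_all
      have X: "X ?n ?k = br ?n b" "X ?n (?k + 1) = bl ?n (b + 1)" unfolding k(2)
        by (simp_all only: X_blast X_bfirst Suc_le_mono le0 One_nat_def)
      show ?thesis
      proof (cases "b div M = (b + 1) div M")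
        case True
        then have p: "blk m (pidx ?k) = blk m (pidx (?k + 1))" unfolding blk_parent bk .
        have A: "eg m ?k (max y (hgt ?n)) = br ?n b" "eg m (?k + 1) (max y (hgt ?n)) = bl ?n (b + 1)"
          using y(1) by (simp_all only: max_absorb2 eg_bot X)
        show ?thesis
        proof (cases "b + 2 < M ^ ?n")
          case True
          then have "x < bl ?n (b + 1)" using up by simp
          show ?thesis
          proof (rule in_slotI[OF slot.mid[OF k(1) kB _ p] y(2)])
            show "blk ?n ?k \<noteq> blk ?n (?k + 1)" "blk ?n (?k + 1) + 1 < M ^ ?n" using bk True by simp_all
            show "eg m ?k (max y (hgt ?n)) < x" using A lo by simp
            show "x < eg m (?k + 1) (max y (hgt ?n))" unfolding A by fact
          qed
        next
          case False
          then have last: "blk ?n (?k + 1) + 1 = M ^ ?n" using Suc.prems(1) bk by simp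
          show ?thesis
          proof (rule in_slotI[OF slot.mid_last[OF k(1) kB _ p last] y(2)])
            show "blk ?n ?k \<noteq> blk ?n (?k + 1)" using bk by simp
            show "eg m ?k (max y (hgt ?n)) < x" using A lo by simp
            have "min y (hgt ?n) = y" using y(1) by simp
            then show "x < eg m (?k + 1) (max y (hgt ?n)) +
                (LW ?n (blk ?n (?k + 1)) (min y (hgt ?n)) - X ?n (?k + 1))"
              unfolding A bk X using Suc.prems(4) by simp
          qed
        qed
      next
        case False
        have e: "b + 1 = (b div M + 1) * M" "b = b div M * M + M - 1"
        proof -
          have "(b + 1) mod M = 0" using False by (simp add: div_Suc split: if_splits)
          moreover have "(b + 1) div M = b div M + 1" using False by (simp add: div_Suc split: if_splits)
          ultimately show "b + 1 = (b div M + 1) * M" using div_mult_mod_eq[of "b + 1" M] by simp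
          then show "b = b div M * M + M - 1" by simp
        qed
        \<comment> \<open>Here \<open>b + 1\<close> is a multiple of \<open>M\<close>, which the
          last address \<open>M ^ ?n - 1\<close> is not. So the exceptional last block cannot
          occur.\<close>
        have "b + 2 \<noteq> M ^ ?n"
        proof
          assume "b + 2 = M ^ ?n"
          then have "M ^ ?n = (b div M + 1) * M + 1" using e(1) by simp
          then have "M dvd (b div M + 1) * M + 1" by (metis dvd_triv_left power_Suc)
          then have "M dvd 1" by (metis dvd_add_right_iff dvd_triv_right)
          then show False using M_ge by simp
        qed
        then have "x < bl ?n (b + 1)" using up by simp
        then have "x < LW m (b div M + 1) y" using y(1) e(1) by (simp add: wall_low)
        moreover have "RW m (b div M) y < x" using y(1) lo e(2) by (simp add: wall_low)
        moreover have "b div M + 1 < M ^ m"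
        proof -
          have "(b div M + 1) * M < M ^ m * M" using Suc.prems(1) e(1) by (simp add: mult.commute)
          then show ?thesis by (simp only: mult_less_cancel2)
        qed
        ultimately show ?thesis using Suc.IH Suc.prems(5) y(2) by blast
      qed
    qed
  qed
qed simp

text \<open>The same climb along the left border; it stops at depth 1, beyond which only the outer
  face remains.\<close>

lemma left_of_walls:
  assumes "1 \<le> n" "y < hgt n" "x < LW n 0 y" "\<not> on_vert x y"
  shows "in_slot x y \<or> (x < bl 1 0 \<and> y \<le> hgt 1)"
  using assms
proof (induction n rule: nat_induct_at_least)
  case base
  have "1 < M ^ 1" using M_ge by simp
  then have "in_slot x y" if "bl 1 0 < x"
    using that base by (intro in_slotI[OF slot.left[of 1 0]]) auto
  moreover have "x \<noteq> bl 1 0" using on_vert_ends(1)[of 1 0 y] base \<open>1 < M ^ 1\<close> by auto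
  ultimately show ?case using base by linarith
next
  case (Suc n)
  have "1 < M ^ Suc n" using M_ge by (metis Suc_1 Suc_le_lessD one_less_power zero_less_Suc)
  then have "in_slot x y" if "bl (Suc n) 0 < x"
    using that Suc.prems by (intro in_slotI[OF slot.left[of "Suc n" 0]]) auto
  moreover have "x \<noteq> bl (Suc n) 0"
    using on_vert_ends(1)[of "Suc n" 0 y] Suc.prems \<open>1 < M ^ Suc n\<close> by auto
  moreover have ?case if "x < bl (Suc n) 0"
  proof (rule Suc.IH)
    show "y < hgt n" using Suc.prems(1) hgt_less[of n "Suc n"] by simp
    show "x < LW n 0 y" using that Suc.prems(1) by (simp add: wall_low)
  qed (rule Suc.prems(3))
  ultimately show ?case by linarith
qed

text \<open>An explicit set of points that miss the drawing. Whole cells are excluded, because the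
  diagonals of the strip run inside them.\<close>

definition off :: "real \<Rightarrow> real \<Rightarrow> bool" where
  "off x y \<longleftrightarrow> \<not> on_strip x y \<and> \<not> on_vert x y \<and> (\<forall>n k. proper n k \<longrightarrow> \<not> in_cell n k x y)"

lemma strip_range:
  assumes "hgt (Suc n) \<le> y" "y < hgt n" "on_strip x y"
  shows "eg n 1 y \<le> x" "x \<le> eg n (B ^ Suc n) y"
proof -
  have B1: "1 \<le> B ^ Suc n" using M_ge by simp
  have "eg n 1 y \<le> x \<and> x \<le> eg n (B ^ Suc n) y"
    using assms(3) unfolding on_strip_level[OF assms(1,2)]
  proof (elim disjE exE conjE)
    fix k assume "(Suc n, k) \<in> V" "x = eg n k y"
    then show ?thesis using eg_mono_le[OF assms(1), of 1 k] eg_mono_le[OF assms(1), of k "B ^ Suc n"] assms(2)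
      by (auto simp: mem_V)
  next
    fix k assume *: "y = hgt (Suc n)" "proper n k" "X (Suc n) k \<le> x" "x \<le> X (Suc n) (k + 1)"
    then have "1 \<le> k" "k + 1 \<le> B ^ Suc n" by (auto simp: proper_def)
    then show ?thesis unfolding *(1) eg_bot
      using X_mono_le[of 1 k "Suc n"] X_mono_le[of "k + 1" "B ^ Suc n" "Suc n"] *(3,4) by auto
  qed
  then show "eg n 1 y \<le> x" "x \<le> eg n (B ^ Suc n) y" by auto
qed

lemma cell_range:
  assumes "hgt (Suc n) \<le> y" "y < hgt n" "proper m k" "in_cell m k x y"
  shows "eg n 1 y \<le> x" "x \<le> eg n (B ^ Suc n) y" "m = n"
proof -
  have *: "hgt (Suc m) < y" "y < hgt m" "eg m k y < x" "x < eg m (k + 1) y"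
    using assms(4) by (auto simp: in_cell_def)
  have "\<not> hgt n \<le> hgt (Suc m)" "\<not> hgt m \<le> hgt (Suc n)" using * assms(1,2) by linarith+
  then show mn: "m = n" unfolding hgt_le_iff by simp
  have k: "1 \<le> k" "k + 1 \<le> B ^ Suc n" using assms(3) unfolding mn by (auto simp: proper_def)
  show "eg n 1 y \<le> x" using eg_mono_le[OF assms(1), of 1 k] assms(2) k *(3) unfolding mn by auto
  show "x \<le> eg n (B ^ Suc n) y"
    using eg_mono_le[OF assms(1), of "k + 1" "B ^ Suc n"] assms(2) k *(4) unfolding mn by auto
qed

text \<open>Only the last block reaches the right border, and it has no vertical edges. All vertical
  segments are therefore to the left of the rightmost tree edge, and the plane is free to the right
  of it.\<close>

lemma last_edge_block:
  assumes "hgt (Suc n) \<le> y" "y \<le> hgt n" "y \<le> hgt m" "1 \<le> m" "b + 1 < M ^ m" "m \<le> n \<or> y = hgt (Suc n) \<and> m = Suc n"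
  shows "br m b < eg n (B ^ Suc n) y"
proof -
  have B1: "1 \<le> B ^ Suc n" using M_ge by simp
  have last: "blk (Suc n) (B ^ Suc n) = M ^ Suc n - 1"
  proof -
    have "B ^ Suc n = blast (Suc n) (M ^ Suc n - 1)" unfolding blast_def B_power[of "Suc n"] by simp
    then show ?thesis by simp
  qed
  have lt: "br m b < bl m (M ^ m - 1)" using assms(5) by (intro block_order) auto
  show ?thesis
  proof (cases "m \<le> n")
    case True
    then obtain r where r: "n = m + r" using le_Suc_ex by blast
    have "blk n (pidx (B ^ Suc n)) = M ^ n - 1"
    proof -
      have "M ^ Suc n - 1 = (M ^ n - 1) * M + (M - 1)"
      proof -
        obtain q where "M ^ n = Suc q" using M_pos by (metis gr0_implies_Suc zero_less_power)
        then show ?thesis using M_ge by (simp add: mult.commute)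
      qed
      moreover have "((M ^ n - 1) * M + (M - 1)) div M = M ^ n - 1"
        using M_ge by (subst div_mult_self3) simp_all
      ultimately have "(M ^ Suc n - 1) div M = M ^ n - 1" by simp
      then show ?thesis unfolding blk_parent last .
    qed
    then have "bl n (M ^ n - 1) \<le> eg n (B ^ Suc n) y"
      using eg_block[OF assms(1,2) B1] by simp
    moreover have "(M ^ n - 1) div M ^ r = M ^ m - 1"
    proof (rule div_nat_eqI)
      have "(M ^ m - 1) * M ^ r + M ^ r = M ^ n" 
      proof -
        have "(M ^ m - 1) * M ^ r + M ^ r = Suc (M ^ m - 1) * M ^ r" by (simp only: mult_Suc add.commute)
        moreover have "Suc (M ^ m - 1) = M ^ m" by simp
        ultimately show ?thesis unfolding r by (simp only: power_add)
      qed
      moreover have "1 \<le> M ^ r" using M_ge by (intro one_le_power) linarith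
      ultimately show "M ^ r * (M ^ m - 1) \<le> M ^ n - 1" by (simp add: mult.commute)
      have "Suc (M ^ m - 1) = M ^ m" by simp
      then show "M ^ n - 1 < M ^ r * Suc (M ^ m - 1)" unfolding r by (simp add: power_add mult.commute)
    qed
    ultimately show ?thesis using block_nested_le(1)[of m "M ^ n - 1" r] lt unfolding r by simp
  next
    case False
    with assms(6) have y: "y = hgt (Suc n)" and m: "m = Suc n" by auto
    have "bl (Suc n) (M ^ Suc n - 1) \<le> X (Suc n) (B ^ Suc n)" using X_bounds[of "B ^ Suc n" "Suc n"] last by simp
    then show ?thesis unfolding y eg_bot using lt m by simp
  qed
qed

lemma right_off:
  assumes "hgt (Suc n) \<le> y" "y < hgt n" "eg n (B ^ Suc n) y < x"
  shows "off x y"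
  unfolding off_def
proof (intro conjI allI impI notI)
  show False if "on_strip x y" using strip_range(2)[OF assms(1,2) that] assms(3) by simp
  show False if "proper m k" "in_cell m k x y" for m k using cell_range(2)[OF assms(1,2) that] assms(3) by simp
  show False if v: "on_vert x y"
  proof -
    obtain m b where m: "1 \<le> m" "b + 1 < M ^ m" "y \<le> hgt m" "x = bl m b \<or> x = br m b"
      using v unfolding on_vert_def by blast
    have "hgt (Suc n) \<le> hgt m" using assms(1) m(3) by simp
    then have "m \<le> Suc n" unfolding hgt_le_iff .
    then have "m \<le> n \<or> y = hgt (Suc n) \<and> m = Suc n" using assms(1) m(3) by (cases "m = Suc n") auto
    then have "br m b < eg n (B ^ Suc n) y"
      using assms(1,2) m by (intro last_edge_block) auto
    moreover have "x \<le> br m b" using m(4) wd_pos[of m] by (elim disjE) linarith+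
    ultimately show False using assms(3) by linarith
  qed
qed

lemma vert_low: "on_vert x y \<Longrightarrow> bl 1 0 \<le> x" "on_vert x y \<Longrightarrow> y \<le> hgt 1"
proof -
  assume "on_vert x y"
  then obtain m b where m: "1 \<le> m" "b + 1 < M ^ m" "y \<le> hgt m" "x = bl m b \<or> x = br m b"
    unfolding on_vert_def by blast
  have "bl m b \<le> x" "x \<le> br m b" using m(4) wd_pos[of m] by (elim disjE; linarith)+
  then obtain j where "j < M ^ 1" "bl 1 j \<le> x" using block_in[OF m(1), of b x] m(2) by auto
  then show "bl 1 0 \<le> x" using block_order_le[of 0 j 1] by simp
  show "y \<le> hgt 1" using hgt_mono[OF m(1)] m(3) by simp
qed

lemma left_off_low:
  assumes "0 < y" "y \<le> hgt 1" "x < bl 1 0"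
  shows "off x y"
  unfolding off_def
proof (intro conjI allI impI notI)
  show False if st: "on_strip x y"
  proof -
    obtain j where "j < M ^ 1" "bl 1 j \<le> x" using on_strip_block[OF st assms(2)] by auto
    then show False using block_order_le[of 0 j 1] assms(3) by simp
  qed
  show False if "on_vert x y" using vert_low(1)[OF that] assms(3) by simp
  show False if c: "proper m k" "in_cell m k x y" for m k
  proof -
    have *: "hgt (Suc m) < y" "y < hgt m" "eg m k y < x" using c by (auto simp: in_cell_def)
    have "hgt (Suc m) < hgt 1" using * assms by linarith
    then have "1 \<le> m" using hgt_mono[of "Suc m" 1] by (cases m) auto
    have k: "1 \<le> k" "k \<le> B ^ Suc m" using c(1) by (auto simp: proper_def)
    have "(Suc m, k) \<in> V" using k by (simp add: mem_V)
    then have "on_strip (eg m k y) y" using * by (intro on_strip_edge) auto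
    then obtain j where "j < M ^ 1" "bl 1 j \<le> eg m k y" using on_strip_block[OF _ assms(2)] by auto
    then show False using block_order_le[of 0 j 1] * assms(3) by simp
  qed
qed

lemma left_off_high:
  assumes "hgt 1 \<le> y" "y < 1" "x < eg 0 1 y"
  shows "off x y"
  unfolding off_def
proof (intro conjI allI impI notI)
  have y: "hgt (Suc 0) \<le> y" "y < hgt 0" using assms(1,2) by simp_all
  show False if "on_strip x y" using strip_range(1)[OF y that] assms(3) by simp
  show False if "proper m k" "in_cell m k x y" for m k using cell_range(1)[OF y that] assms(3) by simp
  show False if v: "on_vert x y"
  proof -
    have "y = hgt (Suc 0)" using vert_low(2)[OF v] assms(1) by simp
    moreover have "X (Suc 0) 1 = bl (Suc 0) 0" using X_bfirst[of "Suc 0" 0] by (simp add: bfirst_def)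
    ultimately have "x < bl 1 0" using assms(3) eg_bot[of 0 1] by simp
    then show False using vert_low(1)[OF v] by simp
  qed
qed

lemma above_off: "1 \<le> y \<Longrightarrow> \<not> on_strip x y \<Longrightarrow> off x y"
proof -
  assume y: "1 \<le> y" and s: "\<not> on_strip x y"
  have "\<not> on_vert x y" using vert_low(2)[of x y] hgt_less[of 0 1] y by auto
  moreover have "\<not> in_cell n k x y" for n k using hgt_mono[of 0 n] y by (auto simp: in_cell_def)
  ultimately show ?thesis using s by (simp add: off_def)
qed

definition free_ray :: "real \<Rightarrow> real \<Rightarrow> bool" where
  "free_ray x y \<longleftrightarrow> (\<forall>x'\<ge>x. off x' y) \<or> (\<forall>x'\<le>x. off x' y)"

text \<open>The three cases confine a face to a cell, confine it to a slot, or identify it as the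
  outer face, which has infinitely many boundary vertices.\<close>

theorem classify:
  assumes "0 < y" "\<not> on_strip x y" "\<not> on_vert x y"
  shows "(\<exists>n k. proper n k \<and> in_cell n k x y) \<or> in_slot x y \<or> free_ray x y"
proof (cases "1 \<le> y")
  case True
  show ?thesis
  proof (cases "x \<le> 1 / 2")
    case le: True
    have "\<not> on_strip x' y" if "x' \<le> x" for x'
      using assms(2) le that unfolding on_strip_above[OF True] by auto
    then show ?thesis unfolding free_ray_def using above_off[OF True] by blast
  next
    case False
    then have "\<not> on_strip x' y" if "x' \<ge> x" for x'
      using that unfolding on_strip_above[OF True] by auto
    then show ?thesis unfolding free_ray_def using above_off[OF True] by blast
  qed
next
  case False
  then obtain n where n: "hgt (Suc n) \<le> y" "y < hgt n" using strip_index assms(1) by (metis not_le)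
  from n assms(2) show ?thesis
  proof (cases rule: locate)
    case left
    show ?thesis
    proof (cases "n = 0")
      case True
      then have "\<forall>x'\<le>x. off x' y" using left n left_off_high[of y] by simp
      then show ?thesis by (simp add: free_ray_def)
    next
      case False
      have "bfirst (Suc n) (0 * M) = 1" by (simp add: bfirst_def)
      then have "x < LW n 0 y" unfolding wall_high[OF n(1)] using left by simp
      then consider "in_slot x y" | "x < bl 1 0" "y \<le> hgt 1"
        using left_of_walls[of n y x] False n(2) assms(3) by auto
      then show ?thesis
      proof cases
        case 2
        then have "\<forall>x'\<le>x. off x' y" using left_off_low[OF assms(1)] by auto
        then show ?thesis by (simp add: free_ray_def)
      qed simp
    qed
  next
    case right
    then have "\<forall>x'\<ge>x. off x' y" using right_off[OF n] by auto
    then show ?thesis by (simp add: free_ray_def)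
  next
    case (cell k)
    then show ?thesis by blast
  next
    case (gap k)
    note g = gap_blocks[OF gap(1,3)]
    let ?j = "blk (Suc n) k"
    have k: "k \<le> B ^ Suc n" using gap(2) by simp
    show ?thesis
    proof (cases "blk n (pidx k) = blk n (pidx (k + 1))")
      case True
      have j: "blk (Suc n) (k + 1) < M ^ Suc n" using gap(2) by (intro blk_less) auto
      show ?thesis
      proof (cases "blk (Suc n) (k + 1) + 1 < M ^ Suc n")
        case last: True
        then have "in_slot x y" using gap n True
          by (intro in_slotI[OF slot.mid[of k n]]) (simp_all add: max_absorb1)
        then show ?thesis by simp
      next
        case False
        then have last: "blk (Suc n) (k + 1) + 1 = M ^ Suc n" using j by simp
        have "X (Suc n) (k + 1) = bl (Suc n) (blk (Suc n) (k + 1))"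
          unfolding g(3) by (subst g(2)) (rule X_bfirst, simp)
        then have "in_slot x y" using gap n True last
          by (intro in_slotI[OF slot.mid_last[of k n]]) (simp_all add: max_absorb1 min_absorb2 wall_top)
        then show ?thesis by simp
      qed
    next
      case False
      then have ne: "?j div M \<noteq> (?j + 1) div M" unfolding blk_parent g(3) .
      have e: "?j + 1 = (?j div M + 1) * M" "?j = ?j div M * M + M - 1"
      proof -
        have "(?j + 1) mod M = 0" using ne by (simp add: div_Suc split: if_splits)
        moreover have "(?j + 1) div M = ?j div M + 1" using ne by (simp add: div_Suc split: if_splits)
        ultimately show "?j + 1 = (?j div M + 1) * M" using div_mult_mod_eq[of "?j + 1" M] by simp
        then show "?j = ?j div M * M + M - 1" by simp
      qed
      have "?j + 1 < M ^ Suc n" using blk_less[OF gap(2)] g(3) by simp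
      then have "(?j div M + 1) * M < M ^ n * M" using e(1) by (simp add: mult.commute)
      then have b: "?j div M + 1 < M ^ n" by (simp only: mult_less_cancel2)
      have "RW n (?j div M) y < x"
        unfolding wall_high[OF n(1)] e(2)[symmetric] g(1)[symmetric] by (rule gap(4))
      moreover have "x < LW n (?j div M + 1) y"
        unfolding wall_high[OF n(1)] e(1)[symmetric] g(2)[symmetric] by (rule gap(5))
      ultimately show ?thesis using between_walls[OF b n(2)] assms(3) by blast
    qed
  qed
qed

end

section \<open>Faces and the added diagonals\<close>

lemma closed_segment_complex:
  "closed_segment (Complex a u) (Complex b v) =
    {Complex ((1 - t) * a + t * b) ((1 - t) * u + t * v) | t. 0 \<le> t \<and> t \<le> 1}"
  by (auto simp: closed_segment_def complex_eq_iff)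

lemma convex_hull_cnj: "z \<in> convex hull (cnj ` S) \<longleftrightarrow> cnj z \<in> convex hull S"
proof -
  have "convex hull (cnj ` S) = cnj ` (convex hull S)"
    by (rule convex_hull_linear_image[symmetric]) (rule bounded_linear.linear[OF bounded_linear_cnj])
  then show ?thesis by (metis complex_cnj_cnj image_iff)
qed

text \<open>A connected set that meets \<open>R\<close> and its complement meets the frontier of
  \<open>R\<close>.\<close>

lemma component_in_region:
  assumes "f \<in> components (- D)" "frontier R \<subseteq> D" "z \<in> f" "z \<in> R"
  shows "f \<subseteq> R"
proof (rule ccontr)
  assume "\<not> f \<subseteq> R"
  moreover have "connected f" using assms(1) by (rule in_components_connected)
  ultimately have "f \<inter> frontier R \<noteq> {}" using assms(3,4) by (intro connected_Int_frontier) auto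
  moreover have "f \<subseteq> - D" using assms(1) by (rule in_components_subset)
  ultimately show False using assms(2) by blast
qed

text \<open>Taking \<open>g\<close> to be a signed imaginary part or its absolute value handles both
  half planes at once.\<close>

lemma region_closure:
  fixes A A' g :: "_ \<Rightarrow> real" and l h :: real
  assumes "continuous_on UNIV A" "continuous_on UNIV A'" "continuous_on UNIV (g :: complex \<Rightarrow> real)"
  defines "R \<equiv> {z. l < g z \<and> g z < h \<and> A (g z) < Re z \<and> Re z < A' (g z)}"
  shows "closure R \<subseteq> {z. l \<le> g z \<and> g z \<le> h \<and> A (g z) \<le> Re z \<and> Re z \<le> A' (g z)}"
    and "frontier R \<subseteq> {z. l \<le> g z \<and> g z \<le> h \<and> A (g z) \<le> Re z \<and> Re z \<le> A' (g z)} - R"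
proof -
  have c: "continuous_on UNIV (\<lambda>z. A (g z))" "continuous_on UNIV (\<lambda>z. A' (g z))"
    using assms by (auto intro: continuous_on_compose2)
  have "closed {z. l \<le> g z \<and> g z \<le> h \<and> A (g z) \<le> Re z \<and> Re z \<le> A' (g z)}"
    by (intro closed_Collect_conj closed_Collect_le continuous_intros assms c)
  then show cl: "closure R \<subseteq> {z. l \<le> g z \<and> g z \<le> h \<and> A (g z) \<le> Re z \<and> Re z \<le> A' (g z)}"
    by (rule closure_minimal[rotated]) (auto simp: R_def)
  have "open R" unfolding R_def
    by (intro open_Collect_conj open_Collect_less continuous_intros assms c)
  then have "frontier R = closure R - R" by (simp add: frontier_def interior_open)
  with cl show "frontier R \<subseteq> {z. l \<le> g z \<and> g z \<le> h \<and> A (g z) \<le> Re z \<and> Re z \<le> A' (g z)} - R"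
    by blast
qed

context strip_tree
begin

lemma pos_eq: "pos d M (n, i) = Complex (X n i) (hgt n)"
  by (simp add: pos_def hgt_def)

lemma tree_segment:
  "z \<in> convex hull (pos d M ` {(n, pidx k), (Suc n, k)}) \<longleftrightarrow>
    hgt (Suc n) \<le> Im z \<and> Im z \<le> hgt n \<and> Re z = eg n k (Im z)"
proof -
  have hull: "convex hull (pos d M ` {(n, pidx k), (Suc n, k)}) =
      closed_segment (Complex (X (Suc n) k) (hgt (Suc n))) (Complex (X n (pidx k)) (hgt n))"
    by (simp add: pos_eq insert_commute flip: segment_convex_hull)
  have im: "(1 - t) * hgt (Suc n) + t * hgt n = (1 + t) * hgt (Suc n)" for t
    unfolding hgt_Suc[of n] by (simp add: algebra_simps)
  \<comment> \<open>The product of \<open>2 ^ Suc n\<close> and the height runs from 1 to 2 along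
    the edge, so the affine parameter \<open>t\<close> can be read off from the height.\<close>
  have w: "2 ^ Suc n * ((1 + t) * hgt (Suc n)) - 1 = t" for t
  proof -
    have "2 ^ Suc n * ((1 + t) * hgt (Suc n)) = (1 + t) * (2 ^ Suc n * hgt (Suc n))"
      by (simp only: mult_ac)
    then show ?thesis by (simp only: hgt_mult mult_1_right add_diff_cancel_left')
  qed
  show ?thesis
  proof
    assume "z \<in> convex hull (pos d M ` {(n, pidx k), (Suc n, k)})"
    then obtain t where t: "0 \<le> t" "t \<le> 1"
      "z = Complex ((1 - t) * X (Suc n) k + t * X n (pidx k)) ((1 + t) * hgt (Suc n))"
      unfolding hull closed_segment_complex im by blast
    have "1 * hgt (Suc n) \<le> (1 + t) * hgt (Suc n)" "(1 + t) * hgt (Suc n) \<le> 2 * hgt (Suc n)"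
      using t by (intro mult_right_mono; simp add: less_imp_le)+
    then show "hgt (Suc n) \<le> Im z \<and> Im z \<le> hgt n \<and> Re z = eg n k (Im z)"
      unfolding t(3) complex.sel eg_convex w hgt_Suc[of n] by simp
  next
    assume *: "hgt (Suc n) \<le> Im z \<and> Im z \<le> hgt n \<and> Re z = eg n k (Im z)"
    define t where "t = 2 ^ Suc n * Im z - 1"
    have t: "0 \<le> t" "t \<le> 1" unfolding t_def using eg_weight[of n "Im z"] * by auto
    have "(1 + t) * hgt (Suc n) = Im z * (2 ^ Suc n * hgt (Suc n))" unfolding t_def by (simp only: algebra_simps)
    then have "(1 + t) * hgt (Suc n) = Im z" unfolding hgt_mult by simp
    moreover have "Re z = (1 - t) * X (Suc n) k + t * X n (pidx k)"
      using * unfolding eg_convex t_def by blast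
    ultimately have "z = Complex ((1 - t) * X (Suc n) k + t * X n (pidx k)) ((1 + t) * hgt (Suc n))"
      by (simp only: complex_eq_iff complex.sel simp_thms)
    then show "z \<in> convex hull (pos d M ` {(n, pidx k), (Suc n, k)})"
      unfolding hull closed_segment_complex im using t by blast
  qed
qed

lemma hor_segment:
  assumes "proper n k"
  shows "z \<in> convex hull (pos d M ` {(Suc n, k), (Suc n, k + 1)}) \<longleftrightarrow>
    Im z = hgt (Suc n) \<and> X (Suc n) k \<le> Re z \<and> Re z \<le> X (Suc n) (k + 1)"
proof -
  let ?a = "X (Suc n) k" and ?b = "X (Suc n) (k + 1)"
  have ab: "?a < ?b" using assms by (intro X_mono) (auto simp: proper_def)
  have hull: "convex hull (pos d M ` {(Suc n, k), (Suc n, k + 1)}) =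
      closed_segment (Complex ?a (hgt (Suc n))) (Complex ?b (hgt (Suc n)))"
    by (simp add: pos_eq flip: segment_convex_hull)
  have im: "(1 - t) * hgt (Suc n) + t * hgt (Suc n) = hgt (Suc n)" for t
    by (simp add: algebra_simps)
  have re: "(1 - t) * ?a + t * ?b = ?a + t * (?b - ?a)" for t by (simp add: algebra_simps)
  show ?thesis
  proof
    assume "z \<in> convex hull (pos d M ` {(Suc n, k), (Suc n, k + 1)})"
    then obtain t where t: "0 \<le> t" "t \<le> 1" "z = Complex (?a + t * (?b - ?a)) (hgt (Suc n))"
      unfolding hull closed_segment_complex im re by blast
    define u where "u = t * (?b - ?a)"
    have "0 \<le> t * (?b - ?a)" "t * (?b - ?a) \<le> 1 * (?b - ?a)"
      using t ab by (intro mult_nonneg_nonneg mult_right_mono; simp)+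
    then have "0 \<le> u" "u \<le> ?b - ?a" unfolding u_def by simp_all
    then show "Im z = hgt (Suc n) \<and> ?a \<le> Re z \<and> Re z \<le> ?b"
      unfolding t(3) complex.sel u_def[symmetric] by simp
  next
    assume *: "Im z = hgt (Suc n) \<and> ?a \<le> Re z \<and> Re z \<le> ?b"
    define t where "t = (Re z - ?a) / (?b - ?a)"
    have "0 \<le> t" "t \<le> 1" "Re z = ?a + t * (?b - ?a)" using * ab by (auto simp: t_def)
    then have "z = Complex (?a + t * (?b - ?a)) (hgt (Suc n))" "0 \<le> t" "t \<le> 1"
      using * by (auto simp: complex_eq_iff)
    then show "z \<in> convex hull (pos d M ` {(Suc n, k), (Suc n, k + 1)})"
      unfolding hull closed_segment_complex im re by blast
  qed
qed

lemma drawing_strip: "z \<in> drawing (pos d M) (strip_edges d M) \<longleftrightarrow> on_strip (Re z) (Im z)"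
proof
  assume "z \<in> drawing (pos d M) (strip_edges d M)"
  then obtain e where e: "e \<in> strip_edges d M" "z \<in> convex hull (pos d M ` e)"
    unfolding drawing_def by blast
  from e(1) show "on_strip (Re z) (Im z)"
  proof (cases rule: strip_edge_cases)
    case (tree n k)
    then show ?thesis using e(2) unfolding tree(2) tree_segment on_strip_def by blast
  next
    case (hor n k)
    then show ?thesis using e(2) unfolding hor(2) hor_segment[OF hor(1)] on_strip_def by blast
  qed
next
  assume "on_strip (Re z) (Im z)"
  then consider n k where "(Suc n, k) \<in> V" "hgt (Suc n) \<le> Im z \<and> Im z \<le> hgt n \<and> Re z = eg n k (Im z)"
    | n k where "proper n k" "Im z = hgt (Suc n) \<and> X (Suc n) k \<le> Re z \<and> Re z \<le> X (Suc n) (k + 1)"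
    unfolding on_strip_def by blast
  then show "z \<in> drawing (pos d M) (strip_edges d M)"
  proof cases
    case 1
    then show ?thesis unfolding drawing_def using strip_edge_tree tree_segment by blast
  next
    case 2
    then show ?thesis unfolding drawing_def using strip_edge_hor hor_segment by blast
  qed
qed

definition closed_cell :: "nat \<Rightarrow> nat \<Rightarrow> complex set" where
  "closed_cell n k = {z. hgt (Suc n) \<le> Im z \<and> Im z \<le> hgt n \<and> eg n k (Im z) \<le> Re z \<and> Re z \<le> eg n (k + 1) (Im z)}"

lemma closed_cell_cases:
  assumes "proper n k" "z \<in> closed_cell n k"
  shows "on_strip (Re z) (Im z) \<or> in_cell n k (Re z) (Im z)"
proof -
  have k: "1 \<le> k" "k + 1 \<le> B ^ Suc n" "blk (Suc n) k = blk (Suc n) (k + 1)"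
    using assms(1) by (auto simp: proper_def)
  then have V: "(Suc n, k) \<in> V" "(Suc n, k + 1) \<in> V" by (auto simp: mem_V)
  have z: "hgt (Suc n) \<le> Im z" "Im z \<le> hgt n" "eg n k (Im z) \<le> Re z" "Re z \<le> eg n (k + 1) (Im z)"
    using assms(2) by (auto simp: closed_cell_def)
  consider "Re z = eg n k (Im z)" | "Re z = eg n (k + 1) (Im z)" | "Im z = hgt (Suc n)" | "Im z = hgt n"
    | "in_cell n k (Re z) (Im z)" using z unfolding in_cell_def by fastforce
  then show ?thesis
  proof cases
    case 3
    then show ?thesis using z(3,4) assms(1) unfolding on_strip_def 3 eg_bot by blast
  next
    case 4
    have "blk n (pidx k) = blk n (pidx (k + 1))" unfolding blk_parent k(3) ..
    then show ?thesis using mid_top[OF k(1,2)] z(3,4) unfolding 4 eg_top by blast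
  qed (use on_strip_edge V z(1,2) in \<open>force+\<close>)
qed

text \<open>The two sides are affine in the height, so the closed cell is an intersection of four
  half planes. Every diagonal between its corners stays inside.\<close>

lemma convex_closed_cell: "convex (closed_cell n k)"
proof -
  have e: "eg n k y = (X (Suc n) k - (X n (pidx k) - X (Suc n) k)) + (2 ^ Suc n * (X n (pidx k) - X (Suc n) k)) * y" for k y
    by (simp add: eg_def algebra_simps)
  have c1: "convex {z. a \<le> Re z + b * Im z}" and c2: "convex {z. Re z + b * Im z \<le> a}" for a b
  proof -
    have "Re z + b * Im z = Complex 1 b \<bullet> z" for z by (simp add: inner_complex_def)
    then show "convex {z. a \<le> Re z + b * Im z}" "convex {z. Re z + b * Im z \<le> a}"
      using convex_halfspace_ge[of a "Complex 1 b"] convex_halfspace_le[of "Complex 1 b" a] by simp_all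
  qed
  have c3: "convex {z. a \<le> Im z}" "convex {z. Im z \<le> a}" for a
    using convex_halfspace_Im_ge[of a] convex_halfspace_Im_le[of a] by simp_all
  define a b where "a k = X (Suc n) k - (X n (pidx k) - X (Suc n) k)"
    and "b k = 2 ^ Suc n * (X n (pidx k) - X (Suc n) k)" for k
  have "closed_cell n k = {z. hgt (Suc n) \<le> Im z} \<inter> {z. Im z \<le> hgt n} \<inter>
      {z. a k \<le> Re z + - b k * Im z} \<inter> {z. Re z + - b (k + 1) * Im z \<le> a (k + 1)}"
    unfolding closed_cell_def e a_def[symmetric] b_def[symmetric] by auto
  also have "convex \<dots>" by (intro convex_Int c1 c2 c3)
  finally show ?thesis .
qed

lemma cell_verts_closed:
  assumes "proper n k" "v \<in> cell n k" shows "pos d M v \<in> closed_cell n k"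
proof -
  have k: "1 \<le> k" "k + 1 \<le> B ^ Suc n" using assms(1) by (auto simp: proper_def)
  have X1: "X (Suc n) k \<le> X (Suc n) (k + 1)" using k by (intro X_mono_le) auto
  have X2: "X n (pidx k) \<le> X n (pidx (k + 1))"
    using k pidx_mono[of k "k + 1"] pidx_le[of "k + 1" n] by (intro X_mono_le) auto
  have h: "hgt (Suc n) \<le> hgt n" by (rule hgt_mono) simp
  show ?thesis using assms(2) X1 X2 h unfolding cell_def closed_cell_def
    by (auto simp: pos_eq eg_bot eg_top)
qed

lemma vertex_in_closed_cell:
  assumes "proper n k" "(m, i) \<in> V" "pos d M (m, i) \<in> closed_cell n k"
  shows "(m, i) \<in> cell n k"
proof -
  have k: "1 \<le> k" "k + 1 \<le> B ^ Suc n" using assms(1) by (auto simp: proper_def)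
  have i: "1 \<le> i" "i \<le> B ^ m" using assms(2) by (auto simp: mem_V)
  have z: "hgt (Suc n) \<le> hgt m" "hgt m \<le> hgt n" "eg n k (hgt m) \<le> X m i" "X m i \<le> eg n (k + 1) (hgt m)"
    using assms(3) by (auto simp: closed_cell_def pos_eq)
  then consider "m = n" | "m = Suc n" unfolding hgt_le_iff by linarith
  then show ?thesis
  proof cases
    case 1
    have "pidx k \<le> i" "i \<le> pidx (k + 1)"
      using z(3,4) i k pidx_le[of k n] pidx_le[of "k + 1" n] X_le_iff unfolding 1 eg_top by auto
    then show ?thesis using pidx_Suc[OF k(1)] unfolding 1 cell_def by auto
  next
    case 2
    have "k \<le> i" "i \<le> k + 1" using z(3,4) i k X_le_iff unfolding 2 eg_bot by auto
    then show ?thesis unfolding 2 cell_def by auto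
  qed
qed

lemma closed_cell_region:
  assumes "proper n k" "\<bar>\<sigma>\<bar> = (1::real)"
  defines "R \<equiv> {z. in_cell n k (Re z) (\<sigma> * Im z)}"
  shows "closure R \<subseteq> {z. Complex (Re z) (\<sigma> * Im z) \<in> closed_cell n k}"
    and "z \<in> frontier R \<Longrightarrow> on_strip (Re z) (\<sigma> * Im z)"
proof -
  have c: "continuous_on UNIV (eg n k)" for k unfolding eg_def by (intro continuous_intros)
  have g: "continuous_on UNIV (\<lambda>z. \<sigma> * Im z)" by (intro continuous_intros)
  have R: "R = {z. hgt (Suc n) < \<sigma> * Im z \<and> \<sigma> * Im z < hgt n \<and>
      eg n k (\<sigma> * Im z) < Re z \<and> Re z < eg n (k + 1) (\<sigma> * Im z)}"
    unfolding R_def in_cell_def by blast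
  note rc = region_closure[OF c[of k] c[of "k + 1"] g, of "hgt (Suc n)" "hgt n", folded R]
  show "closure R \<subseteq> {z. Complex (Re z) (\<sigma> * Im z) \<in> closed_cell n k}"
    using rc(1) unfolding closed_cell_def by simp
  assume "z \<in> frontier R"
  then have z: "Complex (Re z) (\<sigma> * Im z) \<in> closed_cell n k" "z \<notin> R"
    using rc(2) unfolding closed_cell_def by auto
  then show "on_strip (Re z) (\<sigma> * Im z)"
    using closed_cell_cases[OF assms(1) z(1)] unfolding R_def by simp
qed

section \<open>The outer face and the finite faces\<close>

definition far_set :: "complex set" where
  "far_set = {z. Re z < 0} \<union> {z. 1 < Re z} \<union> {z. 1 < \<bar>Im z\<bar>}"

lemma connected_far_set: "connected far_set"
proof -
  have eq: "far_set = (({z. Re z < 0} \<union> {z. 1 < Im z}) \<union> {z. 1 < Re z}) \<union> {z. Im z < - 1}"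
    unfolding far_set_def by auto
  have c: "connected {z. Re z < 0}" "connected {z. 1 < Re z}" "connected {z. 1 < Im z}" "connected {z. Im z < - 1}"
    by (intro convex_connected convex_halfspace_Re_lt convex_halfspace_Re_gt
        convex_halfspace_Im_gt convex_halfspace_Im_lt)+
  have n1: "{z. Re z < 0} \<inter> {z. 1 < Im z} \<noteq> {}" (is "?S \<noteq> _")
  proof -
    have "Complex (- 1) 2 \<in> ?S" by simp
    then show ?thesis by blast
  qed
  have n2: "({z. Re z < 0} \<union> {z. 1 < Im z}) \<inter> {z. 1 < Re z} \<noteq> {}" (is "?S \<noteq> _")
  proof -
    have "Complex 2 2 \<in> ?S" by simp
    then show ?thesis by blast
  qed
  have n3: "(({z. Re z < 0} \<union> {z. 1 < Im z}) \<union> {z. 1 < Re z}) \<inter> {z. Im z < - 1} \<noteq> {}" (is "?S \<noteq> _")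
  proof -
    have "Complex 2 (- 2) \<in> ?S" by simp
    then show ?thesis by blast
  qed
  show ?thesis unfolding eq
    by (rule connected_Un[OF connected_Un[OF connected_Un[OF c(1) c(3) n1] c(2) n2] c(4) n3])
qed

lemma on_strip_bounded: "on_strip x y \<Longrightarrow> 0 \<le> x \<and> x \<le> 1 \<and> 0 < y \<and> y \<le> 1"
proof -
  assume s: "on_strip x y"
  have y: "0 < y" "y \<le> 1"
  proof -
    obtain n where "hgt (Suc n) \<le> y" "y \<le> hgt n"
      using s hgt_less[of n "Suc n" for n] unfolding on_strip_def by (metis less_imp_le lessI order_refl)
    then show "0 < y" "y \<le> 1" using hgt_pos[of "Suc n"] hgt_mono[of 0 n] hgt_0 by linarith+
  qed
  have 0: "bl 0 0 = 0" "br 0 0 = 1" by (simp_all add: wd_0)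
  show ?thesis
  proof (cases "y = 1")
    case True
    then show ?thesis using s on_strip_above[of y x] by auto
  next
    case False
    then obtain n where n: "hgt (Suc n) \<le> y" "y < hgt n" using strip_index y by (metis order_le_less)
    have eb: "0 \<le> eg n k y \<and> eg n k y \<le> 1" if "1 \<le> k" "k \<le> B ^ Suc n" for k
    proof -
      have "blk n (pidx k) < M ^ n" using that pidx_le by (intro blk_less) auto
      then have "\<exists>j'<M ^ 0. bl 0 j' \<le> eg n k y \<and> eg n k y \<le> br 0 j'"
        using eg_block[OF n(1) _ that] n(2) by (intro block_in[of 0 n "blk n (pidx k)"]) auto
      then show ?thesis using 0 by auto
    qed
    have B1: "1 \<le> B ^ Suc n" using M_ge by simp
    show ?thesis using strip_range[OF n s] eb[of 1] eb[of "B ^ Suc n"] B1 y by auto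
  qed
qed

text \<open>A horizontal ray from the right reaches each rightmost vertex without meeting the
  drawing, so all of them are on the frontier of the outer face.\<close>

lemma infinite_right_vertices:
  assumes f: "f \<in> components (- D)" "far_set \<subseteq> f"
    and ray: "\<And>n x. X n (B ^ n) < x \<Longrightarrow> {z. x \<le> Re z \<and> Im z = hgt n} \<subseteq> - D"
    and D: "\<And>n. Complex (X n (B ^ n)) (hgt n) \<in> D"
  shows "infinite {n. Complex (X n (B ^ n)) (hgt n) \<in> frontier f}"
proof -
  have "Complex (X n (B ^ n)) (hgt n) \<in> frontier f" for n
  proof -
    let ?x = "X n (B ^ n)"
    have in_f: "Complex x (hgt n) \<in> f" if "?x < x" for x
    proof -
      have "connected {z. x \<le> Re z \<and> Im z = hgt n}"
      proof -
        have "{z. x \<le> Re z \<and> Im z = hgt n} = {z. x \<le> Re z} \<inter> {z. Im z \<le> hgt n} \<inter> {z. hgt n \<le> Im z}" by auto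
        moreover have "convex \<dots>"
          using convex_halfspace_Re_ge[of x] convex_halfspace_Im_le[of "hgt n"] convex_halfspace_Im_ge[of "hgt n"]
          by (intro convex_Int) simp_all
        ultimately show ?thesis by (simp add: convex_connected)
      qed
      moreover have "Complex (max x 2) (hgt n) \<in> f \<inter> {z. x \<le> Re z \<and> Im z = hgt n}"
        using f(2) unfolding far_set_def by auto
      ultimately have "{z. x \<le> Re z \<and> Im z = hgt n} \<subseteq> f"
        using components_maximal[OF f(1)] ray[OF that] by blast
      then show ?thesis by auto
    qed
    have "Complex ?x (hgt n) \<in> closure f"
      unfolding closure_approachable
    proof (intro allI impI)
      fix e :: real assume e: "0 < e"
      have "Complex (?x + e / 2) (hgt n) \<in> f" using e by (intro in_f) simp
      moreover have "dist (Complex (?x + e / 2) (hgt n)) (Complex ?x (hgt n)) < e"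
        using e by (simp add: dist_norm cmod_def)
      ultimately show "\<exists>y\<in>f. dist y (Complex ?x (hgt n)) < e" by blast
    qed
    moreover have "Complex ?x (hgt n) \<notin> f" using D in_components_subset[OF f(1)] by blast
    ultimately show ?thesis unfolding frontier_def using interior_subset by blast
  qed
  then show ?thesis by simp
qed

text \<open>The ray connects \<open>z\<close> with \<open>far_set\<close>, which is connected and
  lies outside the box containing the drawing.\<close>

lemma ray_in_face:
  assumes f: "f \<in> components (- D)" "z \<in> f"
    and D: "\<And>z. z \<in> D \<Longrightarrow> 0 \<le> Re z \<and> Re z \<le> 1 \<and> \<bar>Im z\<bar> \<le> 1"
    and ray: "(\<forall>x\<ge>Re z. Complex x (Im z) \<notin> D) \<or> (\<forall>x\<le>Re z. Complex x (Im z) \<notin> D)"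
  shows "far_set \<subseteq> f"
proof -
  have conv: "connected {w. Re z \<le> Re w \<and> Im w = Im z}" "connected {w. Re w \<le> Re z \<and> Im w = Im z}"
  proof -
    have e: "{w. Re z \<le> Re w \<and> Im w = Im z} = {w. Re z \<le> Re w} \<inter> {w. Im w \<le> Im z} \<inter> {w. Im z \<le> Im w}"
      "{w. Re w \<le> Re z \<and> Im w = Im z} = {w. Re w \<le> Re z} \<inter> {w. Im w \<le> Im z} \<inter> {w. Im z \<le> Im w}" by auto
    have "convex {w. Re z \<le> Re w}" "convex {w. Re w \<le> Re z}" "convex {w. Im w \<le> Im z}" "convex {w. Im z \<le> Im w}"
      using convex_halfspace_Re_ge[of "Re z"] convex_halfspace_Re_le[of "Re z"]
        convex_halfspace_Im_le[of "Im z"] convex_halfspace_Im_ge[of "Im z"] by simp_all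
    note conv = this
    show "connected {w. Re z \<le> Re w \<and> Im w = Im z}"
      unfolding e(1) by (intro convex_connected convex_Int conv)
    show "connected {w. Re w \<le> Re z \<and> Im w = Im z}"
      unfolding e(2) by (intro convex_connected convex_Int conv)
  qed
  have far: "far_set \<subseteq> - D" using D unfolding far_set_def by force
  have "\<exists>w\<in>f. w \<in> far_set" using ray
  proof
    assume r: "\<forall>x\<ge>Re z. Complex x (Im z) \<notin> D"
    have "{w. Re z \<le> Re w \<and> Im w = Im z} \<subseteq> - D"
    proof safe
      fix w assume "Re z \<le> Re w" "Im w = Im z" "w \<in> D"
      then show False using r[rule_format, of "Re w"] by (metis complex_surj)
    qed
    then have "{w. Re z \<le> Re w \<and> Im w = Im z} \<subseteq> f"
      using components_maximal[OF f(1) conv(1)] f(2) by blast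
    moreover have "Complex (max (Re z) 2) (Im z) \<in> {w. Re z \<le> Re w \<and> Im w = Im z}" by simp
    moreover have "Complex (max (Re z) 2) (Im z) \<in> far_set" by (simp add: far_set_def less_max_iff_disj)
    ultimately show ?thesis by blast
  next
    assume r: "\<forall>x\<le>Re z. Complex x (Im z) \<notin> D"
    have "{w. Re w \<le> Re z \<and> Im w = Im z} \<subseteq> - D"
    proof safe
      fix w assume "Re w \<le> Re z" "Im w = Im z" "w \<in> D"
      then show False using r[rule_format, of "Re w"] by (metis complex_surj)
    qed
    then have "{w. Re w \<le> Re z \<and> Im w = Im z} \<subseteq> f"
      using components_maximal[OF f(1) conv(2)] f(2) by blast
    moreover have "Complex (min (Re z) (-1)) (Im z) \<in> {w. Re w \<le> Re z \<and> Im w = Im z}" by simp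
    moreover have "Complex (min (Re z) (-1)) (Im z) \<in> far_set" by (simp add: far_set_def min_less_iff_disj)
    ultimately show ?thesis by blast
  qed
  then show ?thesis using components_maximal[OF f(1) connected_far_set far] by blast
qed

text \<open>Its purpose is to exclude the outer face from \<open>fan_faces\<close>, for the strip as
  well as for the doubled graph.\<close>

lemma far_face_infinite:
  assumes f: "f \<in> components (- D)" "far_set \<subseteq> f"
    and D: "\<And>z. z \<in> D \<Longrightarrow> \<not> off (Re z) \<bar>Im z\<bar>" "\<And>z. on_strip (Re z) (Im z) \<Longrightarrow> z \<in> D"
  shows "infinite {n. pos d M (n, B ^ n) \<in> frontier f}"
proof -
  have off: "off x (hgt n)" if "X n (B ^ n) < x" for n x
  proof (cases n)
    case 0
    then have "\<not> on_strip x 1" using that on_strip_above[of 1 x] by (simp add: X_0)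
    then show ?thesis using above_off[of 1 x] 0 by simp
  next
    case (Suc m)
    have "hgt (Suc m) < hgt m" by (rule hgt_less) simp
    then show ?thesis using right_off[of m "hgt (Suc m)" x] that unfolding Suc eg_bot by simp
  qed
  have 1: "{z. x \<le> Re z \<and> Im z = hgt n} \<subseteq> - D" if "X n (B ^ n) < x" for n x
  proof safe
    fix z assume "x \<le> Re z" "Im z = hgt n" "z \<in> D"
    then show False using D(1)[of z] off[of n "Re z"] that hgt_pos[of n] by simp
  qed
  have 2: "Complex (X n (B ^ n)) (hgt n) \<in> D" for n
    using D(2) on_strip_vertex[of n "B ^ n"] M_ge by (simp add: mem_V)
  show ?thesis unfolding pos_eq by (rule infinite_right_vertices[OF f 1 2])
qed

lemma gap_not_strip:
  assumes y: "hgt (Suc n) \<le> y" "y < hgt n"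
    and gap: "1 \<le> k" "k + 1 \<le> B ^ Suc n" "blk (Suc n) k \<noteq> blk (Suc n) (k + 1)"
      "eg n k y < x" "x < eg n (k + 1) y"
  shows "\<not> on_strip x y"
  unfolding on_strip_level[OF y]
proof (safe)
  fix k' assume "(Suc n, k') \<in> V" "x = eg n k' y"
  then show False using eg_mono_le[OF y(1), of k' k] eg_mono_le[OF y(1), of "k + 1" k'] y(2) gap
    by (cases "k' \<le> k") (auto simp: mem_V)
next
  fix k' assume *: "y = hgt (Suc n)" "proper n k'" "X (Suc n) k' \<le> x" "x \<le> X (Suc n) (k' + 1)"
  have k': "1 \<le> k'" "k' + 1 \<le> B ^ Suc n" using *(2) by (auto simp: proper_def)
  have "k' \<noteq> k" using *(2) gap(3) by (auto simp: proper_def)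
  then consider "k' + 1 \<le> k" | "k + 1 \<le> k'" by linarith
  then show False
  proof cases
    case 1
    then have "X (Suc n) (k' + 1) \<le> X (Suc n) k" using gap(2) by (intro X_mono_le) auto
    then show False using *(4) gap(4) unfolding *(1) eg_bot by simp
  next
    case 2
    then have "X (Suc n) (k + 1) \<le> X (Suc n) k'" using k' by (intro X_mono_le) auto
    then show False using *(3) gap(5) unfolding *(1) eg_bot by simp
  qed
qed

text \<open>Without the vertical edges every gap between two blocks is open to the lower half plane.\<close>
lemma gap_far:
  assumes f: "f \<in> components (- D)" "z \<in> f"
    and D: "\<And>z. z \<in> D \<longleftrightarrow> on_strip (Re z) (Im z)"
    and y: "hgt (Suc n) \<le> Im z" "Im z < hgt n"
    and gap: "1 \<le> k" "k + 1 \<le> B ^ Suc n" "blk (Suc n) k \<noteq> blk (Suc n) (k + 1)"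
      "eg n k (Im z) < Re z" "Re z < eg n (k + 1) (Im z)"
  shows "far_set \<subseteq> f"
proof -
  note g = gap_blocks[OF gap(1,3)]
  \<comment> \<open>The escape path keeps the fixed ratio \<open>t\<close> between the two
    neighbouring tree edges down to the line of depth \<open>Suc n\<close> and then drops vertically
    through the gap.\<close>
  define t where "t = (Re z - eg n k (Im z)) / (eg n (k + 1) (Im z) - eg n k (Im z))"
  have t: "0 < t" "t < 1" "Re z = eg n k (Im z) + t * (eg n (k + 1) (Im z) - eg n k (Im z))"
    using gap(4,5) by (auto simp: t_def)
  have strict: "a < a + t * (b - a) \<and> a + t * (b - a) < b" if "a < b" for a b
  proof -
    have "0 < t * (b - a)" "t * (b - a) < 1 * (b - a)"
      using t that by (intro mult_pos_pos mult_strict_right_mono; simp)+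
    then show ?thesis by simp
  qed
  define q where "q y = eg n k y + t * (eg n (k + 1) y - eg n k y)" for y
  define S1 where "S1 = (\<lambda>y. Complex (q y) y) ` {hgt (Suc n) .. Im z}"
  define S2 where "S2 = {w. Re w = q (hgt (Suc n)) \<and> Im w \<le> hgt (Suc n)}"
  have "continuous_on {hgt (Suc n) .. Im z} (\<lambda>y. Complex (q y) y)"
    unfolding q_def eg_def by (intro continuous_intros)
  then have c1: "connected S1" unfolding S1_def by (rule connected_continuous_image) simp
  have "S2 = {w. Re w \<le> q (hgt (Suc n))} \<inter> {w. q (hgt (Suc n)) \<le> Re w} \<inter> {w. Im w \<le> hgt (Suc n)}"
    unfolding S2_def by auto
  moreover have "convex \<dots>"
    using convex_halfspace_Re_ge[of "q (hgt (Suc n))"] convex_halfspace_Re_le[of "q (hgt (Suc n))"]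
      convex_halfspace_Im_le[of "hgt (Suc n)"] by (intro convex_Int) simp_all
  ultimately have c2: "connected S2" by (simp add: convex_connected)
  have "Complex (q (hgt (Suc n))) (hgt (Suc n)) \<in> S1 \<inter> S2"
    using y(1) by (auto simp: S1_def S2_def)
  then have c: "connected (S1 \<union> S2)" using c1 c2 by (intro connected_Un) blast+
  have zS: "z \<in> S1" using y(1) t(3) unfolding S1_def q_def by (auto simp: complex_eq_iff intro!: image_eqI[of _ _ "Im z"])
  have sub1: "S1 \<subseteq> - D"
  proof
    fix w assume "w \<in> S1"
    then obtain v where v: "w = Complex (q v) v" "hgt (Suc n) \<le> v" "v \<le> Im z" by (auto simp: S1_def)
    have vn: "v < hgt n" using v(3) y(2) by simp
    have "eg n k v < eg n (k + 1) v" using gap(1,2) v(2) vn by (intro eg_mono) auto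
    then show "w \<in> - D" using gap_not_strip[OF v(2) vn gap(1-3), of "q v"] strict D v(1) by (simp add: q_def)
  qed
  have "S2 \<subseteq> - D"
  proof
    fix w assume "w \<in> S2"
    then have w: "Re w = q (hgt (Suc n))" "Im w \<le> hgt (Suc n)" by (auto simp: S2_def)
    have X: "X (Suc n) k = br (Suc n) (blk (Suc n) k)" by (subst g(1)) (rule X_blast, simp)
    have X': "X (Suc n) (k + 1) = bl (Suc n) (blk (Suc n) k + 1)" by (subst g(2)) (rule X_bfirst, simp)
    have "X (Suc n) k < X (Suc n) (k + 1)" using gap(1,2) by (intro X_mono) auto
    then have lo: "br (Suc n) (blk (Suc n) k) < Re w" and hi: "Re w < bl (Suc n) (blk (Suc n) k + 1)"
      unfolding w q_def eg_bot X[symmetric] X'[symmetric] using strict by blast+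
    have "\<not> on_strip (Re w) (Im w)"
    proof
      assume "on_strip (Re w) (Im w)"
      then obtain j where j: "j < M ^ Suc n" "bl (Suc n) j \<le> Re w" "Re w \<le> br (Suc n) j"
        using on_strip_block[OF _ w(2)] by auto
      have b1: "blk (Suc n) k < M ^ Suc n" using gap by (intro blk_less) auto
      show False
      proof (cases "j \<le> blk (Suc n) k")
        case True
        then show False using block_order_le[OF True b1] j lo by linarith
      next
        case False
        then have "bl (Suc n) (blk (Suc n) k + 1) \<le> bl (Suc n) j" using j by (intro block_order_le) auto
        then show False using j hi by linarith
      qed
    qed
    then show "w \<in> - D" using D by simp
  qed
  then have "S1 \<union> S2 \<subseteq> f" using components_maximal[OF f(1) c] sub1 zS f(2) by blast
  moreover have "- 2 \<le> hgt (Suc n)" using hgt_pos[of "Suc n"] by linarith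
  then have "Complex (q (hgt (Suc n))) (- 2) \<in> S2" by (simp add: S2_def)
  moreover have "Complex (q (hgt (Suc n))) (- 2) \<in> far_set" by (simp add: far_set_def)
  moreover have "far_set \<subseteq> - D" using D on_strip_bounded unfolding far_set_def by fastforce
  ultimately show ?thesis using components_maximal[OF f(1) connected_far_set] by blast
qed

text \<open>Points outside the cells belong to the outer face: they see infinity sideways or through
  a gap. A face to which the fan rule applies is therefore inside one cell, and its diagonals join
  corners of that cell.\<close>

lemma half_edge_cases:
  assumes "e \<in> half_edges d M"
  shows "e \<in> strip_edges d M \<or> (\<exists>n k. proper n k \<and> e \<subseteq> cell n k)"
proof (cases "e \<in> strip_edges d M")
  case False
  let ?D = "drawing (pos d M) (strip_edges d M)"
  obtain f w x where e: "e = {w, x}" and f: "f \<in> fan_faces (pos d M) V (strip_edges d M)"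
    and wx: "w \<in> boundary_verts (pos d M) V f" "x \<in> boundary_verts (pos d M) V f"
    using assms False unfolding half_edges_def fan_triangulate_def fan_apex_def by blast
  have comp: "f \<in> components (- ?D)" and fin: "finite (boundary_verts (pos d M) V f)"
    using f unfolding fan_faces_def faces_def by auto
  have bounded: "0 \<le> Re z \<and> Re z \<le> 1 \<and> \<bar>Im z\<bar> \<le> 1" if "z \<in> ?D" for z
    using on_strip_bounded[of "Re z" "Im z"] that unfolding drawing_strip by auto
  have nfar: "\<not> far_set \<subseteq> f"
  proof
    assume far: "far_set \<subseteq> f"
    have "infinite {n. pos d M (n, B ^ n) \<in> frontier f}"
    proof (rule far_face_infinite[OF comp far])
      fix z assume "z \<in> ?D"
      then have "on_strip (Re z) (Im z)" unfolding drawing_strip .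
      moreover from this have "\<bar>Im z\<bar> = Im z" using on_strip_bounded by force
      ultimately show "\<not> off (Re z) \<bar>Im z\<bar>" by (simp add: off_def)
    qed (simp add: drawing_strip)
    moreover have "inj (\<lambda>n. (n, B ^ n))" by (rule injI) simp
    ultimately have "infinite ((\<lambda>n. (n, B ^ n)) ` {n. pos d M (n, B ^ n) \<in> frontier f})"
      using finite_imageD inj_on_subset by blast
    moreover have "(\<lambda>n. (n, B ^ n)) ` {n. pos d M (n, B ^ n) \<in> frontier f} \<subseteq> boundary_verts (pos d M) V f"
      using M_ge by (auto simp: boundary_verts_def mem_V)
    ultimately show False using fin finite_subset by blast
  qed
  have "pos d M w \<in> closure f" using wx(1) frontier_def unfolding boundary_verts_def by blast
  moreover have "open {z. 0 < Im z}" by (rule open_halfspace_Im_gt)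
  moreover have "pos d M w \<in> {z. 0 < Im z}" by (cases w) (simp add: pos_eq)
  ultimately obtain z where z: "z \<in> f" "0 < Im z" using open_Int_closure_eq_empty by blast
  have nz: "\<not> on_strip (Re z) (Im z)"
    using z(1) in_components_subset[OF comp] unfolding drawing_strip[symmetric] by blast
  have "\<exists>n k. proper n k \<and> in_cell n k (Re z) (Im z)"
  proof (rule ccontr)
    assume nc: "\<not> ?thesis"
    have ray: "far_set \<subseteq> f" if "(\<forall>x\<ge>Re z. \<not> on_strip x (Im z)) \<or> (\<forall>x\<le>Re z. \<not> on_strip x (Im z))"
      using ray_in_face[OF comp z(1) bounded] that by (simp add: drawing_strip)
    have "far_set \<subseteq> f"
    proof (cases "1 \<le> Im z")
      case True
      then show ?thesis using ray on_strip_above[OF True] nz by force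
    next
      case False
      then obtain n where n: "hgt (Suc n) \<le> Im z" "Im z < hgt n" using strip_index z(2) by (metis not_le)
      from n nz show ?thesis
      proof (cases rule: locate)
        case left
        then show ?thesis using ray strip_range(1)[OF n] by fastforce
      next
        case right
        then show ?thesis using ray strip_range(2)[OF n] by fastforce
      next
        case (cell k)
        then show ?thesis using nc by blast
      next
        case (gap k)
        then show ?thesis using gap_far[OF comp z(1) drawing_strip n] by blast
      qed
    qed
    with nfar show False by simp
  qed
  then obtain n k where p: "proper n k" and c: "in_cell n k (Re z) (Im z)" by blast
  let ?R = "{z. in_cell n k (Re z) (1 * Im z)}"
  have "frontier ?R \<subseteq> ?D" using closed_cell_region(2)[OF p, of 1] by (auto simp: drawing_strip)
  then have "f \<subseteq> ?R" using component_in_region[OF comp _ z(1)] c by simp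
  then have cl: "closure f \<subseteq> {z. Complex (Re z) (1 * Im z) \<in> closed_cell n k}"
    using closure_mono closed_cell_region(1)[OF p, of 1] by (metis abs_one order_trans)
  have "v \<in> cell n k" if "v \<in> boundary_verts (pos d M) V f" for v
  proof -
    have "v \<in> V" "pos d M v \<in> closure f" using that frontier_def unfolding boundary_verts_def by blast+
    then show ?thesis using vertex_in_closed_cell[OF p] cl by (cases v) (auto simp: pos_eq)
  qed
  then show ?thesis using p e wx by blast
qed simp

lemma strip_half: "strip_edges d M \<subseteq> half_edges d M"
  by (simp add: half_edges_def fan_triangulate_def)

lemma half_hull:
  assumes "e \<in> half_edges d M" "z \<in> convex hull (pos d M ` e)"
  shows "0 < Im z \<and> (on_strip (Re z) (Im z) \<or> (\<exists>n k. proper n k \<and> in_cell n k (Re z) (Im z)))"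
proof -
  have "on_strip (Re z) (Im z) \<or> (\<exists>n k. proper n k \<and> in_cell n k (Re z) (Im z))"
    using half_edge_cases[OF assms(1)]
  proof (elim disjE exE conjE)
    assume "e \<in> strip_edges d M"
    then have "z \<in> drawing (pos d M) (strip_edges d M)" using assms(2) unfolding drawing_def by blast
    then show ?thesis unfolding drawing_strip by blast
  next
    fix n k assume p: "proper n k" "e \<subseteq> cell n k"
    have "pos d M ` e \<subseteq> closed_cell n k" using cell_verts_closed[OF p(1)] p(2) by blast
    then have "convex hull (pos d M ` e) \<subseteq> closed_cell n k" using convex_closed_cell by (rule hull_minimal)
    then show ?thesis using closed_cell_cases[OF p(1)] assms(2) p(1) by blast
  qed
  moreover have "0 < y" if "in_cell n k x y" for n k x y
    using that hgt_pos[of "Suc n"] unfolding in_cell_def by linarith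
  ultimately show ?thesis using on_strip_bounded by blast
qed

lemma G_pos_hull:
  "z \<in> convex hull (G_pos d M ` Pair s ` e) \<longleftrightarrow>
    (case s of Upper \<Rightarrow> z | Lower \<Rightarrow> cnj z) \<in> convex hull (pos d M ` e)"
proof (cases s)
  case Upper
  then show ?thesis by (simp add: G_pos_def image_image)
next
  case Lower
  then have "G_pos d M ` Pair s ` e = cnj ` pos d M ` e" by (simp add: G_pos_def image_image)
  then show ?thesis using convex_hull_cnj Lower by simp
qed

lemma vertical_hull:
  "z \<in> convex hull (G_pos d M ` {(Upper, (n, i)), (Lower, (n, i))}) \<longleftrightarrow> Re z = X n i \<and> \<bar>Im z\<bar> \<le> hgt n"
proof -
  have hull: "convex hull (G_pos d M ` {(Upper, (n, i)), (Lower, (n, i))}) =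
      closed_segment (Complex (X n i) (hgt n)) (Complex (X n i) (- hgt n))"
    by (simp add: G_pos_def pos_eq complex_cnj flip: segment_convex_hull)
  have e: "Complex ((1 - t) * X n i + t * X n i) ((1 - t) * hgt n + t * - hgt n) =
      Complex (X n i) (hgt n - t * (2 * hgt n))" for t by (simp add: algebra_simps)
  show ?thesis
  proof
    assume "z \<in> convex hull (G_pos d M ` {(Upper, (n, i)), (Lower, (n, i))})"
    then obtain t where t: "0 \<le> t" "t \<le> 1" "z = Complex (X n i) (hgt n - t * (2 * hgt n))"
      unfolding hull closed_segment_complex e by blast
    define u where "u = t * (2 * hgt n)"
    have c: "0 \<le> 2 * hgt n" using hgt_pos[of n] by linarith
    have "0 \<le> u" "u \<le> 2 * hgt n"
      unfolding u_def using mult_nonneg_nonneg[OF t(1) c] mult_right_mono[OF t(2) c] by simp_all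
    then show "Re z = X n i \<and> \<bar>Im z\<bar> \<le> hgt n"
      unfolding t(3) complex.sel u_def[symmetric] by (simp add: abs_le_iff)
  next
    assume *: "Re z = X n i \<and> \<bar>Im z\<bar> \<le> hgt n"
    define t where "t = (hgt n - Im z) / (2 * hgt n)"
    have "0 \<le> t" "t \<le> 1" "t * (2 * hgt n) = hgt n - Im z"
      using * hgt_pos[of n] unfolding t_def by (auto simp: abs_le_iff)
    then have "0 \<le> t" "t \<le> 1" "z = Complex (X n i) (hgt n - t * (2 * hgt n))"
      using * by (simp_all add: complex_eq_iff)
    then show "z \<in> convex hull (G_pos d M ` {(Upper, (n, i)), (Lower, (n, i))})"
      unfolding hull closed_segment_complex e by blast
  qed
qed

lemma vertical_edges_eq: "vertical_edges d M =
  {{(Upper, (n, i)), (Lower, (n, i))} | n i b. 1 \<le> n \<and> b + 1 < M ^ n \<and> (i = bfirst n b \<or> i = blast n b)}"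
proof (intro set_eqI iffI)
  fix e assume "e \<in> vertical_edges d M"
  then obtain n j v where *: "e = {(Upper, v), (Lower, v)}" "1 \<le> n" "1 \<le> j" "j \<le> M ^ n - 1"
    "v = block_first d M n j \<or> v = block_last d M n j" unfolding vertical_edges_def by blast
  obtain b where b: "j = b + 1" using *(3) by (metis add.commute le_Suc_ex)
  have "b + 1 < M ^ n" using *(4) b by (metis M_pos Suc_eq_plus1 diff_less le_less_trans less_numeral_extra(1) zero_less_power)
  moreover have "v = (n, bfirst n b) \<or> v = (n, blast n b)"
    using *(5) unfolding b block_first_def block_last_def bfirst_def blast_def by simp
  ultimately show "e \<in> {{(Upper, (n, i)), (Lower, (n, i))} | n i b. 1 \<le> n \<and> b + 1 < M ^ n \<and> (i = bfirst n b \<or> i = blast n b)}"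
    using *(1,2) by blast
next
  fix e assume "e \<in> {{(Upper, (n, i)), (Lower, (n, i))} | n i b. 1 \<le> n \<and> b + 1 < M ^ n \<and> (i = bfirst n b \<or> i = blast n b)}"
  then obtain n i b where *: "e = {(Upper, (n, i)), (Lower, (n, i))}" "1 \<le> n" "b + 1 < M ^ n" "i = bfirst n b \<or> i = blast n b"
    by blast
  have "(n, i) = block_first d M n (b + 1) \<or> (n, i) = block_last d M n (b + 1)"
    using *(4) unfolding block_first_def block_last_def bfirst_def blast_def by simp
  moreover have "1 \<le> b + 1" "b + 1 \<le> M ^ n - 1" using *(3) by linarith+
  ultimately show "e \<in> vertical_edges d M" unfolding vertical_edges_def using *(1,2) by blast
qed

text \<open>Brackets the drawing: it contains the strips and vertical segments of both halves and
  avoids \<open>off\<close>. The diagonals lie in between. The lower bound supplies the frontiers of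
  cells and slots, the upper bound the free rays.\<close>

lemma drawing_G0:
  defines "D \<equiv> drawing (G_pos d M) (G0_edges d M)"
  shows "on_strip (Re z) \<bar>Im z\<bar> \<or> on_vert (Re z) \<bar>Im z\<bar> \<Longrightarrow> z \<in> D"
    and "z \<in> D \<Longrightarrow> \<not> off (Re z) \<bar>Im z\<bar>"
proof -
  show "z \<in> D" if "on_strip (Re z) \<bar>Im z\<bar> \<or> on_vert (Re z) \<bar>Im z\<bar>" using that
  proof
    assume s: "on_strip (Re z) \<bar>Im z\<bar>"
    define \<sigma> where "\<sigma> = (if 0 \<le> Im z then Upper else Lower)"
    define w where "w = (case \<sigma> of Upper \<Rightarrow> z | Lower \<Rightarrow> cnj z)"
    have "on_strip (Re w) (Im w)" using s unfolding w_def \<sigma>_def by (cases "0 \<le> Im z") auto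
    then obtain e where e: "e \<in> strip_edges d M" "w \<in> convex hull (pos d M ` e)"
      unfolding drawing_strip[symmetric] drawing_def by blast
    then have "z \<in> convex hull (G_pos d M ` Pair \<sigma> ` e)" unfolding G_pos_hull w_def by simp
    moreover have "Pair \<sigma> ` e \<in> G0_edges d M" unfolding G0_edges_def using strip_half e(1) by blast
    ultimately show "z \<in> D" unfolding D_def drawing_def by blast
  next
    assume "on_vert (Re z) \<bar>Im z\<bar>"
    then obtain n b where v: "1 \<le> n" "b + 1 < M ^ n" "\<bar>Im z\<bar> \<le> hgt n" "Re z = bl n b \<or> Re z = br n b"
      unfolding on_vert_def by blast
    then obtain i where i: "i = bfirst n b \<or> i = blast n b" "Re z = X n i"
      using X_bfirst[OF v(1)] X_blast[OF v(1)] by metis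
    have "{(Upper, (n, i)), (Lower, (n, i))} \<in> G0_edges d M"
      unfolding G0_edges_def vertical_edges_eq using v(1,2) i(1) by blast
    moreover have "z \<in> convex hull (G_pos d M ` {(Upper, (n, i)), (Lower, (n, i))})"
      unfolding vertical_hull using v(3) i(2) by simp
    ultimately show "z \<in> D" unfolding D_def drawing_def by blast
  qed
  assume "z \<in> D"
  then obtain e where e: "e \<in> G0_edges d M" "z \<in> convex hull (G_pos d M ` e)"
    unfolding D_def drawing_def by blast
  from e(1) consider s e' where "e = Pair s ` e'" "e' \<in> half_edges d M" | "e \<in> vertical_edges d M"
    unfolding G0_edges_def by blast
  then show "\<not> off (Re z) \<bar>Im z\<bar>"
  proof cases
    case 1
    define w where "w = (case s of Upper \<Rightarrow> z | Lower \<Rightarrow> cnj z)"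
    have "w \<in> convex hull (pos d M ` e')" using e(2) unfolding 1(1) G_pos_hull w_def .
    note h = half_hull[OF 1(2) this]
    then have "Re w = Re z" "Im w = \<bar>Im z\<bar>" unfolding w_def by (cases s; simp)+
    then show ?thesis using h unfolding off_def by auto
  next
    case 2
    then obtain n i b where *: "e = {(Upper, (n, i)), (Lower, (n, i))}" "1 \<le> n" "b + 1 < M ^ n" "i = bfirst n b \<or> i = blast n b"
      unfolding vertical_edges_eq by blast
    have "Re z = X n i \<and> \<bar>Im z\<bar> \<le> hgt n" using e(2) unfolding *(1) vertical_hull .
    then have "on_vert (Re z) \<bar>Im z\<bar>" unfolding on_vert_def using * X_bfirst[OF *(2)] X_blast[OF *(2)] by metis
    then show ?thesis unfolding off_def by blast
  qed
qed

lemma G0_bounded: "z \<in> drawing (G_pos d M) (G0_edges d M) \<Longrightarrow> 0 \<le> Re z \<and> Re z \<le> 1 \<and> \<bar>Im z\<bar> \<le> 1"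
proof -
  assume "z \<in> drawing (G_pos d M) (G0_edges d M)"
  then have n: "\<not> off (Re z) \<bar>Im z\<bar>" by (rule drawing_G0(2))
  have "\<not> \<bar>Im z\<bar> > 1" using n above_off[of "\<bar>Im z\<bar>" "Re z"] on_strip_bounded by force
  moreover have "0 \<le> Re z \<and> Re z \<le> 1"
  proof (rule ccontr)
    assume out: "\<not> (0 \<le> Re z \<and> Re z \<le> 1)"
    have 1: "\<not> on_strip (Re z) y" for y using on_strip_bounded out by blast
    have 2: "\<not> on_vert (Re z) y" for y
    proof
      assume "on_vert (Re z) y"
      then obtain m b where m: "1 \<le> m" "b + 1 < M ^ m" "Re z = bl m b \<or> Re z = br m b"
        unfolding on_vert_def by blast
      have "bl m b \<le> Re z" "Re z \<le> br m b" using m(3) wd_pos[of m] by (elim disjE; linarith)+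
      then obtain j where "j < M ^ 0" "bl 0 j \<le> Re z" "Re z \<le> br 0 j" using block_in[of 0 m b "Re z"] m by auto
      then show False using out by (simp add: wd_0)
    qed
    have 3: "\<not> in_cell n k (Re z) y" if "proper n k" for n k y
    proof
      assume c: "in_cell n k (Re z) y"
      have "(Suc n, k) \<in> V" "(Suc n, k + 1) \<in> V" using proper_V[OF that] by (auto simp: cell_def)
      then have "on_strip (eg n k y) y" "on_strip (eg n (k + 1) y) y"
        using c by (auto intro!: on_strip_edge simp: in_cell_def)
      then show False using c out on_strip_bounded unfolding in_cell_def by (meson le_less_trans less_imp_le order_trans)
    qed
    show False using n 1 2 3 unfolding off_def by blast
  qed
  ultimately show ?thesis by simp
qed

lemma G_face:
  assumes f: "f \<in> fan_faces (G_pos d M) (G_verts d M) (G0_edges d M)"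
  obtains n k where "\<And>s v. (s, v) \<in> boundary_verts (G_pos d M) (G_verts d M) f \<Longrightarrow> v \<in> near n k"
proof -
  let ?D = "drawing (G_pos d M) (G0_edges d M)" and ?bv = "boundary_verts (G_pos d M) (G_verts d M) f"
  have comp: "f \<in> components (- ?D)" and fin: "finite ?bv" and card: "4 \<le> card ?bv"
    using f unfolding fan_faces_def faces_def by auto
  have abs_pos: "Re (G_pos d M (s, (m, i))) = X m i" "\<bar>Im (G_pos d M (s, (m, i)))\<bar> = hgt m"
    "Im (G_pos d M (s, (m, i))) \<noteq> 0" for s m i
  proof -
    have h: "hgt m \<noteq> 0" "\<bar>hgt m\<bar> = hgt m" using hgt_pos[of m] by linarith+
    show "Re (G_pos d M (s, (m, i))) = X m i" by (cases s) (simp_all add: G_pos_def pos_eq)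
    show "\<bar>Im (G_pos d M (s, (m, i)))\<bar> = hgt m" by (cases s) (simp_all add: G_pos_def pos_eq h)
    show "Im (G_pos d M (s, (m, i))) \<noteq> 0" by (cases s) (simp_all add: G_pos_def pos_eq h)
  qed
  have nfar: "\<not> far_set \<subseteq> f"
  proof
    assume far: "far_set \<subseteq> f"
    have "infinite {n. pos d M (n, B ^ n) \<in> frontier f}"
    proof (rule far_face_infinite[OF comp far])
      fix z assume s: "on_strip (Re z) (Im z)"
      then have "\<bar>Im z\<bar> = Im z" using on_strip_bounded by force
      then show "z \<in> ?D" using drawing_G0(1) s by simp
    qed (rule drawing_G0(2))
    moreover have "inj (\<lambda>n. (Upper, (n, B ^ n)))" by (rule injI) simp
    ultimately have "infinite ((\<lambda>n. (Upper, (n, B ^ n))) ` {n. pos d M (n, B ^ n) \<in> frontier f})"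
      using finite_imageD inj_on_subset by blast
    moreover have "(\<lambda>n. (Upper, (n, B ^ n))) ` {n. pos d M (n, B ^ n) \<in> frontier f} \<subseteq> ?bv"
      using M_ge by (auto simp: boundary_verts_def G_verts_def mem_V G_pos_def)
    ultimately show False using fin finite_subset by blast
  qed
  obtain s0 m0 i0 where v0: "(s0, (m0, i0)) \<in> ?bv" using card
    by (metis card.empty ex_in_conv not_numeral_le_zero surj_pair)
  have "G_pos d M (s0, (m0, i0)) \<in> closure f" using v0 frontier_def unfolding boundary_verts_def by blast
  \<comment> \<open>All vertices are off the real axis, so a face with a boundary vertex has a point
    off the axis, to which \<open>classify\<close> applies after reflection.\<close>
  moreover have "open {z. Im z \<noteq> 0}" by (intro open_Collect_neq continuous_intros)
  moreover have "G_pos d M (s0, (m0, i0)) \<in> {z. Im z \<noteq> 0}" using abs_pos(3) by simp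
  ultimately obtain z where z: "z \<in> f" "Im z \<noteq> 0" using open_Int_closure_eq_empty by blast
  have zD: "z \<notin> ?D" using z(1) in_components_subset[OF comp] by blast
  have cl: "v \<in> tree_verts d M \<and> G_pos d M (s, v) \<in> closure R" if "f \<subseteq> R" "(s, v) \<in> ?bv" for R s v
    using that closure_mono[OF that(1)] frontier_def unfolding boundary_verts_def G_verts_def by blast
  have "\<not> on_strip (Re z) \<bar>Im z\<bar>" "\<not> on_vert (Re z) \<bar>Im z\<bar>" using zD drawing_G0(1) by blast+
  then consider n k where "proper n k" "in_cell n k (Re z) \<bar>Im z\<bar>" | "in_slot (Re z) \<bar>Im z\<bar>" | "free_ray (Re z) \<bar>Im z\<bar>"
    using classify[of "\<bar>Im z\<bar>" "Re z"] z(2) by auto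
  then show thesis
  proof cases
    case (1 n k)
    define \<sigma> where "\<sigma> = sgn (Im z)"
    have \<sigma>: "\<bar>\<sigma>\<bar> = 1" "\<sigma> * Im z = \<bar>Im z\<bar>" using z(2) unfolding \<sigma>_def by (auto simp: sgn_real_def)
    have abs\<sigma>: "\<sigma> * y = \<bar>y\<bar>" if "0 < \<sigma> * y" for y
      using that \<sigma>(1) by (metis abs_mult abs_of_pos mult_1)
    let ?R = "{z. in_cell n k (Re z) (\<sigma> * Im z)}"
    have "frontier ?R \<subseteq> ?D"
    proof
      fix w assume "w \<in> frontier ?R"
      then have s: "on_strip (Re w) (\<sigma> * Im w)" using closed_cell_region(2)[OF 1(1) \<sigma>(1)] by blast
      then have "\<sigma> * Im w = \<bar>Im w\<bar>" using abs\<sigma> on_strip_bounded by blast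
      then show "w \<in> ?D" using drawing_G0(1) s by simp
    qed
    then have fR: "f \<subseteq> ?R" using component_in_region[OF comp _ z(1)] 1(2) \<sigma>(2) by simp
    have "v \<in> near n k" if bv: "(s, v) \<in> ?bv" for s v
    proof -
      obtain m i where v: "v = (m, i)" by (cases v)
      have V: "(m, i) \<in> V" and c: "Complex (X m i) (\<sigma> * Im (G_pos d M (s, (m, i)))) \<in> closed_cell n k"
        using cl[OF fR bv] closed_cell_region(1)[OF 1(1) \<sigma>(1)] abs_pos unfolding v by auto
      have "0 < \<sigma> * Im (G_pos d M (s, (m, i)))" using c unfolding closed_cell_def by (intro less_le_trans[OF hgt_pos[of "Suc n"]]) simp
      then have "\<sigma> * Im (G_pos d M (s, (m, i))) = hgt m" by (rule trans[OF abs\<sigma> abs_pos(2)])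
      then have "pos d M (m, i) \<in> closed_cell n k" using c by (simp add: pos_eq)
      then show ?thesis using vertex_in_closed_cell[OF 1(1) V] unfolding v cell_def near_def by blast
    qed
    then show thesis by (rule that)
  next
    case 2
    then obtain n k A A' where sl: "slot n k A A'" and zs: "\<bar>Im z\<bar> < hgt n" "A \<bar>Im z\<bar> < Re z" "Re z < A' \<bar>Im z\<bar>"
      unfolding in_slot_def by blast
    let ?R = "{z. - 1 < \<bar>Im z\<bar> \<and> \<bar>Im z\<bar> < hgt n \<and> A \<bar>Im z\<bar> < Re z \<and> Re z < A' \<bar>Im z\<bar>}"
    have cont: "continuous_on UNIV A" "continuous_on UNIV A'" "continuous_on UNIV (\<lambda>z. \<bar>Im z\<bar>)"
      using slot_continuous[OF sl] by (auto intro!: continuous_intros)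
    note rc = region_closure[OF cont, of "- 1" "hgt n"]
    have "frontier ?R \<subseteq> ?D"
    proof
      fix w assume "w \<in> frontier ?R"
      then have w: "\<bar>Im w\<bar> \<le> hgt n" "A \<bar>Im w\<bar> \<le> Re w" "Re w \<le> A' \<bar>Im w\<bar>" "w \<notin> ?R" using rc(2) by blast+
      have "- 1 < \<bar>Im w\<bar>" by simp
      then consider "\<bar>Im w\<bar> = hgt n" | "Re w = A \<bar>Im w\<bar>" | "Re w = A' \<bar>Im w\<bar>" using w by force
      then have "on_strip (Re w) \<bar>Im w\<bar> \<or> on_vert (Re w) \<bar>Im w\<bar>"
      proof cases
        case 1
        then show ?thesis using slot_top[OF sl] w(2,3) by metis
      qed (use slot_sides[OF sl w(1)] in simp_all)
      then show "w \<in> ?D" by (rule drawing_G0(1))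
    qed
    then have fR: "f \<subseteq> ?R" using component_in_region[OF comp _ z(1)] zs by simp
    have "v \<in> near n k" if bv: "(s, v) \<in> ?bv" for s v
    proof -
      obtain m i where v: "v = (m, i)" by (cases v)
      have V: "(m, i) \<in> V" and c: "hgt m \<le> hgt n" "A (hgt m) \<le> X m i" "X m i \<le> A' (hgt m)"
        using cl[OF fR bv] rc(1) abs_pos unfolding v by auto
      then show ?thesis using slot_vertices[OF sl V] unfolding v hgt_le_iff by blast
    qed
    then show thesis by (rule that)
  next
    case 3
    have "(\<forall>x\<ge>Re z. Complex x (Im z) \<notin> ?D) \<or> (\<forall>x\<le>Re z. Complex x (Im z) \<notin> ?D)"
      using 3 drawing_G0(2)[of "Complex x (Im z)" for x] unfolding free_ray_def by auto
    then have "far_set \<subseteq> f" using ray_in_face[OF comp z(1) G0_bounded] by blast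
    with nfar show thesis by simp
  qed
qed

text \<open>After forgetting the copy, an edge of \<open>G\<close> collapses or joins two vertices
  of one set \<open>near n k\<close>. This bounds the degrees of the projected graph in
  \<open>card_near_nbrs\<close>.\<close>

theorem G_edge_near:
  assumes "{(s, x), (t, y)} \<in> G_edges d M"
  shows "x \<in> V" "y \<in> V" "x = y \<or> (\<exists>n k. x \<in> near n k \<and> y \<in> near n k)"
proof -
  have "\<exists>x' y'. ({x', y'} = {x, y} \<and> x' \<in> V \<and> y' \<in> V \<and> (x' = y' \<or> (\<exists>n k. x' \<in> near n k \<and> y' \<in> near n k)))"
  proof (cases "{(s, x), (t, y)} \<in> G0_edges d M")
    case True
    then consider s' e where "{(s, x), (t, y)} = Pair s' ` e" "e \<in> half_edges d M" | "{(s, x), (t, y)} \<in> vertical_edges d M"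
      unfolding G0_edges_def by blast
    then show ?thesis
    proof cases
      case 1
      have "snd ` {(s, x), (t, y)} = snd ` Pair s' ` e" using 1(1) by simp
      then have e: "e = {x, y}" by (simp add: image_image)
      from half_edge_cases[OF 1(2)] show ?thesis
      proof (elim disjE exE conjE)
        assume st: "e \<in> strip_edges d M"
        then have "x \<in> V \<and> y \<in> V" unfolding e by (rule strip_edge_V)
        moreover from st have "\<exists>n k. e \<subseteq> near n k"
          by (cases rule: strip_edge_cases) (auto simp: near_def)
        ultimately show ?thesis unfolding e by blast
      next
        fix n k assume p: "proper n k" and sub: "e \<subseteq> cell n k"
        have xy: "x \<in> cell n k" "y \<in> cell n k" using sub unfolding e by simp_all
        then have "x \<in> V" "y \<in> V" using proper_V[OF p] by blast+
        moreover have "x \<in> near n k" "y \<in> near n k" using xy unfolding cell_def near_def by blast+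
        ultimately show ?thesis by blast
      qed
    next
      case 2
      then obtain n i b where *: "{(s, x), (t, y)} = {(Upper, (n, i)), (Lower, (n, i))}" "b + 1 < M ^ n"
        "i = bfirst n b \<or> i = blast n b" unfolding vertical_edges_eq by blast
      have "snd ` {(s, x), (t, y)} = snd ` {(Upper, (n, i)), (Lower, (n, i))}" using *(1) by simp
      then have "{x, y} = {(n, i), (n, i)}" by simp
      moreover have "(n, i) \<in> V" using *(2,3) bfirst_le[of b n] blast_le[of b n] by (auto simp: mem_V)
      ultimately show ?thesis by metis
    qed
  next
    case False
    then obtain f w u where e: "{(s, x), (t, y)} = {w, u}"
      and f: "f \<in> fan_faces (G_pos d M) (G_verts d M) (G0_edges d M)"
      and wu: "w \<in> boundary_verts (G_pos d M) (G_verts d M) f" "u \<in> boundary_verts (G_pos d M) (G_verts d M) f"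
      using assms unfolding G_edges_def fan_triangulate_def fan_apex_def by blast
    have "snd ` {(s, x), (t, y)} = snd ` {w, u}" using e by simp
    then have xy: "{snd w, snd u} = {x, y}" by simp
    obtain n k where nk: "\<And>s v. (s, v) \<in> boundary_verts (G_pos d M) (G_verts d M) f \<Longrightarrow> v \<in> near n k"
      using G_face[OF f] by blast
    have "snd w \<in> V" "snd u \<in> V" using wu unfolding boundary_verts_def G_verts_def by auto
    moreover have "snd w \<in> near n k" "snd u \<in> near n k" using nk wu by (metis surj_pair snd_conv)+
    ultimately show ?thesis using xy by blast
  qed
  then obtain x' y' where *: "{x', y'} = {x, y}" "x' \<in> V" "y' \<in> V" "x' = y' \<or> (\<exists>n k. x' \<in> near n k \<and> y' \<in> near n k)"
    by blast
  from *(1) have "x' = x \<and> y' = y \<or> x' = y \<and> y' = x" by (simp add: doubleton_eq_iff)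
  with *(2-4) show "x \<in> V" "y \<in> V" "x = y \<or> (\<exists>n k. x \<in> near n k \<and> y \<in> near n k)" by blast+
qed

lemma G_edge_strip: "{x, y} \<in> strip_edges d M \<Longrightarrow> {(s, x), (s, y)} \<in> G_edges d M"
proof -
  assume "{x, y} \<in> strip_edges d M"
  then have "Pair s ` {x, y} \<in> G0_edges d M" unfolding G0_edges_def using strip_half by blast
  then show ?thesis unfolding G_edges_def fan_triangulate_def by simp
qed

lemma G_edge_vertical:
  assumes "1 \<le> n" "b + 1 < M ^ n"
  shows "{(Upper, (n, bfirst n b)), (Lower, (n, bfirst n b))} \<in> G_edges d M"
proof -
  have "{(Upper, (n, bfirst n b)), (Lower, (n, bfirst n b))} \<in> G0_edges d M"
    unfolding G0_edges_def vertical_edges_eq using assms by blast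
  then show ?thesis unfolding G_edges_def fan_triangulate_def by simp
qed

end

section \<open>Vertices linked to the other half\<close>

definition site_prob :: "'v set \<Rightarrow> real \<Rightarrow> (('v \<Rightarrow> bool) \<Rightarrow> bool) \<Rightarrow> real" where
  "site_prob W p P = measure (site_measure W p) {\<omega> \<in> space (site_measure W p). P \<omega>}"

lemma site_event:
  assumes "local_event W K P"
  shows "{\<omega> \<in> space (site_measure W p). P \<omega>} \<in> sets (site_measure W p)"
proof -
  have "Measurable.pred (site_measure W p) P"
    unfolding pred_site_measure by (rule local_event_pred[OF assms])
  then show ?thesis by (rule predE)
qed

lemma site_prob_bounds: "0 \<le> site_prob W p P" "site_prob W p P \<le> 1"
  unfolding site_prob_def using prob_space.prob_le_1[OF prob_space_site_measure] by auto

lemma site_prob_not: "local_event W K P \<Longrightarrow> site_prob W p (\<lambda>\<omega>. \<not> P \<omega>) = 1 - site_prob W p P"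
  unfolding site_prob_def by (rule prob_space.prob_neg[OF prob_space_site_measure site_event])

lemma site_prob_mono:
  assumes "local_event W K Q" "\<And>\<omega>. P \<omega> \<Longrightarrow> Q \<omega>"
  shows "site_prob W p P \<le> site_prob W p Q"
proof -
  interpret prob_space "site_measure W p" by (rule prob_space_site_measure)
  show ?thesis unfolding site_prob_def
    by (rule finite_measure_mono[OF _ site_event[OF assms(1)]]) (use assms(2) in blast)
qed

lemma site_prob_ball:
  assumes "finite I" "\<And>i. i \<in> I \<Longrightarrow> local_event W (K i) (P i)"
    "\<And>i. i \<in> I \<Longrightarrow> K i \<subseteq> W" "disjoint_family_on K I"
  shows "site_prob W p (\<lambda>\<omega>. \<forall>i\<in>I. P i \<omega>) = (\<Prod>i\<in>I. site_prob W p (P i))"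
  unfolding site_prob_def by (rule prob_local_events[OF assms])

lemma site_prob_conj:
  assumes "local_event W K P" "local_event W L Q" "K \<subseteq> W" "L \<subseteq> W" "K \<inter> L = {}"
  shows "site_prob W p (\<lambda>\<omega>. P \<omega> \<and> Q \<omega>) = site_prob W p P * site_prob W p Q"
proof -
  have "site_prob W p (\<lambda>\<omega>. \<forall>i\<in>UNIV. (if i then P else Q) \<omega>) =
      (\<Prod>i\<in>UNIV. site_prob W p (if i then P else Q))"
    by (rule site_prob_ball[where K = "\<lambda>i. if i then K else L"])
       (use assms in \<open>auto simp: disjoint_family_on_def\<close>)
  moreover have "(\<lambda>\<omega>. \<forall>i\<in>UNIV. (if i then P else Q) \<omega>) = (\<lambda>\<omega>. P \<omega> \<and> Q \<omega>)"
    by (simp add: fun_eq_iff all_bool_eq conj_commute)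
  ultimately show ?thesis by (simp only: UNIV_bool) (simp add: mult.commute)
qed

lemma site_prob_Un:
  assumes "finite I" "\<And>i. i \<in> I \<Longrightarrow> local_event W (K i) (P i)"
  shows "site_prob W p (\<lambda>\<omega>. \<exists>i\<in>I. P i \<omega>) \<le> (\<Sum>i\<in>I. site_prob W p (P i))"
proof -
  interpret prob_space "site_measure W p" by (rule prob_space_site_measure)
  have "{\<omega> \<in> space (site_measure W p). \<exists>i\<in>I. P i \<omega>} = (\<Union>i\<in>I. {\<omega> \<in> space (site_measure W p). P i \<omega>})"
    by auto
  then show ?thesis unfolding site_prob_def
    using finite_measure_subadditive_finite[OF assms(1), of "\<lambda>i. {\<omega> \<in> space (site_measure W p). P i \<omega>}"]
      site_event[OF assms(2)] by (metis (no_types, lifting) image_subset_iff)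
qed

lemma site_prob_decreasing:
  assumes "\<And>n. local_event W K (P n)" "\<And>n \<omega>. P (Suc n) \<omega> \<Longrightarrow> P n \<omega>" "\<And>n. a \<le> site_prob W p (P n)"
  shows "a \<le> site_prob W p (\<lambda>\<omega>. \<forall>n::nat. P n \<omega>)"
proof -
  interpret prob_space "site_measure W p" by (rule prob_space_site_measure)
  let ?A = "\<lambda>n. {\<omega> \<in> space (site_measure W p). P n \<omega>}"
  have "decseq ?A" using assms(2) by (auto simp: decseq_Suc_iff)
  moreover have "range ?A \<subseteq> sets (site_measure W p)" using site_event[OF assms(1)] by blast
  ultimately have "(\<lambda>n. prob (?A n)) \<longlonglongrightarrow> prob (\<Inter>n. ?A n)" by (intro finite_Lim_measure_decseq)
  then have "a \<le> prob (\<Inter>n. ?A n)"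
    using assms(3) unfolding site_prob_def by (intro LIMSEQ_le_const) auto
  moreover have "(\<Inter>n. ?A n) = {\<omega> \<in> space (site_measure W p). \<forall>n. P n \<omega>}" by auto
  ultimately show ?thesis unfolding site_prob_def by simp
qed

text \<open>From \<open>(1 - a) ^ m * (1 + a) ^ m \<le> 1\<close> and Bernoulli's inequality for the
  second factor. It bounds from below the chance that one of \<open>m\<close> independent trials
  succeeds.\<close>

lemma survival_bound:
  assumes "0 \<le> a" "a \<le> (1::real)"
  shows "real m * a / (1 + real m * a) \<le> 1 - (1 - a) ^ m"
proof -
  have "(1 - a) ^ m * (1 + real m * a) \<le> (1 - a) ^ m * (1 + a) ^ m"
    using assms Bernoulli_inequality[of a m] by (intro mult_left_mono) (auto simp: mult.commute)
  also have "\<dots> = (1 - a * a) ^ m" by (simp add: algebra_simps flip: power_mult_distrib)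
  also have "\<dots> \<le> 1" using assms by (intro power_le_one) (auto simp: mult_le_one)
  finally have "(1 - a) ^ m * (1 + real m * a) \<le> 1" .
  moreover have "0 < 1 + real m * a" using assms by (simp add: add_pos_nonneg)
  ultimately show ?thesis by (simp add: field_simps)
qed

lemma UNIV_side: "UNIV = {Upper, Lower}" using side.exhaust by blast

context strip_tree
begin

abbreviation GV :: "(side \<times> vertex) set" where "GV \<equiv> G_verts d M"

lemma GV_eq: "GV = UNIV \<times> V" by (simp add: G_verts_def)

section \<open>Subtrees and open paths towards the leaves\<close>

definition sub :: "vertex \<Rightarrow> vertex set" where
  "sub x = {(fst x + r, k) | r k. 1 \<le> k \<and> (pidx ^^ r) k = snd x}"

lemma sub_self: "x \<in> V \<Longrightarrow> x \<in> sub x"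
  by (cases x) (auto simp: sub_def mem_V intro!: exI[of _ 0])

lemma pidx_funpow_pos: "1 \<le> k \<Longrightarrow> 1 \<le> (pidx ^^ r) k"
  by (cases r) simp_all

lemma sub_V: "x \<in> V \<Longrightarrow> sub x \<subseteq> V"
proof
  fix y assume x: "x \<in> V" and "y \<in> sub x"
  then obtain r k where y: "y = (fst x + r, k)" "1 \<le> k" "(pidx ^^ r) k = snd x" by (auto simp: sub_def)
  have "k \<le> (pidx ^^ r) k * B ^ r" for k
  proof (induction r arbitrary: k)
    case (Suc r)
    have k: "k \<le> pidx k * B" if "1 \<le> k" using pidx_eq_iff[OF that pidx_pos(1)] by blast
    have "pidx k \<le> (pidx ^^ r) (pidx k) * B ^ r" by (rule Suc.IH)
    then have "pidx k * B \<le> (pidx ^^ r) (pidx k) * B ^ r * B" by (rule mult_le_mono1)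
    also have "\<dots> = (pidx ^^ Suc r) k * B ^ Suc r"
      by (simp only: funpow_Suc_right o_apply power_Suc2 mult.assoc)
    finally have "pidx k * B \<le> (pidx ^^ Suc r) k * B ^ Suc r" .
    then show ?case using k by (cases "1 \<le> k") (linarith, simp)
  qed simp
  then have "k \<le> snd x * B ^ r" using y(3) by metis
  also have "\<dots> \<le> B ^ fst x * B ^ r" using x by (cases x) (simp add: mem_V)
  finally show "y \<in> V" using y by (simp add: mem_V power_add)
qed

lemma children_sub: "y \<in> children x \<Longrightarrow> sub y \<subseteq> sub x"
proof
  fix z assume y: "y \<in> children x" and "z \<in> sub y"
  then obtain r k where z: "z = (fst y + r, k)" "1 \<le> k" "(pidx ^^ r) k = snd y" by (auto simp: sub_def)
  have "(pidx ^^ Suc r) k = snd x" "fst y + r = fst x + Suc r"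
    using y z(3) by (auto simp: children_def)
  then show "z \<in> sub x" using z unfolding sub_def by blast
qed

lemma sub_common:
  assumes "z \<in> sub x" "z \<in> sub y" "fst x \<le> fst y"
  shows "y \<in> sub x"
proof -
  obtain r k where r: "z = (fst x + r, k)" "1 \<le> k" "(pidx ^^ r) k = snd x" using assms(1) by (auto simp: sub_def)
  obtain q where q: "fst x + r = fst y + q" "(pidx ^^ q) k = snd y" using assms(2) r(1) by (auto simp: sub_def)
  obtain t where t: "fst y = fst x + t" using assms(3) le_Suc_ex by blast
  then have "r = t + q" using q(1) by simp
  then have "(pidx ^^ t) (snd y) = snd x" using r(3) q(2) by (simp add: funpow_add)
  moreover have "1 \<le> snd y" using pidx_funpow_pos[OF r(2), of q] q(2) by simp
  ultimately show ?thesis using t unfolding sub_def by (cases y) auto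
qed

lemma sub_parent:
  assumes "y \<in> sub x" "y \<in> children x'" "y \<noteq> x"
  shows "x' \<in> sub x"
proof -
  obtain r where r: "fst y = fst x + r" "1 \<le> snd y" "(pidx ^^ r) (snd y) = snd x" using assms(1) by (auto simp: sub_def)
  have "r \<noteq> 0" using r assms(3) by (metis add_0_right funpow_0 prod_eqI)
  then obtain q where q: "r = Suc q" by (cases r) auto
  have x': "fst y = Suc (fst x')" "pidx (snd y) = snd x'" using assms(2) by (auto simp: children_def)
  have "(pidx ^^ q) (snd x') = snd x" using r(3) x'(2) unfolding q by (simp add: funpow_Suc_right del: funpow.simps)
  moreover have "1 \<le> snd x'" "fst x' = fst x + q" using x' r(1) q pidx_pos(1)[of "snd y"] by auto
  ultimately show ?thesis unfolding sub_def by (cases x') auto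
qed

lemma sub_level: "y \<in> sub x \<Longrightarrow> fst x \<le> fst y" by (auto simp: sub_def)

lemma sub_antisym: "y \<in> sub x \<Longrightarrow> fst y \<le> fst x \<Longrightarrow> y = x"
proof -
  assume "y \<in> sub x" and le: "fst y \<le> fst x"
  then obtain r k where r: "y = (fst x + r, k)" "(pidx ^^ r) k = snd x" by (auto simp: sub_def)
  then have "r = 0" using le by simp
  then show "y = x" using r by (simp add: prod_eq_iff)
qed

lemma children_disjoint: "x \<noteq> x' \<Longrightarrow> children x \<inter> children x' = {}"
  by (auto simp: children_def prod_eq_iff)

lemma siblings_disjoint: "y \<in> children x \<Longrightarrow> y' \<in> children x \<Longrightarrow> y \<noteq> y' \<Longrightarrow> sub y \<inter> sub y' = {}"
proof (rule ccontr)
  assume *: "y \<in> children x" "y' \<in> children x" "y \<noteq> y'" "sub y \<inter> sub y' \<noteq> {}"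
  then obtain z where z: "z \<in> sub y" "z \<in> sub y'" by blast
  have l: "fst y = fst y'" using * by (auto simp: children_def)
  have "y' \<in> sub y" using sub_common[OF z] l by simp
  then show False using sub_antisym l *(3) by (metis order_refl)
qed

lemma not_in_child_sub: "y \<in> children x \<Longrightarrow> x \<notin> sub y"
  using sub_level[of x y] by (auto simp: children_def)

text \<open>\<open>J\<close> lists the copies that have to be open along the whole path: one copy
  for survival of the tree, both for links between the copies.\<close>

primrec down :: "side set \<Rightarrow> (vertex \<Rightarrow> bool) \<Rightarrow> nat \<Rightarrow> (side \<times> vertex \<Rightarrow> bool) \<Rightarrow> vertex \<Rightarrow> bool" where
  "down J P 0 \<omega> y = ((\<forall>s\<in>J. \<omega> (s, y)) \<and> P y)"
| "down J P (Suc k) \<omega> y = ((\<forall>s\<in>J. \<omega> (s, y)) \<and> (\<exists>c\<in>children y. down J P k \<omega> c))"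

lemma card_side: "card (UNIV :: side set) = 2"
  unfolding UNIV_side by simp

lemma finite_side: "finite (J :: side set)"
proof -
  have "finite (UNIV :: side set)" unfolding UNIV_side by simp
  then show ?thesis using finite_subset[OF subset_UNIV] by blast
qed

lemma countable_side: "countable (J :: side set)"
  by (rule countable_finite[OF finite_side])

lemma local_open:
  assumes "y \<in> V"
  shows "local_event GV (J \<times> {y}) (\<lambda>\<omega>. \<forall>s\<in>J. \<omega> (s, y))"
proof (rule local_event_ball[OF countable_side])
  fix s assume "s \<in> J"
  then show "local_event GV (J \<times> {y}) (\<lambda>\<omega>. \<omega> (s, y))"
    using assms by (intro local_event_mono[OF local_event_site[of "(s, y)"]]) (auto simp: GV_eq)
qed

lemma local_down: "y \<in> V \<Longrightarrow> local_event GV (J \<times> sub y) (\<lambda>\<omega>. down J P k \<omega> y)"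
proof (induction k arbitrary: y)
  case 0
  then show ?case unfolding down.simps using sub_self[OF 0]
    by (intro local_event_conj local_event_const local_event_mono[OF local_open]) auto
next
  case (Suc k)
  have "local_event GV (J \<times> sub y) (\<lambda>\<omega>. \<exists>c\<in>children y. down J P k \<omega> c)"
  proof (rule local_event_bex)
    show "countable (children y)" using finite_children countable_finite by blast
    fix c assume c: "c \<in> children y"
    show "local_event GV (J \<times> sub y) (\<lambda>\<omega>. down J P k \<omega> c)"
      by (rule local_event_mono[OF Suc.IH[OF children_V[OF Suc.prems c]]]) (use children_sub[OF c] in blast)
  qed
  then show ?case unfolding down.simps using sub_self[OF Suc.prems] Suc.prems
    by (intro local_event_conj local_event_mono[OF local_open]) auto
qed

lemma prob_open:
  assumes "y \<in> V" "0 \<le> p" "p \<le> 1"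
  shows "site_prob GV p (\<lambda>\<omega>. \<forall>s\<in>J. \<omega> (s, y)) = p ^ card J"
proof -
  have "site_prob GV p (\<lambda>\<omega>. \<forall>s\<in>J. \<omega> (s, y)) = (\<Prod>s\<in>J. site_prob GV p (\<lambda>\<omega>. \<omega> (s, y)))"
  proof (rule site_prob_ball[where K = "\<lambda>s. {(s, y)}"])
    fix s
    show "local_event GV {(s, y)} (\<lambda>\<omega>. \<omega> (s, y))" by (rule local_event_site) (simp add: GV_eq assms)
  qed (use assms in \<open>auto simp: GV_eq disjoint_family_on_def finite_side\<close>)
  also have "\<dots> = (\<Prod>s\<in>J. p)"
    by (intro prod.cong refl) (use assms in \<open>auto simp: GV_eq site_prob_def intro!: prob_site_open(1)\<close>)
  finally show ?thesis by simp
qed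

text \<open>The subtrees of the children are disjoint and do not contain \<open>y\<close>, so the
  branching recursion holds. \<open>C\<close> may be a proper subset of the children: a single one
  in \<open>first_run\<close>, all but the last one in \<open>linked_below_prob\<close>.\<close>

lemma down_lower:
  assumes y: "y \<in> V" and p: "0 \<le> p" "p \<le> 1" and C: "C \<subseteq> children y" "m \<le> card C"
    and a: "0 \<le> a" "a \<le> 1" "\<And>c. c \<in> C \<Longrightarrow> a \<le> site_prob GV p (\<lambda>\<omega>. down J P k \<omega> c)"
  shows "p ^ card J * (1 - (1 - a) ^ m) \<le> site_prob GV p (\<lambda>\<omega>. down J P (Suc k) \<omega> y)"
proof -
  have CV: "c \<in> V" if "c \<in> C" for c using that C(1) children_V[OF y] by blast
  have fin: "finite C" using C(1) finite_children finite_subset by blast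
  have loc: "local_event GV (J \<times> sub c) (\<lambda>\<omega>. down J P k \<omega> c)" if "c \<in> C" for c by (rule local_down[OF CV[OF that]])
  have locs: "local_event GV (J \<times> (\<Union>c\<in>C. sub c)) (\<lambda>\<omega>. \<exists>c\<in>C. down J P k \<omega> c)"
    by (rule local_event_bex[OF countable_finite[OF fin]], rule local_event_mono[OF loc]) auto
  have "1 - (\<Prod>c\<in>C. 1 - site_prob GV p (\<lambda>\<omega>. down J P k \<omega> c)) =
      1 - (\<Prod>c\<in>C. site_prob GV p (\<lambda>\<omega>. \<not> down J P k \<omega> c))"
    using site_prob_not[OF loc] by simp
  also have "\<dots> = 1 - site_prob GV p (\<lambda>\<omega>. \<forall>c\<in>C. \<not> down J P k \<omega> c)"
  proof (subst site_prob_ball[where K = "\<lambda>c. J \<times> sub c"])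
    show "local_event GV (J \<times> sub c) (\<lambda>\<omega>. \<not> down J P k \<omega> c)" if "c \<in> C" for c
      by (rule local_event_not[OF loc[OF that]])
    show "J \<times> sub c \<subseteq> GV" if "c \<in> C" for c using sub_V[OF CV[OF that]] by (auto simp: GV_eq)
    show "disjoint_family_on (\<lambda>c. J \<times> sub c) C"
      using siblings_disjoint C(1) unfolding disjoint_family_on_def by blast
  qed (use fin in auto)
  also have "\<dots> = site_prob GV p (\<lambda>\<omega>. \<exists>c\<in>C. down J P k \<omega> c)"
    using site_prob_not[OF locs] by (simp add: Bex_def Ball_def)
  finally have e: "site_prob GV p (\<lambda>\<omega>. \<exists>c\<in>C. down J P k \<omega> c) =
      1 - (\<Prod>c\<in>C. 1 - site_prob GV p (\<lambda>\<omega>. down J P k \<omega> c))" by simp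
  have "(\<Prod>c\<in>C. 1 - site_prob GV p (\<lambda>\<omega>. down J P k \<omega> c)) \<le> (\<Prod>c\<in>C. 1 - a)"
    using a(3) site_prob_bounds(2) by (intro prod_mono) auto
  also have "\<dots> \<le> (1 - a) ^ m" using a C(2) by (simp add: power_decreasing)
  finally have "1 - (1 - a) ^ m \<le> site_prob GV p (\<lambda>\<omega>. \<exists>c\<in>C. down J P k \<omega> c)" unfolding e by simp
  then have "p ^ card J * (1 - (1 - a) ^ m) \<le>
      site_prob GV p (\<lambda>\<omega>. \<forall>s\<in>J. \<omega> (s, y)) * site_prob GV p (\<lambda>\<omega>. \<exists>c\<in>C. down J P k \<omega> c)"
    unfolding prob_open[OF y p] using p by (intro mult_left_mono) auto
  also have "\<dots> = site_prob GV p (\<lambda>\<omega>. (\<forall>s\<in>J. \<omega> (s, y)) \<and> (\<exists>c\<in>C. down J P k \<omega> c))"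
  proof (rule site_prob_conj[OF local_open[OF y] locs, symmetric])
    show "J \<times> {y} \<subseteq> GV" using y by (auto simp: GV_eq)
    show "J \<times> (\<Union>c\<in>C. sub c) \<subseteq> GV" using sub_V CV by (auto simp: GV_eq)
    show "J \<times> {y} \<inter> J \<times> (\<Union>c\<in>C. sub c) = {}" using not_in_child_sub C(1) by blast
  qed
  also have "\<dots> \<le> site_prob GV p (\<lambda>\<omega>. down J P (Suc k) \<omega> y)"
    by (rule site_prob_mono[OF local_down[OF y]]) (use C(1) in auto)
  finally show ?thesis .
qed

lemma down_True_Suc: "down J (\<lambda>_. True) (Suc k) \<omega> y \<Longrightarrow> down J (\<lambda>_. True) k \<omega> y"
  by (induction k arbitrary: y) auto

text \<open>The bound \<open>q / 2\<close> reproduces itself: since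
  \<open>B * (q / 2) \<ge> 4\<close>, some child continues with probability at least
  \<open>1 / 2\<close>, and the vertex itself is open with probability \<open>q\<close>.\<close>

lemma upper_survival:
  assumes q: "0 \<le> q" "q \<le> 1" "8 \<le> q * real B" and y: "y \<in> V"
  shows "q / 2 \<le> site_prob GV q (\<lambda>\<omega>. \<forall>k. down {Upper} (\<lambda>_. True) k \<omega> y)"
proof (rule site_prob_decreasing[OF local_down[OF y] down_True_Suc])
  fix k
  show "q / 2 \<le> site_prob GV q (\<lambda>\<omega>. down {Upper} (\<lambda>_. True) k \<omega> y)" using y
  proof (induction k arbitrary: y)
    case 0
    then show ?case using prob_open[OF 0 q(1,2), of "{Upper}"] q by simp
  next
    case (Suc k)
    have "4 \<le> real B * (q / 2)" using q(3) by (simp add: mult.commute)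
    then have "1 / 2 \<le> real B * (q / 2) / (1 + real B * (q / 2))" by (simp add: field_simps)
    also have "\<dots> \<le> 1 - (1 - q / 2) ^ B" using q by (intro survival_bound) auto
    finally have "q * (1 / 2) \<le> q * (1 - (1 - q / 2) ^ B)" using q(1) by (rule mult_left_mono)
    also have "\<dots> = q ^ card {Upper} * (1 - (1 - q / 2) ^ B)" by simp
    also have "\<dots> \<le> site_prob GV q (\<lambda>\<omega>. down {Upper} (\<lambda>_. True) (Suc k) \<omega> y)"
      using q Suc card_children[OF Suc.prems] children_V[OF Suc.prems]
      by (intro down_lower[where C = "children y"]) auto
    finally show ?case by simp
  qed
qed

text \<open>Among the ends of vertical edges only the first vertices of blocks are used, because
  they can be reached by following first children.\<close>

definition vert_below :: "nat \<Rightarrow> vertex \<Rightarrow> bool" where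
  "vert_below N z \<longleftrightarrow> (\<exists>n b. z = (n, bfirst n b) \<and> 1 \<le> n \<and> b + 1 < M ^ n \<and> N \<le> n)"

text \<open>Below \<open>y\<close> the two copies are joined by doubly open tree paths and vertical edges at arbitrarily large depth.\<close>
definition linked :: "(side \<times> vertex \<Rightarrow> bool) \<Rightarrow> vertex \<Rightarrow> bool" where
  "linked \<omega> y \<longleftrightarrow> (\<forall>N. \<exists>k. down UNIV (vert_below N) k \<omega> y)"

text \<open>The condition concerns the children, not \<open>x\<close>, so it is independent of the
  states of both copies of \<open>x\<close>. A linked child is open in both copies, hence every open
  copy of a fertile \<open>x\<close> is joined to it.\<close>

definition fertile :: "(side \<times> vertex \<Rightarrow> bool) \<Rightarrow> vertex \<Rightarrow> bool" where
  "fertile \<omega> x \<longleftrightarrow> (\<exists>c\<in>children x. linked \<omega> c)"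

lemma local_linked_below: "y \<in> V \<Longrightarrow> local_event GV (UNIV \<times> sub y) (\<lambda>\<omega>. \<exists>k. down UNIV (vert_below N) k \<omega> y)"
  using local_event_bex[of "UNIV :: nat set", OF _ local_down[of y UNIV]] by simp

lemma local_linked: "y \<in> V \<Longrightarrow> local_event GV (UNIV \<times> sub y) (\<lambda>\<omega>. linked \<omega> y)"
  unfolding linked_def using local_event_ball[of "UNIV :: nat set", OF _ local_linked_below] by simp

lemma local_fertile:
  assumes "x \<in> V" shows "local_event GV (UNIV \<times> sub x) (\<lambda>\<omega>. fertile \<omega> x)"
  unfolding fertile_def
proof (rule local_event_bex)
  show "countable (children x)" using finite_children countable_finite by blast
  fix c assume c: "c \<in> children x"
  show "local_event GV (UNIV \<times> sub x) (\<lambda>\<omega>. linked \<omega> c)"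
    by (rule local_event_mono[OF local_linked[OF children_V[OF assms c]]]) (use children_sub[OF c] in blast)
qed

text \<open>\<open>(m + k, (i - 1) * B ^ k + 1)\<close> is reached by taking the first child
  \<open>k\<close> times; each of the \<open>Suc k\<close> vertices on the way is open in both
  copies with probability \<open>p ^ 2\<close>.\<close>

lemma first_run:
  assumes p: "0 \<le> p" "p \<le> 1"
  shows "(m, i) \<in> V \<Longrightarrow> vert_below N (m + k, (i - 1) * B ^ k + 1) \<Longrightarrow>
    (p ^ 2) ^ Suc k \<le> site_prob GV p (\<lambda>\<omega>. down UNIV (vert_below N) k \<omega> (m, i))"
proof (induction k arbitrary: m i)
  case 0
  then have "vert_below N (m, i)" by (auto simp: mem_V)
  then show ?case using prob_open[OF 0(1) p, of UNIV] by (simp add: UNIV_side power2_eq_square)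
next
  case (Suc k)
  let ?c = "(Suc m, (i - 1) * B + 1)"
  have i: "1 \<le> i" using Suc.prems(1) by (simp add: mem_V)
  have c: "?c \<in> children (m, i)" unfolding children_eq[OF i] using B_ge by (intro image_eqI[of _ _ 1]) auto
  have "vert_below N (Suc m + k, (((i - 1) * B + 1) - 1) * B ^ k + 1)"
    using Suc.prems(2) by (simp add: mult.assoc)
  then have IH: "(p ^ 2) ^ Suc k \<le> site_prob GV p (\<lambda>\<omega>. down UNIV (vert_below N) k \<omega> ?c)"
    by (rule Suc.IH[OF children_V[OF Suc.prems(1) c]])
  have "p ^ card (UNIV :: side set) * (1 - (1 - (p ^ 2) ^ Suc k) ^ 1) \<le>
      site_prob GV p (\<lambda>\<omega>. down UNIV (vert_below N) (Suc k) \<omega> (m, i))"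
  proof (rule down_lower[OF Suc.prems(1) p, of "{?c}"])
    show "(p ^ 2) ^ Suc k \<le> 1" using p by (intro power_le_one) auto
  qed (use c IH in auto)
  then show ?case by (simp add: card_side)
qed

end

text \<open>By \<open>p_run\<close> the growth of the tree over one level pays for a run of
  \<open>d - 1\<close> first children; by \<open>p_B\<close> infertility becomes as unlikely as two
  closed sites.\<close>

locale percolation = strip_tree +
  fixes p :: real
  assumes p_pos: "0 \<le> p" and p_less: "p < 1" and p_sq: "3 / 4 \<le> p ^ 2"
    and p_run: "2 \<le> (p ^ 2) ^ (d - 1) * (real B / 8)"
    and p_half: "2 * (1 - p) \<le> 1" and p_B: "2 * (1 / 2) ^ B \<le> (2 * (1 - p)) ^ 2"
begin

text \<open>Each level climbed multiplies the probability by at least \<open>B / 8\<close> until it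
  saturates at \<open>1 / 2\<close>. The last vertex of each level is left out, since at the bottom
  it leads to the last block, which has no vertical edges; children of the other vertices are never
  last.\<close>

lemma linked_climb:
  assumes "j \<le> m'"
    and start: "\<And>i. 1 \<le> i \<Longrightarrow> i < B ^ m' \<Longrightarrow> q \<le> site_prob GV p (\<lambda>\<omega>. down UNIV P k \<omega> (m', i))" and q: "0 \<le> q"
  shows "1 \<le> i \<Longrightarrow> i < B ^ (m' - j) \<Longrightarrow>
    min (1 / 2) (q * (real B / 8) ^ j) \<le> site_prob GV p (\<lambda>\<omega>. down UNIV P (k + j) \<omega> (m' - j, i))"
  using assms(1)
proof (induction j arbitrary: i)
  case 0
  then show ?case using start[of i] by simp
next
  case (Suc j)
  let ?y = "(m' - Suc j, i)"
  define a where "a = min (1 / 2) (q * (real B / 8) ^ j)"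
  have y: "?y \<in> V" using Suc.prems by (simp add: mem_V)
  have l: "Suc (m' - Suc j) = m' - j" using Suc.prems(3) by simp
  have ch: "a \<le> site_prob GV p (\<lambda>\<omega>. down UNIV P (k + j) \<omega> c)" if cc: "c \<in> children ?y" for c
  proof -
    obtain n where c: "c = (m' - j, n)" "1 \<le> n" "pidx n = i" using cc l by (auto simp: children_def)
    have "n \<le> i * B" using pidx_eq_iff[OF c(2) Suc.prems(1)] c(3) by blast
    also have "\<dots> < B ^ (m' - Suc j) * B" using Suc.prems(2) B_ge by (intro mult_strict_right_mono) auto
    also have "\<dots> = B ^ (m' - j)" using l by (metis power_Suc2)
    finally show ?thesis using Suc.IH[of n] c Suc.prems(3) unfolding a_def by simp
  qed
  have a: "0 \<le> a" "a \<le> 1" using q unfolding a_def by auto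
  have B: "8 \<le> real B" using B_ge by (metis of_nat_le_iff of_nat_numeral)
  \<comment> \<open>For \<open>3 \<le> B * a\<close> the product is at least \<open>9 / 16\<close>.
    Otherwise the denominator is below \<open>4\<close>, and the factor \<open>3 / 16\<close>
    exceeds \<open>1 / 8\<close>.\<close>
  have "min (1 / 2) (a * (real B / 8)) \<le> p ^ 2 * (real B * a / (1 + real B * a))"
  proof (cases "3 \<le> real B * a")
    case True
    then have "3 / 4 \<le> real B * a / (1 + real B * a)" by (simp add: field_simps)
    then have "3 / 4 * (3 / 4) \<le> p ^ 2 * (real B * a / (1 + real B * a))"
      using p_sq by (intro mult_mono) auto
    then show ?thesis by linarith
  next
    case False
    have n: "0 \<le> real B * a" using a by simp
    have "real B * a / 4 \<le> real B * a / (1 + real B * a)"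
      using False n by (intro divide_left_mono) auto
    then have "3 / 4 * (real B * a / 4) \<le> p ^ 2 * (real B * a / (1 + real B * a))"
      using p_sq n by (intro mult_mono) auto
    moreover have "a * (real B / 8) \<le> 3 / 4 * (real B * a / 4)" using n by (simp add: algebra_simps)
    ultimately show ?thesis by linarith
  qed
  also have "\<dots> \<le> p ^ card (UNIV :: side set) * (1 - (1 - a) ^ B)"
  proof -
    have "0 \<le> real B * a / (1 + real B * a)" using a by (intro divide_nonneg_nonneg) auto
    then show ?thesis unfolding card_side using survival_bound[OF a, of B] by (intro mult_left_mono) auto
  qed
  also have "\<dots> \<le> site_prob GV p (\<lambda>\<omega>. down UNIV P (Suc (k + j)) \<omega> ?y)"
    using p_pos p_less card_children[OF y] a ch by (intro down_lower[OF y, of p "children ?y"]) auto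
  finally have *: "min (1 / 2) (a * (real B / 8)) \<le> site_prob GV p (\<lambda>\<omega>. down UNIV P (k + Suc j) \<omega> ?y)"
    by simp
  have "min (1 / 2) (q * (real B / 8) ^ Suc j) \<le> min (1 / 2) (a * (real B / 8))"
  proof (cases "1 / 2 \<le> q * (real B / 8) ^ j")
    case True
    then show ?thesis using B unfolding a_def by simp
  next
    case False
    then show ?thesis unfolding a_def by (simp add: mult_ac)
  qed
  with * show ?case by linarith
qed

text \<open>At depth \<open>d * m'\<close> a block has \<open>B ^ ((d - 1) * m')\<close> vertices,
  exactly the number of descendants there of one vertex of depth \<open>m'\<close>. Following first
  children from depth \<open>m'\<close> therefore ends at the first vertex of a block. The cost of
  this run is regained on the climb from \<open>m'\<close> to \<open>m\<close>.\<close>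

lemma linked_level: "\<exists>k. \<forall>i. 1 \<le> i \<and> i < B ^ m \<longrightarrow>
    1 / 2 \<le> site_prob GV p (\<lambda>\<omega>. down UNIV (vert_below N) k \<omega> (m, i))"
proof -
  define r where "r = (p ^ 2) ^ (d - 1) * (real B / 8)"
  have B: "8 \<le> real B" using B_ge by (metis of_nat_le_iff of_nat_numeral)
  have "\<exists>t. real t > (real B / 8) ^ m" by (rule reals_Archimedean2)
  \<comment> \<open>\<open>t\<close> makes \<open>2 ^ m'\<close> exceed \<open>(B / 8) ^ m\<close>,
    the gain that is missing because the climb stops at depth \<open>m\<close> instead of the
    root.\<close>
  then obtain t where t: "(real B / 8) ^ m < real t" by blast
  define m' where "m' = m + N + t + 1"
  have m': "m \<le> m'" "N \<le> m'" "1 \<le> m'" "t \<le> m'" unfolding m'_def by auto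
  define k where "k = (d - 1) * m'"
  define q where "q = (p ^ 2) ^ Suc k"
  have dk: "m' + k = d * m'" using d_ge unfolding k_def by (cases d) auto
  have start: "q \<le> site_prob GV p (\<lambda>\<omega>. down UNIV (vert_below N) k \<omega> (m', i))"
    if i: "1 \<le> i" "i < B ^ m'" for i
    unfolding q_def
  proof (rule first_run)
    show "(m', i) \<in> V" using i by (simp add: mem_V)
    have "B ^ k = block_size d M (d * m')"
      unfolding block_size_def k_def by (simp add: power_mult[symmetric] mult_ac)
    then have "(m' + k, (i - 1) * B ^ k + 1) = (d * m', bfirst (d * m') (i - 1))"
      unfolding dk bfirst_def by simp
    moreover have "i - 1 + 1 < M ^ (d * m')" using i by (simp add: power_mult)
    moreover have "m' \<le> d * m'" using d_ge by simp
    ultimately show "vert_below N (m' + k, (i - 1) * B ^ k + 1)" unfolding vert_below_def using m' by fastforce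
  qed (use p_pos p_less in auto)
  have q0: "0 \<le> q" unfolding q_def by simp
  have "1 / 2 \<le> q * (real B / 8) ^ (m' - m)"
  proof -
    have "(real B / 8) ^ m \<le> real t" using t by simp
    also have "\<dots> \<le> real m'" using m' by simp
    also have "\<dots> \<le> 2 ^ m'" using less_exp[of m'] by (metis less_imp_le of_nat_le_iff of_nat_numeral of_nat_power)
    also have "\<dots> \<le> r ^ m'" using p_run unfolding r_def by (intro power_mono) auto
    finally have 1: "(real B / 8) ^ m \<le> r ^ m'" .
    have "q * (real B / 8) ^ (m' - m) * (real B / 8) ^ m = p ^ 2 * (p ^ 2) ^ k * (real B / 8) ^ m'"
      unfolding q_def using m'(1) by (simp flip: power_add add: mult.assoc)
    also have "(p ^ 2) ^ k = ((p ^ 2) ^ (d - 1)) ^ m'" unfolding k_def by (simp add: power_mult)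
    also have "p ^ 2 * ((p ^ 2) ^ (d - 1)) ^ m' * (real B / 8) ^ m' = p ^ 2 * r ^ m'"
      unfolding r_def by (simp only: power_mult_distrib mult.assoc)
    also have "\<dots> \<ge> 3 / 4 * (real B / 8) ^ m" using 1 p_sq B by (intro mult_mono) auto
    finally have "3 / 4 * (real B / 8) ^ m \<le> q * (real B / 8) ^ (m' - m) * (real B / 8) ^ m" .
    moreover have "0 < (real B / 8) ^ m" using B by simp
    ultimately have "3 / 4 \<le> q * (real B / 8) ^ (m' - m)" by (rule mult_right_le_imp_le)
    then show ?thesis by simp
  qed
  then have "1 / 2 \<le> site_prob GV p (\<lambda>\<omega>. down UNIV (vert_below N) (k + (m' - m)) \<omega> (m, i))"
    if "1 \<le> i" "i < B ^ m" for i
    using linked_climb[of "m' - m" m' q "vert_below N" k i, OF _ start q0] that m'(1) by simp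
  then show ?thesis by blast
qed

text \<open>The last vertex of a level is treated through its children other than the last one;
  there are at least 7 of them, each with probability at least \<open>1 / 2\<close>.\<close>

lemma linked_below_prob:
  assumes "y \<in> V" shows "1 / 2 \<le> site_prob GV p (\<lambda>\<omega>. \<exists>k. down UNIV (vert_below N) k \<omega> y)"
proof -
  obtain m i where y: "y = (m, i)" "1 \<le> i" "i \<le> B ^ m" using assms by (cases y) (auto simp: mem_V)
  have "\<exists>k. 1 / 2 \<le> site_prob GV p (\<lambda>\<omega>. down UNIV (vert_below N) k \<omega> y)"
  proof (cases "i < B ^ m")
    case True
    then show ?thesis using linked_level[of m N] y by blast
  next
    case False
    then have i: "i = B ^ m" using y by simp
    obtain k where k: "\<And>i. 1 \<le> i \<Longrightarrow> i < B ^ Suc m \<Longrightarrow>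
        1 / 2 \<le> site_prob GV p (\<lambda>\<omega>. down UNIV (vert_below N) k \<omega> (Suc m, i))"
      using linked_level[of "Suc m" N] by blast
    let ?C = "children y - {(Suc m, B ^ Suc m)}"
    have C: "1 / 2 \<le> site_prob GV p (\<lambda>\<omega>. down UNIV (vert_below N) k \<omega> c)" if cC: "c \<in> ?C" for c
    proof -
      obtain n where n: "c = (Suc m, n)" "1 \<le> n" "n \<noteq> B ^ Suc m" using cC y by (auto simp: children_def)
      moreover have "n \<le> B ^ Suc m" using children_V[OF assms, of c] cC n(1) by (auto simp: mem_V)
      ultimately show ?thesis using k[of n] by simp
    qed
    have "B - 1 \<le> card ?C"
      using card_children[OF assms] finite_children[of y] by (simp add: card_Diff_singleton_if)
    then have "7 \<le> card ?C" using B_ge by linarith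
    then have "p ^ card (UNIV :: side set) * (1 - (1 - 1 / 2) ^ 7) \<le>
        site_prob GV p (\<lambda>\<omega>. down UNIV (vert_below N) (Suc k) \<omega> y)"
      using p_pos p_less C by (intro down_lower[OF assms, of p ?C]) auto
    moreover have "3 / 4 * (127 / 128) \<le> p ^ 2 * (127 / 128)" using p_sq by (intro mult_right_mono) auto
    ultimately have "1 / 2 \<le> site_prob GV p (\<lambda>\<omega>. down UNIV (vert_below N) (Suc k) \<omega> y)"
      by (simp add: card_side power_divide)
    then show ?thesis by blast
  qed
  then obtain k where "1 / 2 \<le> site_prob GV p (\<lambda>\<omega>. down UNIV (vert_below N) k \<omega> y)" by blast
  also have "\<dots> \<le> site_prob GV p (\<lambda>\<omega>. \<exists>k. down UNIV (vert_below N) k \<omega> y)"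
    by (rule site_prob_mono[OF local_linked_below[OF assms]]) blast
  finally show ?thesis .
qed

lemma down_mono: "(\<And>z. P z \<Longrightarrow> Q z) \<Longrightarrow> down J P k \<omega> y \<Longrightarrow> down J Q k \<omega> y"
  by (induction k arbitrary: y) auto

lemma vert_below_mono: "N' \<le> N \<Longrightarrow> vert_below N z \<Longrightarrow> vert_below N' z"
  unfolding vert_below_def using order_trans by blast

lemma linked_prob: "y \<in> V \<Longrightarrow> 1 / 2 \<le> site_prob GV p (\<lambda>\<omega>. linked \<omega> y)"
  unfolding linked_def
proof (rule site_prob_decreasing[OF local_linked_below])
  fix n \<omega> assume "\<exists>k. down UNIV (vert_below (Suc n)) k \<omega> y"
  then show "\<exists>k. down UNIV (vert_below n) k \<omega> y"
    using down_mono[of "vert_below (Suc n)" "vert_below n"] vert_below_mono[of n "Suc n"] by (metis le_SucI order_refl)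
qed (use linked_below_prob in auto)

end

section \<open>Probability of chains\<close>

text \<open>Steps are pairs so that a walk can carry extra data: for chains, the second component is
  the bad vertex of the lower copy that a downward step relies on.\<close>

primrec walks :: "('a \<Rightarrow> ('a \<times> 'b) set) \<Rightarrow> nat \<Rightarrow> 'a \<Rightarrow> ('a \<times> 'b) list set" where
  "walks nx 0 v = {[]}"
| "walks nx (Suc L) v = (\<Union>zy\<in>nx v. Cons zy ` walks nx L (fst zy))"

primrec walk_weight :: "('a \<Rightarrow> 'a \<Rightarrow> real) \<Rightarrow> 'a \<Rightarrow> ('a \<times> 'b) list \<Rightarrow> real" where
  "walk_weight w v [] = 1"
| "walk_weight w v (zy # xs) = w v (fst zy) * walk_weight w (fst zy) xs"

lemma finite_walks: "(\<And>v. finite (nx v)) \<Longrightarrow> finite (walks nx L v)"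
  by (induction L arbitrary: v) auto

lemma walks_length: "xs \<in> walks nx L v \<Longrightarrow> length xs = L"
  by (induction L arbitrary: v xs) auto

text \<open>The usual path count: splitting off the first step gives one factor
  \<open>\<kappa>\<close> per step.\<close>

lemma sum_walk_weight:
  assumes fin: "\<And>v. finite (nx v)" and w: "\<And>v z. 0 \<le> w v z"
    and sum: "\<And>v. v \<in> S \<Longrightarrow> (\<Sum>zy\<in>nx v. w v (fst zy)) \<le> \<kappa>" and S: "\<And>v zy. v \<in> S \<Longrightarrow> zy \<in> nx v \<Longrightarrow> fst zy \<in> S"
    and \<kappa>: "0 \<le> \<kappa>"
  shows "v \<in> S \<Longrightarrow> (\<Sum>xs\<in>walks nx L v. walk_weight w v xs) \<le> \<kappa> ^ L"
proof (induction L arbitrary: v)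
  case (Suc L)
  have "(\<Sum>xs\<in>walks nx (Suc L) v. walk_weight w v xs) =
      (\<Sum>zy\<in>nx v. \<Sum>xs\<in>Cons zy ` walks nx L (fst zy). walk_weight w v xs)"
    unfolding walks.simps by (rule sum.UNION_disjoint) (use fin finite_walks[OF fin] in auto)
  also have "\<dots> = (\<Sum>zy\<in>nx v. w v (fst zy) * (\<Sum>xs\<in>walks nx L (fst zy). walk_weight w (fst zy) xs))"
    by (intro sum.cong refl, subst sum.reindex) (auto simp: sum_distrib_left)
  also have "\<dots> \<le> (\<Sum>zy\<in>nx v. w v (fst zy) * \<kappa> ^ L)"
    using Suc.IH S[OF Suc.prems] w by (intro sum_mono mult_left_mono) auto
  also have "\<dots> = (\<Sum>zy\<in>nx v. w v (fst zy)) * \<kappa> ^ L" by (simp add: sum_distrib_right)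
  also have "\<dots> \<le> \<kappa> * \<kappa> ^ L" using sum[OF Suc.prems] \<kappa> by (intro mult_right_mono) auto
  finally show ?case by simp
qed simp

lemma walk_weight_prod:
  "walk_weight w v xs = (\<Prod>t<length xs. w ((v # map fst xs) ! t) ((v # map fst xs) ! Suc t))"
proof (induction xs arbitrary: v)
  case (Cons a xs)
  show ?case unfolding walk_weight.simps length_Cons
    by (subst prod.lessThan_Suc_shift) (simp add: Cons.IH)
qed simp

lemma walks_step:
  "xs \<in> walks nx L v \<Longrightarrow> t < L \<Longrightarrow> xs ! t \<in> nx ((v # map fst xs) ! t)"
proof (induction L arbitrary: v xs t)
  case (Suc L)
  then obtain a ys where *: "xs = a # ys" "a \<in> nx v" "ys \<in> walks nx L (fst a)" by auto
  show ?case
  proof (cases t)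
    case (Suc t')
    then show ?thesis using Suc.IH[OF *(3), of t'] Suc.prems(2) *(1) by simp
  qed (use * in simp)
qed simp

lemma walks_of_path:
  assumes "\<And>t. t < L \<Longrightarrow> (f (Suc t), g t) \<in> nx (f t)"
  shows "map (\<lambda>t. (f (Suc t), g t)) [0..<L] \<in> walks nx L (f 0)"
  using assms
proof (induction L arbitrary: f g)
  case (Suc L)
  have "map (\<lambda>t. (f (Suc t), g t)) [0..<Suc L] =
      (f 1, g 0) # map (\<lambda>t. (f (Suc (Suc t)), g (Suc t))) [0..<L]"
    by (subst upt_conv_Cons) (simp_all add: map_Suc_upt[symmetric] del: upt_Suc)
  moreover have "map (\<lambda>t. (f (Suc (Suc t)), g (Suc t))) [0..<L] \<in> walks nx L (f (Suc 0))"
    using Suc.IH[of "\<lambda>t. f (Suc t)" "\<lambda>t. g (Suc t)"] Suc.prems by simp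
  moreover have "(f 1, g 0) \<in> nx (f 0)" using Suc.prems[of 0] by simp
  ultimately show ?case unfolding walks.simps by (metis (no_types, lifting) UN_I fst_conv imageI One_nat_def)
qed simp

lemma path_vertices: "f 0 # map fst (map (\<lambda>t. (f (Suc t), g t)) [0..<L]) = map f [0..<Suc L]"
  by (induction L) auto

context percolation
begin

section \<open>Joint probability of bad vertices\<close>

definition bad :: "side \<Rightarrow> (side \<times> vertex \<Rightarrow> bool) \<Rightarrow> vertex \<Rightarrow> bool" where
  "bad s \<omega> x \<longleftrightarrow> \<not> \<omega> (s, x) \<or> \<not> fertile \<omega> x"

lemma local_all: "local_event GV K P \<Longrightarrow> K \<subseteq> GV \<Longrightarrow> local_event GV GV P"
  by (rule local_event_mono)

lemma local_all_site: "x \<in> V \<Longrightarrow> local_event GV GV (\<lambda>\<omega>. \<omega> (s, x))"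
  by (rule local_all[OF local_event_site]) (auto simp: GV_eq)

lemma local_all_fertile: "x \<in> V \<Longrightarrow> local_event GV GV (\<lambda>\<omega>. fertile \<omega> x)"
proof (rule local_all[OF local_fertile])
  assume "x \<in> V"
  then show "UNIV \<times> sub x \<subseteq> GV" unfolding GV_eq using sub_V[of x] by blast
qed

lemma local_event_disj:
  "local_event W K P \<Longrightarrow> local_event W K Q \<Longrightarrow> local_event W K (\<lambda>\<omega>. P \<omega> \<or> Q \<omega>)"
  using local_event_not[OF local_event_conj[OF local_event_not local_event_not], of W K P Q] by simp

lemma local_all_bad: "x \<in> V \<Longrightarrow> local_event GV GV (\<lambda>\<omega>. bad s \<omega> x)"
  unfolding bad_def by (intro local_event_disj local_event_not local_all_site local_all_fertile)

text \<open>An infertile vertex has \<open>B\<close> unlinked children, but linkedness of a child is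
  independent of the other data only if its subtree avoids \<open>S\<close>. In total at most
  \<open>card S\<close> children are lost.\<close>

lemma free_children:
  assumes fin: "finite S" and SF: "SF \<subseteq> S" "S \<subseteq> V"
  defines "F \<equiv> {y. \<exists>x\<in>SF. y \<in> children x \<and> sub y \<inter> S = {}}"
  shows "finite F" "B * card SF \<le> card F + card S"
proof -
  have finSF: "finite SF" using fin SF(1) finite_subset by blast
  let ?C = "\<Union>x\<in>SF. children x"
  define N where "N = {y \<in> ?C. sub y \<inter> S \<noteq> {}}"
  have C: "?C = F \<union> N" "F \<inter> N = {}" unfolding F_def N_def by blast+
  have finC: "finite ?C" using finSF finite_children by blast
  have "F \<subseteq> ?C" using C(1) by blast
  then show finF: "finite F" using finC by (rule finite_subset)
  have finN: "finite N" unfolding N_def by (rule finite_subset[OF _ finC]) blast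
  have "card ?C = (\<Sum>x\<in>SF. card (children x))"
    by (rule card_UN_disjoint[OF finSF]) (use finite_children children_disjoint in blast)+
  also have "\<dots> = (\<Sum>x\<in>SF. B)" using SF card_children by (intro sum.cong) auto
  finally have "card ?C = B * card SF" by simp
  moreover have "card ?C = card F + card N"
    unfolding C(1) by (rule card_Un_disjoint[OF finF finN C(2)])
  ultimately have "B * card SF = card F + card N" by simp
  moreover have "card N \<le> card S"
  proof -
    have "\<exists>s. s \<in> sub y \<inter> S \<and> (\<forall>s'\<in>sub y \<inter> S. fst s \<le> fst s')" if "y \<in> N" for y
    proof -
      have "\<exists>s. s \<in> sub y \<inter> S" using that unfolding N_def by blast
      then show ?thesis using ex_has_least_nat[of "\<lambda>s. s \<in> sub y \<inter> S" _ fst] by blast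
    qed
    then obtain g where g: "\<And>y. y \<in> N \<Longrightarrow> g y \<in> sub y \<inter> S"
      "\<And>y s'. y \<in> N \<Longrightarrow> s' \<in> sub y \<inter> S \<Longrightarrow> fst (g y) \<le> fst s'" by metis
    text \<open>A topmost element \<open>g y\<close> of \<open>S\<close> below \<open>y\<close> determines \<open>y\<close>: the parent of \<open>y\<close> is the next element of \<open>S\<close> above it.\<close>
    have key: "y = y'" if y: "y \<in> N" "y' \<in> N" "g y = g y'" "fst y \<le> fst y'" for y y'
    proof (rule ccontr)
      assume ne: "y \<noteq> y'"
      have gy: "g y \<in> sub y" "g y \<in> sub y'" using g(1)[OF y(1)] g(1)[OF y(2)] y(3) by auto
      have "y' \<in> sub y" by (rule sub_common[OF gy y(4)])
      moreover obtain x' where x': "x' \<in> SF" "y' \<in> children x'" using y(2) unfolding N_def by blast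
      ultimately have "x' \<in> sub y" using sub_parent[of y' y x'] ne by simp
      then have "fst (g y) \<le> fst x'" using g(2)[OF y(1)] x'(1) SF(1) by blast
      moreover have "fst x' < fst y'" using x'(2) by (auto simp: children_def)
      moreover have "fst y' \<le> fst (g y)" using sub_level[OF gy(2)] .
      ultimately show False by simp
    qed
    have "inj_on g N"
    proof (rule inj_onI)
      fix y y' assume "y \<in> N" "y' \<in> N" "g y = g y'"
      then show "y = y'" using key[of y y'] key[of y' y] nat_le_linear[of "fst y" "fst y'"] by metis
    qed
    moreover have "g ` N \<subseteq> S" using g(1) by blast
    ultimately show ?thesis using card_inj_on_le[OF _ _ fin] by blast
  qed
  ultimately show "B * card SF \<le> card F + card S" by simp
qed

text \<open>Closed sites and unlinked vertices of \<open>F\<close> are independent, as the subtrees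
  of \<open>F\<close> are disjoint and avoid the given vertices. Children lost in
  \<open>free_children\<close> cost a factor \<open>2\<close> per vertex, hence the base
  \<open>2 * (1 - p)\<close>; by \<open>p_B\<close> each infertile vertex still weighs as much as
  two closed sites.\<close>

lemma joint_closed:
  assumes fin: "finite S1" "finite S2" "finite SF" and V: "S1 \<subseteq> V" "S2 \<subseteq> V" "SF \<subseteq> V"
  shows "site_prob GV p (\<lambda>\<omega>. (\<forall>x\<in>S1. \<not> \<omega> (Upper, x)) \<and> (\<forall>x\<in>S2. \<not> \<omega> (Lower, x)) \<and> (\<forall>x\<in>SF. \<not> fertile \<omega> x))
    \<le> (2 * (1 - p)) ^ (card S1 + card S2 + 2 * card SF)"
proof -
  let ?S = "S1 \<union> S2 \<union> SF"
  define F where "F = {y. \<exists>x\<in>SF. y \<in> children x \<and> sub y \<inter> ?S = {}}"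
  have finS: "finite ?S" using fin by simp
  note fc = free_children[OF finS, of SF, folded F_def]
  have F: "finite F" "B * card SF \<le> card F + card ?S" using fc V by auto
  define T where "T = {Upper} \<times> S1 \<union> {Lower} \<times> S2"
  have "card T = card ({Upper} \<times> S1) + card ({Lower} \<times> S2)"
    unfolding T_def by (rule card_Un_disjoint) (use fin in auto)
  then have T: "finite T" "card T = card S1 + card S2"
    unfolding T_def using fin by (simp_all add: card_cartesian_product_singleton)
  \<comment> \<open>The sum type indexes two kinds of independent events: a closed site on the left,
    an unlinked subtree on the right.\<close>
  define I where "I = (Inl ` T :: (side \<times> vertex + vertex) set) \<union> Inr ` F"
  define K where "K i = (case i of Inl v \<Rightarrow> {v} | Inr y \<Rightarrow> UNIV \<times> sub y)" for i :: "side \<times> vertex + vertex"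
  define P where "P i \<omega> = (case i of Inl v \<Rightarrow> \<not> \<omega> v | Inr y \<Rightarrow> \<not> linked \<omega> y)" for i :: "side \<times> vertex + vertex" and \<omega>
  have FV: "y \<in> V" if "y \<in> F" for y using that V(3) children_V unfolding F_def by blast
  have TG: "T \<subseteq> GV" unfolding T_def using V by (auto simp: GV_eq)
  have finI: "finite I" unfolding I_def using T F by simp
  have ev: "local_event GV (K i) (P i)" if "i \<in> I" for i
  proof (cases i)
    case (Inl v)
    then have "v \<in> GV" using that TG unfolding I_def by auto
    then show ?thesis unfolding Inl K_def P_def by (simp add: local_event_not local_event_site)
  next
    case (Inr y)
    then have "y \<in> V" using that FV unfolding I_def by auto
    then show ?thesis unfolding Inr K_def P_def by (simp add: local_event_not local_linked)
  qed
  have KG: "K i \<subseteq> GV" if "i \<in> I" for i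
  proof (cases i)
    case (Inl v)
    then show ?thesis using that TG unfolding I_def K_def by auto
  next
    case (Inr y)
    then have "y \<in> F" using that unfolding I_def by auto
    then have "sub y \<subseteq> V" using FV sub_V by blast
    then show ?thesis unfolding Inr K_def GV_eq by auto
  qed
  have subF: "sub y \<inter> sub y' = {}" if y: "y \<in> F" "y' \<in> F" "y \<noteq> y'" for y y'
  proof -
    have key: False if k: "y \<in> F" "y' \<in> F" "y \<noteq> y'" "z \<in> sub y" "z \<in> sub y'" "fst y \<le> fst y'" for y y' z
    proof -
      have "y' \<in> sub y" by (rule sub_common[OF k(4-6)])
      moreover obtain x' where x': "x' \<in> SF" "y' \<in> children x'" using k(2) unfolding F_def by blast
      ultimately have "x' \<in> sub y" using sub_parent[of y' y x'] k(3) by simp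
      then show False using k(1) x'(1) unfolding F_def by blast
    qed
    show ?thesis using key[of y y'] key[of y' y] y nat_le_linear[of "fst y" "fst y'"] by blast
  qed
  have subT: "v \<notin> UNIV \<times> sub y" if "v \<in> T" "y \<in> F" for v y
    using that unfolding T_def F_def by auto
  have dis: "disjoint_family_on K I"
    unfolding disjoint_family_on_def
  proof (intro ballI impI)
    fix i j assume "i \<in> I" "j \<in> I" "i \<noteq> j"
    then show "K i \<inter> K j = {}"
      using subF subT unfolding I_def K_def by (cases i; cases j) (auto, blast+)
  qed
  have "site_prob GV p (\<lambda>\<omega>. (\<forall>x\<in>S1. \<not> \<omega> (Upper, x)) \<and> (\<forall>x\<in>S2. \<not> \<omega> (Lower, x)) \<and> (\<forall>x\<in>SF. \<not> fertile \<omega> x))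
      \<le> site_prob GV p (\<lambda>\<omega>. \<forall>i\<in>I. P i \<omega>)"
  proof (rule site_prob_mono)
    show "local_event GV GV (\<lambda>\<omega>. \<forall>i\<in>I. P i \<omega>)"
      by (rule local_event_ball[OF countable_finite[OF finI]]) (rule local_event_mono[OF ev KG])
    fix \<omega> assume *: "(\<forall>x\<in>S1. \<not> \<omega> (Upper, x)) \<and> (\<forall>x\<in>S2. \<not> \<omega> (Lower, x)) \<and> (\<forall>x\<in>SF. \<not> fertile \<omega> x)"
    show "\<forall>i\<in>I. P i \<omega>"
      using * unfolding I_def P_def T_def F_def fertile_def by auto
  qed
  also have "\<dots> = (\<Prod>i\<in>I. site_prob GV p (P i))" by (rule site_prob_ball[OF finI ev KG dis])
  also have "\<dots> = (\<Prod>v\<in>T. site_prob GV p (P (Inl v))) * (\<Prod>y\<in>F. site_prob GV p (P (Inr y)))"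
    unfolding I_def using T F by (subst prod.union_disjoint) (auto simp: prod.reindex)
  also have "\<dots> \<le> (\<Prod>v\<in>T. 1 - p) * (\<Prod>y\<in>F. 1 / 2)"
  proof (intro mult_mono prod_mono conjI site_prob_bounds(1) prod_nonneg)
    fix v assume "v \<in> T"
    then have "v \<in> GV" using TG by blast
    then show "site_prob GV p (P (Inl v)) \<le> 1 - p"
      using prob_site_open(2)[of v GV p] p_pos p_less unfolding P_def site_prob_def by simp
  next
    fix y assume "y \<in> F"
    then have y: "y \<in> V" by (rule FV)
    show "site_prob GV p (P (Inr y)) \<le> 1 / 2"
      using linked_prob[OF y] site_prob_not[OF local_linked[OF y], of p] unfolding P_def by simp
  qed (use p_less in auto)
  also have "\<dots> = (1 - p) ^ (card S1 + card S2) * (1 / 2) ^ card F" using T by simp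
  also have "\<dots> \<le> (2 * (1 - p)) ^ (card S1 + card S2 + 2 * card SF)"
  proof -
    have "card ?S \<le> card S1 + card S2 + card SF"
      using card_Un_le[of "S1 \<union> S2" SF] card_Un_le[of S1 S2] by linarith
    then have le: "B * card SF \<le> card F + (card S1 + card S2 + card SF)" using F(2) by linarith
    have "(1 / 2) ^ card F * (1 / 2) ^ (card S1 + card S2 + card SF) \<le> ((1::real) / 2) ^ (B * card SF)"
      unfolding power_add[symmetric] by (rule power_decreasing[OF le]) auto
    then have "(1 / 2) ^ card F \<le> ((1::real) / 2) ^ (B * card SF) * 2 ^ (card S1 + card S2 + card SF)"
      by (simp add: power_one_over field_simps)
    also have "\<dots> = 2 ^ (card S1 + card S2) * (2 * (1 / 2) ^ B) ^ card SF"
      by (simp add: power_add power_mult power_mult_distrib)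
    also have "\<dots> \<le> 2 ^ (card S1 + card S2) * ((2 * (1 - p)) ^ 2) ^ card SF"
      using p_B by (intro mult_left_mono power_mono) auto
    finally have "(1 - p) ^ (card S1 + card S2) * (1 / 2) ^ card F \<le>
        (1 - p) ^ (card S1 + card S2) * (2 ^ (card S1 + card S2) * ((2 * (1 - p)) ^ 2) ^ card SF)"
      using p_less by (intro mult_left_mono) auto
    also have "\<dots> = (2 * (1 - p)) ^ (card S1 + card S2) * (2 * (1 - p)) ^ (2 * card SF)"
      unfolding power_mult_distrib[of 2 "1 - p" "card S1 + card S2"] power_mult by simp
    finally show ?thesis by (simp only: power_add)
  qed
  finally show ?thesis .
qed

text \<open>Union bound over the set \<open>SF\<close> of infertile vertices; the number of subsets
  turns the base \<open>2 * (1 - p)\<close> into \<open>4 * (1 - p)\<close>. A vertex may occur in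
  both \<open>R1\<close> and \<open>R2\<close>, so an infertile one has to weigh as much as two
  closed sites.\<close>

lemma bad_prob:
  assumes fin: "finite R1" "finite R2" and V: "R1 \<subseteq> V" "R2 \<subseteq> V"
  shows "site_prob GV p (\<lambda>\<omega>. (\<forall>x\<in>R1. bad Upper \<omega> x) \<and> (\<forall>x\<in>R2. bad Lower \<omega> x))
    \<le> (4 * (1 - p)) ^ (card R1 + card R2)"
proof -
  let ?E = "\<lambda>SF \<omega>. (\<forall>x\<in>R1 - SF. \<not> \<omega> (Upper, x)) \<and> (\<forall>x\<in>R2 - SF. \<not> \<omega> (Lower, x)) \<and> (\<forall>x\<in>SF. \<not> fertile \<omega> x)"
  have finP: "finite (Pow (R1 \<union> R2))" using fin by simp
  have cnt: "countable S" if "S \<subseteq> R1 \<union> R2" for S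
    using countable_finite finite_subset[OF that] fin by blast
  have loc: "local_event GV GV (?E SF)" if "SF \<in> Pow (R1 \<union> R2)" for SF
  proof (intro local_event_conj local_event_ball cnt local_event_not local_all_site local_all_fertile)
  qed (use that V in auto)
  have "site_prob GV p (\<lambda>\<omega>. (\<forall>x\<in>R1. bad Upper \<omega> x) \<and> (\<forall>x\<in>R2. bad Lower \<omega> x))
      \<le> site_prob GV p (\<lambda>\<omega>. \<exists>SF\<in>Pow (R1 \<union> R2). ?E SF \<omega>)"
  proof (rule site_prob_mono)
    show "local_event GV GV (\<lambda>\<omega>. \<exists>SF\<in>Pow (R1 \<union> R2). ?E SF \<omega>)"
      by (rule local_event_bex[OF countable_finite[OF finP] loc])
    fix \<omega> assume *: "(\<forall>x\<in>R1. bad Upper \<omega> x) \<and> (\<forall>x\<in>R2. bad Lower \<omega> x)"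
    show "\<exists>SF\<in>Pow (R1 \<union> R2). ?E SF \<omega>"
      by (rule bexI[of _ "{x \<in> R1 \<union> R2. \<not> fertile \<omega> x}"]) (use * in \<open>auto simp: bad_def\<close>)
  qed
  also have "\<dots> \<le> (\<Sum>SF\<in>Pow (R1 \<union> R2). site_prob GV p (?E SF))"
    by (rule site_prob_Un[OF finP loc])
  also have "\<dots> \<le> (\<Sum>SF\<in>Pow (R1 \<union> R2). (2 * (1 - p)) ^ (card R1 + card R2))"
  proof (rule sum_mono)
    fix SF assume SF: "SF \<in> Pow (R1 \<union> R2)"
    then have finSF: "finite SF" using fin finite_subset by blast
    have "site_prob GV p (?E SF) \<le> (2 * (1 - p)) ^ (card (R1 - SF) + card (R2 - SF) + 2 * card SF)"
      by (rule joint_closed) (use SF V fin finSF in auto)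
    also have "\<dots> \<le> (2 * (1 - p)) ^ (card R1 + card R2)"
    proof (rule power_decreasing)
      have "card R1 \<le> card (R1 - SF) + card SF" "card R2 \<le> card (R2 - SF) + card SF"
        using card_mono[of "R1 - SF \<union> SF" R1] card_mono[of "R2 - SF \<union> SF" R2] fin finSF
          card_Un_le[of "R1 - SF" SF] card_Un_le[of "R2 - SF" SF] by (force intro: order_trans)+
      then show "card R1 + card R2 \<le> card (R1 - SF) + card (R2 - SF) + 2 * card SF" by simp
    qed (use p_less p_half in auto)
    finally show "site_prob GV p (?E SF) \<le> (2 * (1 - p)) ^ (card R1 + card R2)" .
  qed
  also have "\<dots> = 2 ^ card (R1 \<union> R2) * (2 * (1 - p)) ^ (card R1 + card R2)"
    using fin by (simp add: card_Pow)
  also have "\<dots> \<le> 2 ^ (card R1 + card R2) * (2 * (1 - p)) ^ (card R1 + card R2)"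
    using card_Un_le[of R1 R2] p_less by (intro mult_right_mono power_increasing) auto
  also have "\<dots> = (4 * (1 - p)) ^ (card R1 + card R2)" by (simp flip: power_mult_distrib)
  finally show ?thesis .
qed

section \<open>Steps of a chain and their witnesses\<close>

definition hnbrs :: "vertex \<Rightarrow> vertex set" where
  "hnbrs x = {(fst x, snd x - 1), x, (fst x, snd x + 1)}"

text \<open>A bounded superset of the vertices other than children that share a cell with
  \<open>x\<close>. The last two entries are the last child of the left neighbour and the first
  child of the right one.\<close>

definition other_nbrs :: "vertex \<Rightarrow> vertex set" where
  "other_nbrs x = (case x of (m, i) \<Rightarrow>
     {(m - 1, pidx i), (m - 1, pidx i - 1), (m - 1, pidx i + 1), (m, i - 1), (m, i + 1),
      (Suc m, (i - 1) * B), (Suc m, i * B + 1)})"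

text \<open>A step to a child also chooses a witness, horizontally next to one of its two ends, so
  there are at most six choices. Other steps repeat their target as a dummy.\<close>

definition next_chain :: "vertex \<Rightarrow> (vertex \<times> vertex) set" where
  "next_chain x = (SIGMA c:children x. (hnbrs x \<union> hnbrs c) \<inter> V) \<union> (\<lambda>z. (z, z)) ` (other_nbrs x \<inter> V)"

lemma card_hnbrs: "finite (hnbrs x)" "card (hnbrs x) \<le> 3"
  unfolding hnbrs_def by (simp_all add: card_insert_if)

lemma card_other_nbrs: "finite (other_nbrs x)" "card (other_nbrs x) \<le> 7"
proof -
  obtain m i where x: "x = (m, i)" by (cases x)
  have "other_nbrs x = set [(m - 1, pidx i), (m - 1, pidx i - 1), (m - 1, pidx i + 1), (m, i - 1), (m, i + 1),
      (Suc m, (i - 1) * B), (Suc m, i * B + 1)]" unfolding x other_nbrs_def by simp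
  then show "finite (other_nbrs x)" "card (other_nbrs x) \<le> 7" using card_length by (simp, metis (no_types, lifting) length_Cons list.size(3) numeral_eq_Suc pred_numeral_simps semiring_norm(26,27,28) eval_nat_numeral card_length)
qed

text \<open>Two different parents occur only if \<open>k\<close> is the last child of the first one,
  that is \<open>k = pidx k * B\<close>; this fixes the relative positions of all four
  corners.\<close>

lemma cell_step:
  assumes p: "proper n k" and z: "z \<in> cell n k" "z' \<in> cell n k" "z \<noteq> z'"
  shows "z' \<in> children z \<Longrightarrow> cell n k \<subseteq> hnbrs z \<union> hnbrs z'" "z' \<notin> children z \<Longrightarrow> z' \<in> other_nbrs z"
proof -
  have k: "1 \<le> k" using p by (simp add: proper_def)
  have e: "pidx (k + 1) = pidx k \<or> (pidx (k + 1) = pidx k + 1 \<and> k = pidx k * B)"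
  proof (cases "pidx (k + 1) = pidx k")
    case False
    then have a: "pidx (k + 1) = pidx k + 1" using pidx_Suc[OF k] by simp
    have "k \<le> pidx k * B" using pidx_eq_iff[OF k pidx_pos(1)] by blast
    moreover have "(pidx k + 1 - 1) * B < k + 1" using pidx_eq_iff[of "k + 1" "pidx k + 1"] a by simp
    ultimately show ?thesis using a by simp
  qed simp
  obtain a b where ab: "pidx k = a" "pidx (Suc k) = b" by simp
  have z': "z \<in> {(n, a), (n, b), (Suc n, k), (Suc n, Suc k)}" "z' \<in> {(n, a), (n, b), (Suc n, k), (Suc n, Suc k)}"
    using z(1,2) unfolding cell_def ab[symmetric] by simp_all
  have e': "b = a \<or> (b = Suc a \<and> a * B = k)" using e unfolding ab[symmetric] Suc_eq_plus1 by metis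
  show "cell n k \<subseteq> hnbrs z \<union> hnbrs z'" if "z' \<in> children z"
  proof -
    have "cell n k = {(n, a), (n, b), (Suc n, k), (Suc n, Suc k)}" unfolding cell_def ab[symmetric] by simp
    moreover have "fst z' = Suc (fst z)" using that by (auto simp: children_def)
    ultimately show ?thesis using z' e' unfolding hnbrs_def by (elim insertE emptyE disjE) auto
  qed
  show "z' \<in> other_nbrs z" if "z' \<notin> children z"
  proof -
    have nc: "z = (n, a) \<Longrightarrow> z' \<noteq> (Suc n, k)" "z = (n, b) \<Longrightarrow> z' \<noteq> (Suc n, Suc k)"
      using that k ab by (auto simp: children_def)
    from e' show ?thesis
    proof (elim disjE conjE)
      assume "b = a"
      then show ?thesis using z' z(3) nc ab unfolding other_nbrs_def by (elim insertE emptyE) auto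
    next
      assume "b = Suc a" "a * B = k"
      then show ?thesis using z' z(3) nc ab unfolding other_nbrs_def by (elim insertE emptyE) auto
    qed
  qed
qed

text \<open>The bad vertex of the lower copy may be any corner of the common cell: two consecutive
  cut edges in a cell supply one, but not necessarily at \<open>z\<close> or
  \<open>z'\<close>.\<close>

definition chain_rel :: "(side \<times> vertex \<Rightarrow> bool) \<Rightarrow> (vertex \<times> vertex) set" where
  "chain_rel \<omega> = {(z, z'). z \<noteq> z' \<and> bad Upper \<omega> z \<and> bad Upper \<omega> z' \<and>
     (\<exists>n k. proper n k \<and> z \<in> cell n k \<and> z' \<in> cell n k \<and> (\<exists>y\<in>cell n k. bad Lower \<omega> y))}"

text \<open>The witnesses enter as a set, since several steps may use the same one.\<close>

definition chain_event :: "vertex \<Rightarrow> (vertex \<times> vertex) list \<Rightarrow> (side \<times> vertex \<Rightarrow> bool) \<Rightarrow> bool" where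
  "chain_event v xs \<omega> \<longleftrightarrow> distinct (v # map fst xs) \<and> (\<forall>z\<in>set (v # map fst xs). bad Upper \<omega> z) \<and>
     (\<forall>y\<in>{snd (xs ! t) | t. t < length xs \<and> (v # map fst xs) ! Suc t \<in> children ((v # map fst xs) ! t)}.
        bad Lower \<omega> y)"

lemma chain_of_path:
  assumes f: "\<And>t. t < L \<Longrightarrow> (f t, f (Suc t)) \<in> chain_rel \<omega>" "inj_on f {..L}" "bad Upper \<omega> (f 0)"
  shows "\<exists>xs\<in>walks next_chain L (f 0). chain_event (f 0) xs \<omega>"
proof -
  have "\<exists>y. (f (Suc t), y) \<in> next_chain (f t) \<and> (f (Suc t) \<in> children (f t) \<longrightarrow> bad Lower \<omega> y)" if tL: "t < L" for t
  proof -
    obtain n k y where *: "proper n k" "f t \<in> cell n k" "f (Suc t) \<in> cell n k" "f t \<noteq> f (Suc t)" "y \<in> cell n k" "bad Lower \<omega> y"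
      using f(1)[OF tL] unfolding chain_rel_def by blast
    note V = proper_V[OF *(1)]
    show ?thesis
    proof (cases "f (Suc t) \<in> children (f t)")
      case True
      then have "(f (Suc t), y) \<in> next_chain (f t)"
        using cell_step(1)[OF *(1-4) True] *(5) V unfolding next_chain_def by blast
      then show ?thesis using *(6) by blast
    next
      case False
      then have "(f (Suc t), f (Suc t)) \<in> next_chain (f t)"
        using cell_step(2)[OF *(1-4) False] *(3) V unfolding next_chain_def by blast
      then show ?thesis using False by blast
    qed
  qed
  then obtain g where g: "\<And>t. t < L \<Longrightarrow> (f (Suc t), g t) \<in> next_chain (f t)"
    "\<And>t. t < L \<Longrightarrow> f (Suc t) \<in> children (f t) \<Longrightarrow> bad Lower \<omega> (g t)" by metis
  let ?xs = "map (\<lambda>t. (f (Suc t), g t)) [0..<L]"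
  have xs: "?xs \<in> walks next_chain L (f 0)" by (rule walks_of_path[of L f g next_chain, OF g(1)])
  have vs: "f 0 # map fst ?xs = map f [0..<Suc L]" by (rule path_vertices)
  have "chain_event (f 0) ?xs \<omega>"
    unfolding chain_event_def vs
  proof (intro conjI ballI)
    have "set [0..<Suc L] = {..L}" by auto
    then show "distinct (map f [0..<Suc L])" using f(2) by (simp only: distinct_map distinct_upt simp_thms)
  next
    fix z assume "z \<in> set (map f [0..<Suc L])"
    then obtain t where "t \<in> {0..<Suc L}" "z = f t" by (metis imageE set_map set_upt)
    then have t: "t \<le> L" "z = f t" by simp_all
    then show "bad Upper \<omega> z"
    proof (cases t)
      case (Suc t')
      then show ?thesis using f(1)[of t'] t unfolding chain_rel_def by auto
    qed (use f(3) in simp)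
  next
    fix y assume "y \<in> {snd (?xs ! t) | t. t < length ?xs \<and> map f [0..<Suc L] ! Suc t \<in> children (map f [0..<Suc L] ! t)}"
    then obtain t where t: "y = snd (?xs ! t)" "t < L" "map f [0..<Suc L] ! Suc t \<in> children (map f [0..<Suc L] ! t)" by auto
    have "map f [0..<Suc L] ! Suc t = f (Suc t)" "map f [0..<Suc L] ! t = f t" using t(2)
      by (simp_all add: nth_append del: upt_Suc)
    then show "bad Lower \<omega> y" using g(2)[OF t(2)] t by simp
  qed
  then show ?thesis using xs by blast
qed

end

text \<open>One bad vertex costs \<open>\<theta> ^ 6\<close>, so a sixth of a witness costs
  \<open>\<theta>\<close>. The left side of the bound on \<open>\<mu> ^ 2\<close> is the total
  weight of one step: \<open>6 * B\<close> pairs of a child and a witness, and 7 other steps. The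
  square allows for chains of half the depth, and \<open>M * \<mu> \<le> 1 / 4\<close> makes them
  beat the number of starting points.\<close>

locale chain_bounds = percolation +
  fixes \<theta> \<mu> :: real
  assumes \<theta>: "0 \<le> \<theta>" "\<theta> \<le> 1" "\<theta> ^ 6 = 4 * (1 - p)"
    and \<mu>: "0 \<le> \<mu>" "6 * real B * \<theta> ^ 7 + 7 * \<theta> ^ 6 \<le> \<mu> ^ 2" "real M * \<mu> \<le> 1 / 4"
    and infertile_bound: "8 * real B * (4 * (1 - p)) ^ 2 \<le> 1 / 2"
begin

lemma next_chain_V: "v \<in> V \<Longrightarrow> zy \<in> next_chain v \<Longrightarrow> fst zy \<in> V \<and> snd zy \<in> V"
proof -
  assume v: "v \<in> V" and "zy \<in> next_chain v"
  then consider c y where "zy = (c, y)" "c \<in> children v" "y \<in> V" | z where "zy = (z, z)" "z \<in> V"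
    unfolding next_chain_def by blast
  then show ?thesis using children_V[OF v] by cases simp_all
qed

lemma finite_next_chain: "finite (next_chain v)"
  unfolding next_chain_def using finite_children card_hnbrs(1) card_other_nbrs(1) by auto

lemma local_chain_event:
  assumes "v \<in> V" "xs \<in> walks next_chain L v"
  shows "set (v # map fst xs) \<subseteq> V" "snd ` set xs \<subseteq> V" "local_event GV GV (chain_event v xs)"
proof -
  have "set (v # map fst xs) \<subseteq> V \<and> snd ` set xs \<subseteq> V" using assms
  proof (induction L arbitrary: v xs)
    case (Suc L)
    then obtain a ys where *: "xs = a # ys" "a \<in> next_chain v" "ys \<in> walks next_chain L (fst a)" by auto
    then show ?case using Suc.IH[OF _ *(3)] next_chain_V[OF Suc.prems(1) *(2)] Suc.prems(1) by auto
  qed simp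
  then show V: "set (v # map fst xs) \<subseteq> V" "snd ` set xs \<subseteq> V" by auto
  show "local_event GV GV (chain_event v xs)"
    unfolding chain_event_def
  proof (intro local_event_conj local_event_ball local_event_const local_all_bad)
    let ?Y = "{snd (xs ! t) | t. t < length xs \<and> (v # map fst xs) ! Suc t \<in> children ((v # map fst xs) ! t)}"
    have Y: "?Y \<subseteq> snd ` set xs" by auto
    then show "countable ?Y" by (meson countable_finite finite_imageI finite_set finite_subset)
    show "x \<in> V" if "x \<in> ?Y" for x using Y that V(2) by blast
  qed (use V(1) in \<open>auto intro: countable_finite\<close>)
qed

text \<open>
  Every downward step of a chain has \<open>B\<close> choices, but it needs a bad vertex of the lower copy nearby, and
  each of these serves at most six steps.
\<close>
lemma chain_event_prob:
  assumes v: "v \<in> V" and xs: "xs \<in> walks next_chain L v"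
  shows "site_prob GV p (chain_event v xs) \<le> \<theta> ^ 6 * walk_weight (\<lambda>x z. if z \<in> children x then \<theta> ^ 7 else \<theta> ^ 6) v xs"
    (is "_ \<le> _ * walk_weight ?w v xs")
proof (cases "distinct (v # map fst xs)")
  case False
  then have "chain_event v xs = (\<lambda>\<omega>. False)" by (intro ext) (simp only: chain_event_def simp_thms)
  then have "site_prob GV p (chain_event v xs) = 0" by (simp add: site_prob_def)
  moreover have "0 \<le> walk_weight ?w v xs" unfolding walk_weight_prod by (rule prod_nonneg) (use \<theta>(1,2) in auto)
  ultimately show ?thesis using \<theta>(1,2) by simp
next
  case True
  define vs where "vs = v # map fst xs"
  have len: "length xs = L" by (rule walks_length[OF xs])
  define D where "D = {t. t < L \<and> vs ! Suc t \<in> children (vs ! t)}"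
  define R2 where "R2 = (\<lambda>t. snd (xs ! t)) ` D"
  have finD: "finite D" unfolding D_def by simp
  have cardvs: "card (set vs) = Suc L" using True len distinct_card[of vs] unfolding vs_def by simp
  have inj: "t = t'" if "vs ! t = vs ! t'" "t \<le> L" "t' \<le> L" for t t'
    using True that nth_eq_iff_index_eq[of vs t t'] len unfolding vs_def by simp
  \<comment> \<open>A witness is in \<open>hnbrs\<close> of an end of its step, so that end is in
    the three-element set \<open>hnbrs y\<close>. The vertices of the walk are distinct, which
    leaves three steps for each of the two ends.\<close>
  have fibre: "card {t \<in> D. snd (xs ! t) = y} \<le> 6" for y
  proof -
    have "{t \<in> D. snd (xs ! t) = y} \<subseteq> {t. t \<le> L \<and> vs ! t \<in> hnbrs y} \<union> {t. t < L \<and> vs ! Suc t \<in> hnbrs y}"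
    proof safe
      fix t assume t: "t \<in> D" "vs ! Suc t \<notin> hnbrs (snd (xs ! t))"
      have tL: "t < L" "vs ! Suc t \<in> children (vs ! t)" using t(1) unfolding D_def by auto
      have step: "xs ! t \<in> next_chain (vs ! t)" using walks_step[OF xs tL(1)] unfolding vs_def .
      have fst: "fst (xs ! t) = vs ! Suc t" unfolding vs_def using tL(1) len by simp
      have vV: "vs ! t \<in> V" using local_chain_event(1)[OF v xs] tL(1) len unfolding vs_def
        by (metis length_Cons length_map less_SucI nth_mem subset_iff)
      have "snd (xs ! t) \<in> hnbrs (vs ! t) \<union> hnbrs (vs ! Suc t)"
      proof (cases "snd (xs ! t) = fst (xs ! t)")
        case True
        then show ?thesis unfolding fst hnbrs_def by simp
      next
        case False
        then show ?thesis using step fst unfolding next_chain_def by (auto simp: prod_eq_iff)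
      qed
      \<comment> \<open>Membership in \<open>V\<close> excludes position 0, where truncated
        subtraction would break the symmetry of \<open>hnbrs\<close>.\<close>
      moreover have sym: "b \<in> hnbrs a" if "a \<in> hnbrs b" "b \<in> V" for a b
        using that by (cases b) (auto simp: hnbrs_def mem_V)
      moreover have "vs ! Suc t \<in> V" using children_V[OF vV tL(2)] .
      ultimately show "vs ! t \<in> hnbrs (snd (xs ! t))" using t(2) vV by blast
    qed (auto simp: D_def)
    moreover have "card {t. t \<le> L \<and> vs ! t \<in> hnbrs y} \<le> 3"
    proof -
      have "inj_on ((!) vs) {t. t \<le> L \<and> vs ! t \<in> hnbrs y}" by (rule inj_onI) (use inj in auto)
      then have "card {t. t \<le> L \<and> vs ! t \<in> hnbrs y} \<le> card (hnbrs y)"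
        by (rule card_inj_on_le) (auto simp: card_hnbrs)
      then show ?thesis using card_hnbrs(2)[of y] by linarith
    qed
    moreover have "card {t. t < L \<and> vs ! Suc t \<in> hnbrs y} \<le> 3"
    proof -
      have "inj_on (\<lambda>t. vs ! Suc t) {t. t < L \<and> vs ! Suc t \<in> hnbrs y}" by (rule inj_onI) (use inj in fastforce)
      then have "card {t. t < L \<and> vs ! Suc t \<in> hnbrs y} \<le> card (hnbrs y)"
        by (rule card_inj_on_le) (auto simp: card_hnbrs)
      then show ?thesis using card_hnbrs(2)[of y] by linarith
    qed
    ultimately show ?thesis
      using card_mono[of "{t. t \<le> L \<and> vs ! t \<in> hnbrs y} \<union> {t. t < L \<and> vs ! Suc t \<in> hnbrs y}" "{t \<in> D. snd (xs ! t) = y}"]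
        card_Un_le[of "{t. t \<le> L \<and> vs ! t \<in> hnbrs y}" "{t. t < L \<and> vs ! Suc t \<in> hnbrs y}"] by force
  qed
  have "card D \<le> 6 * card R2"
  proof -
    have "D = (\<Union>y\<in>R2. {t \<in> D. snd (xs ! t) = y})" unfolding R2_def by blast
    then have "card D \<le> (\<Sum>y\<in>R2. card {t \<in> D. snd (xs ! t) = y})"
      using card_UN_le[of R2 "\<lambda>y. {t \<in> D. snd (xs ! t) = y}"] finD unfolding R2_def by simp
    also have "\<dots> \<le> (\<Sum>y\<in>R2. 6)" by (rule sum_mono) (rule fibre)
    finally show ?thesis by simp
  qed
  then have le: "6 * L + card D + 6 \<le> 6 * (Suc L + card R2)" by simp
  have "chain_event v xs = (\<lambda>\<omega>. (\<forall>x\<in>set vs. bad Upper \<omega> x) \<and> (\<forall>x\<in>R2. bad Lower \<omega> x))"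
  proof -
    have "{snd (xs ! t) | t. t < L \<and> vs ! Suc t \<in> children (vs ! t)} = R2"
      unfolding R2_def D_def by blast
    then show ?thesis using True unfolding chain_event_def vs_def[symmetric] len by (intro ext) simp
  qed
  then have "site_prob GV p (chain_event v xs) \<le> (4 * (1 - p)) ^ (card (set vs) + card R2)"
    using bad_prob[of "set vs" R2] local_chain_event(1,2)[OF v xs] finD len
    unfolding vs_def[symmetric] R2_def D_def by force
  also have "\<dots> = \<theta> ^ (6 * (Suc L + card R2))" unfolding cardvs \<theta>(3)[symmetric] by (simp only: power_mult)
  also have "\<dots> \<le> \<theta> ^ (6 * L + card D + 6)" by (rule power_decreasing[OF le]) (use \<theta>(1,2) in auto)
  also have "\<dots> = \<theta> ^ 6 * walk_weight ?w v xs"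
  proof -
    have "walk_weight ?w v xs = (\<Prod>t<L. \<theta> ^ (6 + (if t \<in> D then 1 else 0)))"
      unfolding walk_weight_prod len vs_def[symmetric] by (intro prod.cong refl) (auto simp: D_def)
    also have "\<dots> = \<theta> ^ (\<Sum>t<L. 6 + (if t \<in> D then 1 else 0))" by (rule power_sum[symmetric])
    also have "(\<Sum>t<L. 6 + (if t \<in> D then 1 else 0)) = 6 * L + card D"
    proof -
      have "(\<Sum>t<L. if t \<in> D then 1 else 0) = card ({..<L} \<inter> D)"
        by (subst sum.inter_restrict[symmetric]) simp_all
      moreover have "{..<L} \<inter> D = D" unfolding D_def by auto
      ultimately show ?thesis by (simp add: sum.distrib)
    qed
    finally show ?thesis by (simp only: power_add mult.commute)
  qed
  finally show ?thesis .
qed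

lemma next_chain_weight:
  assumes "v \<in> V"
  shows "(\<Sum>zy\<in>next_chain v. if fst zy \<in> children v then \<theta> ^ 7 else \<theta> ^ 6) \<le> \<mu> ^ 2"
proof -
  let ?A = "SIGMA c:children v. (hnbrs v \<union> hnbrs c) \<inter> V" and ?C = "(\<lambda>z. (z, z)) ` (other_nbrs v \<inter> V)"
  let ?w = "\<lambda>zy. if fst zy \<in> children v then \<theta> ^ 7 else \<theta> ^ 6"
  have fin: "finite ?A" "finite ?C" using finite_next_chain[of v] unfolding next_chain_def by auto
  have w: "0 \<le> ?w zy" for zy using \<theta>(1,2) by simp
  have "\<theta> ^ 7 \<le> \<theta> ^ 6" using \<theta> by (intro power_decreasing) auto
  have "0 \<le> sum ?w (?A \<inter> ?C)" by (rule sum_nonneg) (rule w)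
  then have "sum ?w (next_chain v) \<le> sum ?w ?A + sum ?w ?C"
    unfolding next_chain_def using sum_Un[OF fin, of ?w] by linarith
  also have "sum ?w ?A = real (card ?A) * \<theta> ^ 7" by (subst sum.cong[of ?A ?A ?w "\<lambda>_. \<theta> ^ 7"]) auto
  also have "real (card ?A) * \<theta> ^ 7 \<le> (6 * real B) * \<theta> ^ 7"
  proof (rule mult_right_mono)
    have c: "card ((hnbrs v \<union> hnbrs c) \<inter> V) \<le> 6" for c
    proof -
      have "card ((hnbrs v \<union> hnbrs c) \<inter> V) \<le> card (hnbrs v \<union> hnbrs c)"
        by (rule card_mono) (auto simp: card_hnbrs)
      also have "\<dots> \<le> card (hnbrs v) + card (hnbrs c)" by (rule card_Un_le)
      finally show ?thesis using card_hnbrs(2)[of v] card_hnbrs(2)[of c] by linarith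
    qed
    have "card ?A = (\<Sum>c\<in>children v. card ((hnbrs v \<union> hnbrs c) \<inter> V))"
      by (rule card_SigmaI[OF finite_children]) (auto simp: card_hnbrs)
    also have "\<dots> \<le> (\<Sum>c\<in>children v. 6)" by (rule sum_mono) (rule c)
    also have "\<dots> = 6 * B" using card_children[OF assms] by simp
    finally have "real (card ?A) \<le> real (6 * B)" by (rule of_nat_mono)
    then show "real (card ?A) \<le> 6 * real B" by simp
  qed (use \<theta>(1,2) in simp)
  also have "sum ?w ?C \<le> (\<Sum>zy\<in>?C. \<theta> ^ 6)" by (rule sum_mono) (use \<open>\<theta> ^ 7 \<le> \<theta> ^ 6\<close> in auto)
  also have "\<dots> \<le> 7 * \<theta> ^ 6"
  proof -
    have "card ?C \<le> card (other_nbrs v \<inter> V)" by (rule card_image_le) (simp add: card_other_nbrs)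
    also have "\<dots> \<le> card (other_nbrs v)" by (rule card_mono) (auto simp: card_other_nbrs)
    also have "\<dots> \<le> 7" by (rule card_other_nbrs)
    finally have "real (card ?C) \<le> 7" by simp
    then show ?thesis using \<theta>(1,2) by (simp add: mult_right_mono)
  qed
  finally show ?thesis using \<mu>(2) by linarith
qed

lemma local_chain_ex:
  "v \<in> V \<Longrightarrow> local_event GV GV (\<lambda>\<omega>. \<exists>xs\<in>walks next_chain L v. chain_event v xs \<omega>)"
  by (rule local_event_bex[OF countable_finite[OF finite_walks[OF finite_next_chain]] local_chain_event(3)])

lemma chain_prob:
  assumes "v \<in> V"
  shows "site_prob GV p (\<lambda>\<omega>. \<exists>xs\<in>walks next_chain L v. chain_event v xs \<omega>) \<le> \<theta> ^ 6 * \<mu> ^ (2 * L)"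
proof -
  let ?w = "\<lambda>x z. if z \<in> children x then \<theta> ^ 7 else \<theta> ^ 6"
  have "site_prob GV p (\<lambda>\<omega>. \<exists>xs\<in>walks next_chain L v. chain_event v xs \<omega>) \<le>
      (\<Sum>xs\<in>walks next_chain L v. site_prob GV p (chain_event v xs))"
    by (rule site_prob_Un[OF finite_walks[OF finite_next_chain] local_chain_event(3)[OF assms]])
  also have "\<dots> \<le> (\<Sum>xs\<in>walks next_chain L v. \<theta> ^ 6 * walk_weight ?w v xs)"
    by (rule sum_mono) (rule chain_event_prob[OF assms])
  also have "\<dots> = \<theta> ^ 6 * (\<Sum>xs\<in>walks next_chain L v. walk_weight ?w v xs)" by (simp add: sum_distrib_left)
  also have "\<dots> \<le> \<theta> ^ 6 * (\<mu> ^ 2) ^ L"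
  proof (rule mult_left_mono)
    show "(\<Sum>xs\<in>walks next_chain L v. walk_weight ?w v xs) \<le> (\<mu> ^ 2) ^ L"
      by (rule sum_walk_weight[OF finite_next_chain _ next_chain_weight _ _ assms])
         (use \<theta>(1,2) next_chain_V in auto)
  qed (use \<theta>(1,2) in simp)
  finally show ?thesis by (simp add: power_mult)
qed

section \<open>Paths of infertile vertices\<close>

definition near_nbrs :: "vertex \<Rightarrow> vertex set" where
  "near_nbrs x = {y \<in> V. \<exists>n k. x \<in> near n k \<and> y \<in> near n k}"

lemma card_near_nbrs:
  assumes "x \<in> V" shows "finite (near_nbrs x)" "card (near_nbrs x) \<le> 8 * B"
proof -
  obtain m i where x: "x = (m, i)" "1 \<le> i" using assms by (cases x) (auto simp: mem_V)
  \<comment> \<open>The indices \<open>(n, k)\<close> for which \<open>x\<close> can be an entry of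
    \<open>near n k\<close>: the two upper entries leave an interval of values \<open>k\<close>,
    each of the other three a single index.\<close>
  define T where "T = Pair m ` {(i - 1) * B .. i * B} \<union> {(m - 1, i), (m - 1, i - 1), (m - 2, (i - 1) div B)}"
  have B0: "0 < B" using B_ge by linarith
  have pk: "k \<in> {(i - 1) * B .. i * B}" if "pidx k = i" for k
  proof (cases "k = 0")
    case True
    then show ?thesis using that by (simp add: pidx_def)
  next
    case False
    then show ?thesis using pidx_eq_iff[of k i] that x(2) by auto
  qed
  have pk': "k \<in> {(i - 1) * B .. i * B}" if "pidx (k + 1) = i" for k
    using pidx_eq_iff[of "k + 1" i] that x(2) by auto
  have sub: "near_nbrs x \<subseteq> (\<Union>(n, k)\<in>T. near n k)"
  proof
    fix y assume "y \<in> near_nbrs x"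
    then obtain n k where nk: "x \<in> near n k" "y \<in> near n k" unfolding near_nbrs_def by blast
    have "(n, k) \<in> T"
      using nk(1) pk[of k] pk'[of k] B0 unfolding near_def x T_def by auto
    then show "y \<in> (\<Union>(n, k)\<in>T. near n k)" using nk(2) by blast
  qed
  have finT: "finite T" unfolding T_def by simp
  have fn: "finite (near n k)" "card (near n k) \<le> 5" for n k
    unfolding near_def by (simp_all add: card_insert_if)
  show "finite (near_nbrs x)" by (rule finite_subset[OF sub]) (use finT fn in auto)
  have cT: "card T \<le> B + 4"
  proof -
    have "card (Pair m ` {(i - 1) * B .. i * B}) \<le> card {(i - 1) * B .. i * B}" by (rule card_image_le) simp
    also have "\<dots> = B + 1" using x(2) by (cases i) auto
    finally have "card (Pair m ` {(i - 1) * B .. i * B}) \<le> B + 1" .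
    moreover have "card {(m - 1, i), (m - 1, i - 1), (m - 2, (i - 1) div B)} \<le> 3" by (simp add: card_insert_if)
    ultimately show ?thesis unfolding T_def
      using card_Un_le[of "Pair m ` {(i - 1) * B .. i * B}" "{(m - 1, i), (m - 1, i - 1), (m - 2, (i - 1) div B)}"] by linarith
  qed
  have "card (near_nbrs x) \<le> card (\<Union>(n, k)\<in>T. near n k)" by (rule card_mono[OF _ sub]) (use finT fn in auto)
  also have "\<dots> \<le> (\<Sum>(n, k)\<in>T. card (near n k))"
    using card_UN_le[OF finT, of "\<lambda>(n, k). near n k"] by (simp add: case_prod_unfold)
  also have "\<dots> \<le> (\<Sum>_\<in>T. 5)" by (rule sum_mono) (use fn in auto)
  also have "\<dots> \<le> 5 * (B + 4)" using cT by simp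
  also have "\<dots> \<le> 8 * B"
  proof -
    have "5 * (b + 4) \<le> 8 * b" if "8 \<le> b" for b :: nat using that by simp
    then show ?thesis using B_ge .
  qed
  finally show "card (near_nbrs x) \<le> 8 * B" .
qed

definition next_near :: "vertex \<Rightarrow> (vertex \<times> vertex) set" where
  "next_near x = (if x \<in> V then (\<lambda>z. (z, z)) ` near_nbrs x else {})"

lemma finite_next_near: "finite (next_near v)"
  unfolding next_near_def using card_near_nbrs by simp

definition infertile_event :: "vertex \<Rightarrow> (vertex \<times> vertex) list \<Rightarrow> (side \<times> vertex \<Rightarrow> bool) \<Rightarrow> bool" where
  "infertile_event v xs \<omega> \<longleftrightarrow> distinct (v # map fst xs) \<and> (\<forall>z\<in>set (v # map fst xs). \<not> fertile \<omega> z)"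

lemma infertile_walk_V: "v \<in> V \<Longrightarrow> xs \<in> walks next_near L v \<Longrightarrow> set (v # map fst xs) \<subseteq> V"
proof (induction L arbitrary: v xs)
  case (Suc L)
  then obtain a ys where *: "xs = a # ys" "a \<in> next_near v" "ys \<in> walks next_near L (fst a)" by auto
  then have "fst a \<in> V" unfolding next_near_def near_nbrs_def by (auto split: if_splits)
  then show ?case using Suc.IH[OF _ *(3)] Suc.prems(1) *(1) by auto
qed simp

lemma local_infertile_event:
  "v \<in> V \<Longrightarrow> xs \<in> walks next_near L v \<Longrightarrow> local_event GV GV (infertile_event v xs)"
  unfolding infertile_event_def using infertile_walk_V[of v xs L]
  by (intro local_event_conj local_event_ball local_event_const local_event_not local_all_fertile)
     (auto intro: countable_finite)

lemma local_infertile_ex: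
  "v \<in> V \<Longrightarrow> local_event GV GV (\<lambda>\<omega>. \<exists>xs\<in>walks next_near L v. infertile_event v xs \<omega>)"
  by (rule local_event_bex[OF countable_finite[OF finite_walks[OF finite_next_near]] local_infertile_event])

text \<open>An infertile vertex is bad in both copies, so it costs the square of
  \<open>4 * (1 - p)\<close>, which outweighs even the crude count of \<open>8 * B\<close>
  neighbours. This is what excludes infinite clusters without fertile vertices.\<close>

lemma infertile_prob:
  assumes "v \<in> V"
  shows "site_prob GV p (\<lambda>\<omega>. \<exists>xs\<in>walks next_near L v. infertile_event v xs \<omega>) \<le> (1 / 2) ^ L"
proof -
  let ?w = "\<lambda>x z. (4 * (1 - p)) ^ 2" and ?q = "4 * (1 - p)"
  have q: "0 \<le> ?q" "?q \<le> 1" using p_less \<theta>(1,2) power_le_one[of \<theta> 6] unfolding \<theta>(3)[symmetric] by auto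
  have "site_prob GV p (infertile_event v xs) \<le> walk_weight ?w v xs" if xs: "xs \<in> walks next_near L v" for xs
  proof (cases "distinct (v # map fst xs)")
    case False
    then have "infertile_event v xs = (\<lambda>\<omega>. False)" by (intro ext) (simp only: infertile_event_def simp_thms)
    then have "site_prob GV p (infertile_event v xs) = 0" by (simp add: site_prob_def)
    moreover have "0 \<le> walk_weight ?w v xs" unfolding walk_weight_prod by (rule prod_nonneg) auto
    ultimately show ?thesis by simp
  next
    case True
    let ?R = "set (v # map fst xs)"
    have card: "card ?R = Suc L" using True distinct_card[of "v # map fst xs"] walks_length[OF xs] by simp
    note RV = infertile_walk_V[OF assms xs]
    have "site_prob GV p (infertile_event v xs) \<le>
        site_prob GV p (\<lambda>\<omega>. (\<forall>x\<in>?R. bad Upper \<omega> x) \<and> (\<forall>x\<in>?R. bad Lower \<omega> x))"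
    proof (rule site_prob_mono)
      show "local_event GV GV (\<lambda>\<omega>. (\<forall>x\<in>?R. bad Upper \<omega> x) \<and> (\<forall>x\<in>?R. bad Lower \<omega> x))"
        using RV by (intro local_event_conj local_event_ball local_all_bad) (auto intro: countable_finite)
    qed (auto simp: infertile_event_def bad_def)
    also have "\<dots> \<le> ?q ^ (card ?R + card ?R)" by (rule bad_prob) (use RV in auto)
    also have "\<dots> \<le> ?q ^ (2 * L)" unfolding card by (rule power_decreasing) (use q in auto)
    also have "\<dots> = walk_weight ?w v xs" unfolding walk_weight_prod walks_length[OF xs] by (simp add: power_mult)
    finally show ?thesis .
  qed
  then have "(\<Sum>xs\<in>walks next_near L v. site_prob GV p (infertile_event v xs)) \<le> (\<Sum>xs\<in>walks next_near L v. walk_weight ?w v xs)"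
    by (rule sum_mono)
  also have "\<dots> \<le> (1 / 2) ^ L"
  proof (rule sum_walk_weight[OF finite_next_near _ _ _ _ assms])
    fix v assume v: "v \<in> V"
    have "card (next_near v) \<le> 8 * B"
      unfolding next_near_def using v card_near_nbrs[OF v] card_image_le[of "near_nbrs v" "\<lambda>z. (z, z)"] by simp
    then have "real (card (next_near v)) \<le> real (8 * B)" by (rule of_nat_mono)
    then have "real (card (next_near v)) * ?q ^ 2 \<le> 8 * real B * ?q ^ 2" by (intro mult_right_mono) auto
    then show "(\<Sum>zy\<in>next_near v. ?q ^ 2) \<le> 1 / 2" using infertile_bound by simp
    show "fst zy \<in> V" if "zy \<in> next_near v" for zy
      using that unfolding next_near_def near_nbrs_def by (auto split: if_splits)
  qed auto
  finally have "(\<Sum>xs\<in>walks next_near L v. site_prob GV p (infertile_event v xs)) \<le> (1 / 2) ^ L" .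
  moreover have "site_prob GV p (\<lambda>\<omega>. \<exists>xs\<in>walks next_near L v. infertile_event v xs \<omega>) \<le>
      (\<Sum>xs\<in>walks next_near L v. site_prob GV p (infertile_event v xs))"
    by (rule site_prob_Un[OF finite_walks[OF finite_next_near] local_infertile_event[OF assms]])
  ultimately show ?thesis by (rule order_trans[rotated])
qed

end

section \<open>Separating chains\<close>

text \<open>A shortest path is simple, because the part between two visits of a vertex could be cut
  out.\<close>

lemma simple_path:
  assumes "(a, b) \<in> r\<^sup>*"
  obtains n f where "f 0 = a" "f n = b" "\<And>i. i < n \<Longrightarrow> (f i, f (Suc i)) \<in> r" "inj_on f {..n::nat}"
proof -
  define n where "n = (LEAST n. (a, b) \<in> r ^^ n)"
  have "\<exists>n. (a, b) \<in> r ^^ n" using assms by (simp add: rtrancl_power)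
  then have n: "(a, b) \<in> r ^^ n" unfolding n_def by (rule LeastI_ex)
  have min: "n \<le> m" if "(a, b) \<in> r ^^ m" for m unfolding n_def using that by (rule Least_le)
  obtain f where f: "f 0 = a" "f n = b" "\<And>i. i < n \<Longrightarrow> (f i, f (Suc i)) \<in> r"
    using n unfolding relpow_fun_conv by blast
  have seg: "(f i, f (i + k)) \<in> r ^^ k" if "i + k \<le> n" for i k
    using that
  proof (induction k)
    case (Suc k)
    then have "(f i, f (i + k)) \<in> r ^^ k" "(f (i + k), f (i + Suc k)) \<in> r" using f(3)[of "i + k"] by auto
    then show ?case by auto
  qed simp
  have ne: "f i \<noteq> f j" if "i < j" "j \<le> n" for i j
  proof
    assume eq: "f i = f j"
    have "(a, f i) \<in> r ^^ i" using seg[of 0 i] that f(1) by simp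
    moreover have "(f j, b) \<in> r ^^ (n - j)" using seg[of j "n - j"] that f(2) by simp
    ultimately have "(a, b) \<in> r ^^ (i + (n - j))" unfolding eq by (auto simp: relpow_add)
    then show False using min[of "i + (n - j)"] that by simp
  qed
  have "inj_on f {..n}"
    by (rule inj_onI) (metis atMost_iff ne nat_neq_iff)
  then show thesis using that[of f n] f by blast
qed

text \<open>Finite branching leaves a reachable vertex at distance greater than \<open>L\<close>; a
  shortest path to it begins with a simple path of length \<open>L\<close>.\<close>

lemma long_simple_path:
  assumes inf: "infinite (r\<^sup>* `` {v})" and fin: "\<And>x. finite (r `` {x})"
  obtains f where "f 0 = v" "\<And>i. i < L \<Longrightarrow> (f i, f (Suc i)) \<in> r" "inj_on f {..L::nat}"
proof -
  have fl: "finite ((r ^^ k) `` {v})" for k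
  proof (induction k)
    case (Suc k)
    have "(r ^^ Suc k) `` {v} = (\<Union>x\<in>(r ^^ k) `` {v}. r `` {x})" by auto
    then show ?case using Suc fin by simp
  qed simp
  have "finite (\<Union>k\<in>{..L}. (r ^^ k) `` {v})" using fl by simp
  then obtain u where u: "u \<in> r\<^sup>* `` {v}" "u \<notin> (\<Union>k\<in>{..L}. (r ^^ k) `` {v})"
    using inf by (meson finite_subset subsetI)
  from u(1) have vu: "(v, u) \<in> r\<^sup>*" by simp
  obtain n f where f: "f 0 = v" "f n = u" "\<And>i. i < n \<Longrightarrow> (f i, f (Suc i)) \<in> r" "inj_on f {..n}"
    by (rule simple_path[OF vu]) (rule that)
  have "(v, u) \<in> r ^^ n" unfolding relpow_fun_conv using f by blast
  then have "L < n" using u(2) by (metis ImageI UN_I atMost_iff not_le singletonI)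
  then show thesis using that[of f] f(1,3) inj_on_subset[OF f(4), of "{..L}"] by simp
qed

context strip_tree
begin

lemma adj_sym: "(x, y) \<in> adj S \<Longrightarrow> (y, x) \<in> adj S"
  unfolding adj_def by (simp add: insert_commute)

lemma adj_rtrancl_sym: "(x, y) \<in> (adj S)\<^sup>* \<Longrightarrow> (y, x) \<in> (adj S)\<^sup>*"
proof -
  have "sym (adj S)" using adj_sym by (auto simp: sym_def)
  then show "(x, y) \<in> (adj S)\<^sup>* \<Longrightarrow> (y, x) \<in> (adj S)\<^sup>*" using sym_rtrancl by (metis symD)
qed

section \<open>Gaps between blocks as points of the unit interval\<close>

definition iv_lo :: "vertex \<Rightarrow> real" where "iv_lo v = (real (snd v) - 1) / real B ^ fst v"
definition iv_hi :: "vertex \<Rightarrow> real" where "iv_hi v = real (snd v) / real B ^ fst v"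

text \<open>
  A vertex at depth \<open>l\<close> is identified with an \<open>M\<^sup>d\<close>-adic interval of length \<open>M\<^sup>-\<^sup>d\<^sup>l\<close>, a block with an \<open>M\<close>-adic
  interval of length \<open>M\<^sup>-\<^sup>l\<close>.
\<close>
definition touches :: "vertex \<Rightarrow> real \<Rightarrow> bool" where
  "touches v g \<longleftrightarrow> iv_lo v \<le> g \<and> g \<le> iv_hi v"

text \<open>The exponent is \<open>l + 1\<close> because a cut edge at a gap of depth
  \<open>l + 1\<close> may have its ends one level above. The points \<open>0\<close> and
  \<open>1\<close> belong to the outer borders of the strip.\<close>

definition wall_point :: "nat \<Rightarrow> real \<Rightarrow> bool" where
  "wall_point l g \<longleftrightarrow> (\<exists>a::nat. g = real a / real M ^ (l + 1))"

lemma wall_point_mono: "wall_point l g \<Longrightarrow> l \<le> l' \<Longrightarrow> wall_point l' g"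
proof -
  assume "wall_point l g" "l \<le> l'"
  then obtain a r where *: "g = real a / real M ^ (l + 1)" "l' = l + r"
    unfolding wall_point_def using le_Suc_ex by blast
  have "g = real (a * M ^ r) / real M ^ (l' + 1)" using * by (simp add: power_add)
  then show ?thesis unfolding wall_point_def by blast
qed

lemma real_B_pos: "0 < real B" using B_ge by linarith

lemma touches_parent: "1 \<le> k \<Longrightarrow> touches (Suc n, k) g \<Longrightarrow> touches (n, pidx k) g"
proof -
  assume k: "1 \<le> k" and t: "touches (Suc n, k) g"
  have p: "(pidx k - 1) * B < k" "k \<le> pidx k * B" using pidx_eq_iff[OF k pidx_pos(1)] by blast+
  have B: "0 < real B ^ n" "0 < real B" using real_B_pos by simp_all
  have "real ((pidx k - 1) * B) \<le> real k - 1" using p(1) by linarith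
  then have 1: "(real (pidx k) - 1) * real B \<le> real k - 1" using pidx_pos(1)[of k] by (simp add: of_nat_diff)
  have "real k \<le> real (pidx k * B)" using p(2) by (rule of_nat_mono)
  then have 2: "real k \<le> real (pidx k) * real B" by simp
  have e: "x / real B ^ n = x * real B / real B ^ Suc n" for x using B by simp
  have "iv_lo (n, pidx k) \<le> iv_lo (Suc n, k)" unfolding iv_lo_def fst_conv snd_conv e
    using 1 B by (intro divide_right_mono) auto
  moreover have "iv_hi (Suc n, k) \<le> iv_hi (n, pidx k)" unfolding iv_hi_def fst_conv snd_conv e[of "real (pidx k)"]
    using 2 B by (intro divide_right_mono) auto
  ultimately show ?thesis using t unfolding touches_def by linarith
qed

text \<open>The point \<open>k / B ^ Suc n\<close> separates the intervals of the two lower corners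
  and belongs to both; the intervals of the parents contain it as well. Moving through cells
  therefore changes the position on the line only by interval lengths.\<close>

lemma cell_common_point:
  assumes "proper n k" obtains c where "\<And>v. v \<in> cell n k \<Longrightarrow> touches v c"
proof -
  let ?c = "real k / real B ^ Suc n"
  have k: "1 \<le> k" using assms by (simp add: proper_def)
  have B: "0 < real B ^ Suc n" using real_B_pos by simp
  have 1: "touches (Suc n, k) ?c" "touches (Suc n, k + 1) ?c"
    unfolding touches_def iv_lo_def iv_hi_def using B by (auto intro!: divide_right_mono simp del: power_Suc)
  have "touches (n, pidx k) ?c" "touches (n, pidx (k + 1)) ?c"
    using touches_parent[OF k 1(1)] touches_parent[OF _ 1(2)] by auto
  then show thesis using 1 that[of ?c] unfolding cell_def by blast
qed

lemma touches_dist: "touches v a \<Longrightarrow> touches v b \<Longrightarrow> \<bar>a - b\<bar> \<le> 1 / real B ^ fst v"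
proof -
  assume t: "touches v a" "touches v b"
  have "iv_hi v = iv_lo v + 1 / real B ^ fst v" unfolding iv_lo_def iv_hi_def by (simp add: diff_divide_distrib)
  then show ?thesis using t unfolding touches_def by linarith
qed

lemma touches_block:
  assumes "j < M ^ n"
  shows "touches (n, blast n j) (real (j + 1) / real M ^ n)" "touches (n, bfirst n j) (real j / real M ^ n)"
proof -
  let ?s = "block_size d M n"
  have s: "0 < real ?s" by simp
  have e: "real B ^ n = real M ^ n * real ?s"
  proof -
    have "real (B ^ n) = real (M ^ n * ?s)" unfolding B_power ..
    then show ?thesis by simp
  qed
  have q: "real a / real M ^ n = real a * real ?s / real B ^ n" for a :: nat unfolding e using s by simp
  have B: "0 < real B ^ n" using real_B_pos by simp
  show "touches (n, blast n j) (real (j + 1) / real M ^ n)"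
    unfolding touches_def iv_lo_def iv_hi_def fst_conv snd_conv q blast_def using B
    by (auto intro!: divide_right_mono simp: algebra_simps)
  show "touches (n, bfirst n j) (real j / real M ^ n)"
    unfolding touches_def iv_lo_def iv_hi_def fst_conv snd_conv q bfirst_def using B
    by (auto intro!: divide_right_mono simp: algebra_simps)
qed

definition touched :: "vertex set set \<Rightarrow> real \<Rightarrow> bool" where
  "touched C g \<longleftrightarrow> (\<exists>e\<in>C. \<forall>v\<in>e. touches v g \<and> wall_point (fst v) g)"

lemma edge_cutI:
  assumes "{x, y} \<in> strip_edges d M" "(x \<in> D) \<noteq> (y \<in> D)"
  shows "{x, y} \<in> edge_cut D"
proof -
  have *: "{a, b} \<in> edge_cut D" if "a \<in> D" "b \<notin> D" "{a, b} \<in> strip_edges d M" for a b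
    unfolding edge_cut_def using that by (intro CollectI exI[of _ a] exI[of _ b] conjI refl)
  show ?thesis
  proof (cases "x \<in> D")
    case True
    then show ?thesis using * assms by blast
  next
    case False
    then have "{y, x} \<in> edge_cut D" using *[of y x] assms insert_commute[of x y "{}"] by simp
    then show ?thesis by (simp only: insert_commute)
  qed
qed

lemma touchedI:
  assumes "{x, y} \<in> strip_edges d M" "(x \<in> D) \<noteq> (y \<in> D)"
    "touches x g" "touches y g" "wall_point (fst x) g" "wall_point (fst y) g"
  shows "touched (edge_cut D) g"
  unfolding touched_def using edge_cutI[OF assms(1,2)] assms(3-6) by (intro bexI[of _ "{x, y}"]) auto

text \<open>The status changes on the way from one side of the gap through the parents to the other
  side. If the parents are in different blocks, the step between them is no edge, but then
  \<open>g\<close> is also a gap one level higher and the induction hypothesis applies.\<close>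

lemma gap_touched:
  "j + 1 < M ^ n \<Longrightarrow> ((n, blast n j) \<in> D) \<noteq> ((n, bfirst n (j + 1)) \<in> D) \<Longrightarrow>
   touched (edge_cut D) (real (j + 1) / real M ^ n)"
proof (induction n arbitrary: j)
  case (Suc m)
  let ?g = "real (j + 1) / real M ^ Suc m"
  let ?r = "(Suc m, blast (Suc m) j)" and ?l = "(Suc m, bfirst (Suc m) (j + 1))"
  let ?p = "(m, pidx (blast (Suc m) j))" and ?p' = "(m, pidx (bfirst (Suc m) (j + 1)))"
  have j: "j < M ^ Suc m" using Suc.prems(1) by simp
  have V: "?r \<in> V" "?l \<in> V" using blast_le[OF j] bfirst_le[OF Suc.prems(1)] by (simp_all add: mem_V)
  have t: "touches ?r ?g" "touches ?l ?g"
    using touches_block(1)[OF j] touches_block(2)[OF Suc.prems(1)] by simp_all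
  have tp: "touches ?p ?g" "touches ?p' ?g"
    using touches_parent[OF _ t(1)] touches_parent[OF _ t(2)] by simp_all
  have wm: "wall_point m ?g" unfolding wall_point_def by (metis Suc_eq_plus1)
  then have ws: "wall_point (Suc m) ?g" by (rule wall_point_mono) simp
  consider "(?p \<in> D) \<noteq> (?r \<in> D)" | "(?p' \<in> D) \<noteq> (?l \<in> D)" | "(?p \<in> D) \<noteq> (?p' \<in> D)" using Suc.prems(2) by blast
  then show ?case
  proof cases
    case 1
    then show ?thesis using touchedI[OF strip_edge_tree[OF V(1)] 1 tp(1) t(1)] wm ws by simp
  next
    case 2
    then show ?thesis using touchedI[OF strip_edge_tree[OF V(2)] 2 tp(2) t(2)] wm ws by simp
  next
    case 3
    have s: "blast (Suc m) j + 1 = bfirst (Suc m) (j + 1)" by (rule blast_Suc)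
    have b: "blk m (pidx (blast (Suc m) j)) = j div M" "blk m (pidx (bfirst (Suc m) (j + 1))) = (j + 1) div M"
      by (simp_all add: blk_parent)
    have ne: "?p \<noteq> ?p'" using 3 by auto
    then have s': "pidx (bfirst (Suc m) (j + 1)) = pidx (blast (Suc m) j) + 1"
      using pidx_Suc[of "blast (Suc m) j"] unfolding s by auto
    show ?thesis
    proof (cases "j div M = (j + 1) div M")
      case True
      have le: "pidx (blast (Suc m) j) + 1 \<le> B ^ m"
        using pidx_le[OF bfirst_le[OF Suc.prems(1)]] s' by simp
      then obtain q where q: "m = Suc q" using pidx_pos(1)[of "blast (Suc m) j"] by (cases m) auto
      have "blk m (pidx (blast (Suc m) j)) = blk m (pidx (blast (Suc m) j) + 1)"
        using b True unfolding s'[symmetric] by simp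
      then have "proper q (pidx (blast (Suc m) j))" using le unfolding proper_def q by simp
      then have "{?p, ?p'} \<in> strip_edges d M" unfolding s' using strip_edge_hor q by simp
      then show ?thesis using touchedI[OF _ 3 tp] wm by simp
    next
      case False
      have e: "j + 1 = (j div M + 1) * M" "j = j div M * M + M - 1"
      proof -
        have "(j + 1) mod M = 0" using False by (simp add: div_Suc split: if_splits)
        moreover have "(j + 1) div M = j div M + 1" using False by (simp add: div_Suc split: if_splits)
        ultimately show "j + 1 = (j div M + 1) * M" using div_mult_mod_eq[of "j + 1" M] by simp
        then show "j = j div M * M + M - 1" by simp
      qed
      have "(j div M + 1) * M < M ^ m * M" using Suc.prems(1) e(1) by (simp add: mult.commute)
      then have lt: "j div M + 1 < M ^ m" by (simp only: mult_less_cancel2)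
      have "pidx (blast (Suc m) j) = blast m (j div M)" using pidx_blast[of m "j div M"] e(2) by simp
      moreover have "pidx (bfirst (Suc m) (j + 1)) = bfirst m (j div M + 1)" using pidx_bfirst[of m "j div M + 1"] e(1) by simp
      ultimately have "touched (edge_cut D) (real (j div M + 1) / real M ^ m)" using Suc.IH[OF lt] 3 by simp
      moreover have "?g = real (j div M + 1) / real M ^ m"
      proof -
        have "real (j + 1) = real (j div M + 1) * real M" using arg_cong[OF e(1), of real] by (simp only: of_nat_mult)
        then show ?thesis by simp
      qed
      ultimately show ?thesis by simp
    qed
  qed
qed simp

text \<open>Along the left and right borders of the tree: if the two lower ends differ in status,
  one of them differs from the root.\<close>

lemma outer_touched:
  assumes "((n, 1) \<in> D) \<noteq> ((n, B ^ n) \<in> D)"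
  shows "touched (edge_cut D) 0 \<or> touched (edge_cut D) 1"
proof -
  have B: "0 < real B ^ m" for m using real_B_pos by simp
  have 0: "touches (m, 1) 0" "touches (m, B ^ m) 1" for m
    using B[of m] by (auto simp: touches_def iv_lo_def iv_hi_def field_simps)
  have w: "wall_point m 0" "wall_point m 1" for m
    unfolding wall_point_def by (rule exI[of _ 0], simp) (rule exI[of _ "M ^ (m + 1)"], simp)
  have "((n, 1) \<in> D) \<noteq> ((0, 1) \<in> D) \<Longrightarrow> touched (edge_cut D) 0" for n
  proof (induction n)
    case (Suc n)
    have V: "(Suc n, 1) \<in> V" using M_ge by (simp add: mem_V)
    have p: "pidx 1 = 1" by (simp add: pidx_def)
    show ?case
    proof (cases "((n, 1) \<in> D) = ((Suc n, 1) \<in> D)")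
      case False
      then show ?thesis using touchedI[OF strip_edge_tree[OF V]] 0(1) w(1) unfolding p by metis
    qed (use Suc in simp)
  qed simp
  moreover have "((n, B ^ n) \<in> D) \<noteq> ((0, 1) \<in> D) \<Longrightarrow> touched (edge_cut D) 1" for n
  proof (induction n)
    case (Suc n)
    have V: "(Suc n, B ^ Suc n) \<in> V" using M_ge by (simp add: mem_V)
    have p: "pidx (B ^ Suc n) = B ^ n"
      using M_ge by (subst pidx_eq_iff) (auto simp: mult.commute)
    show ?case
    proof (cases "((n, B ^ n) \<in> D) = ((Suc n, B ^ Suc n) \<in> D)")
      case False
      then show ?thesis using touchedI[OF strip_edge_tree[OF V]] 0(2) w(2) unfolding p by metis
    qed (use Suc in simp)
  qed simp
  ultimately show ?thesis using assms by blast
qed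

definition block_at :: "nat \<Rightarrow> vertex \<Rightarrow> nat" where
  "block_at n y = blk n ((pidx ^^ (fst y - n)) (snd y))"

lemma ancestor_V: "(n + r, k) \<in> V \<Longrightarrow> (n, (pidx ^^ r) k) \<in> V"
proof (induction r arbitrary: k)
  case (Suc r)
  have "(n + r, pidx k) \<in> V" using pidx_V[of "n + r" k] Suc.prems by simp
  then show ?case using Suc.IH by (simp add: funpow_Suc_right del: funpow.simps)
qed simp

lemma block_at_less: "y \<in> V \<Longrightarrow> n \<le> fst y \<Longrightarrow> block_at n y < M ^ n"
proof -
  assume "y \<in> V" "n \<le> fst y"
  then obtain r k where "y = (n + r, k)" "(n + r, k) \<in> V" by (metis le_Suc_ex prod.collapse)
  then show ?thesis using ancestor_V[of n r k] unfolding block_at_def by (auto simp: mem_V intro!: blk_less)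
qed

lemma block_at_div: "n \<le> n1 \<Longrightarrow> n1 \<le> fst y \<Longrightarrow> block_at n y = block_at n1 y div M ^ (n1 - n)"
proof -
  assume n: "n \<le> n1" "n1 \<le> fst y"
  obtain r where r: "n1 = n + r" using n(1) le_Suc_ex by blast
  have key: "blk n ((pidx ^^ r) i) = blk (n + r) i div M ^ r" for i
  proof (induction r arbitrary: i)
    case (Suc r)
    have "blk n ((pidx ^^ Suc r) i) = blk n ((pidx ^^ r) (pidx i))" by (simp add: funpow_Suc_right del: funpow.simps)
    also have "\<dots> = blk (n + r) (pidx i) div M ^ r" by (rule Suc.IH)
    also have "\<dots> = blk (n + Suc r) i div M ^ Suc r" by (simp add: blk_parent div_mult2_eq)
    finally show ?case .
  qed simp
  have "(pidx ^^ (fst y - n)) (snd y) = (pidx ^^ r) ((pidx ^^ (fst y - n1)) (snd y))"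
    using n unfolding r by (simp add: funpow_add[symmetric, THEN fun_cong, unfolded o_apply])
  then show ?thesis unfolding block_at_def using key r by simp
qed

text \<open>Below the cut neither tree edges nor horizontal edges change the status, so one can
  climb to depth \<open>n1\<close> and then walk along the block to its first vertex.\<close>

lemma deep_status:
  assumes deep: "\<And>e v. e \<in> edge_cut D \<Longrightarrow> v \<in> e \<Longrightarrow> fst v < n1" and y: "y \<in> V" "n1 \<le> fst y"
  shows "y \<in> D \<longleftrightarrow> (n1, bfirst n1 (block_at n1 y)) \<in> D"
proof -
  have same: "x \<in> D \<longleftrightarrow> z \<in> D" if "{x, z} \<in> strip_edges d M" "n1 \<le> fst z" for x z
    using edge_cutI[OF that(1)] deep[of "{x, z}" z] that(2) by force
  have up: "(n1 + r, k) \<in> D \<longleftrightarrow> (n1, (pidx ^^ r) k) \<in> D" if "(n1 + r, k) \<in> V" for r k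
    using that
  proof (induction r arbitrary: k)
    case (Suc r)
    have V: "(Suc (n1 + r), k) \<in> V" using Suc.prems by simp
    have "(n1 + r, pidx k) \<in> D \<longleftrightarrow> (Suc (n1 + r), k) \<in> D"
      by (rule same[OF strip_edge_tree[OF V]]) simp
    moreover have "(n1 + r, pidx k) \<in> D \<longleftrightarrow> (n1, (pidx ^^ r) (pidx k)) \<in> D" by (rule Suc.IH[OF pidx_V[OF V]])
    ultimately show ?case by (simp add: funpow_Suc_right del: funpow.simps)
  qed simp
  obtain r k where r: "y = (n1 + r, k)" using y(2) by (metis le_Suc_ex prod.collapse)
  define i where "i = (pidx ^^ r) k"
  have iV: "(n1, i) \<in> V" unfolding i_def using ancestor_V y(1) r by simp
  have i1: "1 \<le> i" "i \<le> B ^ n1" using iV by (auto simp: mem_V)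
  have row: "(n1, bfirst n1 (blk n1 i) + q) \<in> D \<longleftrightarrow> (n1, bfirst n1 (blk n1 i)) \<in> D"
    if "bfirst n1 (blk n1 i) + q \<le> i" for q
    using that
  proof (induction q)
    case (Suc q)
    let ?a = "bfirst n1 (blk n1 i) + q"
    have bl: "blk n1 ?a = blk n1 i" "blk n1 (?a + 1) = blk n1 i"
    proof -
      have "blk n1 (bfirst n1 (blk n1 i)) \<le> blk n1 ?a" "blk n1 ?a \<le> blk n1 (?a + 1)" "blk n1 (?a + 1) \<le> blk n1 i"
        using Suc.prems by (intro blk_mono; simp)+
      then show "blk n1 ?a = blk n1 i" "blk n1 (?a + 1) = blk n1 i" by simp_all
    qed
    have "n1 \<noteq> 0"
    proof
      assume "n1 = 0"
      then have "i \<le> 1" using i1(2) by simp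
      then show False using Suc.prems bfirst_pos(1)[of n1 "blk n1 i"] by linarith
    qed
    then obtain m where m: "n1 = Suc m" by (cases n1) auto
    have "proper m ?a" using bl Suc.prems i1 unfolding proper_def m by (simp add: trans_le_add1)
    then have "(n1, ?a) \<in> D \<longleftrightarrow> (n1, ?a + 1) \<in> D" using same[OF strip_edge_hor] m by simp
    then show ?case using Suc by simp
  qed simp
  have "y \<in> D \<longleftrightarrow> (n1, i) \<in> D" using up[of r k] y(1) unfolding r i_def by simp
  also have "\<dots> \<longleftrightarrow> (n1, bfirst n1 (blk n1 i)) \<in> D"
    using row[of "i - bfirst n1 (blk n1 i)"] blk_range[OF i1(1), of n1] by simp
  finally show ?thesis unfolding block_at_def i_def r by simp
qed

lemma status_change:
  fixes P :: "nat \<Rightarrow> bool"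
  assumes "a \<le> b" "P a \<noteq> P b"
  obtains j where "a \<le> j" "j < b" "P j \<noteq> P (j + 1)"
proof -
  have "\<exists>j. a \<le> j \<and> j < b \<and> P j \<noteq> P (j + 1)"
  proof (rule ccontr)
    assume n: "\<not> ?thesis"
    have "P (a + q) = P a" if "a + q \<le> b" for q
      using that by (induction q) (use n in \<open>auto simp: less_eq_Suc_le\<close>)
    from this[of "b - a"] show False using assms by simp
  qed
  then show thesis using that by blast
qed

text \<open>The status of the blocks of depth \<open>n1\<close> changes at a gap inside the common
  block of depth \<open>n0\<close>, and such a gap is no wall point of a level below
  \<open>n0\<close>. Around the cycle of these blocks, closed up through the outer borders, the
  number of changes is even, so there is a second one.\<close>

lemma two_touched:
  assumes deep: "\<And>e v. e \<in> edge_cut D \<Longrightarrow> v \<in> e \<Longrightarrow> fst v < n1" and n: "n0 \<le> n1"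
    and y: "y \<in> V" "n1 \<le> fst y" "y \<notin> D" and y': "y' \<in> V" "n1 \<le> fst y'" "y' \<in> D"
    and same: "block_at n0 y = block_at n0 y'"
  obtains g g' where "touched (edge_cut D) g" "touched (edge_cut D) g'" "g \<noteq> g'" "\<And>l. wall_point l g \<Longrightarrow> n0 \<le> l"
proof -
  define st where "st j = ((n1, bfirst n1 j) \<in> D)" for j
  have n1V: "(n1, i) \<in> V \<Longrightarrow> (n1, i) \<in> D \<longleftrightarrow> st (blk n1 i)" for i
    using deep_status[OF deep, where y = "(n1, i)"] unfolding st_def block_at_def by simp
  \<comment> \<open>\<open>K\<close> blocks of depth \<open>n1\<close> make up one block of depth
    \<open>n0\<close>. Equal quotients by \<open>K\<close> say that the gap between \<open>j\<close>
    and \<open>j + 1\<close> is inside such a block.\<close>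
  define K where "K = M ^ (n1 - n0)"
  have K: "0 < K" unfolding K_def by simp
  have last: "(n1, blast n1 j) \<in> D \<longleftrightarrow> st j" if "j < M ^ n1" for j
    using n1V[of "blast n1 j"] blast_le[OF that] by (simp add: mem_V)
  have tch: "touched (edge_cut D) (real (j + 1) / real M ^ n1)" if "j + 1 < M ^ n1" "st j \<noteq> st (j + 1)" for j
    using gap_touched[OF that(1)] last[of j] that unfolding st_def[of "j + 1"] by simp
  let ?a = "block_at n1 y" and ?b = "block_at n1 y'"
  have ab: "\<not> st ?a" "st ?b" "?a < M ^ n1" "?b < M ^ n1" "?a div K = ?b div K"
    using deep_status[OF deep y(1,2)] deep_status[OF deep y'(1,2)] y(3) y'(3) block_at_less y y'
      same block_at_div[OF n y(2)] block_at_div[OF n y'(2)] unfolding st_def K_def by auto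
  obtain j where j: "j + 1 < M ^ n1" "st j \<noteq> st (j + 1)" "j div K = (j + 1) div K"
  proof (cases "?a \<le> ?b")
    case True
    obtain j where *: "?a \<le> j" "j < ?b" "st j \<noteq> st (j + 1)" using status_change[OF True, of st] ab by blast
    have "?a div K \<le> j div K" "j div K \<le> (j + 1) div K" "(j + 1) div K \<le> ?b div K"
      using * by (intro div_le_mono; simp)+
    then have "j div K = (j + 1) div K" using ab(5) by linarith
    moreover have "j + 1 < M ^ n1" using *(2) ab(4) by linarith
    ultimately show thesis using that *(3) by blast
  next
    case False
    have le: "?b \<le> ?a" "st ?b \<noteq> st ?a" using False ab(1,2) by simp_all
    obtain j where *: "?b \<le> j" "j < ?a" "st j \<noteq> st (j + 1)" by (rule status_change[of ?b ?a st, OF le]) (rule that)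
    have "?b div K \<le> j div K" "j div K \<le> (j + 1) div K" "(j + 1) div K \<le> ?a div K"
      using * by (intro div_le_mono; simp)+
    then have "j div K = (j + 1) div K" using ab(5) by linarith
    moreover have "j + 1 < M ^ n1" using *(2) ab(3) by linarith
    ultimately show thesis using that *(3) by blast
  qed
  let ?g = "real (j + 1) / real M ^ n1"
  have Mn: "0 < real M ^ n1" by simp
  have wp: "n0 \<le> l" if w: "wall_point l ?g" for l
  proof (rule ccontr)
    assume "\<not> n0 \<le> l"
    then obtain q where q: "n0 = Suc l + q" using less_imp_Suc_add[of l n0] by auto
    obtain a :: nat where a: "?g = real a / real M ^ (l + 1)" using w unfolding wall_point_def by blast
    have e: "n1 = (l + 1) + (q + (n1 - n0))" using n q by simp
    have "real (j + 1) = real a * real M ^ (q + (n1 - n0))"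
    proof -
      have "real M ^ n1 = real M ^ (l + 1) * real M ^ (q + (n1 - n0))" by (subst e) (rule power_add)
      moreover have "J = A * Y" if "J / (X * Y) = A / X" "0 < X" "0 < Y" for J A X Y :: real
        using that by (simp add: field_simps)
      ultimately show ?thesis using a by simp
    qed
    then have "real (j + 1) = real (a * M ^ (q + (n1 - n0)))" by simp
    then have "j + 1 = a * M ^ (q + (n1 - n0))" by (rule of_nat_eq_iff[THEN iffD1])
    then have "j + 1 = a * M ^ q * K" unfolding K_def by (simp add: power_add)
    then have "(j + 1) mod K = 0" by simp
    then have "(j + 1) div K = j div K + 1" using K by (simp add: div_Suc)
    then show False using j(3) by simp
  qed
  obtain g' where g': "touched (edge_cut D) g'" "?g \<noteq> g'"
  proof (cases "st 0 = st (M ^ n1 - 1)")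
    case False
    have "(n1, 1) = (n1, bfirst n1 0)" by (simp add: bfirst_def)
    moreover have "(n1, B ^ n1) = (n1, blast n1 (M ^ n1 - 1))" by (simp add: blast_def B_power)
    ultimately have "((n1, 1) \<in> D) \<noteq> ((n1, B ^ n1) \<in> D)"
      using False last[of "M ^ n1 - 1"] unfolding st_def[of 0] by simp
    then have "touched (edge_cut D) 0 \<or> touched (edge_cut D) 1" by (rule outer_touched)
    moreover have "?g \<noteq> 0" using Mn by simp
    moreover have "?g \<noteq> 1"
    proof
      assume "?g = 1"
      then have "real (j + 1) = real (M ^ n1)" using Mn by simp
      then show False using j(1) by (simp only: of_nat_eq_iff)
    qed
    ultimately show thesis using that by blast
  next
    case True
    have "\<exists>j'. j' \<noteq> j \<and> j' + 1 < M ^ n1 \<and> st j' \<noteq> st (j' + 1)"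
    proof (cases "st 0 = st j")
      case False
      obtain j' where "0 \<le> j'" "j' < j" "st j' \<noteq> st (j' + 1)" by (rule status_change[of 0 j st, OF _ False]) (simp, rule that)
      then show ?thesis using j(1) by (intro exI[of _ j']) auto
    next
      case st0: True
      then have ch: "st (j + 1) \<noteq> st (M ^ n1 - 1)" using True j(2) by simp
      have le: "j + 1 \<le> M ^ n1 - 1" using j(1) by linarith
      obtain j' where "j + 1 \<le> j'" "j' < M ^ n1 - 1" "st j' \<noteq> st (j' + 1)"
        by (rule status_change[OF le ch]) (rule that)
      then show ?thesis by (intro exI[of _ j']) auto
    qed
    then obtain j' where j': "j' \<noteq> j" "j' + 1 < M ^ n1" "st j' \<noteq> st (j' + 1)" by blast
    have "?g \<noteq> real (j' + 1) / real M ^ n1" using j'(1) Mn by simp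
    then show thesis using that tch[OF j'(2,3)] by blast
  qed
  show thesis using that[OF tch[OF j(1,2)] g'] wp by blast
qed

end

context percolation
begin

text \<open>With \<open>l\<close> the depth of \<open>f 0\<close>, the levels stay between
  \<open>l - L\<close> and \<open>l + L\<close>. Passing through common points bounds the distance
  of \<open>g\<close> and \<open>g'\<close> by \<open>(L + 1) / B ^ (l - L)\<close>, while different
  points with denominator \<open>M ^ (l + L + 1)\<close> are at least its inverse apart. As
  \<open>L + 1 \<le> M ^ L\<close> and \<open>d \<ge> 4\<close>, this gives
  \<open>4 * (l - L) \<le> l + 2 * L + 1\<close>, which fails for \<open>l > 2 * L\<close>.\<close>

lemma chain_length:
  assumes d: "4 \<le> d" and f: "\<And>i. i < L \<Longrightarrow> (f i, f (Suc i)) \<in> chain_rel \<omega>"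
    and g: "touches (f 0) g" "wall_point (fst (f 0)) g" and g': "touches (f L) g'" "wall_point (fst (f L)) g'"
    and ne: "g \<noteq> g'"
  shows "fst (f 0) \<le> 2 * L"
proof (rule ccontr)
  assume "\<not> ?thesis"
  then have l: "2 * L < fst (f 0)" by simp
  let ?l = "fst (f 0)"
  have step: "\<exists>c. touches (f i) c \<and> touches (f (Suc i)) c \<and> fst (f i) \<le> fst (f (Suc i)) + 1 \<and> fst (f (Suc i)) \<le> fst (f i) + 1"
    if i: "i < L" for i
  proof -
    obtain n k where nk: "proper n k" "f i \<in> cell n k" "f (Suc i) \<in> cell n k"
      using f[OF i] unfolding chain_rel_def by blast
    obtain c where c: "\<And>v. v \<in> cell n k \<Longrightarrow> touches v c" using cell_common_point[OF nk(1)] by blast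
    have lv: "n \<le> fst v \<and> fst v \<le> Suc n" if "v \<in> cell n k" for v using that by (auto simp: cell_def)
    show ?thesis using c[OF nk(2)] c[OF nk(3)] lv[OF nk(2)] lv[OF nk(3)] by (intro exI[of _ c]) linarith
  qed
  have lev: "?l \<le> fst (f t) + t \<and> fst (f t) \<le> ?l + t" if "t \<le> L" for t
    using that
  proof (induction t)
    case (Suc t)
    then show ?case using step[of t] by fastforce
  qed simp
  have B: "1 \<le> real B" using B_ge by linarith
  let ?w = "1 / real B ^ (?l - L)"
  have w: "1 / real B ^ fst (f t) \<le> ?w" if "t \<le> L" for t
    using lev[OF that] that B by (intro divide_left_mono power_increasing) auto
  have dist: "\<bar>a - g\<bar> \<le> real (t + 1) * ?w" if "t \<le> L" "touches (f t) a" for t a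
    using that
  proof (induction t arbitrary: a)
    case 0
    then show ?case using touches_dist[OF 0(2) g(1)] w[of 0] by simp
  next
    case (Suc t)
    obtain c where c: "touches (f t) c" "touches (f (Suc t)) c" using step[of t] Suc.prems(1) by auto
    have "\<bar>c - g\<bar> \<le> real (t + 1) * ?w" using Suc.IH[OF _ c(1)] Suc.prems(1) by simp
    moreover have "\<bar>a - c\<bar> \<le> ?w" using touches_dist[OF Suc.prems(2) c(2)] w[OF Suc.prems(1)] by linarith
    moreover have "real (Suc t + 1) * ?w = real (t + 1) * ?w + ?w" by (simp add: add_divide_distrib)
    ultimately show ?case by linarith
  qed
  have up: "\<bar>g' - g\<bar> \<le> real (L + 1) * ?w" by (rule dist[OF order_refl g'(1)])
  let ?q = "?l + L"
  obtain a where a: "g = real a / real M ^ (?q + 1)"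
    using wall_point_mono[OF g(2), of ?q] unfolding wall_point_def by auto
  obtain a' where a': "g' = real a' / real M ^ (?q + 1)"
    using wall_point_mono[OF g'(2), of ?q] lev[OF order_refl] unfolding wall_point_def by auto
  have "a \<noteq> a'" using a a' ne by auto
  then have "1 \<le> \<bar>real a' - real a\<bar>" by linarith
  moreover have "\<bar>g' - g\<bar> = \<bar>real a' - real a\<bar> / real M ^ (?q + 1)" unfolding a a' by (simp add: diff_divide_distrib[symmetric] abs_divide)
  ultimately have low: "1 / real M ^ (?q + 1) \<le> \<bar>g' - g\<bar>" by (simp add: divide_right_mono)
  have pos: "0 < real M ^ (?q + 1)" "0 < real B ^ (?l - L)" using real_B_pos by simp_all
  have "1 / real M ^ (?q + 1) \<le> real (L + 1) / real B ^ (?l - L)" using low up by simp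
  then have "real B ^ (?l - L) \<le> real (L + 1) * real M ^ (?q + 1)" using pos by (simp add: divide_simps mult.commute)
  then have "real (B ^ (?l - L)) \<le> real ((L + 1) * M ^ (?q + 1))" by (simp only: of_nat_mult of_nat_power)
  then have "B ^ (?l - L) \<le> (L + 1) * M ^ (?q + 1)" by (rule of_nat_le_iff[THEN iffD1])
  also have "L + 1 \<le> M ^ L"
  proof -
    have "L < 2 ^ L" by simp
    also have "(2::nat) ^ L \<le> M ^ L" using M_ge by (intro power_mono) auto
    finally show ?thesis by simp
  qed
  finally have "M ^ (d * (?l - L)) \<le> M ^ (L + (?q + 1))" by (simp add: power_mult power_add mult_ac)
  then have "d * (?l - L) \<le> L + (?q + 1)" using M_ge by (subst (asm) power_increasing_iff) auto
  moreover have "4 * (?l - L) \<le> d * (?l - L)" using d by (rule mult_le_mono1)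
  ultimately have "4 * (?l - L) \<le> L + (?q + 1)" by (rule order_trans[rotated])
  then show False using l by linarith
qed

text \<open>The copy may differ from edge to edge, since all open copies of a fertile vertex are in
  one cluster.\<close>

definition ok_rel :: "(side \<times> vertex \<Rightarrow> bool) \<Rightarrow> (vertex \<times> vertex) set" where
  "ok_rel \<omega> = {(x, y). {x, y} \<in> strip_edges d M \<and> fertile \<omega> x \<and> fertile \<omega> y \<and> (\<exists>s. \<omega> (s, x) \<and> \<omega> (s, y))}"

lemma ok_V: "(x, y) \<in> (ok_rel \<omega>)\<^sup>* \<Longrightarrow> x \<in> V \<Longrightarrow> y \<in> V"
  by (induction rule: rtrancl_induct) (use strip_edge_V in \<open>auto simp: ok_rel_def\<close>)

definition wall_verts :: "nat \<Rightarrow> vertex set" where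
  "wall_verts l = {v \<in> V. fst v = l \<and> (\<exists>g. touches v g \<and> wall_point l g)}"

text \<open>\<open>(l + 1) div 2\<close> is half the depth rounded up, the length guaranteed by
  \<open>chain_length\<close>.\<close>

definition bad_level :: "nat \<Rightarrow> (side \<times> vertex \<Rightarrow> bool) \<Rightarrow> bool" where
  "bad_level l \<omega> \<longleftrightarrow> (\<exists>w\<in>wall_verts l. \<exists>xs\<in>walks next_chain ((l + 1) div 2) w. chain_event w xs \<omega>)"

text \<open>
  Two different good components reaching infinitely far into the same strip are separated by a cut that is
  connected through cells. It is met by a chain that is infinite or joins the walls of two different gaps.
\<close>
lemma components_merge:
  assumes d: "4 \<le> d"
    and fin: "\<And>v. v \<in> V \<Longrightarrow> finite ((chain_rel \<omega>)\<^sup>* `` {v})"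
    and nb: "\<And>l. n0 \<le> l \<Longrightarrow> \<not> bad_level l \<omega>"
    and x: "x1 \<in> V" "x2 \<in> V"
    and inf1: "infinite {y \<in> (ok_rel \<omega>)\<^sup>* `` {x1}. n0 \<le> fst y \<and> block_at n0 y = \<beta>}"
    and inf2: "infinite {y \<in> (ok_rel \<omega>)\<^sup>* `` {x2}. n0 \<le> fst y \<and> block_at n0 y = \<beta>}"
  shows "(x1, x2) \<in> (ok_rel \<omega>)\<^sup>*"
proof (rule ccontr)
  assume sep: "(x1, x2) \<notin> (ok_rel \<omega>)\<^sup>*"
  define A where "A = (ok_rel \<omega>)\<^sup>* `` {x1}"
  \<comment> \<open>\<open>D\<close> is the component of \<open>x2\<close> in the whole complement
    of \<open>A\<close>, not only under \<open>ok_rel\<close>. In this way both sides of the cut are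
    connected and all its outer ends are in \<open>A\<close>.\<close>
  define D where "D = (adj (V - A))\<^sup>* `` {x2}"
  have AV: "A \<subseteq> V" unfolding A_def using ok_V x(1) by blast
  have x2A: "x2 \<in> V - A" using sep x(2) unfolding A_def by blast
  have D_sub: "D \<subseteq> V - A"
  proof
    fix y assume "y \<in> D"
    then have "(x2, y) \<in> (adj (V - A))\<^sup>*" unfolding D_def by simp
    then show "y \<in> V - A" by (cases rule: rtranclE) (use x2A in \<open>auto simp: adj_def\<close>)
  qed
  have Aconn: "(a, b) \<in> (adj A)\<^sup>*" if ab: "a \<in> A" "b \<in> A" for a b
  proof -
    have from1: "(x1, c) \<in> (adj A)\<^sup>*" if "c \<in> A" for c
    proof -
      have "(x1, c) \<in> (ok_rel \<omega>)\<^sup>*" using that unfolding A_def by simp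
      then show ?thesis
      proof (induction rule: rtrancl_induct)
        case (step y z)
        have "y \<in> A" "z \<in> A" unfolding A_def using step(1,2) by (auto intro: rtrancl_into_rtrancl)
        then have "(y, z) \<in> adj A" using step(2) unfolding adj_def ok_rel_def by simp
        then show ?case using step.IH by (rule rtrancl_into_rtrancl[rotated])
      qed simp
    qed
    show ?thesis using adj_rtrancl_sym[OF from1[OF ab(1)]] from1[OF ab(2)] by (rule rtrancl_trans)
  qed
  have Dconn: "(a, b) \<in> (adj D)\<^sup>*" if ab: "a \<in> D" "b \<in> D" for a b
  proof -
    have from2: "(x2, c) \<in> (adj D)\<^sup>*" if "c \<in> D" for c
    proof -
      have "(x2, c) \<in> (adj (V - A))\<^sup>*" using that unfolding D_def by simp
      then show ?thesis
      proof (induction rule: rtrancl_induct)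
        case (step y z)
        have "y \<in> D" "z \<in> D" unfolding D_def using step(1,2) by (auto intro: rtrancl_into_rtrancl)
        then have "(y, z) \<in> adj D" using step(2) unfolding adj_def by simp
        then show ?case using step.IH by (rule rtrancl_into_rtrancl[rotated])
      qed simp
    qed
    show ?thesis using adj_rtrancl_sym[OF from2[OF ab(1)]] from2[OF ab(2)] by (rule rtrancl_trans)
  qed
  have nbr: "z \<in> A" if "y \<in> D" "z \<notin> D" "{y, z} \<in> strip_edges d M" for y z
  proof (rule ccontr)
    assume "z \<notin> A"
    then have "(y, z) \<in> adj (V - A)" using that D_sub strip_edge_V[OF that(3)] unfolding adj_def by auto
    then show False using that(1,2) unfolding D_def by (auto intro: rtrancl_into_rtrancl)
  qed
  have disj: "A \<inter> D = {}" using D_sub by blast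
  \<comment> \<open>If both ends of a cut edge were fertile and open in one copy,
    \<open>ok_rel\<close> would contain the edge and \<open>A\<close> would extend into
    \<open>D\<close>. So every cut edge has a bad vertex for each copy.\<close>
  have badU: "\<exists>z\<in>e. bad Upper \<omega> z" and badL: "\<exists>z\<in>e. bad Lower \<omega> z" if e: "e \<in> edge_cut D" for e
  proof -
    obtain y z where yz: "e = {y, z}" "y \<in> D" "z \<notin> D" "{y, z} \<in> strip_edges d M" using e unfolding edge_cut_def by blast
    have z: "z \<in> A" by (rule nbr[OF yz(2-4)])
    have "(z, y) \<notin> ok_rel \<omega>" using z disj yz(2) unfolding A_def by (auto intro: rtrancl_into_rtrancl)
    then have "\<not> fertile \<omega> y \<or> \<not> fertile \<omega> z \<or> (\<forall>s. \<not> \<omega> (s, y) \<or> \<not> \<omega> (s, z))"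
      using yz(4) insert_commute[of y z] unfolding ok_rel_def by auto
    then show "\<exists>z\<in>e. bad Upper \<omega> z" "\<exists>z\<in>e. bad Lower \<omega> z" unfolding yz(1) bad_def by auto
  qed
  obtain \<zeta> where \<zeta>: "\<And>e. e \<in> edge_cut D \<Longrightarrow> \<zeta> e \<in> e \<and> bad Upper \<omega> (\<zeta> e)" using badU by metis
  have chain: "(\<zeta> e, \<zeta> f) \<in> (chain_rel \<omega>)\<^sup>*" if e: "e \<in> edge_cut D" and f: "f \<in> edge_cut D" for e f
  proof -
    have "(e, f) \<in> {(e, f). e \<in> edge_cut D \<and> f \<in> edge_cut D \<and> (\<exists>n k. proper n k \<and> e \<union> f \<subseteq> cell n k)}\<^sup>*"
      using cut_connected[of A D e f] Aconn Dconn disj nbr e f by blast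
    then show ?thesis
    proof (induction rule: rtrancl_induct)
      case (step g h)
      then obtain n k where nk: "g \<in> edge_cut D" "h \<in> edge_cut D" "proper n k" "g \<union> h \<subseteq> cell n k" by blast
      have "\<zeta> g = \<zeta> h \<or> (\<zeta> g, \<zeta> h) \<in> chain_rel \<omega>"
        using \<zeta>[OF nk(1)] \<zeta>[OF nk(2)] badL[OF nk(1)] nk(3,4) unfolding chain_rel_def by blast
      then show ?case using step.IH by (auto intro: rtrancl_into_rtrancl)
    qed simp
  qed
  have eV: "v \<in> V" if "e \<in> edge_cut D" "v \<in> e" for e v
    using that strip_edge_V unfolding edge_cut_def by blast
  \<comment> \<open>The chosen upper bad vertices of all cut edges are in the finite chain component
    of one of them, so the cut has bounded depth.\<close>
  have "\<exists>N. \<forall>e\<in>edge_cut D. \<forall>v\<in>e. fst v < N"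
  proof (cases "edge_cut D = {}")
    case False
    then obtain e0 where e0: "e0 \<in> edge_cut D" by blast
    have f: "finite ((chain_rel \<omega>)\<^sup>* `` {\<zeta> e0})" by (rule fin) (use \<zeta>[OF e0] eV[OF e0] in blast)
    define m where "m = Max (fst ` ((chain_rel \<omega>)\<^sup>* `` {\<zeta> e0}))"
    have m: "fst (\<zeta> e) \<le> m" if "e \<in> edge_cut D" for e
      unfolding m_def using chain[OF e0 that] f by (intro Max_ge) auto
    have "fst v < m + 2" if e: "e \<in> edge_cut D" and v: "v \<in> e" for e v
    proof -
      have es: "e \<in> strip_edges d M" using e unfolding edge_cut_def by blast
      then have "fst v \<le> fst (\<zeta> e) + 1" using v \<zeta>[OF e] by (cases rule: strip_edge_cases) auto
      then show ?thesis using m[OF e] by simp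
    qed
    then show ?thesis by blast
  qed simp
  then obtain N where N: "\<And>e v. e \<in> edge_cut D \<Longrightarrow> v \<in> e \<Longrightarrow> fst v < N" by blast
  define n1 where "n1 = max N n0"
  have deep: "fst v < n1" if "e \<in> edge_cut D" "v \<in> e" for e v using N[OF that] unfolding n1_def by simp
  have finlev: "finite {y \<in> V. fst y < n1}"
  proof (rule finite_subset)
    show "{y \<in> V. fst y < n1} \<subseteq> (\<Union>n\<in>{..<n1}. Pair n ` {..B ^ n})" by (auto simp: mem_V)
  qed simp
  have pick: "\<exists>y\<in>S. n1 \<le> fst y" if "infinite S" "S \<subseteq> V" for S
  proof (rule ccontr)
    assume "\<not> ?thesis"
    then have "S \<subseteq> {y \<in> V. fst y < n1}" using that(2) by auto
    then show False using finlev that(1) finite_subset by blast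
  qed
  obtain y1 where y1: "y1 \<in> A" "n0 \<le> fst y1" "block_at n0 y1 = \<beta>" "n1 \<le> fst y1"
  proof -
    have "{y \<in> (ok_rel \<omega>)\<^sup>* `` {x1}. n0 \<le> fst y \<and> block_at n0 y = \<beta>} \<subseteq> V" using AV unfolding A_def by blast
    from pick[OF inf1 this] show thesis using that unfolding A_def by blast
  qed
  obtain y2 where y2: "(x2, y2) \<in> (ok_rel \<omega>)\<^sup>*" "n0 \<le> fst y2" "block_at n0 y2 = \<beta>" "n1 \<le> fst y2"
  proof -
    have "{y \<in> (ok_rel \<omega>)\<^sup>* `` {x2}. n0 \<le> fst y \<and> block_at n0 y = \<beta>} \<subseteq> V" using ok_V x(2) by blast
    from pick[OF inf2 this] show thesis using that by blast
  qed
  have "y2 \<in> D" using y2(1)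
  proof (induction rule: rtrancl_induct)
    case (step y z)
    have "z \<notin> A"
    proof
      assume "z \<in> A"
      moreover have "(z, y) \<in> ok_rel \<omega>" using step(2) by (auto simp: ok_rel_def insert_commute)
      ultimately have "y \<in> A" unfolding A_def by (auto intro: rtrancl_into_rtrancl)
      then show False using step.IH disj by blast
    qed
    moreover have "{y, z} \<in> strip_edges d M" using step(2) by (auto simp: ok_rel_def)
    ultimately show ?case using nbr[OF step.IH] by blast
  qed (simp add: D_def)
  have y1D: "y1 \<notin> D" using y1(1) disj by blast
  obtain g g' where g: "touched (edge_cut D) g" "touched (edge_cut D) g'" "g \<noteq> g'" "\<And>l. wall_point l g \<Longrightarrow> n0 \<le> l"
  proof -
    have n01: "n0 \<le> n1" by (simp add: n1_def)
    have y1V: "y1 \<in> V" using y1(1) AV by blast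
    have same: "block_at n0 y1 = block_at n0 y2" using y1(3) y2(3) by simp
    show thesis
      by (rule two_touched[where D = D and ?n1.0 = n1 and ?n0.0 = n0 and y = y1 and y' = y2])
        (use deep n01 y1V y1(4) y1D ok_V[OF y2(1) x(2)] y2(4) \<open>y2 \<in> D\<close> same that in blast)+
  qed
  obtain e where e: "e \<in> edge_cut D" "\<And>v. v \<in> e \<Longrightarrow> touches v g \<and> wall_point (fst v) g" using g(1) unfolding touched_def by blast
  obtain e' where e': "e' \<in> edge_cut D" "\<And>v. v \<in> e' \<Longrightarrow> touches v g' \<and> wall_point (fst v) g'" using g(2) unfolding touched_def by blast
  obtain L f where f: "f 0 = \<zeta> e" "f L = \<zeta> e'" "\<And>i. i < L \<Longrightarrow> (f i, f (Suc i)) \<in> chain_rel \<omega>" "inj_on f {..L}"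
    by (rule simple_path[OF chain[OF e(1) e'(1)]]) (rule that)
  have t: "touches (f 0) g" "wall_point (fst (f 0)) g" "touches (f L) g'" "wall_point (fst (f L)) g'"
    using e(2) e'(2) \<zeta>[OF e(1)] \<zeta>[OF e'(1)] unfolding f(1,2) by blast+
  let ?l = "fst (f 0)"
  have "?l \<le> 2 * L" by (rule chain_length[OF d f(3) t g(3)])
  then have le: "(?l + 1) div 2 \<le> L" by simp
  have "\<exists>xs\<in>walks next_chain ((?l + 1) div 2) (f 0). chain_event (f 0) xs \<omega>"
  proof (rule chain_of_path)
    show "(f t, f (Suc t)) \<in> chain_rel \<omega>" if "t < (?l + 1) div 2" for t using f(3) that le by simp
    show "inj_on f {..(?l + 1) div 2}" by (rule inj_on_subset[OF f(4)]) (use le in auto)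
    show "bad Upper \<omega> (f 0)" unfolding f(1) using \<zeta>[OF e(1)] by blast
  qed
  moreover have "f 0 \<in> wall_verts ?l"
    unfolding wall_verts_def using t(1,2) eV[OF e(1)] \<zeta>[OF e(1)] f(1) by auto
  ultimately have "bad_level ?l \<omega>" unfolding bad_level_def by blast
  then show False using nb[OF g(4)[OF t(2)]] by blast
qed

end

section \<open>Clusters and measurability\<close>

lemma open_adj_sym: "sym (open_adj W E \<omega>)"
  by (auto simp: sym_def open_adj_def insert_commute)

lemma open_conn_sym: "(u, v) \<in> (open_adj W E \<omega>)\<^sup>* \<Longrightarrow> (v, u) \<in> (open_adj W E \<omega>)\<^sup>*"
  using sym_rtrancl[OF open_adj_sym] by (rule symD)

lemma open_conn_mem: "(u, v) \<in> (open_adj W E \<omega>)\<^sup>* \<Longrightarrow> u \<in> W \<Longrightarrow> \<omega> u \<Longrightarrow> v \<in> W \<and> \<omega> v"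
  by (induction rule: rtrancl_induct) (auto simp: open_adj_def)

lemma cluster_eq:
  assumes "C1 \<in> open_clusters W E \<omega>" "C2 \<in> open_clusters W E \<omega>" "a \<in> C1" "b \<in> C2"
    "(a, b) \<in> (open_adj W E \<omega>)\<^sup>*"
  shows "C1 = C2"
proof -
  let ?R = "(open_adj W E \<omega>)\<^sup>*"
  obtain u v where C: "C1 = ?R `` {u}" "C2 = ?R `` {v}" using assms(1,2) unfolding open_clusters_def by blast
  have ua: "(u, a) \<in> ?R" and vb: "(v, b) \<in> ?R" using assms(3,4) C by auto
  have uv: "(u, v) \<in> ?R" by (rule rtrancl_trans[OF rtrancl_trans[OF ua assms(5)] open_conn_sym[OF vb]])
  show ?thesis unfolding C using rtrancl_trans[OF uv] rtrancl_trans[OF open_conn_sym[OF uv]] by blast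
qed

context
  fixes W :: "'v set" and E :: "'v set set"
  assumes countable_W: "countable W"
begin

lemma local_adj: "local_event W W (\<lambda>\<omega>. (u, v) \<in> open_adj W E \<omega>)"
proof (cases "u \<in> W \<and> v \<in> W")
  case True
  have site: "local_event W W (\<lambda>\<omega>. \<omega> w)" if "w \<in> W" for w
    by (rule local_event_mono[OF local_event_site[OF that]]) (use that in simp)
  show ?thesis unfolding open_adj_def mem_Collect_eq prod.case
    by (intro local_event_conj local_event_const site) (use True in simp_all)
next
  case False
  then have "(\<lambda>\<omega>. (u, v) \<in> open_adj W E \<omega>) = (\<lambda>\<omega>. False)" by (auto simp: open_adj_def)
  then show ?thesis using local_event_const[of W W False] by simp
qed

lemma local_conn: "local_event W W (\<lambda>\<omega>. (u, v) \<in> (open_adj W E \<omega>)\<^sup>*)"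
proof -
  have "local_event W W (\<lambda>\<omega>. (u, v) \<in> open_adj W E \<omega> ^^ n)" for n v
  proof (induction n arbitrary: v)
    case 0
    then show ?case using local_event_const[of W W "u = v"] by simp
  next
    case (Suc n)
    have "((u, v) \<in> open_adj W E \<omega> ^^ Suc n) = (\<exists>w\<in>W. (u, w) \<in> open_adj W E \<omega> ^^ n \<and> (w, v) \<in> open_adj W E \<omega>)" for \<omega>
      by (auto simp: open_adj_def)
    then show ?case using local_event_bex[OF countable_W local_event_conj[OF Suc local_adj]] by simp
  qed
  then show ?thesis
    using local_event_bex[of "UNIV :: nat set" W W "\<lambda>n \<omega>. (u, v) \<in> open_adj W E \<omega> ^^ n"] by (simp add: rtrancl_power)
qed

text \<open>A cluster is infinite if no finite set covers it, and \<open>W\<close> has only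
  countably many finite subsets.\<close>

lemma local_infinite_cluster:
  assumes v: "v \<in> W"
  shows "local_event W W (\<lambda>\<omega>. \<omega> v \<and> infinite ((open_adj W E \<omega>)\<^sup>* `` {v}))"
proof -
  have site: "local_event W W (\<lambda>\<omega>. \<omega> v)"
    by (rule local_event_mono[OF local_event_site[OF v]]) (use v in simp)
  have "(\<omega> v \<and> infinite ((open_adj W E \<omega>)\<^sup>* `` {v})) =
      (\<omega> v \<and> (\<forall>F\<in>{F. finite F \<and> F \<subseteq> W}. \<exists>w\<in>W - F. (v, w) \<in> (open_adj W E \<omega>)\<^sup>*))" (is "?l \<omega> = ?r \<omega>") for \<omega>
  proof (cases "\<omega> v")
    case True
    let ?C = "(open_adj W E \<omega>)\<^sup>* `` {v}"
    have CW: "?C \<subseteq> W" using open_conn_mem[where \<omega> = \<omega> and u = v] v True by blast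
    have "infinite ?C \<longleftrightarrow> (\<forall>F\<in>{F. finite F \<and> F \<subseteq> W}. \<exists>w\<in>W - F. (v, w) \<in> (open_adj W E \<omega>)\<^sup>*)"
    proof
      assume inf: "infinite ?C"
      show "\<forall>F\<in>{F. finite F \<and> F \<subseteq> W}. \<exists>w\<in>W - F. (v, w) \<in> (open_adj W E \<omega>)\<^sup>*"
      proof
        fix F assume "F \<in> {F. finite F \<and> F \<subseteq> W}"
        then have "\<not> ?C \<subseteq> F" using inf finite_subset by blast
        then show "\<exists>w\<in>W - F. (v, w) \<in> (open_adj W E \<omega>)\<^sup>*" using CW by blast
      qed
    next
      assume all: "\<forall>F\<in>{F. finite F \<and> F \<subseteq> W}. \<exists>w\<in>W - F. (v, w) \<in> (open_adj W E \<omega>)\<^sup>*"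
      show "infinite ?C"
      proof
        assume "finite ?C"
        then obtain w where "w \<in> W - ?C" "(v, w) \<in> (open_adj W E \<omega>)\<^sup>*" using all CW by blast
        then show False by blast
      qed
    qed
    then show ?thesis using True by simp
  qed simp
  moreover have "local_event W W ?r"
    by (intro local_event_conj site local_event_ball local_event_bex local_conn
        countable_Collect_finite_subset[OF countable_W] countable_subset[OF Diff_subset countable_W])
  ultimately show ?thesis by simp
qed

lemma infinite_cluster_iff:
  "(\<exists>C. C \<in> infinite_open_clusters W E \<omega>) \<longleftrightarrow> (\<exists>v\<in>W. \<omega> v \<and> infinite ((open_adj W E \<omega>)\<^sup>* `` {v}))"
  unfolding infinite_open_clusters_def open_clusters_def by blast

text \<open>Uniqueness is expressed through countably many pairs of vertices, which makes the event
  measurable.\<close>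

lemma unique_cluster_iff:
  "(\<exists>!C. C \<in> infinite_open_clusters W E \<omega>) \<longleftrightarrow>
    (\<exists>v\<in>W. \<omega> v \<and> infinite ((open_adj W E \<omega>)\<^sup>* `` {v})) \<and>
    (\<forall>v\<in>W. \<forall>w\<in>W. \<not> ((\<omega> v \<and> infinite ((open_adj W E \<omega>)\<^sup>* `` {v})) \<and>
       (\<omega> w \<and> infinite ((open_adj W E \<omega>)\<^sup>* `` {w})) \<and> (v, w) \<notin> (open_adj W E \<omega>)\<^sup>*))"
  (is "?l \<longleftrightarrow> ?e \<and> ?u")
proof
  let ?R = "(open_adj W E \<omega>)\<^sup>*"
  have mem: "?R `` {v} \<in> infinite_open_clusters W E \<omega>" if "v \<in> W" "\<omega> v" "infinite (?R `` {v})" for v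
    unfolding infinite_open_clusters_def open_clusters_def using that by blast
  assume l: ?l
  then have "?e" using infinite_cluster_iff by blast
  moreover have ?u
  proof (intro ballI notI)
    fix v w assume "v \<in> W" "w \<in> W" and h: "(\<omega> v \<and> infinite (?R `` {v})) \<and> (\<omega> w \<and> infinite (?R `` {w})) \<and> (v, w) \<notin> ?R"
    then have "?R `` {v} = ?R `` {w}" using l mem by blast
    then show False using h by blast
  qed
  ultimately show "?e \<and> ?u" by blast
next
  let ?R = "(open_adj W E \<omega>)\<^sup>*"
  assume h: "?e \<and> ?u"
  show ?l
  proof (rule ex_ex1I)
    show "\<exists>C. C \<in> infinite_open_clusters W E \<omega>" using h infinite_cluster_iff by blast
    fix C1 C2 assume C: "C1 \<in> infinite_open_clusters W E \<omega>" "C2 \<in> infinite_open_clusters W E \<omega>"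
    obtain v w where vw: "C1 = ?R `` {v}" "v \<in> W" "\<omega> v" "C2 = ?R `` {w}" "w \<in> W" "\<omega> w" "infinite C1" "infinite C2"
      using C unfolding infinite_open_clusters_def open_clusters_def by blast
    have "(v, w) \<in> ?R" using h vw by blast
    then show "C1 = C2" using C vw(1,4) unfolding infinite_open_clusters_def
      by (intro cluster_eq[of C1 W E \<omega> C2 v w]) auto
  qed
qed

lemma local_ex_infinite: "local_event W W (\<lambda>\<omega>. \<exists>C. C \<in> infinite_open_clusters W E \<omega>)"
  unfolding infinite_cluster_iff by (intro local_event_bex countable_W local_infinite_cluster)

lemma local_unique_infinite: "local_event W W (\<lambda>\<omega>. \<exists>!C. C \<in> infinite_open_clusters W E \<omega>)"
  unfolding unique_cluster_iff
  by (intro local_event_conj local_event_bex local_event_ball local_event_not countable_W local_infinite_cluster local_conn)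

end

lemma p_c_site_le:
  assumes "0 \<le> q" "q \<le> 1" "0 < site_prob W q (\<lambda>\<omega>. \<exists>C. C \<in> infinite_open_clusters W E \<omega>)"
  shows "p_c_site W E \<le> q"
  unfolding p_c_site_def
  by (rule cInf_lower) (use assms in \<open>auto simp: site_prob_def intro!: bdd_belowI[of _ 0]\<close>)

lemma p_u_site_le:
  assumes "0 \<le> q" "q \<le> 1" "0 < site_prob W q (\<lambda>\<omega>. \<exists>!C. C \<in> infinite_open_clusters W E \<omega>)"
  shows "p_u_site W E \<le> q"
  unfolding p_u_site_def
  by (rule cInf_lower) (use assms in \<open>auto simp: site_prob_def intro!: bdd_belowI[of _ 0]\<close>)

text \<open>A union bound; it gives a positive value when the two probabilities sum to more than 1,
  as in \<open>p_u_le\<close>.\<close>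

lemma site_prob_conj_ge:
  assumes "local_event W W P" "local_event W W Q"
  shows "site_prob W p P + site_prob W p Q - 1 \<le> site_prob W p (\<lambda>\<omega>. P \<omega> \<and> Q \<omega>)"
proof -
  let ?F = "\<lambda>i \<omega>. if i then P \<omega> \<and> Q \<omega> else \<not> Q \<omega>"
  have loc: "local_event W W (?F i)" for i :: bool
    by (cases i) (simp_all add: local_event_conj[OF assms] local_event_not[OF assms(2)])
  have "site_prob W p P \<le> site_prob W p (\<lambda>\<omega>. \<exists>i\<in>UNIV. ?F i \<omega>)"
    by (rule site_prob_mono[OF local_event_bex[OF _ loc]]) (auto simp: UNIV_bool)
  also have "\<dots> \<le> (\<Sum>i\<in>UNIV. site_prob W p (?F i))" by (rule site_prob_Un[where K = "\<lambda>_. W"]) (simp, rule loc)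
  also have "\<dots> = site_prob W p (\<lambda>\<omega>. P \<omega> \<and> Q \<omega>) + (1 - site_prob W p Q)"
    by (simp add: UNIV_bool site_prob_not[OF assms(2)])
  finally show ?thesis by simp
qed

lemma AE_not_all:
  assumes "\<And>n. local_event W W (P n)" "\<And>n. site_prob W p (P n) \<le> b n" "b \<longlonglongrightarrow> 0"
  shows "AE \<omega> in site_measure W p. \<exists>n::nat. \<not> P n \<omega>"
proof -
  interpret prob_space "site_measure W p" by (rule prob_space_site_measure)
  have loc: "local_event W W (\<lambda>\<omega>. \<forall>n\<in>UNIV. P n \<omega>)" by (intro local_event_ball assms(1)) simp
  let ?A = "{\<omega> \<in> space (site_measure W p). \<forall>n\<in>UNIV. P n \<omega>}"
  have "site_prob W p (\<lambda>\<omega>. \<forall>n\<in>UNIV. P n \<omega>) \<le> b n" for n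
    by (rule order_trans[OF site_prob_mono[OF assms(1)] assms(2)]) simp
  then have "site_prob W p (\<lambda>\<omega>. \<forall>n\<in>UNIV. P n \<omega>) \<le> 0" using assms(3) by (intro LIMSEQ_le_const) auto
  then have "prob ?A = 0" using measure_nonneg[of "site_measure W p" ?A] unfolding site_prob_def by linarith
  then have "AE \<omega> in site_measure W p. \<omega> \<notin> ?A" using prob_eq_0[OF site_event[OF loc]] by simp
  then show ?thesis using AE_space by eventually_elim auto
qed

context strip_tree
begin

section \<open>From tree paths to clusters of the doubled graph\<close>

abbreviation conn :: "(side \<times> vertex \<Rightarrow> bool) \<Rightarrow> ((side \<times> vertex) \<times> (side \<times> vertex)) set" where
  "conn \<omega> \<equiv> (open_adj GV (G_edges d M) \<omega>)\<^sup>*"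

lemma countable_V: "countable V" by simp

lemma countable_GV: "countable GV" unfolding GV_eq by (rule countable_SIGMA[OF countable_side countable_V])

lemma root_V: "(0, 1) \<in> V" by (simp add: mem_V)

lemma child_edge: "x \<in> V \<Longrightarrow> y \<in> children x \<Longrightarrow> {x, y} \<in> strip_edges d M"
proof -
  assume x: "x \<in> V" and y: "y \<in> children x"
  obtain k where k: "y = (Suc (fst x), k)" "pidx k = snd x" using y unfolding children_def by blast
  have "{(fst x, pidx k), (Suc (fst x), k)} \<in> strip_edges d M"
    by (rule strip_edge_tree) (use children_V[OF x y] k(1) in simp)
  then show ?thesis using k by simp
qed

lemma conn_strip: "{x, y} \<in> strip_edges d M \<Longrightarrow> \<omega> (s, x) \<Longrightarrow> \<omega> (s, y) \<Longrightarrow> ((s, x), (s, y)) \<in> conn \<omega>"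
  using G_edge_strip strip_edge_V by (intro r_into_rtrancl) (auto simp: open_adj_def GV_eq)

lemma conn_sides: "((Upper, x), (Lower, x)) \<in> conn \<omega> \<Longrightarrow> ((s, x), (t, x)) \<in> conn \<omega>"
  using open_conn_sym[of "(Upper, x)" "(Lower, x)"] by (cases s; cases t) auto

lemma infinite_if_levels:
  assumes "\<And>k. \<exists>y\<in>S. f y = a + (k::nat)" shows "infinite S"
proof
  assume "finite S"
  have "{a..} \<subseteq> f ` S"
  proof
    fix m assume "m \<in> {a..}"
    then obtain y where "y \<in> S" "f y = m" using assms[of "m - a"] by auto
    then show "m \<in> f ` S" by blast
  qed
  then have "finite {a..}" using \<open>finite S\<close> finite_subset by blast
  then show False by (simp add: infinite_Ici)
qed

lemma survival_infinite:
  assumes y: "y \<in> V" and d: "\<And>k. down {Upper} (\<lambda>_. True) k \<omega> y"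
  shows "infinite (conn \<omega> `` {(Upper, y)})"
proof -
  have step: "\<exists>z. ((Upper, y), (Upper, z)) \<in> conn \<omega> \<and> fst z = fst y + k"
    if "y \<in> V" "down {Upper} (\<lambda>_. True) k \<omega> y" for k y
    using that
  proof (induction k arbitrary: y)
    case (Suc k)
    then obtain c where c: "\<omega> (Upper, y)" "c \<in> children y" "down {Upper} (\<lambda>_. True) k \<omega> c" by auto
    obtain z where z: "((Upper, c), (Upper, z)) \<in> conn \<omega>" "fst z = fst c + k"
      using Suc.IH[OF children_V[OF Suc.prems(1) c(2)] c(3)] by blast
    have "\<omega> (Upper, c)" using c(3) by (cases k) auto
    then have "((Upper, y), (Upper, c)) \<in> conn \<omega>" using conn_strip[OF child_edge[OF Suc.prems(1) c(2)]] c(1) by simp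
    then have "((Upper, y), (Upper, z)) \<in> conn \<omega>" using z(1) by (rule rtrancl_trans)
    moreover have "fst z = fst y + Suc k" using z(2) c(2) by (auto simp: children_def)
    ultimately show ?case by blast
  qed auto
  have "\<exists>v\<in>conn \<omega> `` {(Upper, y)}. fst (snd v) = fst y + k" for k
  proof -
    obtain z where "((Upper, y), (Upper, z)) \<in> conn \<omega>" "fst z = fst y + k" using step[OF y d] by blast
    then show ?thesis by (intro bexI[of _ "(Upper, z)"]) auto
  qed
  then show ?thesis by (rule infinite_if_levels)
qed

lemma p_c_le:
  assumes "0 < q" "q \<le> 1" "8 \<le> q * real B"
  shows "p_c_site GV (G_edges d M) \<le> q"
proof (rule p_c_site_le)
  have "q / 2 \<le> site_prob GV q (\<lambda>\<omega>. \<forall>k. down {Upper} (\<lambda>_. True) k \<omega> (0, 1))"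
    using upper_survival[OF _ assms(2,3) root_V] assms(1) by simp
  also have "\<dots> \<le> site_prob GV q (\<lambda>\<omega>. \<exists>C. C \<in> infinite_open_clusters GV (G_edges d M) \<omega>)"
  proof (rule site_prob_mono[OF local_ex_infinite[OF countable_GV]])
    fix \<omega> assume *: "\<forall>k. down {Upper} (\<lambda>_. True) k \<omega> (0, 1)"
    have "infinite (conn \<omega> `` {(Upper, (0, 1))})" using survival_infinite[OF root_V] * by blast
    moreover have "\<omega> (Upper, (0, 1))" using *[rule_format, of 0] by simp
    ultimately show "\<exists>C. C \<in> infinite_open_clusters GV (G_edges d M) \<omega>"
      unfolding infinite_cluster_iff[OF countable_GV] using root_V by (intro bexI[of _ "(Upper, (0, 1))"]) (auto simp: GV_eq)
  qed
  finally show "0 < site_prob GV q (\<lambda>\<omega>. \<exists>C. C \<in> infinite_open_clusters GV (G_edges d M) \<omega>)" using assms(1) by simp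
qed (use assms in simp_all)

lemma down_open: "down J P k \<omega> y \<Longrightarrow> s \<in> J \<Longrightarrow> \<omega> (s, y)"
  by (cases k) auto

text \<open>Down the doubly open path in the upper copy, across the vertical edge, and back in the
  lower copy.\<close>

lemma down_conn:
  "y \<in> V \<Longrightarrow> down UNIV (vert_below N) k \<omega> y \<Longrightarrow> ((Upper, y), (Lower, y)) \<in> conn \<omega>"
proof (induction k arbitrary: y)
  case 0
  then obtain n b where y: "y = (n, bfirst n b)" "1 \<le> n" "b + 1 < M ^ n" unfolding down.simps vert_below_def by blast
  have "((Upper, y), (Lower, y)) \<in> open_adj GV (G_edges d M) \<omega>"
    using 0 G_edge_vertical[OF y(2,3)] unfolding y(1) by (simp add: open_adj_def GV_eq)
  then show ?case by blast
next
  case (Suc k)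
  then obtain c where c: "c \<in> children y" "down UNIV (vert_below N) k \<omega> c" by auto
  have e: "{y, c} \<in> strip_edges d M" by (rule child_edge[OF Suc.prems(1) c(1)])
  have yc: "((s, y), (s, c)) \<in> conn \<omega>" for s
    by (rule conn_strip[OF e]) (use down_open[OF Suc.prems(2)] down_open[OF c(2)] in auto)
  have "((Upper, c), (Lower, c)) \<in> conn \<omega>" using Suc.IH[OF children_V[OF Suc.prems(1) c(1)] c(2)] .
  then show ?case using yc[of Upper] open_conn_sym[OF yc[of Lower]] by (meson rtrancl_trans)
qed

lemma linked_open: "linked \<omega> y \<Longrightarrow> \<omega> (s, y)"
  unfolding linked_def using down_open by blast

lemma fertile_conn:
  assumes x: "x \<in> V" "fertile \<omega> x" "\<omega> (s, x)" "\<omega> (t, x)"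
  shows "((s, x), (t, x)) \<in> conn \<omega>"
proof -
  obtain c where c: "c \<in> children x" "linked \<omega> c" using x(2) unfolding fertile_def by blast
  have "((s, c), (t, c)) \<in> conn \<omega>"
    using down_conn[OF children_V[OF x(1) c(1)]] c(2) unfolding linked_def by (blast intro: conn_sides)
  moreover have "((u, x), (u, c)) \<in> conn \<omega>" if "\<omega> (u, x)" for u
    by (rule conn_strip[OF child_edge[OF x(1) c(1)] that linked_open[OF c(2)]])
  ultimately show ?thesis using x(3,4) open_conn_sym by (meson rtrancl_trans)
qed

end

context percolation
begin

text \<open>A compactness argument: if each of the finitely many children fails from some depth on,
  then \<open>y\<close> fails at a depth \<open>N\<close> beyond all of them. The summand
  \<open>Suc (fst y)\<close> ensures that \<open>y\<close> itself cannot serve as the end of the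
  path.\<close>

lemma linked_child:
  assumes y: "linked \<omega> y" shows "\<exists>c\<in>children y. linked \<omega> c"
proof (rule ccontr)
  assume "\<not> ?thesis"
  then have "\<forall>c\<in>children y. \<exists>N. \<forall>k. \<not> down UNIV (vert_below N) k \<omega> c" unfolding linked_def by blast
  then obtain f where f: "\<And>c k. c \<in> children y \<Longrightarrow> \<not> down UNIV (vert_below (f c)) k \<omega> c" by metis
  define N where "N = Suc (fst y) + sum f (children y)"
  obtain k where k: "down UNIV (vert_below N) k \<omega> y" using y unfolding linked_def by blast
  show False
  proof (cases k)
    case 0
    then have "N \<le> fst y" using k by (auto simp: vert_below_def)
    then show False unfolding N_def by simp
  next
    case (Suc k')
    then obtain c where c: "c \<in> children y" "down UNIV (vert_below N) k' \<omega> c" using k by auto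
    have "f c \<le> N" unfolding N_def using member_le_sum[of c "children y" f] c(1) finite_children by simp
    then have "down UNIV (vert_below (f c)) k' \<omega> c" by (intro down_mono[OF _ c(2)]) (rule vert_below_mono)
    then show False using f[OF c(1)] by blast
  qed
qed

lemma linked_fertile: "linked \<omega> y \<Longrightarrow> fertile \<omega> y"
  unfolding fertile_def by (rule linked_child)

end

section \<open>Walls and uniqueness\<close>

context percolation
begin

text \<open>Whenever the path needs to change the copy, the current vertex is fertile and
  \<open>fertile_conn\<close> joins its open copies.\<close>

lemma ok_conn:
  assumes x: "x \<in> V" "fertile \<omega> x" and xy: "(x, y) \<in> (ok_rel \<omega>)\<^sup>*" and s: "\<omega> (s, x)"
  shows "\<omega> (t, y) \<Longrightarrow> ((s, x), (t, y)) \<in> conn \<omega>"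
  using xy
proof (induction arbitrary: t rule: rtrancl_induct)
  case base
  then show ?case using fertile_conn[OF x s] by simp
next
  case (step y z)
  obtain u where u: "\<omega> (u, y)" "\<omega> (u, z)" and yz: "{y, z} \<in> strip_edges d M" "fertile \<omega> z"
    using step.hyps(2) unfolding ok_rel_def by blast
  have "((s, x), (u, z)) \<in> conn \<omega>" by (rule rtrancl_trans[OF step.IH[OF u(1)] conn_strip[OF yz(1) u]])
  then show ?case by (rule rtrancl_trans) (rule fertile_conn[OF _ yz(2) u(2) step.prems], use strip_edge_V[OF yz(1)] in blast)
qed

lemma ok_open: "(x, y) \<in> (ok_rel \<omega>)\<^sup>* \<Longrightarrow> \<omega> (s, x) \<Longrightarrow> \<exists>t. \<omega> (t, y)"
  by (cases rule: rtranclE) (auto simp: ok_rel_def)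

text \<open>Linked vertices are fertile and open in both copies, so an infinite sequence of linked
  descendants stays inside \<open>ok_rel\<close>.\<close>

lemma ok_infinite:
  assumes x: "x \<in> V" "fertile \<omega> x" "\<omega> (s, x)"
  shows "infinite ((ok_rel \<omega>)\<^sup>* `` {x})"
proof (rule infinite_if_levels[of _ fst "Suc (fst x)"])
  fix k
  have "\<exists>y. (x, y) \<in> (ok_rel \<omega>)\<^sup>* \<and> linked \<omega> y \<and> y \<in> V \<and> fst y = Suc (fst x) + k"
  proof (induction k)
    case 0
    obtain c where c: "c \<in> children x" "linked \<omega> c" using x(2) unfolding fertile_def by blast
    have "(x, c) \<in> ok_rel \<omega>" unfolding ok_rel_def
      using child_edge[OF x(1) c(1)] x(2,3) linked_fertile[OF c(2)] linked_open[OF c(2)] by blast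
    then have "(x, c) \<in> (ok_rel \<omega>)\<^sup>*" by blast
    moreover have "fst c = Suc (fst x) + 0" using c(1) by (auto simp: children_def)
    ultimately show ?case using children_V[OF x(1) c(1)] c(2) by blast
  next
    case (Suc k)
    then obtain y where y: "(x, y) \<in> (ok_rel \<omega>)\<^sup>*" "linked \<omega> y" "y \<in> V" "fst y = Suc (fst x) + k" by blast
    obtain c where c: "c \<in> children y" "linked \<omega> c" using linked_child[OF y(2)] by blast
    have "(y, c) \<in> ok_rel \<omega>" unfolding ok_rel_def
      using child_edge[OF y(3) c(1)] linked_fertile[OF y(2)] linked_open[OF y(2)] linked_fertile[OF c(2)] linked_open[OF c(2)] by blast
    then have "(x, c) \<in> (ok_rel \<omega>)\<^sup>*" using y(1) by (rule rtrancl_into_rtrancl[rotated])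
    moreover have "fst c = Suc (fst x) + Suc k" using c(1) y(4) by (auto simp: children_def)
    ultimately show ?case using children_V[OF y(3) c(1)] c(2) by blast
  qed
  then show "\<exists>y\<in>(ok_rel \<omega>)\<^sup>* `` {x}. fst y = Suc (fst x) + k" by blast
qed

lemma finite_levels: "finite {y \<in> V. fst y < n}"
proof (rule finite_subset)
  show "{y \<in> V. fst y < n} \<subseteq> (\<Union>m\<in>{..<n}. Pair m ` {..B ^ m})" by (auto simp: mem_V)
qed simp

lemma infinite_in_block:
  assumes x: "x \<in> V" "infinite ((ok_rel \<omega>)\<^sup>* `` {x})"
  obtains \<beta> where "\<beta> < M ^ n" "infinite {y \<in> (ok_rel \<omega>)\<^sup>* `` {x}. n \<le> fst y \<and> block_at n y = \<beta>}"
proof -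
  let ?S = "{y \<in> (ok_rel \<omega>)\<^sup>* `` {x}. n \<le> fst y}"
  have SV: "?S \<subseteq> V" using ok_V x(1) by blast
  have "(ok_rel \<omega>)\<^sup>* `` {x} \<subseteq> ?S \<union> {y \<in> V. fst y < n}" using ok_V x(1) by auto
  then have inf: "infinite ?S" using x(2) finite_levels[of n] finite_subset[of _ "?S \<union> {y \<in> V. fst y < n}"] by blast
  have lt: "block_at n ` ?S \<subseteq> {..<M ^ n}" using SV block_at_less by blast
  obtain y where y: "y \<in> ?S" "infinite {a \<in> ?S. block_at n a = block_at n y}"
    using pigeonhole_infinite[OF inf finite_subset[OF lt finite_lessThan]] by blast
  have "{a \<in> ?S. block_at n a = block_at n y} = {a \<in> (ok_rel \<omega>)\<^sup>* `` {x}. n \<le> fst a \<and> block_at n a = block_at n y}" by blast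
  then show thesis using that[of "block_at n y"] y lt by (metis (no_types, lifting) imageI lessThan_iff subsetD)
qed

end

locale percolation_walls = chain_bounds +
  assumes d4: "4 \<le> d" and wall_weight: "real M * \<theta> ^ 6 \<le> 1 / 64"
begin

lemma \<mu>_less: "\<mu> < 1"
proof -
  have "2 * \<mu> \<le> real M * \<mu>" using M_ge \<mu>(1) by (intro mult_right_mono) auto
  then show ?thesis using \<mu>(3) by linarith
qed

text \<open>Projecting the cluster to the tree keeps it infinite, as fibres have at most two points;
  its edges become steps between \<open>near_nbrs\<close>, which have finite degree.\<close>

lemma infertile_path:
  assumes v: "v \<in> V" "\<omega> (s, v)" and inf: "infinite (conn \<omega> `` {(s, v)})"
    and no: "\<And>t y. (t, y) \<in> conn \<omega> `` {(s, v)} \<Longrightarrow> \<not> fertile \<omega> y"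
  shows "\<exists>xs\<in>walks next_near L v. infertile_event v xs \<omega>"
proof -
  define r where "r = {(x, y). x \<in> V \<and> y \<in> near_nbrs x \<and> \<not> fertile \<omega> x \<and> \<not> fertile \<omega> y}"
  have proj: "(v, snd b) \<in> r\<^sup>*" if "((s, v), b) \<in> conn \<omega>" for b
    using that
  proof (induction rule: rtrancl_induct)
    case (step b c)
    obtain t y u z where bc: "b = (t, y)" "c = (u, z)" by (cases b; cases c)
    have e: "{(t, y), (u, z)} \<in> G_edges d M" using step.hyps(2) unfolding bc open_adj_def by simp
    have nf: "\<not> fertile \<omega> y" "\<not> fertile \<omega> z"
      using no[of t y] no[of u z] step.hyps rtrancl_into_rtrancl[OF step.hyps] unfolding bc by auto
    show ?case
    proof (cases "y = z")
      case False
      then have "(y, z) \<in> r" using G_edge_near[OF e] nf unfolding r_def near_nbrs_def by blast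
      then show ?thesis using step.IH unfolding bc by (simp add: rtrancl_into_rtrancl)
    qed (use step.IH bc in simp)
  qed simp
  have "conn \<omega> `` {(s, v)} \<subseteq> UNIV \<times> r\<^sup>* `` {v}" using proj by fastforce
  then have r_inf: "infinite (r\<^sup>* `` {v})"
    using inf finite_cartesian_product[OF finite_side, of "r\<^sup>* `` {v}" UNIV] finite_subset by blast
  have r_fin: "finite (r `` {x})" for x
  proof (cases "x \<in> V")
    case True
    have "r `` {x} \<subseteq> near_nbrs x" unfolding r_def by blast
    then show "finite (r `` {x})" using card_near_nbrs(1)[OF True] finite_subset by blast
  qed (simp add: r_def)
  obtain f where f: "f 0 = v" "\<And>i. i < L \<Longrightarrow> (f i, f (Suc i)) \<in> r" "inj_on f {..L}"
    by (rule long_simple_path[OF r_inf r_fin]) (rule that)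
  let ?xs = "map (\<lambda>t. (f (Suc t), f (Suc t))) [0..<L]"
  have "?xs \<in> walks next_near L (f 0)"
    by (rule walks_of_path[of L f "\<lambda>t. f (Suc t)" next_near]) (use f(2) in \<open>auto simp: next_near_def r_def\<close>)
  moreover have vs: "f 0 # map fst ?xs = map f [0..<Suc L]" by (rule path_vertices)
  have "infertile_event (f 0) ?xs \<omega>"
    unfolding infertile_event_def vs
  proof (intro conjI ballI)
    have "set [0..<Suc L] = {..L}" by auto
    then show "distinct (map f [0..<Suc L])" using f(3) by (simp only: distinct_map distinct_upt simp_thms)
  next
    fix z assume "z \<in> set (map f [0..<Suc L])"
    then obtain t where "t \<in> {0..<Suc L}" "z = f t" by (metis imageE set_map set_upt)
    then have t: "t \<le> L" "z = f t" by simp_all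
    show "\<not> fertile \<omega> z"
    proof (cases t)
      case 0
      then show ?thesis using no[of s v] f(1) t by simp
    next
      case (Suc t')
      then show ?thesis using f(2)[of t'] t unfolding r_def by auto
    qed
  qed
  ultimately show ?thesis unfolding f(1) by blast
qed

lemma AE_infertile: "AE \<omega> in site_measure GV p. \<forall>v\<in>V. \<exists>L. \<not> (\<exists>xs\<in>walks next_near L v. infertile_event v xs \<omega>)"
  unfolding AE_ball_countable[OF countable_V]
proof
  fix v assume v: "v \<in> V"
  show "AE \<omega> in site_measure GV p. \<exists>L. \<not> (\<exists>xs\<in>walks next_near L v. infertile_event v xs \<omega>)"
    by (rule AE_not_all[OF local_infertile_ex[OF v] infertile_prob[OF v]]) (simp add: LIMSEQ_realpow_zero)
qed

lemma chain_path:
  assumes inf: "infinite ((chain_rel \<omega>)\<^sup>* `` {v})"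
  shows "\<exists>xs\<in>walks next_chain L v. chain_event v xs \<omega>"
proof -
  have "chain_rel \<omega> `` {x} \<subseteq> children x \<union> other_nbrs x" for x
    using cell_step(2) unfolding chain_rel_def by blast
  then have fin: "finite (chain_rel \<omega> `` {x})" for x
    using finite_children card_other_nbrs(1) finite_subset finite_UnI by metis
  obtain f where f: "f 0 = v" "\<And>i. i < Suc L \<Longrightarrow> (f i, f (Suc i)) \<in> chain_rel \<omega>" "inj_on f {..Suc L}"
    by (rule long_simple_path[OF inf fin]) (rule that)
  have "\<exists>xs\<in>walks next_chain L (f 0). chain_event (f 0) xs \<omega>"
  proof (rule chain_of_path)
    show "inj_on f {..L}" by (rule inj_on_subset[OF f(3)]) auto
    show "bad Upper \<omega> (f 0)" using f(2)[of 0] unfolding chain_rel_def by blast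
  qed (use f(2) in simp)
  then show ?thesis unfolding f(1) .
qed

lemma AE_chains: "AE \<omega> in site_measure GV p. \<forall>v\<in>V. finite ((chain_rel \<omega>)\<^sup>* `` {v})"
proof -
  have "AE \<omega> in site_measure GV p. \<forall>v\<in>V. \<exists>L. \<not> (\<exists>xs\<in>walks next_chain L v. chain_event v xs \<omega>)"
    unfolding AE_ball_countable[OF countable_V]
  proof
    fix v assume v: "v \<in> V"
    have "\<mu>\<^sup>2 < 1" using \<mu>_less \<mu>(1) by (simp add: power_less_one_iff)
    then have "(\<lambda>L. \<theta> ^ 6 * (\<mu>\<^sup>2) ^ L) \<longlonglongrightarrow> \<theta> ^ 6 * 0" by (intro tendsto_intros LIMSEQ_realpow_zero) auto
    then have lim: "(\<lambda>L. \<theta> ^ 6 * \<mu> ^ (2 * L)) \<longlonglongrightarrow> 0" by (simp add: power_mult)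
    show "AE \<omega> in site_measure GV p. \<exists>L. \<not> (\<exists>xs\<in>walks next_chain L v. chain_event v xs \<omega>)"
      by (rule AE_not_all[OF local_chain_ex[OF v] chain_prob[OF v] lim])
  qed
  then show ?thesis by eventually_elim (use chain_path in blast)
qed

text \<open>There are \<open>M ^ (l + 1) + 1\<close> wall points in the unit interval, and each
  touches at most two intervals of depth \<open>l\<close>.\<close>

lemma wall_verts_bound: "finite (wall_verts l)" "card (wall_verts l) \<le> 2 * (M ^ (l + 1) + 1)"
proof -
  let ?m = "M ^ (l + 1)"
  have sub: "wall_verts l \<subseteq> (\<lambda>(a, b). (l, a * B ^ l div ?m + b)) ` ({..?m} \<times> {..<2})"
  proof
    fix v assume "v \<in> wall_verts l"
    then obtain i a where v: "v = (l, i)" "1 \<le> i" "i \<le> B ^ l"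
      and t: "(real i - 1) / real B ^ l \<le> real a / real M ^ (l + 1)" "real a / real M ^ (l + 1) \<le> real i / real B ^ l"
      unfolding wall_verts_def touches_def wall_point_def iv_lo_def iv_hi_def by (cases v) (auto simp: mem_V)
    have pos: "0 < real B ^ l" "0 < real M ^ (l + 1)" using M_ge by simp_all
    have "(real i - 1) * real M ^ (l + 1) \<le> real a * real B ^ l"
      using t(1) pos by (simp add: divide_simps mult.commute del: power_Suc)
    then have "real ((i - 1) * ?m) \<le> real (a * B ^ l)" using v(2) by (simp add: of_nat_diff del: power_Suc)
    then have 1: "(i - 1) * ?m \<le> a * B ^ l" by (rule of_nat_le_iff[THEN iffD1])
    have "real a * real B ^ l \<le> real i * real M ^ (l + 1)"
      using t(2) pos by (simp add: divide_simps mult.commute del: power_Suc)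
    then have "real (a * B ^ l) \<le> real (i * ?m)" by (simp del: power_Suc)
    then have 2: "a * B ^ l \<le> i * ?m" by (rule of_nat_le_iff[THEN iffD1])
    have m: "0 < ?m" "0 < B ^ l" using M_ge by simp_all
    have q: "i - 1 \<le> a * B ^ l div ?m" using 1 m(1) by (simp add: less_eq_div_iff_mult_less_eq del: power_Suc)
    have "a * B ^ l div ?m \<le> i * ?m div ?m" using 2 by (rule div_le_mono)
    then have q': "a * B ^ l div ?m \<le> i" using m(1) by (simp del: power_Suc)
    have "i * ?m \<le> B ^ l * ?m" using v(3) by (rule mult_le_mono1)
    with 2 have "a * B ^ l \<le> B ^ l * ?m" by (rule order_trans)
    then have "B ^ l * a \<le> B ^ l * ?m" by (simp only: mult.commute[of a])
    then have a: "a \<le> ?m" using m(2) by (simp only: mult_le_cancel1)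
    have "i = a * B ^ l div ?m + (i - a * B ^ l div ?m)" "i - a * B ^ l div ?m < 2" using q q' by simp_all
    then show "v \<in> (\<lambda>(a, b). (l, a * B ^ l div ?m + b)) ` ({..?m} \<times> {..<2})"
      using a v(1) by (intro image_eqI[of _ _ "(a, i - a * B ^ l div ?m)"]) auto
  qed
  show "finite (wall_verts l)" by (rule finite_subset[OF sub]) simp
  have "card (wall_verts l) \<le> card ({..?m} \<times> {..<2::nat})" by (rule surj_card_le[OF _ sub]) simp
  then show "card (wall_verts l) \<le> 2 * (?m + 1)" by (simp add: card_cartesian_product mult.commute)
qed

lemma local_bad_level: "local_event GV GV (bad_level l)"
proof -
  have "local_event GV GV (\<lambda>\<omega>. \<exists>w\<in>wall_verts l. \<exists>xs\<in>walks next_chain ((l + 1) div 2) w. chain_event w xs \<omega>)"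
    by (rule local_event_bex[OF countable_finite[OF wall_verts_bound(1)] local_chain_ex]) (simp add: wall_verts_def)
  then show ?thesis unfolding bad_level_def[abs_def] .
qed

text \<open>The number of starting vertices times the chain bound factors as
  \<open>4 * (M * \<theta> ^ 6) * (M * \<mu>) ^ l\<close>, which is geometric with ratio at most
  \<open>1 / 4\<close>.\<close>

lemma bad_level_prob: "site_prob GV p (bad_level l) \<le> (1 / 16) * (1 / 4) ^ l"
proof -
  let ?L = "(l + 1) div 2"
  have t: "0 \<le> \<theta> ^ 6" using \<theta>(1) by simp
  have "site_prob GV p (bad_level l) \<le>
      (\<Sum>w\<in>wall_verts l. site_prob GV p (\<lambda>\<omega>. \<exists>xs\<in>walks next_chain ?L w. chain_event w xs \<omega>))"
    unfolding bad_level_def[abs_def]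
    by (rule site_prob_Un[OF wall_verts_bound(1) local_chain_ex]) (simp add: wall_verts_def)
  also have "\<dots> \<le> (\<Sum>w\<in>wall_verts l. \<theta> ^ 6 * \<mu> ^ (2 * ?L))"
    by (intro sum_mono chain_prob) (simp add: wall_verts_def)
  also have "\<dots> \<le> (\<Sum>w\<in>wall_verts l. \<theta> ^ 6 * \<mu> ^ l)"
    using \<mu>(1) \<mu>_less t by (intro sum_mono mult_left_mono power_decreasing) auto
  also have "\<dots> = real (card (wall_verts l)) * (\<theta> ^ 6 * \<mu> ^ l)" by simp
  also have "\<dots> \<le> real (4 * M ^ (l + 1)) * (\<theta> ^ 6 * \<mu> ^ l)"
  proof (intro mult_right_mono of_nat_mono)
    have "1 \<le> M ^ (l + 1)" using M_ge by simp
    moreover have "c \<le> 4 * m" if "1 \<le> m" "c \<le> 2 * (m + 1)" for c m :: nat using that by simp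
    ultimately show "card (wall_verts l) \<le> 4 * M ^ (l + 1)" using wall_verts_bound(2) by blast
  qed (use t \<mu>(1) in simp)
  also have "\<dots> = 4 * (real M * \<theta> ^ 6) * (real M * \<mu>) ^ l" by (simp add: power_mult_distrib mult_ac)
  also have "\<dots> \<le> 4 * (1 / 64) * (1 / 4) ^ l"
    using wall_weight \<mu> t by (intro mult_mono power_mono) auto
  finally show ?thesis by simp
qed

lemma AE_bad_levels: "AE \<omega> in site_measure GV p. \<exists>n0. \<forall>l\<ge>n0. \<not> bad_level l \<omega>"
proof -
  interpret prob_space "site_measure GV p" by (rule prob_space_site_measure)
  let ?A = "\<lambda>l. {\<omega> \<in> space (site_measure GV p). bad_level l \<omega>}"
  have "summable (\<lambda>l. (1 / 16) * (1 / 4 :: real) ^ l)" by (intro summable_mult summable_geometric) simp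
  then have sm: "summable (\<lambda>l. prob (?A l))"
    by (rule summable_comparison_test_ev[rotated])
       (use bad_level_prob in \<open>simp add: site_prob_def\<close>)
  have "AE \<omega> in site_measure GV p. \<forall>\<^sub>F l in sequentially. \<omega> \<in> space (site_measure GV p) - ?A l"
    by (rule borel_cantelli_AE1[OF site_event[OF local_bad_level] _ sm]) (simp add: emeasure_eq_measure)
  then show ?thesis by eventually_elim (auto simp: eventually_sequentially)
qed

section \<open>Infinite clusters of tame configurations\<close>

definition tame :: "nat \<Rightarrow> (side \<times> vertex \<Rightarrow> bool) \<Rightarrow> bool" where
  "tame n0 \<omega> \<longleftrightarrow> (\<forall>v\<in>V. \<exists>L. \<not> (\<exists>xs\<in>walks next_near L v. infertile_event v xs \<omega>)) \<and>
     (\<forall>v\<in>V. finite ((chain_rel \<omega>)\<^sup>* `` {v})) \<and> (\<forall>l\<ge>n0. \<not> bad_level l \<omega>)"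

lemma cluster_block:
  assumes t: "tame n0 \<omega>" and C: "C \<in> infinite_open_clusters GV (G_edges d M) \<omega>"
  obtains s x \<beta> where "x \<in> V" "(s, x) \<in> C" "\<omega> (s, x)" "fertile \<omega> x" "\<beta> < M ^ n0"
    "infinite {y \<in> (ok_rel \<omega>)\<^sup>* `` {x}. n0 \<le> fst y \<and> block_at n0 y = \<beta>}"
proof -
  obtain s0 v where v: "C = conn \<omega> `` {(s0, v)}" "v \<in> V" "\<omega> (s0, v)" "infinite C"
    using C unfolding infinite_open_clusters_def open_clusters_def GV_eq by auto
  have "\<exists>s x. (s, x) \<in> C \<and> fertile \<omega> x"
  proof (rule ccontr)
    assume none: "\<not> ?thesis"
    have "\<exists>xs\<in>walks next_near L v. infertile_event v xs \<omega>" for L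
      by (rule infertile_path[where \<omega> = \<omega> and s = s0]) (use v none in blast)+
    then show False using t v(2) unfolding tame_def by blast
  qed
  then obtain s x where x: "(s, x) \<in> C" "fertile \<omega> x" by blast
  have "(s, x) \<in> GV \<and> \<omega> (s, x)"
    using x(1) v(2,3) unfolding v(1) by (intro open_conn_mem[of "(s0, v)"]) (auto simp: GV_eq)
  then have xV: "x \<in> V" "\<omega> (s, x)" by (auto simp: GV_eq)
  obtain \<beta> where \<beta>: "\<beta> < M ^ n0" "infinite {y \<in> (ok_rel \<omega>)\<^sup>* `` {x}. n0 \<le> fst y \<and> block_at n0 y = \<beta>}"
    by (rule infinite_in_block[OF xV(1) ok_infinite[OF xV(1) x(2) xV(2)]]) (rule that)
  show thesis by (rule that[OF xV(1) x(1) xV(2) x(2) \<beta>])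
qed

lemma block_determines_cluster:
  assumes t: "tame n0 \<omega>" and C: "C1 \<in> open_clusters GV (G_edges d M) \<omega>" "C2 \<in> open_clusters GV (G_edges d M) \<omega>"
    and x1: "x1 \<in> V" "(s1, x1) \<in> C1" "\<omega> (s1, x1)" "fertile \<omega> x1"
      "infinite {y \<in> (ok_rel \<omega>)\<^sup>* `` {x1}. n0 \<le> fst y \<and> block_at n0 y = \<beta>}"
    and x2: "x2 \<in> V" "(s2, x2) \<in> C2" "\<omega> (s2, x2)"
      "infinite {y \<in> (ok_rel \<omega>)\<^sup>* `` {x2}. n0 \<le> fst y \<and> block_at n0 y = \<beta>}"
  shows "C1 = C2"
proof -
  have "(x1, x2) \<in> (ok_rel \<omega>)\<^sup>*"
    by (rule components_merge[where ?n0.0 = n0 and \<beta> = \<beta>]) (use t d4 x1 x2 in \<open>auto simp: tame_def\<close>)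
  then have "((s1, x1), (s2, x2)) \<in> conn \<omega>" by (rule ok_conn[OF x1(1,4) _ x1(3) x2(3)])
  then show ?thesis by (rule cluster_eq[OF C x1(2) x2(2)])
qed

lemma finite_clusters:
  assumes t: "tame n0 \<omega>"
  shows "finite (infinite_open_clusters GV (G_edges d M) \<omega>)"
proof -
  let ?I = "infinite_open_clusters GV (G_edges d M) \<omega>"
  let ?Q = "\<lambda>C s x \<beta>. x \<in> V \<and> (s, x) \<in> C \<and> \<omega> (s, x) \<and> fertile \<omega> x \<and> \<beta> < M ^ n0 \<and>
    infinite {y \<in> (ok_rel \<omega>)\<^sup>* `` {x}. n0 \<le> fst y \<and> block_at n0 y = \<beta>}"
  have "\<forall>C\<in>?I. \<exists>\<beta>. \<exists>s x. ?Q C s x \<beta>"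
  proof
    fix C assume "C \<in> ?I"
    then show "\<exists>\<beta>. \<exists>s x. ?Q C s x \<beta>" by (rule cluster_block[OF t]) blast
  qed
  from bchoice[OF this] obtain b where b: "\<And>C. C \<in> ?I \<Longrightarrow> \<exists>s x. ?Q C s x (b C)" by blast
  have inj: "inj_on b ?I"
  proof (rule inj_onI)
    fix C1 C2 assume C: "C1 \<in> ?I" "C2 \<in> ?I" "b C1 = b C2"
    obtain s1 x1 where 1: "?Q C1 s1 x1 (b C1)" using b[OF C(1)] by blast
    obtain s2 x2 where 2: "?Q C2 s2 x2 (b C1)" using b[OF C(2)] unfolding C(3)[symmetric] by blast
    show "C1 = C2"
      by (rule block_determines_cluster[OF t, where ?x1.0 = x1 and ?s1.0 = s1 and ?x2.0 = x2 and ?s2.0 = s2 and \<beta> = "b C1"])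
         (use C(1,2) 1 2 in \<open>auto simp: infinite_open_clusters_def\<close>)
  qed
  have "b ` ?I \<subseteq> {..<M ^ n0}"
  proof
    fix \<beta> assume "\<beta> \<in> b ` ?I"
    then obtain C where C: "C \<in> ?I" "\<beta> = b C" by blast
    then obtain s x where "?Q C s x (b C)" using b by blast
    then show "\<beta> \<in> {..<M ^ n0}" using C(2) by simp
  qed
  then show ?thesis using finite_imageD[OF finite_subset[OF _ finite_lessThan] inj] by blast
qed

text \<open>At depth 0 there is a single block, so any two infinite clusters coincide; the linked
  root provides one.\<close>

lemma unique_cluster:
  assumes t: "tame 0 \<omega>" and l: "linked \<omega> (0, 1)"
  shows "\<exists>!C. C \<in> infinite_open_clusters GV (G_edges d M) \<omega>"
proof (rule ex_ex1I)
  let ?v = "(Upper, (0::nat, 1::nat))"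
  have op: "\<omega> ?v" by (rule linked_open[OF l])
  note root = ok_infinite[OF root_V linked_fertile[OF l] op]
  have "(ok_rel \<omega>)\<^sup>* `` {(0, 1)} \<subseteq> snd ` (conn \<omega> `` {?v})"
  proof
    fix y assume y: "y \<in> (ok_rel \<omega>)\<^sup>* `` {(0, 1)}"
    then obtain t where t: "\<omega> (t, y)" using ok_open[where \<omega> = \<omega> and s = Upper and x = "(0, 1)" and y = y] op by blast
    then have "(?v, (t, y)) \<in> conn \<omega>" using ok_conn[OF root_V linked_fertile[OF l] _ op] y by blast
    then show "y \<in> snd ` (conn \<omega> `` {?v})" by (intro image_eqI[of _ _ "(t, y)"]) auto
  qed
  then have "infinite (conn \<omega> `` {?v})" using root finite_imageI finite_subset by metis
  then show "\<exists>C. C \<in> infinite_open_clusters GV (G_edges d M) \<omega>"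
    unfolding infinite_cluster_iff[OF countable_GV] using op root_V by (intro bexI[of _ ?v]) (auto simp: GV_eq)
next
  fix C1 C2
  assume C: "C1 \<in> infinite_open_clusters GV (G_edges d M) \<omega>" "C2 \<in> infinite_open_clusters GV (G_edges d M) \<omega>"
  obtain s1 x1 \<beta>1 where 1: "x1 \<in> V" "(s1, x1) \<in> C1" "\<omega> (s1, x1)" "fertile \<omega> x1" "\<beta>1 < M ^ 0"
    "infinite {y \<in> (ok_rel \<omega>)\<^sup>* `` {x1}. 0 \<le> fst y \<and> block_at 0 y = \<beta>1}"
    by (rule cluster_block[OF t C(1)]) (rule that)
  obtain s2 x2 \<beta>2 where 2: "x2 \<in> V" "(s2, x2) \<in> C2" "\<omega> (s2, x2)" "fertile \<omega> x2" "\<beta>2 < M ^ 0"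
    "infinite {y \<in> (ok_rel \<omega>)\<^sup>* `` {x2}. 0 \<le> fst y \<and> block_at 0 y = \<beta>2}"
    by (rule cluster_block[OF t C(2)]) (rule that)
  have "\<beta>2 = \<beta>1" using 1(5) 2(5) by simp
  note 2 = 2[unfolded this]
  show "C1 = C2"
    by (rule block_determines_cluster[OF t _ _ 1(1-4,6) 2(1-3,6)]) (use C in \<open>auto simp: infinite_open_clusters_def\<close>)
qed

lemma AE_finite_clusters: "AE \<omega> in site_measure GV p. finite (infinite_open_clusters GV (G_edges d M) \<omega>)"
  using AE_infertile AE_chains AE_bad_levels
proof eventually_elim
  case (elim \<omega>)
  then obtain n0 where "tame n0 \<omega>" unfolding tame_def by blast
  then show ?case by (rule finite_clusters)
qed

text \<open>The bounds for the single levels sum to less than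
  \<open>1 / 16 * 4 / 3 = 1 / 12\<close>.\<close>

lemma no_bad_level_prob: "3 / 4 \<le> site_prob GV p (\<lambda>\<omega>. \<forall>n. \<forall>l\<in>{..<n}. \<not> bad_level l \<omega>)"
proof (rule site_prob_decreasing)
  have loc: "local_event GV GV (\<lambda>\<omega>. \<exists>l\<in>{..<n}. bad_level l \<omega>)" for n
    by (intro local_event_bex countable_finite finite_lessThan local_bad_level)
  show "local_event GV GV (\<lambda>\<omega>. \<forall>l\<in>{..<n}. \<not> bad_level l \<omega>)" for n
    by (intro local_event_ball countable_finite finite_lessThan local_event_not local_bad_level)
  show "\<forall>l\<in>{..<n}. \<not> bad_level l \<omega>" if "\<forall>l\<in>{..<Suc n}. \<not> bad_level l \<omega>" for n \<omega> using that by simp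
  fix n
  have "site_prob GV p (\<lambda>\<omega>. \<exists>l\<in>{..<n}. bad_level l \<omega>) \<le> (\<Sum>l\<in>{..<n}. site_prob GV p (bad_level l))"
    by (rule site_prob_Un[OF finite_lessThan local_bad_level])
  also have "\<dots> \<le> (\<Sum>l\<in>{..<n}. (1 / 16) * (1 / 4) ^ l)" by (rule sum_mono) (rule bad_level_prob)
  also have "\<dots> = (1 / 16) * ((1 - (1 / 4) ^ n) * (4 / 3))"
    by (simp only: sum_distrib_left[symmetric]) (simp add: sum_gp_strict)
  also have "\<dots> \<le> 1 / 4" by (simp add: field_simps)
  finally have "3 / 4 \<le> site_prob GV p (\<lambda>\<omega>. \<not> (\<exists>l\<in>{..<n}. bad_level l \<omega>))"
    unfolding site_prob_not[OF loc] by simp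
  then show "3 / 4 \<le> site_prob GV p (\<lambda>\<omega>. \<forall>l\<in>{..<n}. \<not> bad_level l \<omega>)" by simp
qed

text \<open>No bad level has probability at least \<open>3 / 4\<close> and a linked root at least
  \<open>1 / 2\<close>, so both occur together with probability at least \<open>1 / 4\<close>;
  almost surely this makes the infinite cluster unique.\<close>

lemma p_u_le: "p_u_site GV (G_edges d M) \<le> p"
proof (rule p_u_site_le[OF p_pos less_imp_le[OF p_less]])
  interpret prob_space "site_measure GV p" by (rule prob_space_site_measure)
  have lb: "local_event GV GV (\<lambda>\<omega>. \<forall>n\<in>UNIV. \<forall>l\<in>{..<n}. \<not> bad_level l \<omega>)"
    by (rule local_event_ball, simp) (intro local_event_ball countable_finite finite_lessThan local_event_not local_bad_level)
  have ll: "local_event GV GV (\<lambda>\<omega>. linked \<omega> (0, 1))"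
    by (rule local_all[OF local_linked[OF root_V]]) (use sub_V[OF root_V] in \<open>auto simp: GV_eq\<close>)
  let ?P = "\<lambda>\<omega>. (\<forall>n\<in>UNIV. \<forall>l\<in>{..<n}. \<not> bad_level l \<omega>) \<and> linked \<omega> (0, 1)"
  let ?U = "\<lambda>\<omega>. \<exists>!C. C \<in> infinite_open_clusters GV (G_edges d M) \<omega>"
  have "1 / 4 \<le> site_prob GV p ?P"
    using site_prob_conj_ge[OF lb ll, of p] no_bad_level_prob linked_prob[OF root_V] by simp
  also have "site_prob GV p ?P \<le> site_prob GV p ?U"
    unfolding site_prob_def
  proof (rule finite_measure_mono_AE)
    show "AE \<omega> in site_measure GV p. \<omega> \<in> {\<omega> \<in> space (site_measure GV p). ?P \<omega>} \<longrightarrow>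
        \<omega> \<in> {\<omega> \<in> space (site_measure GV p). ?U \<omega>}"
      using AE_infertile AE_chains
    proof eventually_elim
      case (elim \<omega>)
      show ?case
      proof
        assume P: "\<omega> \<in> {\<omega> \<in> space (site_measure GV p). ?P \<omega>}"
        have "tame 0 \<omega>" unfolding tame_def using elim P by blast
        moreover have "linked \<omega> (0, 1)" "\<omega> \<in> space (site_measure GV p)" using P by simp_all
        ultimately show "\<omega> \<in> {\<omega> \<in> space (site_measure GV p). ?U \<omega>}" using unique_cluster by simp
      qed
    qed
  qed (rule site_event[OF local_unique_infinite[OF countable_GV]])
  finally show "0 < site_prob GV p ?U" by simp
qed

end

theorem theorem8p3:
  shows "\<exists>d M :: nat. 3 \<le> d \<and> 17 \<le> M \<and>
    (\<exists>p :: real. 1 / 2 < p \<and> p < 1 - p_c_site (G_verts d M) (G_edges d M) \<and>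
       (AE \<omega> in site_measure (G_verts d M) p.
          finite (infinite_open_clusters (G_verts d M) (G_edges d M) \<omega>))) \<and>
    p_u_site (G_verts d M) (G_edges d M) < 1 - p_c_site (G_verts d M) (G_edges d M)"
proof -
  \<comment> \<open>For \<open>d = 30\<close> and \<open>M = 32\<close> one has
    \<open>B = 2 ^ 150\<close>, and all constants are powers of 2. Then
    \<open>6 * B * \<theta> ^ 7\<close> is \<open>6 / 2 ^ 18\<close>, below
    \<open>\<mu> ^ 2 = 1 / 2 ^ 14\<close>, and \<open>M * \<mu>\<close> is exactly
    \<open>1 / 4\<close>.\<close>
  define p :: real where "p = 1 - 1 / 2 ^ 146"
  text \<open>Here \<open>p = 1 - 16 / B\<close> and \<open>\<theta> = 2 / M\<^sup>5\<close>, so that \<open>\<theta>\<^sup>6 = 64 / B\<close>.\<close>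
  interpret percolation_walls 30 32 p "1 / 2 ^ 24" "1 / 2 ^ 7"
  proof unfold_locales
    have sq: "1 - 1 / 2 ^ 145 \<le> p ^ 2" unfolding p_def by (simp add: power2_eq_square field_simps)
    show "2 \<le> (p ^ 2) ^ (30 - 1) * (real (32 ^ 30) / 8)"
    proof -
      \<comment> \<open>The crude bound avoids expanding the power of \<open>p\<close>: with
        \<open>B / 8 = 2 ^ 147\<close> there is ample room.\<close>
      have "1 / 2 \<le> p ^ 2" using sq by simp
      then have "(1 / 2) ^ 29 \<le> (p ^ 2) ^ 29" by (intro power_mono) auto
      then have "(1 / 2) ^ 29 * (real (32 ^ 30) / 8) \<le> (p ^ 2) ^ 29 * (real (32 ^ 30) / 8)" by (intro mult_right_mono) auto
      moreover have "2 \<le> (1 / 2 :: real) ^ 29 * (real (32 ^ 30) / 8)" by (simp add: power_one_over)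
      ultimately have "2 \<le> (p ^ 2) ^ 29 * (real (32 ^ 30) / 8)" by (rule order_trans[rotated])
      moreover have e: "30 - 1 = (29 :: nat)" by simp
      ultimately show ?thesis unfolding e by blast
    qed
    show "3 / 4 \<le> p ^ 2" using sq by simp
    show "2 * (1 / 2) ^ (32 ^ 30) \<le> (2 * (1 - p)) ^ 2"
    proof -
      \<comment> \<open>The exponent \<open>300\<close> replaces \<open>2 ^ 150\<close>, which
        cannot be evaluated; it suffices because
        \<open>(2 * (1 - p)) ^ 2 = 1 / 2 ^ 290\<close>.\<close>
      have "(1 / 2 :: real) ^ (32 ^ 30) \<le> (1 / 2) ^ 300" by (rule power_decreasing) simp_all
      also have "2 * (1 / 2 :: real) ^ 300 \<le> (2 * (1 - p)) ^ 2" unfolding p_def by (simp add: power2_eq_square power_one_over)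
      finally show ?thesis by simp
    qed
  qed (simp_all add: p_def power_one_over)
  \<comment> \<open>The bound is \<open>8 / B\<close>, half of \<open>1 - p = 16 / B\<close>; this
    factor 2 yields the strict inequalities.\<close>
  have c: "p_c_site GV (G_edges 30 32) \<le> 1 / 2 ^ 147" by (rule p_c_le) simp_all
  have "p < 1 - p_c_site GV (G_edges 30 32)" using c unfolding p_def by simp
  moreover have "1 / 2 < p" unfolding p_def by simp
  ultimately show ?thesis using AE_finite_clusters p_u_le
    by (intro exI[of _ 30] exI[of _ 32] conjI exI[of _ p]) simp_all
qed

end
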